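(* Given a text $T\in\Sigma^n$ stored in $n\lceil\log\sigma\rceil$ bits, with $|\Sigma|\leq 2^{\mathcal{O}(w)}$, and an index $0\leq i <n$, we can---with high probability of success---find the $i$-th lexicographically smallest text suffix in $\mathcal{O}(n\log^3n)$ expected time using $\mathcal{O}(1)$ words of working space on top of $T$.
   Context: Setting: $\Sigma=\{0,\dots,\sigma-1\}$, the text $T$ of length $n$ is re-writable (it is restored at the end), and computation is on a word RAM with word size $w\ge\log n$ bits. With high probability means with probability at least $1-n^{-c}$ for an arbitrarily large constant $c$. *)

theory Defs
  imports
    "HOL-Probability.Probability"
    "HOL-Library.List_Lexorder"
begin

section \<open>A randomised word RAM\<close>

text \<open>
  A word is a natural number below \<open>2 ^ w\<close>. The mutable storage of the machine consists of a fixed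
  number of registers (the working space) and of a random access memory that holds the text and
  nothing else. Every instruction takes one time step.
\<close>

type_synonym reg = nat

datatype binop = Add | Sub | Mul | Div | Mod | And | Or | Xor | Shl | Shr

datatype instr =
    Const reg nat
  | Op binop reg reg reg
  | Load reg "reg list"
  | Store "reg list" reg
  | Rand reg
  | JumpLess reg reg nat
  | JumpEq reg reg nat

type_synonym prog = "instr list"

record config =
  pc :: nat
  regs :: "nat list"
  mem :: "nat list"

unbundle bit_operations_syntax

fun binop_sem :: "nat \<Rightarrow> binop \<Rightarrow> nat \<Rightarrow> nat \<Rightarrow> nat" where
  "binop_sem w Add x y = take_bit w (x + y)"
| "binop_sem w Sub x y = take_bit w (x + 2 ^ w - y)"
| "binop_sem w Mul x y = take_bit w (x * y)"
| "binop_sem w Div x y = x div y"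
| "binop_sem w Mod x y = x mod y"
| "binop_sem w And x y = x AND y"
| "binop_sem w Or x y = x OR y"
| "binop_sem w Xor x y = x XOR y"
| "binop_sem w Shl x y = take_bit w (push_bit y x)"
| "binop_sem w Shr x y = drop_bit y x"

definition set_reg :: "reg \<Rightarrow> nat \<Rightarrow> config \<Rightarrow> config" where
  "set_reg d x s = s\<lparr>pc := Suc (pc s), regs := (regs s)[d := x]\<rparr>"

text \<open>
  A text of \<open>n \<le> 2 ^ w\<close> characters of \<open>O(w)\<close> bits may occupy more than \<open>2 ^ w\<close> words, so an address is
  given by a list of registers, fixed in the program, least significant word first.
\<close>

definition address :: "nat \<Rightarrow> config \<Rightarrow> reg list \<Rightarrow> nat" where
  "address w s as = horner_sum (\<lambda>r. regs s ! r) (2 ^ w) as"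

text \<open>
  The argument \<open>u\<close> is a fresh random word. An access outside the memory leaves the configuration
  unchanged, so that the machine never halts.
\<close>

fun exec :: "nat \<Rightarrow> nat \<Rightarrow> instr \<Rightarrow> config \<Rightarrow> config" where
  "exec w u (Const d k) s = set_reg d (take_bit w k) s"
| "exec w u (Op f d a b) s = set_reg d (binop_sem w f (regs s ! a) (regs s ! b)) s"
| "exec w u (Load d as) s =
     (if address w s as < length (mem s) then set_reg d (mem s ! address w s as) s else s)"
| "exec w u (Store as a) s =
     (if address w s as < length (mem s)
      then s\<lparr>pc := Suc (pc s), mem := (mem s)[address w s as := regs s ! a]\<rparr> else s)"
| "exec w u (Rand d) s = set_reg d u s"
| "exec w u (JumpLess a b l) s = s\<lparr>pc := (if regs s ! a < regs s ! b then l else Suc (pc s))\<rparr>"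
| "exec w u (JumpEq a b l) s = s\<lparr>pc := (if regs s ! a = regs s ! b then l else Suc (pc s))\<rparr>"

fun instr_regs :: "instr \<Rightarrow> reg set" where
  "instr_regs (Const d k) = {d}"
| "instr_regs (Op f d a b) = {d, a, b}"
| "instr_regs (Load d as) = insert d (set as)"
| "instr_regs (Store as a) = insert a (set as)"
| "instr_regs (Rand d) = {d}"
| "instr_regs (JumpLess a b l) = {a, b}"
| "instr_regs (JumpEq a b l) = {a, b}"

definition uses_regs_below :: "nat \<Rightarrow> prog \<Rightarrow> bool" where
  "uses_regs_below R P \<longleftrightarrow> (\<forall>ins\<in>set P. instr_regs ins \<subseteq> {..<R})"

definition halted :: "prog \<Rightarrow> config \<Rightarrow> bool" where
  "halted P s \<longleftrightarrow> length P \<le> pc s"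

definition step :: "prog \<Rightarrow> nat \<Rightarrow> nat \<Rightarrow> config \<Rightarrow> config" where
  "step P w u s = (if halted P s then s else exec w u (P ! pc s) s)"

text \<open>\<open>\<omega> t\<close> is the random word available at time \<open>t\<close>.\<close>

primrec run :: "prog \<Rightarrow> nat \<Rightarrow> config \<Rightarrow> (nat \<Rightarrow> nat) \<Rightarrow> nat \<Rightarrow> config" where
  "run P w s \<omega> 0 = s"
| "run P w s \<omega> (Suc t) = step P w (\<omega> t) (run P w s \<omega> t)"

definition random_words :: "nat \<Rightarrow> (nat \<Rightarrow> nat) measure" where
  "random_words w = Pi\<^sub>M UNIV (\<lambda>_. uniform_count_measure {..<2 ^ w})"

definition halts_with :: "prog \<Rightarrow> nat \<Rightarrow> config \<Rightarrow> (nat \<Rightarrow> nat) \<Rightarrow> config \<Rightarrow> bool" where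
  "halts_with P w s \<omega> s' \<longleftrightarrow> (\<exists>t. run P w s \<omega> t = s' \<and> halted P s')"

definition run_time :: "prog \<Rightarrow> nat \<Rightarrow> config \<Rightarrow> (nat \<Rightarrow> nat) \<Rightarrow> ennreal" where
  "run_time P w s \<omega> =
     (if \<exists>t. halted P (run P w s \<omega> t)
      then of_nat (LEAST t. halted P (run P w s \<omega> t)) else \<infinity>)"

definition expected_time :: "prog \<Rightarrow> nat \<Rightarrow> config \<Rightarrow> ennreal" where
  "expected_time P w s = (\<integral>\<^sup>+ \<omega>. run_time P w s \<omega> \<partial>random_words w)"


section \<open>Texts and their packed representation\<close>

text \<open>The \<open>k\<close> least significant base-\<open>2 ^ w\<close> digits of \<open>x\<close>, least significant first.\<close>

definition to_words :: "nat \<Rightarrow> nat \<Rightarrow> nat \<Rightarrow> nat list" where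
  "to_words w k x = map (\<lambda>j. take_bit w (drop_bit (j * w) x)) [0..<k]"

definition char_bits :: "nat \<Rightarrow> nat" where
  "char_bits \<sigma> = nat \<lceil>log 2 (real \<sigma>)\<rceil>"

text \<open>
  Character \<open>j\<close> occupies the bits \<open>j * b, \<dots>, j * b + b - 1\<close>, where \<open>b = char_bits \<sigma>\<close>. If the total
  number of bits is not a multiple of \<open>w\<close>, then the last word is padded with zeros.
\<close>

definition pack_text :: "nat \<Rightarrow> nat \<Rightarrow> nat list \<Rightarrow> nat list" where
  "pack_text w \<sigma> T =
     to_words w (nat \<lceil>real (length T * char_bits \<sigma>) / real w\<rceil>)
       (horner_sum id (2 ^ char_bits \<sigma>) T)"

text \<open>
  Initially, the registers hold the parameters \<open>w\<close>, \<open>n\<close>, \<open>\<sigma>\<close>, \<open>\<lceil>log \<sigma>\<rceil>\<close> and \<open>i\<close>, followed by \<open>S\<close> zero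
  words. If \<open>w > 0\<close>, \<open>n \<le> 2 ^ w\<close> and \<open>\<sigma> \<le> 2 ^ (C * w)\<close>, then each parameter fits into \<open>C + 2\<close> words.
\<close>

definition init_config :: "nat \<Rightarrow> nat \<Rightarrow> nat \<Rightarrow> nat \<Rightarrow> nat list \<Rightarrow> nat \<Rightarrow> config" where
  "init_config C S w \<sigma> T i =
     \<lparr>pc = 0,
      regs = concat (map (to_words w (C + 2)) [w, length T, \<sigma>, char_bits \<sigma>, i]) @ replicate S 0,
      mem = pack_text w \<sigma> T\<rparr>"

text \<open>Proper prefixes are smaller, and ranks start at 0.\<close>

definition kth_suffix :: "nat list \<Rightarrow> nat \<Rightarrow> nat list" where
  "kth_suffix T i = sort (map (\<lambda>p. drop p T) [0..<length T]) ! i"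

definition selects_suffix :: "nat list \<Rightarrow> nat \<Rightarrow> config \<Rightarrow> bool" where
  "selects_suffix T i s \<longleftrightarrow> regs s ! 0 < length T \<and> drop (regs s ! 0) T = kth_suffix T i"

end

theory Submission
  imports Defs
begin

text \<open>
  The text is never written. The program is a randomised quickselect on the ranks of the suffixes: the remaining
  candidates are the suffixes strictly between two known ones, the pivot is a random candidate, found by bisecting
  on its position in the text, and every decision is made by counting the suffixes in a prefix of the positions
  that are smaller than a given suffix. With probability at least \<open>1 / 4\<close> a round removes a quarter of the
  candidates, so there are \<open>O(log n)\<close> expected rounds of \<open>O(log n)\<close> countings.

  A counting takes time \<open>O(n log n)\<close> and constant space. It proceeds by levels: on the level \<open>L\<close> the suffixes that
  share at least \<open>L\<close> characters with the given one, but fewer than the next level, are compared to it.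
  They are found by a constant-space string matching that uses the maximal suffix and the period of the prefix of
  length \<open>L\<close>. The next level is a period beyond the point where this period breaks, so that there are \<open>O(log n)\<close>
  levels, and the extension of the occurrences is cheap since they lie a period apart.

  The result is correct whenever the machine halts, and it halts almost surely since its expected running time is finite.
\<close>

section \<open>A structured language and its compilation\<close>

text \<open>Words may have as few as log n bits, so neither n nor a bit position of the text need
  fit into a register. Indices therefore stay below n, ends are inclusive, bounds are tested by
  subtraction, and addresses span several words. Constant space rules out a table of periods. The
  exact period of a prefix of length L is used only if it equals the period of its maximal suffix;
  otherwise a lower bound above L / 3 takes its place, which still separates occurrences and makes
  the next level longer by the factor 4 / 3. A shorter period is exact, and once its run breaks, the
  longer prefix has no short period; hence at most two levels pass before L grows by this factor.
  The 1 / 4 is a product of two halves: half of the ranks are central, and reducing a random word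
  modulo the number of candidates is biased by at most a factor 2. Everything between two draws
  takes the same course for all random words. So programs are verified in a deterministic calculus
  with exact step counts, and probability enters only through a potential averaged over the next
  word.\<close>

datatype 'v exp = Rg 'v | Im nat | Bin binop "'v exp" "'v exp"

datatype 'v bexp = BLt "'v exp" "'v exp" | BEq "'v exp" "'v exp"

text \<open>There is neither a store nor a random draw: the text is a constant of the semantics, and
  every command is deterministic.\<close>

datatype 'v com =
    Skip
  | Asg 'v "'v exp"  (\<open>(\<open>notation=\<open>infix ::=\<close>\<close>_ ::= _)\<close> [1000, 61] 61)
  | Ld 'v "'v list"
  | Seq "'v com" "'v com"  (infixr \<open>;;\<close> 60)
  | Cond "'v bexp" "'v com" "'v com"  (\<open>(\<open>notation=\<open>mixfix IF\<close>\<close>IF _/ THEN _/ ELSE _)\<close> [0, 61, 61] 61)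
  | Loop "'v bexp" "'v com"  (\<open>(\<open>notation=\<open>mixfix WHILE\<close>\<close>WHILE _/ DO _)\<close> [0, 61] 61)

type_synonym 'v state = "'v \<Rightarrow> nat"

primrec aval :: "nat \<Rightarrow> 'v exp \<Rightarrow> 'v state \<Rightarrow> nat" where
  "aval w (Rg x) s = s x"
| "aval w (Im k) s = take_bit w k"
| "aval w (Bin f a b) s = binop_sem w f (aval w a s) (aval w b s)"

primrec bval :: "nat \<Rightarrow> 'v bexp \<Rightarrow> 'v state \<Rightarrow> bool" where
  "bval w (BLt a b) s \<longleftrightarrow> aval w a s < aval w b s"
| "bval w (BEq a b) s \<longleftrightarrow> aval w a s = aval w b s"

primrec elen :: "'v exp \<Rightarrow> nat" where
  "elen (Rg x) = 1"
| "elen (Im k) = 1"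
| "elen (Bin f a b) = elen a + elen b + 1"

primrec blen :: "'v bexp \<Rightarrow> nat" where
  "blen (BLt a b) = elen a + elen b + 1"
| "blen (BEq a b) = elen a + elen b + 1"

definition addr_of :: "nat \<Rightarrow> 'v list \<Rightarrow> 'v state \<Rightarrow> nat" where
  "addr_of w xs s = horner_sum s (2 ^ w) xs"

text \<open>The fourth argument is the exact number of machine steps of the compiled command.\<close>

inductive big :: "nat \<Rightarrow> nat list \<Rightarrow> 'v com \<Rightarrow> 'v state \<Rightarrow> nat \<Rightarrow> 'v state \<Rightarrow> bool" for w M where
  big_Skip: "big w M Skip s 0 s"
| big_Asg: "big w M (x ::= e) s (elen e + 1) (s(x := aval w e s))"
| big_Ld: "addr_of w xs s < length M \<Longrightarrow> big w M (Ld x xs) s 1 (s(x := M ! addr_of w xs s))"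
| big_Seq: "big w M c1 s t1 s1 \<Longrightarrow> big w M c2 s1 t2 s2 \<Longrightarrow> big w M (c1;; c2) s (t1 + t2) s2"
| big_CondT: "bval w b s \<Longrightarrow> big w M c1 s t s1 \<Longrightarrow> big w M (IF b THEN c1 ELSE c2) s (blen b + t) s1"
| big_CondF: "\<not> bval w b s \<Longrightarrow> big w M c2 s t s1 \<Longrightarrow> big w M (IF b THEN c1 ELSE c2) s (blen b + t + 1) s1"
| big_LoopF: "\<not> bval w b s \<Longrightarrow> big w M (WHILE b DO c) s (blen b + 1) s"
| big_LoopT: "bval w b s \<Longrightarrow> big w M c s t1 s1 \<Longrightarrow> big w M (WHILE b DO c) s1 t2 s2 \<Longrightarrow>
    big w M (WHILE b DO c) s (blen b + t1 + 1 + t2) s2"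

text \<open>A syntactic upper bound on the written variables, which lets the simplifier discharge
  frame conditions.\<close>

primrec wr :: "'v com \<Rightarrow> 'v \<Rightarrow> bool" where
  "wr Skip y \<longleftrightarrow> False"
| "wr (x ::= e) y \<longleftrightarrow> y = x"
| "wr (Ld x xs) y \<longleftrightarrow> y = x"
| "wr (c1;; c2) y \<longleftrightarrow> wr c1 y \<or> wr c2 y"
| "wr (IF b THEN c1 ELSE c2) y \<longleftrightarrow> wr c1 y \<or> wr c2 y"
| "wr (WHILE b DO c) y \<longleftrightarrow> wr c y"

lemma big_frame: "big w M c s t s' \<Longrightarrow> \<not> wr c y \<Longrightarrow> s' y = s y"
  by (induction rule: big.induct) auto

text \<open>Total correctness with the cost handed to the postcondition. Asking for some execution
  is enough, since \<open>comp_correct\<close> turns any derivation of \<open>big\<close> into the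
  run of the machine.\<close>

definition wp :: "nat \<Rightarrow> nat list \<Rightarrow> 'v com \<Rightarrow> 'v state \<Rightarrow> ('v state \<Rightarrow> nat \<Rightarrow> bool) \<Rightarrow> bool" where
  "wp w M c s Q \<longleftrightarrow> (\<exists>t s'. big w M c s t s' \<and> Q s' t)"

lemma wp_mono: "wp w M c s Q \<Longrightarrow> (\<And>s' t. Q s' t \<Longrightarrow> Q' s' t) \<Longrightarrow> wp w M c s Q'"
  unfolding wp_def by blast

lemma wp_frame:
  assumes "wp w M c s Q" and "\<And>s' t. Q s' t \<Longrightarrow> (\<And>y. \<not> wr c y \<Longrightarrow> s' y = s y) \<Longrightarrow> Q' s' t"
  shows "wp w M c s Q'"
  using assms big_frame unfolding wp_def by (metis (no_types, lifting))

lemma wp_SkipI: "Q s 0 \<Longrightarrow> wp w M Skip s Q"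
  unfolding wp_def using big_Skip by blast

lemma wp_AsgI: "Q (s(x := aval w e s)) (elen e + 1) \<Longrightarrow> wp w M (x ::= e) s Q"
  unfolding wp_def using big_Asg[of w M x e s] by blast

lemma wp_LdI:
  "addr_of w xs s < length M \<Longrightarrow> Q (s(x := M ! addr_of w xs s)) 1 \<Longrightarrow> wp w M (Ld x xs) s Q"
  unfolding wp_def using big_Ld[of w xs s M x] by blast

lemma wp_SeqI: "wp w M c1 s (\<lambda>s1 t1. wp w M c2 s1 (\<lambda>s2 t2. Q s2 (t1 + t2))) \<Longrightarrow> wp w M (c1;; c2) s Q"
  unfolding wp_def using big_Seq by blast

lemma wp_CondI:
  assumes "bval w b s \<Longrightarrow> wp w M c1 s (\<lambda>s' t. Q s' (blen b + t))"
    and "\<not> bval w b s \<Longrightarrow> wp w M c2 s (\<lambda>s' t. Q s' (blen b + t + 1))"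
  shows "wp w M (IF b THEN c1 ELSE c2) s Q"
  using assms unfolding wp_def by (cases "bval w b s") (blast intro: big_CondT big_CondF)+

text \<open>The potential \<open>\<Phi>\<close> pays for the iterations and thereby also gives termination.\<close>

lemma wp_LoopI:
  assumes "I s0"
    and step: "\<And>s. I s \<Longrightarrow> bval w b s \<Longrightarrow> (\<And>y. \<not> wr c y \<Longrightarrow> s y = s0 y) \<Longrightarrow>
      wp w M c s (\<lambda>s' t. I s' \<and> t + (blen b + 1) + \<Phi> s' \<le> \<Phi> s)"
    and post: "\<And>s t. I s \<Longrightarrow> \<not> bval w b s \<Longrightarrow> t + \<Phi> s \<le> \<Phi> s0 + blen b + 1 \<Longrightarrow>
      (\<And>y. \<not> wr c y \<Longrightarrow> s y = s0 y) \<Longrightarrow> Q s t"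
  shows "wp w M (WHILE b DO c) s0 Q"
proof -
  have "\<exists>t s'. big w M (WHILE b DO c) s t s' \<and> I s' \<and> \<not> bval w b s' \<and> t + \<Phi> s' \<le> \<Phi> s + blen b + 1
      \<and> (\<forall>y. \<not> wr c y \<longrightarrow> s' y = s0 y)"
    if "I s" "\<forall>y. \<not> wr c y \<longrightarrow> s y = s0 y" for s
    using that
  proof (induction "\<Phi> s" arbitrary: s rule: less_induct)
    case less
    show ?case
    proof (cases "bval w b s")
      case False
      then show ?thesis using less.prems big_LoopF[of w b s M c] by fastforce
    next
      case True
      obtain t1 s1 where 1: "big w M c s t1 s1" "I s1" "t1 + (blen b + 1) + \<Phi> s1 \<le> \<Phi> s"
        using step[OF less.prems(1) True] less.prems(2) unfolding wp_def by auto
      have fr: "\<forall>y. \<not> wr c y \<longrightarrow> s1 y = s0 y"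
        using big_frame[OF 1(1)] less.prems(2) by auto
      obtain t2 s2 where 2: "big w M (WHILE b DO c) s1 t2 s2" "I s2" "\<not> bval w b s2"
        "t2 + \<Phi> s2 \<le> \<Phi> s1 + blen b + 1" "\<forall>y. \<not> wr c y \<longrightarrow> s2 y = s0 y"
        using less.hyps[of s1] 1 fr by auto
      have "big w M (WHILE b DO c) s (blen b + t1 + 1 + t2) s2"
        by (rule big_LoopT[OF True 1(1) 2(1)])
      moreover have "blen b + t1 + 1 + t2 + \<Phi> s2 \<le> \<Phi> s + blen b + 1" using 1(3) 2(4) by linarith
      ultimately show ?thesis using 2 by blast
    qed
  qed
  from this[OF assms(1)] show ?thesis unfolding wp_def using post by blast
qed

section \<open>Compilation to machine code and its simulation\<close>

locale regmap =
  fixes \<rho> :: "'v \<Rightarrow> reg" and \<tau> :: "nat \<Rightarrow> reg"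
  assumes inj_rho: "\<rho> x = \<rho> y \<longleftrightarrow> x = y"
    and inj_tau: "\<tau> i = \<tau> j \<longleftrightarrow> i = j"
    and rho_tau: "\<rho> x \<noteq> \<tau> i"
begin

lemma tau_rho [simp]: "\<tau> i \<noteq> \<rho> x"
  using rho_tau by metis

declare inj_rho [simp] inj_tau [simp] rho_tau [simp]

text \<open>The temporaries from \<open>\<tau> k\<close> upwards form the evaluation stack. The
  machine has no move instruction; \<open>Or\<close> of a register with itself takes its
  place.\<close>

primrec cexp :: "'v exp \<Rightarrow> nat \<Rightarrow> prog" where
  "cexp (Rg x) k = [Op Or (\<tau> k) (\<rho> x) (\<rho> x)]"
| "cexp (Im n) k = [Const (\<tau> k) n]"
| "cexp (Bin f a b) k = cexp a k @ cexp b (Suc k) @ [Op f (\<tau> k) (\<tau> k) (\<tau> (Suc k))]"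

fun cbexp :: "'v bexp \<Rightarrow> nat \<Rightarrow> prog" where
  "cbexp (BLt a b) l = cexp a 0 @ cexp b 1 @ [JumpLess (\<tau> 0) (\<tau> 1) l]"
| "cbexp (BEq a b) l = cexp a 0 @ cexp b 1 @ [JumpEq (\<tau> 0) (\<tau> 1) l]"

definition jump :: "nat \<Rightarrow> instr" where
  "jump l = JumpEq (\<tau> 0) (\<tau> 0) l"

text \<open>A failed conditional jump falls through, so the else branch comes first and has to jump
  over the other one. This jump, and the exit jump or back jump of a loop, are the summands 1 in the
  costs of \<open>big\<close>.\<close>

primrec comp :: "'v com \<Rightarrow> nat \<Rightarrow> prog" where
  "comp Skip a = []"
| "comp (x ::= e) a = cexp e 0 @ [Op Or (\<rho> x) (\<tau> 0) (\<tau> 0)]"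
| "comp (Ld x xs) a = [Load (\<rho> x) (map \<rho> xs)]"
| "comp (c1;; c2) a = (let p = comp c1 a in p @ comp c2 (a + length p))"
| "comp (IF b THEN c1 ELSE c2) a =
     (let p2 = comp c2 (a + blen b);
          a1 = a + blen b + length p2 + 1;
          p1 = comp c1 a1
      in cbexp b a1 @ p2 @ [jump (a1 + length p1)] @ p1)"
| "comp (WHILE b DO c) a =
     (let a1 = a + blen b + 1; p = comp c a1
      in cbexp b a1 @ [jump (a1 + length p + 1)] @ p @ [jump a])"

lemma length_cexp [simp]: "length (cexp e k) = elen e"
  by (induction e arbitrary: k) auto

lemma length_cbexp [simp]: "length (cbexp b l) = blen b"
  by (cases b) auto

text \<open>There may be more variables than registers. A variable whose register lies outside the
  machine is left unconstrained; \<open>uses_regs_below\<close> keeps the program away from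
  it.\<close>

definition rel :: "'v state \<Rightarrow> config \<Rightarrow> bool" where
  "rel s cfg \<longleftrightarrow> (\<forall>x. \<rho> x < length (regs cfg) \<longrightarrow> regs cfg ! \<rho> x = s x)"

end

definition code_at :: "prog \<Rightarrow> nat \<Rightarrow> prog \<Rightarrow> bool" where
  "code_at P a c \<longleftrightarrow> (\<exists>p q. P = p @ c @ q \<and> length p = a)"

lemma code_at_appendD:
  assumes "code_at P a (c1 @ c2)"
  shows "code_at P a c1" "code_at P (a + length c1) c2"
proof -
  obtain p q where P: "P = p @ (c1 @ c2) @ q" "length p = a"
    using assms unfolding code_at_def by blast
  have "P = p @ c1 @ (c2 @ q)" "P = (p @ c1) @ c2 @ q" using P by simp_all
  then show "code_at P a c1" "code_at P (a + length c1) c2"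
    unfolding code_at_def using P(2) by (metis length_append)+
qed

lemma code_at_ConsD:
  assumes "code_at P a (i # c)"
  shows "a < length P" "P ! a = i" "code_at P (Suc a) c"
proof -
  obtain p q where P: "P = p @ (i # c) @ q" "length p = a"
    using assms unfolding code_at_def by blast
  show "a < length P" "P ! a = i" using P by auto
  have "P = (p @ [i]) @ c @ q" using P by simp
  then show "code_at P (Suc a) c" unfolding code_at_def using P(2) by (metis length_append_singleton)
qed

text \<open>Quantifying over all random sequences expresses that this stretch of the run does not
  depend on chance.\<close>

definition reach :: "prog \<Rightarrow> nat \<Rightarrow> config \<Rightarrow> nat \<Rightarrow> config \<Rightarrow> bool" where
  "reach P w s t s' \<longleftrightarrow> (\<forall>\<omega>. run P w s \<omega> t = s')"

lemma run_add: "run P w s \<omega> (t1 + t2) = run P w (run P w s \<omega> t1) (\<lambda>k. \<omega> (t1 + k)) t2"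
  by (induction t2) auto

lemma reach_refl: "reach P w s 0 s"
  by (simp add: reach_def)

lemma reach_trans: "reach P w s t1 s1 \<Longrightarrow> reach P w s1 t2 s2 \<Longrightarrow> reach P w s (t1 + t2) s2"
  unfolding reach_def by (simp add: run_add)

lemma reach_step: "pc s < length P \<Longrightarrow> (\<And>u. exec w u (P ! pc s) s = s') \<Longrightarrow> reach P w s 1 s'"
  unfolding reach_def by (simp add: step_def halted_def)

context regmap
begin

definition sim :: "nat \<Rightarrow> nat list \<Rightarrow> nat \<Rightarrow> 'v state \<Rightarrow> config \<Rightarrow> bool" where
  "sim R M a s cfg \<longleftrightarrow> pc cfg = a \<and> mem cfg = M \<and> length (regs cfg) = R \<and> rel s cfg"

lemma code_at_regs:
  "uses_regs_below R P \<Longrightarrow> code_at P a (i # c) \<Longrightarrow> instr_regs i \<subseteq> {..<R}"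
  unfolding uses_regs_below_def by (metis code_at_ConsD(1,2) nth_mem)

text \<open>The last conjunct carries the induction: the value of the left operand has to survive
  the evaluation of the right one, which works one temporary higher.\<close>

lemma cexp_correct:
  assumes "uses_regs_below R P" "code_at P a (cexp e k)" "sim R M a s cfg"
  shows "\<exists>cfg'. reach P w cfg (elen e) cfg' \<and> sim R M (a + elen e) s cfg' \<and>
    regs cfg' ! \<tau> k = aval w e s \<and> (\<forall>i<k. regs cfg' ! \<tau> i = regs cfg ! \<tau> i)"
  using assms(2,3)
proof (induction e arbitrary: a k cfg)
  case (Rg x)
  have R: "\<tau> k < R" "\<rho> x < R" using code_at_regs[OF assms(1) Rg.prems(1)[unfolded cexp.simps]] by auto
  let ?c = "set_reg (\<tau> k) (s x) cfg"
  have "reach P w cfg 1 ?c"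
    using Rg.prems(2) R code_at_ConsD(1,2)[OF Rg.prems(1)[unfolded cexp.simps]]
    by (intro reach_step) (auto simp: sim_def rel_def)
  then show ?case
    using Rg.prems(2) R
    by (intro exI[of _ ?c]) (auto simp: sim_def rel_def set_reg_def nth_list_update)
next
  case (Im n)
  have R: "\<tau> k < R" using code_at_regs[OF assms(1) Im.prems(1)[unfolded cexp.simps]] by auto
  let ?c = "set_reg (\<tau> k) (take_bit w n) cfg"
  have "reach P w cfg 1 ?c"
    using Im.prems(2) R code_at_ConsD(1,2)[OF Im.prems(1)[unfolded cexp.simps]]
    by (intro reach_step) (auto simp: sim_def rel_def)
  then show ?case
    using Im.prems(2) R
    by (intro exI[of _ ?c]) (auto simp: sim_def rel_def set_reg_def nth_list_update)
next
  case (Bin f e1 e2)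
  note c = Bin.prems(1)[unfolded cexp.simps]
  obtain c1 where 1: "reach P w cfg (elen e1) c1" "sim R M (a + elen e1) s c1"
    "regs c1 ! \<tau> k = aval w e1 s" "\<forall>i<k. regs c1 ! \<tau> i = regs cfg ! \<tau> i"
    using Bin.IH(1)[OF code_at_appendD(1)[OF c] Bin.prems(2)] by blast
  have c': "code_at P (a + elen e1) (cexp e2 (Suc k) @ [Op f (\<tau> k) (\<tau> k) (\<tau> (Suc k))])"
    using code_at_appendD(2)[OF c] by simp
  obtain c2 where 2: "reach P w c1 (elen e2) c2" "sim R M (a + elen e1 + elen e2) s c2"
    "regs c2 ! \<tau> (Suc k) = aval w e2 s" "\<forall>i<Suc k. regs c2 ! \<tau> i = regs c1 ! \<tau> i"
    using Bin.IH(2)[OF code_at_appendD(1)[OF c'] 1(2)] by blast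
  have c'': "code_at P (a + elen e1 + elen e2) [Op f (\<tau> k) (\<tau> k) (\<tau> (Suc k))]"
    using code_at_appendD(2)[OF c'] by simp
  have R: "\<tau> k < R" "\<tau> (Suc k) < R" using code_at_regs[OF assms(1) c''] by auto
  let ?c3 = "set_reg (\<tau> k) (aval w (Bin f e1 e2) s) c2"
  have 3: "reach P w c2 1 ?c3"
    using 2 1(3) code_at_ConsD(1,2)[OF c''] by (intro reach_step) (auto simp: sim_def)
  have "reach P w cfg (elen (Bin f e1 e2)) ?c3"
    using reach_trans[OF 1(1) reach_trans[OF 2(1) 3]] by (simp add: algebra_simps)
  moreover have "sim R M (a + elen (Bin f e1 e2)) s ?c3" "regs ?c3 ! \<tau> k = aval w (Bin f e1 e2) s"
    "\<forall>i<k. regs ?c3 ! \<tau> i = regs cfg ! \<tau> i"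
    using 1 2 R by (auto simp: sim_def rel_def set_reg_def nth_list_update)
  ultimately show ?case by blast
qed

lemma cexp2_correct:
  assumes "uses_regs_below R P" "code_at P a (cexp e1 0 @ cexp e2 1 @ c)" "sim R M a s cfg"
  shows "\<exists>cfg'. reach P w cfg (elen e1 + elen e2) cfg' \<and> sim R M (a + elen e1 + elen e2) s cfg' \<and>
    regs cfg' ! \<tau> 0 = aval w e1 s \<and> regs cfg' ! \<tau> 1 = aval w e2 s \<and> code_at P (a + elen e1 + elen e2) c"
proof -
  obtain c1 where 1: "reach P w cfg (elen e1) c1" "sim R M (a + elen e1) s c1"
    "regs c1 ! \<tau> 0 = aval w e1 s"
    using cexp_correct[OF assms(1) code_at_appendD(1)[OF assms(2)] assms(3)] by blast
  have c': "code_at P (a + elen e1) (cexp e2 1 @ c)"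
    using code_at_appendD(2)[OF assms(2)] by simp
  obtain c2 where 2: "reach P w c1 (elen e2) c2" "sim R M (a + elen e1 + elen e2) s c2"
    "regs c2 ! \<tau> 1 = aval w e2 s" "\<forall>i<1. regs c2 ! \<tau> i = regs c1 ! \<tau> i"
    using cexp_correct[OF assms(1) code_at_appendD(1)[OF c'] 1(2)] by blast
  show ?thesis
    using reach_trans[OF 1(1) 2(1)] 2 1 code_at_appendD(2)[OF c'] by auto
qed

lemma sim_pc: "sim R M a s cfg \<Longrightarrow> sim R M b s (cfg\<lparr>pc := b\<rparr>)"
  by (auto simp: sim_def rel_def)

lemma cbexp_correct:
  assumes "uses_regs_below R P" "code_at P a (cbexp b l @ c)" "sim R M a s cfg"
  shows "\<exists>cfg'. reach P w cfg (blen b) cfg' \<and> sim R M (if bval w b s then l else a + blen b) s cfg'"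
proof (cases b)
  case (BLt e1 e2)
  obtain c1 where c1: "reach P w cfg (elen e1 + elen e2) c1" "sim R M (a + elen e1 + elen e2) s c1"
     "regs c1 ! \<tau> 0 = aval w e1 s" "regs c1 ! \<tau> 1 = aval w e2 s"
     "code_at P (a + elen e1 + elen e2) (JumpLess (\<tau> 0) (\<tau> 1) l # c)"
    using cexp2_correct[OF assms(1) _ assms(3)] assms(2) BLt by fastforce
  have "reach P w c1 1 (c1\<lparr>pc := if bval w b s then l else a + blen b\<rparr>)"
    using c1 code_at_ConsD(1,2)[OF c1(5)] BLt by (intro reach_step) (auto simp: sim_def)
  then show ?thesis
    using reach_trans[OF c1(1)] sim_pc[OF c1(2)] BLt by (metis blen.simps(1))
next
  case (BEq e1 e2)
  obtain c1 where c1: "reach P w cfg (elen e1 + elen e2) c1" "sim R M (a + elen e1 + elen e2) s c1"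
     "regs c1 ! \<tau> 0 = aval w e1 s" "regs c1 ! \<tau> 1 = aval w e2 s"
     "code_at P (a + elen e1 + elen e2) (JumpEq (\<tau> 0) (\<tau> 1) l # c)"
    using cexp2_correct[OF assms(1) _ assms(3)] assms(2) BEq by fastforce
  have "reach P w c1 1 (c1\<lparr>pc := if bval w b s then l else a + blen b\<rparr>)"
    using c1 code_at_ConsD(1,2)[OF c1(5)] BEq by (intro reach_step) (auto simp: sim_def)
  then show ?thesis
    using reach_trans[OF c1(1)] sim_pc[OF c1(2)] BEq by (metis blen.simps(2))
qed

lemma jump_correct:
  assumes "code_at P a (jump l # c)" "sim R M a s cfg"
  shows "\<exists>cfg'. reach P w cfg 1 cfg' \<and> sim R M l s cfg'"
proof -
  have "reach P w cfg 1 (cfg\<lparr>pc := l\<rparr>)"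
    using assms code_at_ConsD(1,2)[OF assms(1)] by (intro reach_step) (auto simp: sim_def jump_def)
  then show ?thesis using sim_pc[OF assms(2)] by blast
qed

lemma addr_of_address:
  assumes "rel s cfg" "\<And>x. x \<in> set xs \<Longrightarrow> \<rho> x < length (regs cfg)"
  shows "address w cfg (map \<rho> xs) = addr_of w xs s"
  using assms(2) unfolding address_def addr_of_def
  by (induction xs) (use assms(1) in \<open>auto simp: rel_def\<close>)

text \<open>Induction on the execution instead of the syntax: the unrolled loop in
  \<open>big_LoopT\<close> is the same code at the same address, so its induction hypothesis applies
  right after the jump back.\<close>

theorem comp_correct:
  assumes "uses_regs_below R P" "big w M c s t s'"
  shows "code_at P a (comp c a) \<Longrightarrow> sim R M a s cfg \<Longrightarrow>
    \<exists>cfg'. reach P w cfg t cfg' \<and> sim R M (a + length (comp c a)) s' cfg'"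
  using assms(2)
proof (induction arbitrary: a cfg rule: big.induct)
  case (big_Skip s)
  then show ?case using reach_refl by (auto simp: sim_def)
next
  case (big_Asg x e s)
  note c = big_Asg.prems(1)[unfolded comp.simps]
  obtain c1 where 1: "reach P w cfg (elen e) c1" "sim R M (a + elen e) s c1"
    "regs c1 ! \<tau> 0 = aval w e s"
    using cexp_correct[OF assms(1) code_at_appendD(1)[OF c] big_Asg.prems(2)] by blast
  have c': "code_at P (a + elen e) [Op Or (\<rho> x) (\<tau> 0) (\<tau> 0)]"
    using code_at_appendD(2)[OF c] by simp
  let ?c = "set_reg (\<rho> x) (aval w e s) c1"
  have "reach P w c1 1 ?c"
    using 1 code_at_ConsD(1,2)[OF c'] by (intro reach_step) (auto simp: sim_def)
  moreover have "sim R M (a + length (comp (x ::= e) a)) (s(x := aval w e s)) ?c"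
    using 1 code_at_regs[OF assms(1) c'] by (auto simp: sim_def rel_def set_reg_def nth_list_update)
  ultimately show ?case using reach_trans[OF 1(1)] by (metis add.commute)
next
  case (big_Ld xs s x)
  note c = big_Ld.prems(1)[unfolded comp.simps]
  have R: "\<rho> x < R" "\<And>x. x \<in> set xs \<Longrightarrow> \<rho> x < R" using code_at_regs[OF assms(1) c] by auto
  have ad: "address w cfg (map \<rho> xs) = addr_of w xs s"
    using big_Ld.prems(2) R by (intro addr_of_address) (auto simp: sim_def)
  let ?c = "set_reg (\<rho> x) (M ! addr_of w xs s) cfg"
  have "reach P w cfg 1 ?c"
    using big_Ld code_at_ConsD(1,2)[OF c] by (intro reach_step) (auto simp: sim_def ad)
  moreover have "sim R M (a + length (comp (Ld x xs) a)) (s(x := M ! addr_of w xs s)) ?c"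
    using big_Ld.prems(2) R by (auto simp: sim_def rel_def set_reg_def nth_list_update)
  ultimately show ?case by blast
next
  case (big_Seq c1 s t1 s1 c2 t2 s2)
  note c = big_Seq.prems(1)[unfolded comp.simps Let_def]
  obtain d1 where 1: "reach P w cfg t1 d1" "sim R M (a + length (comp c1 a)) s1 d1"
    using big_Seq.IH(1)[OF code_at_appendD(1)[OF c] big_Seq.prems(2)] by blast
  obtain d2 where 2: "reach P w d1 t2 d2"
    "sim R M (a + length (comp c1 a) + length (comp c2 (a + length (comp c1 a)))) s2 d2"
    using big_Seq.IH(2)[OF code_at_appendD(2)[OF c] 1(2)] by blast
  then show ?case using reach_trans[OF 1(1) 2(1)] by (auto simp: Let_def algebra_simps)
next
  case (big_CondT b s c1 t s1 c2)
  define p2 where "p2 = comp c2 (a + blen b)"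
  define a1 where "a1 = a + blen b + length p2 + 1"
  define p1 where "p1 = comp c1 a1"
  have cd: "comp (IF b THEN c1 ELSE c2) a = cbexp b a1 @ p2 @ [jump (a1 + length p1)] @ p1"
    by (simp add: p1_def p2_def a1_def Let_def)
  note c = big_CondT.prems(1)[unfolded cd]
  obtain d1 where 1: "reach P w cfg (blen b) d1" "sim R M a1 s d1"
    using cbexp_correct[OF assms(1) c big_CondT.prems(2), of w] big_CondT.hyps by auto
  have "code_at P (a + length (cbexp b a1) + length p2 + 1) p1"
    using code_at_appendD(2)[OF code_at_appendD(2)[OF code_at_appendD(2)[OF c]]] by simp
  then have "code_at P a1 (comp c1 a1)" by (simp add: a1_def p1_def)
  then obtain d2 where "reach P w d1 t d2" "sim R M (a1 + length p1) s1 d2"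
    using big_CondT.IH 1(2) p1_def by blast
  then show ?case using reach_trans[OF 1(1)] unfolding cd by (auto simp: a1_def algebra_simps)
next
  case (big_CondF b s c2 t s1 c1)
  define p2 where "p2 = comp c2 (a + blen b)"
  define a1 where "a1 = a + blen b + length p2 + 1"
  define p1 where "p1 = comp c1 a1"
  have cd: "comp (IF b THEN c1 ELSE c2) a = cbexp b a1 @ p2 @ [jump (a1 + length p1)] @ p1"
    by (simp add: p1_def p2_def a1_def Let_def)
  note c = big_CondF.prems(1)[unfolded cd]
  obtain d1 where 1: "reach P w cfg (blen b) d1" "sim R M (a + blen b) s d1"
    using cbexp_correct[OF assms(1) c big_CondF.prems(2), of w] big_CondF.hyps by auto
  note c2 = code_at_appendD(2)[OF c]
  have "code_at P (a + blen b) (comp c2 (a + blen b))"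
    using code_at_appendD(1)[OF c2] by (simp add: p2_def)
  then obtain d2 where 2: "reach P w d1 t d2" "sim R M (a + blen b + length p2) s1 d2"
    using big_CondF.IH 1(2) p2_def by blast
  have "code_at P (a + blen b + length p2) (jump (a1 + length p1) # p1)"
    using code_at_appendD(2)[OF c2] by simp
  then obtain d3 where 3: "reach P w d2 1 d3" "sim R M (a1 + length p1) s1 d3"
    using jump_correct[OF _ 2(2)] by blast
  show ?case using reach_trans[OF reach_trans[OF 1(1) 2(1)] 3(1)] 3(2) unfolding cd
    by (auto simp: a1_def algebra_simps)
next
  case (big_LoopF b s c)
  define a1 where "a1 = a + blen b + 1"
  define p where "p = comp c a1"
  have cd: "comp (WHILE b DO c) a = cbexp b a1 @ [jump (a1 + length p + 1)] @ p @ [jump a]"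
    by (simp add: p_def a1_def Let_def)
  note c = big_LoopF.prems(1)[unfolded cd]
  obtain d1 where 1: "reach P w cfg (blen b) d1" "sim R M (a + blen b) s d1"
    using cbexp_correct[OF assms(1) c big_LoopF.prems(2), of w] big_LoopF.hyps by auto
  have "code_at P (a + blen b) (jump (a1 + length p + 1) # p @ [jump a])"
    using code_at_appendD(2)[OF c] by simp
  then obtain d2 where 2: "reach P w d1 1 d2" "sim R M (a1 + length p + 1) s d2"
    using jump_correct[OF _ 1(2)] by blast
  show ?case using reach_trans[OF 1(1) 2(1)] 2(2) unfolding cd by (auto simp: a1_def algebra_simps)
next
  case (big_LoopT b s c t1 s1 t2 s2)
  define a1 where "a1 = a + blen b + 1"
  define p where "p = comp c a1"
  have cd: "comp (WHILE b DO c) a = cbexp b a1 @ [jump (a1 + length p + 1)] @ p @ [jump a]"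
    by (simp add: p_def a1_def Let_def)
  note c = big_LoopT.prems(1)[unfolded cd]
  obtain d1 where 1: "reach P w cfg (blen b) d1" "sim R M a1 s d1"
    using cbexp_correct[OF assms(1) c big_LoopT.prems(2), of w] big_LoopT.hyps by auto
  have c1: "code_at P a1 (p @ [jump a])"
    using code_at_appendD(2)[OF code_at_appendD(2)[OF c]] by (simp add: a1_def)
  have "code_at P a1 (comp c a1)"
    using code_at_appendD(1)[OF c1] by (simp add: p_def)
  then obtain d2 where 2: "reach P w d1 t1 d2" "sim R M (a1 + length p) s1 d2"
    using big_LoopT.IH(1) 1(2) p_def by blast
  obtain d3 where 3: "reach P w d2 1 d3" "sim R M a s1 d3"
    using jump_correct[OF _ 2(2)] code_at_appendD(2)[OF c1] by blast
  obtain d4 where 4: "reach P w d3 t2 d4" "sim R M (a + length (comp (WHILE b DO c) a)) s2 d4"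
    using big_LoopT.IH(2)[OF big_LoopT.prems(1) 3(2)] by blast
  then show ?case
    using reach_trans[OF reach_trans[OF reach_trans[OF 1(1) 2(1)] 3(1)] 4(1)] by auto
qed

text \<open>This is how the text is restored at the end: it is intact at every moment.\<close>

lemma comp_no_store: "Store as a \<notin> set (comp c l)"
proof -
  have e: "Store as a \<notin> set (cexp e k)" for e k by (induction e arbitrary: k) auto
  have b: "Store as a \<notin> set (cbexp b k)" for b k by (cases b) (auto simp: e)
  show ?thesis by (induction c arbitrary: l) (auto simp: e b Let_def jump_def)
qed

end

section \<open>Periods, maximal suffixes and comparisons of suffixes\<close>

text \<open>Every \<open>q\<close> from \<open>L\<close> on is a period, vacuously, and so is 0;
  hence the side conditions \<open>1 \<le> q\<close> further on.\<close>

definition per :: "(nat \<Rightarrow> 'a) \<Rightarrow> nat \<Rightarrow> nat \<Rightarrow> bool" where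
  "per x L q \<longleftrightarrow> (\<forall>k. k + q < L \<longrightarrow> x (k + q) = x k)"

lemma perD: "per x L q \<Longrightarrow> k + q < L \<Longrightarrow> x (k + q) = x k"
  unfolding per_def by blast

lemma per_mult: "per x L q \<Longrightarrow> k + a * q < L \<Longrightarrow> x (k + a * q) = x k"
proof (induction a)
  case (Suc a)
  have "x ((k + a * q) + q) = x (k + a * q)"
    using Suc.prems by (intro perD[OF Suc.prems(1)]) (simp add: algebra_simps)
  then show ?case using Suc by (simp add: algebra_simps)
qed simp

lemma per_mono: "per x L q \<Longrightarrow> L' \<le> L \<Longrightarrow> per x L' q"
  unfolding per_def by auto

text \<open>
  \<open>duval v i d\<close>: the word \<open>v 0, \<dots>, v (i - 1)\<close> is a prefix of a power of its prefix of length \<open>d\<close>, all of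
  whose proper suffixes are smaller than the word itself because of a mismatch. This is the invariant
  of Duval's algorithm for the reversed order of the alphabet.
\<close>

definition duval :: "(nat \<Rightarrow> 'a::linorder) \<Rightarrow> nat \<Rightarrow> nat \<Rightarrow> bool" where
  "duval v i d \<longleftrightarrow> 1 \<le> d \<and> d \<le> i \<and> per v i d \<and>
    (\<forall>k. 0 < k \<and> k < d \<longrightarrow> (\<exists>t. k + t < d \<and> (\<forall>t'<t. v (k + t') = v t') \<and> v (k + t) < v t))"

lemma duval_mismatch:
  assumes "duval v i d" "0 < k" "k < d"
  obtains t where "k + t < d" "\<And>t'. t' < t \<Longrightarrow> v (k + t') = v t'" "v (k + t) < v t"
  using assms unfolding duval_def by blast

lemma duval_1: "duval v 1 1"
  unfolding duval_def per_def by auto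

lemma duval_le: "duval v i d \<Longrightarrow> 1 \<le> d \<and> d \<le> i"
  unfolding duval_def by blast

lemma duval_cong:
  assumes eq: "\<And>k. k < i \<Longrightarrow> v k = v' k" and D: "duval v i d"
  shows "duval v' i d"
  unfolding duval_def
proof (intro conjI allI impI)
  show "1 \<le> d" "d \<le> i" using duval_le[OF D] by auto
  show "per v' i d" using D eq unfolding duval_def per_def by (metis add_lessD1)
  fix k assume k: "0 < k \<and> k < d"
  obtain t where t: "k + t < d" "\<And>t'. t' < t \<Longrightarrow> v (k + t') = v t'" "v (k + t) < v t"
    using duval_mismatch[OF D] k by blast
  have "v' (k + t') = v (k + t')" "v' t' = v t'" if "t' \<le> t" for t'
    using eq t(1) \<open>d \<le> i\<close> that by auto
  then show "\<exists>t. k + t < d \<and> (\<forall>t'<t. v' (k + t') = v' t') \<and> v' (k + t) < v' t"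
    using t by (intro exI[of _ t]) auto
qed

lemma duval_prefix: "duval v i d \<Longrightarrow> d \<le> i' \<Longrightarrow> i' \<le> i \<Longrightarrow> duval v i' d"
  unfolding duval_def using per_mono by blast

lemma duval_eq:
  assumes "duval v i d" "v i = v (i - d)"
  shows "duval v (Suc i) d"
proof -
  have "v (k + d) = v k" if "k + d < Suc i" for k
  proof (cases "k + d = i")
    case True
    then show ?thesis using assms(2) by (metis add_diff_cancel_right')
  next
    case False
    then show ?thesis using assms(1) that perD[of v i d k] unfolding duval_def by auto
  qed
  then show ?thesis using assms(1) unfolding duval_def per_def by auto
qed

text \<open>Reduces an arbitrary start to one below \<open>d\<close>, where the mismatches are
  known.\<close>

lemma duval_shift_mod:
  assumes "duval v i d" "k + t < i"
  shows "v (k + t) = v (k mod d + t)"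
proof -
  have "v ((k mod d + t) + (k div d) * d) = v (k mod d + t)"
    using assms by (intro per_mult[of v i]) (auto simp: duval_def algebra_simps)
  moreover have "(k mod d + t) + (k div d) * d = k + t"
    using mod_div_mult_eq[of k d] by linarith
  ultimately show ?thesis by simp
qed

text \<open>Reduce the start \<open>k\<close> of a proper suffix modulo \<open>d\<close>. The suffix
  reads like the one at \<open>k mod d\<close> until it reaches position \<open>i\<close>, where it
  drops below it. So it loses to the word at the mismatch known for the residue, or at the latest at
  position \<open>i\<close>; no proper period remains, and the whole word becomes the
  period.\<close>

lemma duval_less:
  assumes D: "duval v i d" and lt: "v i < v (i - d)"
  shows "duval v (Suc i) (Suc i)"
proof -
  have d: "1 \<le> d" "d \<le> i" using duval_le[OF D] by auto
  have "\<exists>t. k + t < Suc i \<and> (\<forall>t'<t. v (k + t') = v t') \<and> v (k + t) < v t"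
    if k: "0 < k" "k < Suc i" for k
  proof -
    \<comment> \<open>The offset at which the suffix from \<open>k\<close> reads the new character
      at position \<open>i\<close>.\<close>
    define t0 where "t0 = i - k"
    have kt0: "k + t0 = i" using k unfolding t0_def by simp
    have md: "k mod d + t0 \<le> i" using kt0 mod_less_eq_dividend[of k d] by linarith
    \<comment> \<open>The two positions differ by a multiple of \<open>d\<close>; so the new
      character is compared, in effect, with the one a period earlier.\<close>
    have end_eq: "v (k mod d + t0) = v (i - d)" if "d \<le> k"
    proof -
      define a where "a = k div d - 1"
      have "k div d \<ge> 1" using that d by (simp add: div_greater_zero_iff Suc_leI)
      then have "k div d = a + 1" unfolding a_def by simp
      then have "k = k mod d + a * d + d" using mod_div_mult_eq[of k d] by (simp add: algebra_simps)
      then have "i - d = (k mod d + t0) + a * d" using kt0 by linarith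
      moreover have "v ((k mod d + t0) + a * d) = v (k mod d + t0)"
        using D \<open>i - d = _\<close> d by (intro per_mult[of v i]) (auto simp: duval_def)
      ultimately show ?thesis by simp
    qed
    show ?thesis
    proof (cases "k mod d = 0")
      case True
      have "d \<le> k" using True k by (meson dvd_imp_le mod_eq_0_iff_dvd)
      have "v (k + t') = v t'" if "t' < t0" for t'
        using duval_shift_mod[OF D, of k t'] that kt0 True by simp
      moreover have "v (k + t0) < v t0" using end_eq[OF \<open>d \<le> k\<close>] lt kt0 True by simp
      ultimately show ?thesis using kt0 by (intro exI[of _ t0]) auto
    next
      case False
      obtain t where t: "k mod d + t < d" "\<And>t'. t' < t \<Longrightarrow> v (k mod d + t') = v t'"
        "v (k mod d + t) < v t"
        using duval_mismatch[OF D, of "k mod d"] False d by auto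
      show ?thesis
      proof (cases "t < t0")
        case True
        have "v (k + t') = v (k mod d + t')" if "t' \<le> t" for t'
          using duval_shift_mod[OF D, of k t'] that kt0 True by simp
        then show ?thesis using t True kt0 by (intro exI[of _ t]) auto
      next
        case False
        have "d \<le> k"
        proof (rule ccontr)
          assume "\<not> d \<le> k"
          then have "k mod d = k" by simp
          then show False using t(1) False kt0 d by linarith
        qed
        have 1: "v (k + t') = v t'" if "t' < t0" for t'
          using duval_shift_mod[OF D, of k t'] that kt0 False t(2)[of t'] by simp
        have "v (k mod d + t0) \<le> v t0"
          using t(2)[of t0] t(3) False by (cases "t = t0") auto
        then have "v (k + t0) < v t0" using end_eq[OF \<open>d \<le> k\<close>] lt kt0 by simp
        then show ?thesis using 1 kt0 by (intro exI[of _ t0]) auto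
      qed
    qed
  qed
  then show ?thesis unfolding duval_def per_def by auto
qed

text \<open>Extends the mismatch property to all suffixes of the periodic word, including those from
  a multiple of \<open>d\<close>, which agree with the word to their end. In
  \<open>wp_advance\<close> it excludes the case of a larger character: a word that is already known
  to be maximal never restarts Duval's algorithm.\<close>

lemma duval_selfmax:
  assumes D: "duval v g d" and "0 < k" "k + t < g" and eq: "\<And>t'. t' < t \<Longrightarrow> v (k + t') = v t'"
  shows "v (k + t) \<le> v t"
proof (cases "k mod d = 0")
  case True
  then show ?thesis using duval_shift_mod[OF D, of k t] assms by simp
next
  case False
  have d: "1 \<le> d" using duval_le[OF D] by auto
  obtain u where u: "k mod d + u < d" "\<And>t'. t' < u \<Longrightarrow> v (k mod d + t') = v t'"
    "v (k mod d + u) < v u"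
    using duval_mismatch[OF D, of "k mod d"] False d by auto
  have sh: "v (k + t') = v (k mod d + t')" if "t' \<le> t" for t'
    using duval_shift_mod[OF D, of k t'] that assms(3) by simp
  consider "t < u" | "t = u" | "u < t" by linarith
  then show ?thesis
  proof cases
    case 3
    then show ?thesis using eq[of u] sh[of u] u(3) by simp
  qed (use sh[of t] u in auto)
qed

text \<open>Only a mismatch inside the word decides: a suffix that is a prefix of another one
  neither beats it nor is beaten by it.\<close>

definition beats :: "(nat \<Rightarrow> 'a::linorder) \<Rightarrow> nat \<Rightarrow> nat \<Rightarrow> nat \<Rightarrow> bool" where
  "beats x L a b \<longleftrightarrow>
    (\<exists>t. a + t < L \<and> b + t < L \<and> (\<forall>t'<t. x (a + t') = x (b + t')) \<and> x (b + t) < x (a + t))"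

lemma beats_trans:
  assumes "beats x L a b" "beats x L b c"
  shows "beats x L a c"
proof -
  obtain t where t: "a + t < L" "b + t < L" "\<forall>t'<t. x (a + t') = x (b + t')" "x (b + t) < x (a + t)"
    using assms(1) unfolding beats_def by blast
  obtain u where u: "b + u < L" "c + u < L" "\<forall>t'<u. x (b + t') = x (c + t')" "x (c + u) < x (b + u)"
    using assms(2) unfolding beats_def by blast
  have "x (c + min t u) < x (a + min t u)"
    using t u by (cases t u rule: linorder_cases) (auto simp: min_def)
  then show ?thesis unfolding beats_def using t u
    by (intro exI[of _ "min t u"]) auto
qed

text \<open>
  \<open>maxsuf x L s d\<close>: the maximal suffix of \<open>x 0, \<dots>, x (L - 1)\<close> starts at \<open>s\<close> and has period \<open>d\<close>.
\<close>

definition maxsuf :: "(nat \<Rightarrow> 'a::linorder) \<Rightarrow> nat \<Rightarrow> nat \<Rightarrow> nat \<Rightarrow> bool" where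
  "maxsuf x L s d \<longleftrightarrow> s < L \<and> duval (\<lambda>k. x (s + k)) (L - s) d \<and> (\<forall>k<s. beats x L s k)"

text \<open>State of Duval's algorithm: the candidate starts at \<open>s\<close>, \<open>i\<close>
  of its characters have been scanned, and \<open>d\<close> is their period. For
  \<open>i = 0\<close> the value of \<open>d\<close> carries no information.\<close>

definition maxsuf_inv :: "(nat \<Rightarrow> 'a::linorder) \<Rightarrow> nat \<Rightarrow> nat \<Rightarrow> nat \<Rightarrow> nat \<Rightarrow> bool" where
  "maxsuf_inv x L s i d \<longleftrightarrow> s < L \<and> s + i \<le> L \<and> (0 < i \<longrightarrow> duval (\<lambda>k. x (s + k)) i d) \<and> (\<forall>k<s. beats x L s k)"

lemma maxsuf_inv_init: "0 < L \<Longrightarrow> maxsuf_inv x L 0 0 d"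
  unfolding maxsuf_inv_def by simp

lemma maxsuf_inv_1: "maxsuf_inv x L s 0 d \<Longrightarrow> maxsuf_inv x L s 1 1"
  unfolding maxsuf_inv_def using duval_1 by fastforce

lemma maxsuf_inv_eq:
  "maxsuf_inv x L s i d \<Longrightarrow> 0 < i \<Longrightarrow> s + i < L \<Longrightarrow> x (s + i) = x (s + i - d) \<Longrightarrow>
    maxsuf_inv x L s (Suc i) d"
  unfolding maxsuf_inv_def using duval_eq[of "\<lambda>k. x (s + k)" i d] duval_le[of "\<lambda>k. x (s + k)" i d] by auto

lemma maxsuf_inv_less:
  "maxsuf_inv x L s i d \<Longrightarrow> 0 < i \<Longrightarrow> s + i < L \<Longrightarrow> x (s + i) < x (s + i - d) \<Longrightarrow>
    maxsuf_inv x L s (Suc i) (Suc i)"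
  unfolding maxsuf_inv_def using duval_less[of "\<lambda>k. x (s + k)" i d] duval_le[of "\<lambda>k. x (s + k)" i d] by auto

text \<open>The larger character makes the suffix at \<open>s + d\<close> beat the one at
  \<open>s\<close>, which beats all starts in between by the known mismatches; so no start before
  \<open>s + d\<close> can win. The scanned characters are kept only if they still contain a full
  period, as \<open>duval\<close> demands \<open>d \<le> i\<close>.\<close>

lemma maxsuf_inv_greater:
  assumes I: "maxsuf_inv x L s i d" and i: "0 < i" "s + i < L" and gt: "x (s + i - d) < x (s + i)"
  shows "maxsuf_inv x L (s + d) (if i - d < d then 0 else i - d) d"
proof -
  have D: "duval (\<lambda>k. x (s + k)) i d" and B: "\<And>k. k < s \<Longrightarrow> beats x L s k"
    using I i unfolding maxsuf_inv_def by auto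
  have d: "1 \<le> d" "d \<le> i" using duval_le[OF D] by auto
  have p: "x (s + (k + d)) = x (s + k)" if "k + d < i" for k
    using D that perD[of "\<lambda>k. x (s + k)" i d k] unfolding duval_def by blast
  have new: "beats x L (s + d) s"
    unfolding beats_def
  proof (intro exI[of _ "i - d"] conjI allI impI)
    fix t' assume "t' < i - d"
    then show "x (s + d + t') = x (s + t')" using p[of t'] by (simp add: algebra_simps)
  qed (use d i gt in \<open>auto simp: algebra_simps\<close>)
  have mid: "beats x L s (s + k)" if k: "0 < k" "k < d" for k
  proof -
    obtain t where "k + t < d" "\<And>t'. t' < t \<Longrightarrow> x (s + (k + t')) = x (s + t')"
      "x (s + (k + t)) < x (s + t)"
      using duval_mismatch[OF D k] by blast
    then show ?thesis unfolding beats_def using i d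
      by (intro exI[of _ t]) (auto simp: algebra_simps)
  qed
  have "beats x L (s + d) k" if "k < s + d" for k
  proof -
    consider "k < s" | "k = s" | "s < k" by linarith
    then show ?thesis
    proof cases
      case 1 then show ?thesis using beats_trans[OF new B] by blast
    next
      case 2 then show ?thesis using new by simp
    next
      case 3 then show ?thesis using beats_trans[OF new mid[of "k - s"]] that by simp
    qed
  qed
  moreover have "duval (\<lambda>k. x (s + d + k)) (i - d) d" if "\<not> i - d < d"
  proof (rule duval_cong)
    show "duval (\<lambda>k. x (s + k)) (i - d) d" using duval_prefix[OF D] that by simp
    show "x (s + k) = x (s + d + k)" if "k < i - d" for k
      using p[of k] that by (simp add: algebra_simps)
  qed
  ultimately show ?thesis unfolding maxsuf_inv_def using d i by auto
qed

lemma maxsuf_inv_final: "maxsuf_inv x L s i d \<Longrightarrow> \<not> s + i < L \<Longrightarrow> maxsuf x L s d \<and> i = L - s"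
  unfolding maxsuf_inv_def maxsuf_def by (auto simp: le_antisym)

lemma maxsuf_le: "maxsuf x L s d \<Longrightarrow> 1 \<le> d \<and> s + d \<le> L"
  unfolding maxsuf_def using duval_le by fastforce

text \<open>
  If a later suffix of the word begins with its maximal suffix \<open>v\<close> and is longer, it would be larger than \<open>v\<close>.
\<close>

lemma maxsuf_no_prefix:
  assumes "maxsuf x L s d" "k < s"
  shows "\<exists>t<L - s. x (k + t) \<noteq> x (s + t)"
proof -
  obtain t where "s + t < L" "x (k + t) < x (s + t)"
    using assms unfolding maxsuf_def beats_def by blast
  then show ?thesis by (intro exI[of _ t]) auto
qed

text \<open>A period \<open>q \<le> s\<close> would put a copy of the maximal suffix at
  \<open>s - q\<close>. So the maximal suffix starts inside the first period.\<close>

lemma maxsuf_per_gt: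
  assumes M: "maxsuf x L s d" and p: "per x L q" "1 \<le> q"
  shows "s < q"
proof (rule ccontr)
  assume "\<not> s < q"
  then obtain t where "t < L - s" "x (s - q + t) \<noteq> x (s + t)"
    using maxsuf_no_prefix[OF M, of "s - q"] p by auto
  moreover have "x (s - q + t + q) = x (s - q + t)"
    using \<open>\<not> s < q\<close> \<open>t < L - s\<close> by (intro perD[OF p(1)]) auto
  ultimately show False using \<open>\<not> s < q\<close> by (auto simp: algebra_simps)
qed

text \<open>A smaller period would equate the two characters at which the maximal suffix differs
  from its own suffix at offset \<open>q\<close>.\<close>

lemma maxsuf_per_ge:
  assumes M: "maxsuf x L s d" and p: "per x L q" "1 \<le> q"
  shows "d \<le> q"
proof (rule ccontr)
  assume "\<not> d \<le> q"
  have D: "duval (\<lambda>k. x (s + k)) (L - s) d" using M unfolding maxsuf_def by blast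
  obtain t where "q + t < d" "x (s + (q + t)) < x (s + t)"
    using duval_mismatch[OF D, of q] \<open>\<not> d \<le> q\<close> p by auto
  moreover have "x (s + t + q) = x (s + t)"
    using \<open>q + t < d\<close> maxsuf_le[OF M] by (intro perD[OF p(1)]) auto
  ultimately show False by (auto simp: algebra_simps)
qed

text \<open>If \<open>q\<close> and another \<open>d\<close> characters fit into the maximal suffix,
  then \<open>d\<close> divides \<open>q\<close>, since otherwise the mismatch at offset
  \<open>q mod d\<close> contradicts the period \<open>q\<close>. Period \<open>d\<close> of the
  maximal suffix then carries over to the positions before \<open>s\<close>, because a shift by
  \<open>q\<close> moves them into it. Used in the contrapositive: if \<open>d\<close> is not a
  period of the word, then all periods exceed \<open>L - s - d\<close>.\<close>

lemma maxsuf_per_long: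
  assumes M: "maxsuf x L s d" and p: "per x L q" "1 \<le> q" and "q + d \<le> L - s"
  shows "per x L d"
proof -
  have D: "duval (\<lambda>k. x (s + k)) (L - s) d" using M unfolding maxsuf_def by blast
  have d: "1 \<le> d" using duval_le[OF D] by auto
  have "q mod d = 0"
  proof (rule ccontr)
    assume "q mod d \<noteq> 0"
    then obtain t where t: "q mod d + t < d" "x (s + (q mod d + t)) < x (s + t)"
      using duval_mismatch[OF D, of "q mod d"] d by auto
    have "x (s + (q + t)) = x (s + (q mod d + t))"
      using duval_shift_mod[OF D, of q t] t assms(4) by simp
    moreover have "x (s + t + q) = x (s + t)"
      using t assms(4) d by (intro perD[OF p(1)]) auto
    ultimately show False using t by (auto simp: algebra_simps)
  qed
  obtain a where a: "q = a * d" using \<open>q mod d = 0\<close> by (metis dvdE mod_eq_0_iff_dvd mult.commute)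
  have sq: "s < q" using maxsuf_per_gt[OF M p] .
  show ?thesis unfolding per_def
  proof (intro allI impI)
    fix k assume k: "k + d < L"
    show "x (k + d) = x k"
    proof (cases "k < s")
      case False
      then show ?thesis using perD[of "\<lambda>k. x (s + k)" "L - s" d "k - s"] D k
        unfolding duval_def by (auto simp: algebra_simps)
    next
      case True
      have 1: "x (k + q) = x k" using True assms(4) d by (intro perD[OF p(1)]) auto
      have 2: "x (k + d + q) = x (k + d)" using True assms(4) d by (intro perD[OF p(1)]) auto
      have "x (s + ((k + q - s) + d)) = x (s + (k + q - s))"
        using perD[of "\<lambda>k. x (s + k)" "L - s" d "k + q - s"] D True sq assms(4) d
        unfolding duval_def by auto
      then show ?thesis using 1 2 sq by (auto simp: algebra_simps)
    qed
  qed
qed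

definition long_pers :: "(nat \<Rightarrow> 'a) \<Rightarrow> nat \<Rightarrow> bool" where
  "long_pers x L \<longleftrightarrow> (\<forall>q. 1 \<le> q \<and> per x L q \<longrightarrow> L \<le> 3 * q)"

text \<open>A short period \<open>r\<close> would connect \<open>e\<close>, \<open>e - r\<close>,
  \<open>e - r - q\<close> and \<open>e - q\<close> by equal characters: two shifts by
  \<open>r\<close> and, inside the run, one by \<open>q\<close>. This contradicts the break at
  \<open>e\<close>. The bounds on \<open>q\<close> and \<open>r\<close> give
  \<open>q + r \<le> e\<close>, so that all four positions exist.\<close>

lemma long_pers_next:
  assumes "per x e q" "x e \<noteq> x (e - q)" "3 * q \<le> e" "1 \<le> q"
  shows "long_pers x (e + q)"
  unfolding long_pers_def
proof (intro allI impI, rule ccontr)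
  fix r assume r: "1 \<le> r \<and> per x (e + q) r" and "\<not> e + q \<le> 3 * r"
  then have le: "q + r \<le> e" using assms by linarith
  have "x (e - r + r) = x (e - r)" using r le assms by (intro perD) auto
  moreover have "x (e - r - q + q) = x (e - r - q)" using r le assms by (intro perD[OF assms(1)]) auto
  moreover have "x (e - r - q + r) = x (e - r - q)" using r le assms by (intro perD[of x "e + q"]) auto
  moreover have "e - r + r = e" "e - r - q + q = e - r" "e - r - q + r = e - q" using le by auto
  ultimately show False using assms(2) by simp
qed

section \<open>Common prefixes of two suffixes\<close>

definition match :: "'a list \<Rightarrow> nat \<Rightarrow> nat \<Rightarrow> nat \<Rightarrow> bool" where
  "match T p l j \<longleftrightarrow> j + l \<le> length T \<and> p + l \<le> length T \<and> (\<forall>k<l. T ! (j + k) = T ! (p + k))"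

lemma match_0: "match T p 0 j \<longleftrightarrow> j \<le> length T \<and> p \<le> length T"
  unfolding match_def by auto

lemma match_Suc:
  "match T p (Suc l) j \<longleftrightarrow> match T p l j \<and> j + l < length T \<and> p + l < length T \<and> T ! (j + l) = T ! (p + l)"
  unfolding match_def by (auto simp: less_Suc_eq)

lemma match_mono: "match T p l j \<Longrightarrow> l' \<le> l \<Longrightarrow> match T p l' j"
  unfolding match_def by auto

lemma append_less_append: "us @ xs < us @ ys \<longleftrightarrow> xs < (ys :: nat list)"
  by (induction us) auto

lemma match_suffix_less:
  assumes "match T p l j"
  shows "drop j T < drop p T \<longleftrightarrow> drop (j + l) T < drop (p + l) (T :: nat list)"
proof -
  have "take l (drop j T) = take l (drop p T)"
    using assms unfolding match_def by (intro nth_equalityI) auto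
  moreover have "drop j T = take l (drop j T) @ drop (j + l) T" "drop p T = take l (drop p T) @ drop (p + l) T"
    by (metis append_take_drop_id drop_drop add.commute)+
  ultimately show ?thesis by (metis append_less_append)
qed

text \<open>The suffix that ends first is the smaller one; this explains the asymmetric treatment of
  the two ends.\<close>

lemma match_less_iff:
  fixes T :: "nat list"
  assumes "match T p l j" "\<not> match T p (Suc l) j"
  shows "drop j T < drop p T \<longleftrightarrow> p + l < length T \<and> (j + l < length T \<longrightarrow> T ! (j + l) < T ! (p + l))"
proof -
  have "j + l \<le> length T" "p + l \<le> length T" using assms(1) unfolding match_def by auto
  moreover have "drop (j + l) T = T ! (j + l) # drop (Suc (j + l)) T" if "j + l < length T"
    using that by (simp add: Cons_nth_drop_Suc)
  moreover have "drop (p + l) T = T ! (p + l) # drop (Suc (p + l)) T" if "p + l < length T"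
    using that by (simp add: Cons_nth_drop_Suc)
  ultimately show ?thesis
    using match_suffix_less[OF assms(1)] assms unfolding match_Suc by (cases "j + l < length T"; cases "p + l < length T") auto
qed

text \<open>A suffix that matches to the end of the pattern extends it. This ends the sequence of
  levels.\<close>

lemma match_full_not_less:
  "match T p l j \<Longrightarrow> length T \<le> p + l \<Longrightarrow> \<not> drop j T < drop p (T :: nat list)"
  using match_suffix_less[of T p l j] by simp

lemma match_period:
  assumes "match T p L j" "match T p L (j + q)"
  shows "per (\<lambda>k. T ! (p + k)) L q"
  unfolding per_def
proof (intro allI impI)
  fix k assume "k + q < L"
  then show "T ! (p + (k + q)) = T ! (p + k)"
    using assms unfolding match_def by (metis add.assoc add.commute add_lessD1)
qed

text \<open>An occurrence at \<open>j + q\<close> would read the copy of the maximal suffix at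
  \<open>j + s\<close> as its own characters from \<open>s - q\<close> on, where the maximal suffix
  does not occur. It justifies a shift by \<open>s + 1\<close> even if the part before the maximal
  suffix fails to match.\<close>

lemma maxsuf_no_match:
  assumes M: "maxsuf (\<lambda>k. T ! (p + k)) L s d" and occ: "\<And>t. t < L - s \<Longrightarrow> T ! (j + s + t) = T ! (p + s + t)"
    and q: "1 \<le> q" "q \<le> s"
  shows "\<not> match T p L (j + q)"
proof
  assume m: "match T p L (j + q)"
  obtain t where t: "t < L - s" "T ! (p + (s - q + t)) \<noteq> T ! (p + (s + t))"
    using maxsuf_no_prefix[OF M, of "s - q"] q by auto
  have "T ! (j + q + (s - q + t)) = T ! (p + (s - q + t))"
    using m t(1) unfolding match_def by auto
  then show False using occ[OF t(1)] t q by (auto simp: algebra_simps)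
qed

text \<open>After \<open>i\<close> matched characters of the maximal suffix, a shift below their
  period \<open>d\<close> runs into a mismatch between characters already read. So the shift is
  determined by the single number \<open>d\<close>.\<close>

lemma duval_no_match:
  assumes D: "duval (\<lambda>k. T ! (p + s + k)) i d" and occ: "\<And>t. t < i \<Longrightarrow> T ! (j + s + t) = T ! (p + s + t)"
    and q: "1 \<le> q" "q < d" and i: "s + i \<le> L"
  shows "\<not> match T p L (j + q)"
proof
  assume m: "match T p L (j + q)"
  obtain t where t: "q + t < d" "T ! (p + s + (q + t)) < T ! (p + s + t)"
    using duval_mismatch[OF D, of q] q by auto
  have d: "d \<le> i" using duval_le[OF D] by auto
  have "T ! (j + q + (s + t)) = T ! (p + (s + t))"
    using m t d i unfolding match_def by auto
  moreover have "T ! (j + s + (q + t)) = T ! (p + s + (q + t))"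
    using t d by (intro occ) auto
  ultimately show False using t by (auto simp: algebra_simps)
qed

text \<open>
  A run of period \<open>q\<close> in the text ending at \<open>F\<close> and a run in the pattern ending at \<open>e\<close> yield a common prefix
  without looking at its characters.
\<close>

lemma match_run:
  assumes m: "match T p L j" and per: "per (\<lambda>k. T ! (p + k)) e q" and q: "1 \<le> q" "q \<le> L" and e: "p + e \<le> length T"
    and run: "\<And>k. j \<le> k \<Longrightarrow> k + q \<le> F \<Longrightarrow> T ! (k + q) = T ! k" and F: "F < length T"
    and l: "l \<le> e" "j + l \<le> Suc F"
  shows "match T p l j"
proof -
  have "T ! (j + k) = T ! (p + k)" if "k < l" for k
    using that
  proof (induction k rule: less_induct)
    case (less k)
    show ?case
    proof (cases "k < L")
      case True
      then show ?thesis using m unfolding match_def by auto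
    next
      case False
      have "T ! (j + (k - q) + q) = T ! (j + (k - q))" using False q less.prems l by (intro run) auto
      moreover have "T ! (p + ((k - q) + q)) = T ! (p + (k - q))" using False q less.prems l by (intro perD[OF per]) auto
      moreover have "T ! (j + (k - q)) = T ! (p + (k - q))" using False q less.prems by (intro less.IH) auto
      ultimately show ?thesis using False q by (auto simp: algebra_simps)
    qed
  qed
  then show ?thesis unfolding match_def using l e F by auto
qed

section \<open>Comparing two characters of the packed text\<close>

text \<open>\<open>Par\<close>: the words of the parameters; \<open>AdA\<close> and
  \<open>AdB\<close>: the words of the addresses of the two characters under comparison;
  \<open>Flag\<close>: \<open>b div w\<close> in unary; \<open>Sc\<close>: all single-word
  variables.\<close>

datatype var = Par nat | AdA nat | AdB nat | Flag nat | Sc nat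

primrec var_code :: "var \<Rightarrow> nat" where
  "var_code (Par k) = 5 * k"
| "var_code (AdA k) = 5 * k + 1"
| "var_code (AdB k) = 5 * k + 2"
| "var_code (Flag k) = 5 * k + 3"
| "var_code (Sc k) = 5 * k + 4"

lemma var_code_inj: "var_code x = var_code y \<longleftrightarrow> x = y"
  by (cases x; cases y) (simp; presburger)+

abbreviation vW :: var where "vW \<equiv> Sc 0"
abbreviation vN :: var where "vN \<equiv> Sc 1"
abbreviation vR :: var where "vR \<equiv> Sc 2"
abbreviation vMask :: var where "vMask \<equiv> Sc 3"
abbreviation CA :: var where "CA \<equiv> Sc 4"
abbreviation CB :: var where "CB \<equiv> Sc 5"
abbreviation OA :: var where "OA \<equiv> Sc 6"
abbreviation OB :: var where "OB \<equiv> Sc 7"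
abbreviation XA :: var where "XA \<equiv> Sc 8"
abbreviation XB :: var where "XB \<equiv> Sc 9"
abbreviation XT :: var where "XT \<equiv> Sc 10"
abbreviation LT :: var where "LT \<equiv> Sc 11"
abbreviation EQ :: var where "EQ \<equiv> Sc 12"
abbreviation vP :: var where "vP \<equiv> Sc 13"
abbreviation vX :: var where "vX \<equiv> Sc 14"
abbreviation vCnt :: var where "vCnt \<equiv> Sc 15"
abbreviation vM :: var where "vM \<equiv> Sc 16"
abbreviation vL :: var where "vL \<equiv> Sc 17"
abbreviation vS :: var where "vS \<equiv> Sc 18"
abbreviation vI :: var where "vI \<equiv> Sc 19"
abbreviation vD :: var where "vD \<equiv> Sc 20"
abbreviation vK :: var where "vK \<equiv> Sc 21"
abbreviation vPer :: var where "vPer \<equiv> Sc 22"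
abbreviation vQ :: var where "vQ \<equiv> Sc 23"
abbreviation vE :: var where "vE \<equiv> Sc 24"
abbreviation vGo :: var where "vGo \<equiv> Sc 25"
abbreviation vJM :: var where "vJM \<equiv> Sc 26"
abbreviation vJ :: var where "vJ \<equiv> Sc 27"
abbreviation vNb :: var where "vNb \<equiv> Sc 28"
abbreviation vF :: var where "vF \<equiv> Sc 29"
abbreviation vMt :: var where "vMt \<equiv> Sc 30"
abbreviation vAdv :: var where "vAdv \<equiv> Sc 31"
abbreviation vGo2 :: var where "vGo2 \<equiv> Sc 32"
abbreviation vOk :: var where "vOk \<equiv> Sc 33"
abbreviation vLen :: var where "vLen \<equiv> Sc 34"
abbreviation vFuel :: var where "vFuel \<equiv> Sc 35"
abbreviation vGo3 :: var where "vGo3 \<equiv> Sc 36"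
abbreviation vU :: var where "vU \<equiv> Sc 37"
abbreviation vRnk :: var where "vRnk \<equiv> Sc 38"
abbreviation vA :: var where "vA \<equiv> Sc 39"
abbreviation vB :: var where "vB \<equiv> Sc 40"
abbreviation vMid :: var where "vMid \<equiv> Sc 41"
abbreviation vSel :: var where "vSel \<equiv> Sc 42"
abbreviation vLo :: var where "vLo \<equiv> Sc 44"
abbreviation vHi :: var where "vHi \<equiv> Sc 45"
abbreviation vRlo :: var where "vRlo \<equiv> Sc 46"
abbreviation vRhi :: var where "vRhi \<equiv> Sc 47"
abbreviation vDone :: var where "vDone \<equiv> Sc 48"

abbreviation (input) plus_exp (infixl \<open>\<oplus>\<close> 65) where "a \<oplus> b \<equiv> Bin Add a b"
abbreviation (input) minus_exp (infixl \<open>\<ominus>\<close> 65) where "a \<ominus> b \<equiv> Bin Sub a b"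

text \<open>Both branches of a conditional are added, a crude bound that needs no knowledge of the
  state. The value 0 for a loop is a dummy, guarded by \<open>loopfree\<close>.\<close>

primrec tmax :: "'v com \<Rightarrow> nat" where
  "tmax Skip = 0"
| "tmax (x ::= e) = elen e + 1"
| "tmax (Ld x xs) = 1"
| "tmax (c1;; c2) = tmax c1 + tmax c2"
| "tmax (IF b THEN c1 ELSE c2) = blen b + 1 + tmax c1 + tmax c2"
| "tmax (WHILE b DO c) = 0"

primrec loopfree :: "'v com \<Rightarrow> bool" where
  "loopfree Skip \<longleftrightarrow> True"
| "loopfree (x ::= e) \<longleftrightarrow> True"
| "loopfree (Ld x xs) \<longleftrightarrow> True"
| "loopfree (c1;; c2) \<longleftrightarrow> loopfree c1 \<and> loopfree c2"
| "loopfree (IF b THEN c1 ELSE c2) \<longleftrightarrow> loopfree c1 \<and> loopfree c2"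
| "loopfree (WHILE b DO c) \<longleftrightarrow> False"

lemma big_tmax: "big w M c s t s' \<Longrightarrow> loopfree c \<Longrightarrow> t \<le> tmax c"
  by (induction rule: big.induct) auto

lemma wp_tmax:
  assumes "wp w M c s Q" "loopfree c"
  shows "wp w M c s (\<lambda>s' t. Q s' t \<and> t \<le> tmax c)"
  using assms big_tmax unfolding wp_def by blast

abbreviation seqs :: "'v com list \<Rightarrow> 'v com" where
  "seqs cs \<equiv> foldr Seq cs Skip"

text \<open>Rule for statically unrolled loops: the index lives in the program text and occupies no
  register.\<close>

lemma wp_seqs:
  assumes "\<And>k s. m \<le> k \<Longrightarrow> k < n \<Longrightarrow> I k s \<Longrightarrow> wp w M (f k) s (\<lambda>s' _. I (Suc k) s')" "I m s" "m \<le> n"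
  shows "wp w M (seqs (map f [m..<n])) s (\<lambda>s' _. I n s')"
  using assms
proof (induction "n - m" arbitrary: m s)
  case 0
  then show ?case by (simp add: wp_SkipI)
next
  case (Suc d)
  then have m: "m < n" by simp
  have "wp w M (f m) s (\<lambda>s' _. I (Suc m) s')" using Suc.prems m by auto
  then have "wp w M (f m) s (\<lambda>s' _. wp w M (seqs (map f [Suc m..<n])) s' (\<lambda>s' _. I n s'))"
    by (rule wp_mono) (use Suc m in auto)
  then show ?case using m by (simp add: upt_rec[of m n] wp_SeqI)
qed

lemma wr_seqs: "wr (seqs cs) y \<longleftrightarrow> (\<exists>c\<in>set cs. wr c y)"
  by (induction cs) auto

lemma loopfree_seqs: "loopfree (seqs cs) \<longleftrightarrow> (\<forall>c\<in>set cs. loopfree c)"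
  by (induction cs) auto

section \<open>Arithmetic on numbers of several words\<close>

primrec incw :: "'v list \<Rightarrow> 'v com" where
  "incw [] = Skip"
| "incw (x # xs) = x ::= (Rg x \<oplus> Im 1);; IF BEq (Rg x) (Im 0) THEN incw xs ELSE Skip"

text \<open>The truncated sum is smaller than the summand exactly if the addition overflowed; this
  detects the carry without a wider word.\<close>

primrec addw :: "'v list \<Rightarrow> 'v \<Rightarrow> 'v com" where
  "addw [] v = Skip"
| "addw (x # xs) v = x ::= (Rg x \<oplus> Rg v);; IF BLt (Rg x) (Rg v) THEN incw xs ELSE Skip"

lemma wr_incw: "wr (incw xs) y \<Longrightarrow> y \<in> set xs"
  by (induction xs) auto

lemma wr_addw: "wr (addw xs v) y \<Longrightarrow> y \<in> set xs"
  by (cases xs) (auto dest: wr_incw)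

lemma loopfree_incw [simp]: "loopfree (incw xs)"
  by (induction xs) auto

lemma loopfree_addw [simp]: "loopfree (addw xs v)"
  by (cases xs) auto

lemma addr_of_Cons: "addr_of w (x # xs) s = s x + 2 ^ w * addr_of w xs s"
  by (simp add: addr_of_def)

lemma addr_of_cong: "(\<And>x. x \<in> set xs \<Longrightarrow> s x = s' x) \<Longrightarrow> addr_of w xs s = addr_of w xs s'"
  unfolding addr_of_def by (induction xs) auto

lemma addr_of_fun_upd [simp]: "x \<notin> set xs \<Longrightarrow> addr_of w xs (s(x := v)) = addr_of w xs s"
  by (rule addr_of_cong) auto

lemma wp_incw:
  assumes "1 \<le> w" "distinct xs" "\<And>x. x \<in> set xs \<Longrightarrow> s x < 2 ^ w" "addr_of w xs s + 1 < 2 ^ (w * length xs)"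
  shows "wp w M (incw xs) s (\<lambda>s' _. addr_of w xs s' = addr_of w xs s + 1 \<and> (\<forall>x\<in>set xs. s' x < 2 ^ w))"
  using assms(2-)
proof (induction xs arbitrary: s)
  case Nil
  then show ?case by (simp add: addr_of_def)
next
  case (Cons x xs)
  have x: "s x < 2 ^ w" using Cons.prems by auto
  have one: "take_bit w (1::nat) = 1" using assms(1) by (simp add: take_bit_eq_mod)
  let ?s = "s(x := take_bit w (s x + 1))"
  show ?case
  proof (cases "s x + 1 < 2 ^ w")
    case True
    then have t: "take_bit w (s x + 1) = s x + 1" by (simp add: take_bit_nat_eq_self)
    show ?thesis
      using Cons.prems True t one
      by (auto intro!: wp_SeqI wp_AsgI wp_CondI wp_SkipI simp: addr_of_Cons)
  next
    case False
    then have eq: "s x + 1 = 2 ^ w" using x by simp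
    have t: "take_bit w (s x + 1) = 0" unfolding eq by simp
    have "2 ^ w * (addr_of w xs s + 1) < 2 ^ w * 2 ^ (w * length xs)"
      using Cons.prems(3) eq by (simp add: addr_of_Cons power_add algebra_simps)
    then have "addr_of w xs s + 1 < 2 ^ (w * length xs)"
      by (simp only: mult_less_cancel1)
    then have lt: "addr_of w xs ?s + 1 < 2 ^ (w * length xs)"
      using Cons.prems(1) by simp
    have pre: "distinct xs" "\<And>y. y \<in> set xs \<Longrightarrow> ?s y < 2 ^ w" using Cons.prems by auto
    have fin: "wp w M (incw xs) ?s (\<lambda>s' _. addr_of w (x # xs) s' = addr_of w (x # xs) s + 1 \<and>
      (\<forall>x\<in>set (x # xs). s' x < 2 ^ w))"
    proof (rule wp_frame[OF Cons.IH[OF pre lt]])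
      fix s' t
      assume a: "addr_of w xs s' = addr_of w xs ?s + 1 \<and> (\<forall>x\<in>set xs. s' x < 2 ^ w)"
        and f: "\<And>y. \<not> wr (incw xs) y \<Longrightarrow> s' y = ?s y"
      have "s' x = 0" using f[of x] wr_incw[of xs x] Cons.prems(1) t by auto
      then show "addr_of w (x # xs) s' = addr_of w (x # xs) s + 1 \<and> (\<forall>x\<in>set (x # xs). s' x < 2 ^ w)"
        using a eq Cons.prems(1) by (auto simp: addr_of_Cons algebra_simps)
    qed
    then show ?thesis
      using t one by (auto intro!: wp_SeqI wp_AsgI wp_CondI)
  qed
qed

lemma wp_addw:
  assumes "1 \<le> w" "distinct xs" "\<And>x. x \<in> set xs \<Longrightarrow> s x < 2 ^ w" "v \<notin> set xs" "s v < 2 ^ w"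
    "addr_of w xs s + s v < 2 ^ (w * length xs)"
  shows "wp w M (addw xs v) s (\<lambda>s' _. addr_of w xs s' = addr_of w xs s + s v \<and> (\<forall>x\<in>set xs. s' x < 2 ^ w))"
proof (cases xs)
  case Nil
  then show ?thesis using assms by (auto simp: addr_of_def intro: wp_SkipI)
next
  case (Cons x ys)
  have x: "s x < 2 ^ w" "x \<notin> set ys" "v \<noteq> x" using assms Cons by auto
  let ?s = "s(x := take_bit w (s x + s v))"
  show ?thesis
  proof (cases "s x + s v < 2 ^ w")
    case True
    then have t: "take_bit w (s x + s v) = s x + s v" by (simp add: take_bit_nat_eq_self)
    show ?thesis unfolding Cons
      using assms True t x Cons
      by (auto intro!: wp_SeqI wp_AsgI wp_CondI wp_SkipI simp: addr_of_Cons)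
  next
    case False
    then have t: "take_bit w (s x + s v) = s x + s v - 2 ^ w"
      using x(1) assms(5) by (simp add: take_bit_eq_mod mod_if[of "s x + s v"])
    have tl: "s x + s v - 2 ^ w < s v" using x(1) False by linarith
    have "2 ^ w * (addr_of w ys s + 1) < 2 ^ w * 2 ^ (w * length ys)"
      using assms(6) False unfolding Cons by (simp add: addr_of_Cons power_add algebra_simps)
    then have "addr_of w ys s + 1 < 2 ^ (w * length ys)"
      by (simp only: mult_less_cancel1)
    then have lt: "addr_of w ys ?s + 1 < 2 ^ (w * length ys)"
      using x by simp
    have pre: "distinct ys" "\<And>y. y \<in> set ys \<Longrightarrow> ?s y < 2 ^ w" using assms Cons by auto
    have fin: "wp w M (incw ys) ?s (\<lambda>s' _. addr_of w (x # ys) s' = addr_of w (x # ys) s + s v \<and>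
      (\<forall>x\<in>set (x # ys). s' x < 2 ^ w))"
    proof (rule wp_frame[OF wp_incw[OF assms(1) pre lt]])
      fix s' t'
      assume a: "addr_of w ys s' = addr_of w ys ?s + 1 \<and> (\<forall>x\<in>set ys. s' x < 2 ^ w)"
        and f: "\<And>y. \<not> wr (incw ys) y \<Longrightarrow> s' y = ?s y"
      have "s' x = s x + s v - 2 ^ w" using f[of x] wr_incw[of ys x] x t by auto
      then show "addr_of w (x # ys) s' = addr_of w (x # ys) s + s v \<and> (\<forall>x\<in>set (x # ys). s' x < 2 ^ w)"
        using a False x tl assms(5) by (auto simp: addr_of_Cons algebra_simps)
    qed
    then show ?thesis unfolding Cons
      using t tl x(3) by (auto intro!: wp_SeqI wp_AsgI wp_CondI)
  qed
qed

section \<open>Bits and digits of the packed text\<close>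

lemma horner_sum_char:
  fixes T :: "nat list"
  assumes "\<And>x. x \<in> set T \<Longrightarrow> x < 2 ^ b" "j < length T"
  shows "take_bit b (drop_bit (j * b) (horner_sum id (2 ^ b) T)) = (T ! j :: nat)"
  using assms
proof (induction T arbitrary: j)
  case (Cons x T)
  have x: "x < 2 ^ b" using Cons.prems by auto
  have "(x + 2 ^ b * h) div 2 ^ b = h" for h
    using x by simp
  then have d: "drop_bit b (x + 2 ^ b * horner_sum id (2 ^ b) T) = horner_sum id (2 ^ b) T"
    by (simp add: drop_bit_eq_div)
  show ?case
  proof (cases j)
    case 0
    then show ?thesis using x by (simp add: take_bit_eq_mod)
  next
    case (Suc j')
    have "drop_bit (j' * b) (drop_bit b (x + 2 ^ b * horner_sum id (2 ^ b) T)) = drop_bit (j' * b) (horner_sum id (2 ^ b) T)"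
      using d by simp
    then have "drop_bit (j * b) (x + 2 ^ b * horner_sum id (2 ^ b) T) = drop_bit (j' * b) (horner_sum id (2 ^ b) T)"
      unfolding Suc drop_bit_drop_bit by (simp add: add.commute)
    then have "take_bit b (drop_bit (j * b) (horner_sum id (2 ^ b) (x # T))) =
        take_bit b (drop_bit (j' * b) (horner_sum id (2 ^ b) T))"
      by (simp only: horner_sum_simps id_apply)
    also have "\<dots> = T ! j'" using Cons.prems Suc by (intro Cons.IH) auto
    finally show ?thesis unfolding Suc nth_Cons_Suc .
  qed
qed simp

text \<open>A field that starts at bit \<open>off\<close> of word \<open>A\<close> consists of the
  upper bits of this word and the lower bits of the next one. The two claims say which bits of the
  text either word contributes.\<close>

lemma bit_piece:
  fixes V :: nat
  assumes "off < w"
  shows "bit (drop_bit off (take_bit w (drop_bit (A * w) V))) n \<longleftrightarrow> n + off < w \<and> bit V (A * w + off + n)"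
    and "bit (take_bit w (push_bit (w - off) (take_bit w (drop_bit (Suc A * w) V)))) n \<longleftrightarrow>
      n < w \<and> w \<le> n + off \<and> bit V (A * w + off + n)"
proof -
  show "bit (drop_bit off (take_bit w (drop_bit (A * w) V))) n \<longleftrightarrow> n + off < w \<and> bit V (A * w + off + n)"
    by (simp add: bit_take_bit_iff bit_drop_bit_eq ac_simps)
  show "bit (take_bit w (push_bit (w - off) (take_bit w (drop_bit (Suc A * w) V)))) n \<longleftrightarrow>
      n < w \<and> w \<le> n + off \<and> bit V (A * w + off + n)"
  proof (cases "w \<le> n + off")
    case True
    then have "Suc A * w + (n - (w - off)) = A * w + off + n" using assms by simp
    then show ?thesis using True assms
      by (auto simp: bit_take_bit_iff bit_drop_bit_eq bit_push_bit_iff ac_simps)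
  qed (auto simp: bit_take_bit_iff bit_push_bit_iff)
qed

lemma piece_full:
  fixes V :: nat
  assumes "off < w"
  shows "drop_bit off (take_bit w (drop_bit (A * w) V)) OR
    take_bit w (push_bit (w - off) (take_bit w (drop_bit (Suc A * w) V))) =
    take_bit w (drop_bit (A * w + off) V)"
proof (rule bit_eqI)
  fix n
  show "bit (drop_bit off (take_bit w (drop_bit (A * w) V)) OR
      take_bit w (push_bit (w - off) (take_bit w (drop_bit (Suc A * w) V)))) n \<longleftrightarrow>
    bit (take_bit w (drop_bit (A * w + off) V)) n"
    unfolding bit_or_iff bit_piece[OF assms] by (auto simp: bit_take_bit_iff bit_drop_bit_eq)
qed

lemma piece_short:
  fixes V :: nat
  assumes "off < w" "off + len \<le> w"
  shows "take_bit len (drop_bit off (take_bit w (drop_bit (A * w) V))) =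
    take_bit len (drop_bit (A * w + off) V)"
proof (rule bit_eqI)
  fix n
  show "bit (take_bit len (drop_bit off (take_bit w (drop_bit (A * w) V)))) n \<longleftrightarrow>
    bit (take_bit len (drop_bit (A * w + off) V)) n"
    unfolding bit_take_bit_iff[of len] bit_piece(1)[OF assms(1)]
    using assms by (auto simp: bit_drop_bit_eq)
qed

lemma take_bit_split:
  "take_bit (k + l) (x::nat) = take_bit k x + 2 ^ k * take_bit l (drop_bit k x)"
  unfolding take_bit_eq_mod drop_bit_eq_div power_add by (simp add: mod_mult2_eq)

lemma digit_less:
  fixes a m x y :: nat
  assumes "a < m" "x < y"
  shows "a + m * x < b + m * y"
proof -
  have "m * Suc x \<le> m * y" using assms(2) by (intro mult_le_mono2) simp
  then show ?thesis using assms(1) by simp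
qed

lemma digit_less_iff:
  fixes a b x y m :: nat
  assumes "a < m" "b < m"
  shows "a + m * x < b + m * y \<longleftrightarrow> x < y \<or> x = y \<and> a < b"
proof (cases x y rule: linorder_cases)
  case less
  then show ?thesis using digit_less[OF assms(1) less] by blast
next
  case equal
  then show ?thesis by simp
next
  case greater
  then show ?thesis using digit_less[OF assms(2) greater, of a] by linarith
qed

lemma digit_eq_iff:
  fixes a b x y m :: nat
  assumes "a < m" "b < m"
  shows "a + m * x = b + m * y \<longleftrightarrow> x = y \<and> a = b"
proof
  assume "a + m * x = b + m * y"
  then have "\<not> a + m * x < b + m * y" "\<not> b + m * y < a + m * x" by simp_all
  then show "x = y \<and> a = b"
    unfolding digit_less_iff[OF assms] digit_less_iff[OF assms(2,1)] by linarith
qed simp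

text \<open>Hands the untouched variables to the second command, so that intermediate assertions
  need not mention them.\<close>

lemma wp_Seq_frame:
  assumes "wp w M c1 s Q1"
    and "\<And>s1 t1. Q1 s1 t1 \<Longrightarrow> (\<And>y. \<not> wr c1 y \<Longrightarrow> s1 y = s y) \<Longrightarrow> wp w M c2 s1 (\<lambda>s2 t2. Q s2 (t1 + t2))"
  shows "wp w M (c1;; c2) s Q"
  by (rule wp_SeqI, rule wp_frame[OF assms(1)]) (use assms(2) in blast)

lemma wp_Asg_SeqI:
  "wp w M c (s(x := aval w e s)) (\<lambda>s' t. Q s' (elen e + 1 + t)) \<Longrightarrow> wp w M (x ::= e;; c) s Q"
  by (intro wp_SeqI wp_AsgI)

lemma wp_Ld_SeqI:
  "addr_of w xs s < length M \<Longrightarrow> wp w M c (s(x := M ! addr_of w xs s)) (\<lambda>s' t. Q s' (1 + t)) \<Longrightarrow>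
    wp w M (Ld x xs;; c) s Q"
  by (intro wp_SeqI wp_LdI)

section \<open>Locating and comparing characters\<close>

definition adr :: "nat \<Rightarrow> (nat \<Rightarrow> var) \<Rightarrow> var list" where
  "adr C f = map f [0..<C + 2]"

abbreviation positive :: "var \<Rightarrow> var bexp" where
  "positive x \<equiv> BLt (Im 0) (Rg x)"

text \<open>Character \<open>c\<close> starts at bit
  \<open>c * b = c * (b div w) * w + c * r\<close>. As \<open>c * r\<close> may overflow,
  \<open>c\<close> is split at \<open>w\<close>, which leaves products that fit: the word part of
  \<open>c * r\<close> is the value of \<open>XT\<close>, the rest is the offset. The product
  \<open>c * (b div w)\<close> needs several words and is formed by one addition for each set
  flag.\<close>

definition set_addr :: "nat \<Rightarrow> (nat \<Rightarrow> var) \<Rightarrow> var \<Rightarrow> var \<Rightarrow> var com" where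
  "set_addr C f off c =
    seqs (map (\<lambda>k. (f k) ::= Im 0) [0..<C + 2]);;
    XT ::= (Bin Mul (Bin Div (Rg c) (Rg vW)) (Rg vR) \<oplus> Bin Div (Bin Mul (Bin Mod (Rg c) (Rg vW)) (Rg vR)) (Rg vW));;
    off ::= Bin Mod (Bin Mul (Bin Mod (Rg c) (Rg vW)) (Rg vR)) (Rg vW);;
    addw (adr C f) XT;;
    seqs (map (\<lambda>k. IF positive (Flag k) THEN addw (adr C f) c ELSE Skip) [0..<C])"

definition or_high :: "nat \<Rightarrow> (nat \<Rightarrow> var) \<Rightarrow> var \<Rightarrow> var \<Rightarrow> var com" where
  "or_high C f off x = Ld XT (adr C f);; x ::= Bin Or (Rg x) (Bin Shl (Rg XT) (Rg vW \<ominus> Rg off))"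

text \<open>With offset 0 the word is complete, and the next one may lie beyond the text, where a
  load would hang the machine; hence the test. The address is left at the following chunk.\<close>

definition fetch_full :: "nat \<Rightarrow> (nat \<Rightarrow> var) \<Rightarrow> var \<Rightarrow> var \<Rightarrow> var com" where
  "fetch_full C f off x =
    Ld x (adr C f);; x ::= Bin Shr (Rg x) (Rg off);; incw (adr C f);;
    IF positive off THEN or_high C f off x ELSE Skip"

text \<open>The second word is read only if the remaining \<open>r\<close> bits really reach into
  it, since it may lie beyond the text. The mask cuts off the bits of the following
  character.\<close>

definition fetch_part :: "nat \<Rightarrow> (nat \<Rightarrow> var) \<Rightarrow> var \<Rightarrow> var \<Rightarrow> var com" where
  "fetch_part C f off x =
    Ld x (adr C f);; x ::= Bin Shr (Rg x) (Rg off);;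
    IF BLt (Rg vW \<ominus> Rg off) (Rg vR) THEN (incw (adr C f);; or_high C f off x) ELSE Skip;;
    x ::= Bin And (Rg x) (Rg vMask)"

text \<open>Chunks arrive in order of increasing significance, so each difference overrules the
  earlier ones.\<close>

definition cmp_upd :: "var com" where
  "cmp_upd =
    IF BLt (Rg XA) (Rg XB) THEN (LT ::= Im 1;; EQ ::= Im 0)
    ELSE IF BLt (Rg XB) (Rg XA) THEN (LT ::= Im 0;; EQ ::= Im 0) ELSE Skip"

text \<open>A character has at most \<open>C\<close> full words, so the loop over them can be
  unrolled and the cost of a comparison depends on \<open>C\<close> only.\<close>

definition cmp :: "nat \<Rightarrow> var exp \<Rightarrow> var exp \<Rightarrow> var com" where
  "cmp C a b =
    CA ::= a;; CB ::= b;;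
    set_addr C AdA OA CA;; set_addr C AdB OB CB;;
    LT ::= Im 0;; EQ ::= Im 1;;
    seqs (map (\<lambda>k. IF positive (Flag k)
      THEN (fetch_full C AdA OA XA;; fetch_full C AdB OB XB;; cmp_upd) ELSE Skip) [0..<C]);;
    IF positive vR THEN (fetch_part C AdA OA XA;; fetch_part C AdB OB XB;; cmp_upd) ELSE Skip"

primrec cmp_scratch :: "var \<Rightarrow> bool" where
  "cmp_scratch (Par k) = False"
| "cmp_scratch (AdA k) = True"
| "cmp_scratch (AdB k) = True"
| "cmp_scratch (Flag k) = False"
| "cmp_scratch (Sc k) = (4 \<le> k \<and> k \<le> 12)"

lemma Sc_notin_range [simp]: "Sc k \<notin> range AdA" "Sc k \<notin> range AdB" "AdA k \<notin> range AdB" "AdB k \<notin> range AdA"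
  by auto

lemma set_adr: "set (adr C f) = f ` {..<C + 2}"
  unfolding adr_def by (simp only: set_map set_upt atLeast0LessThan)

lemma wr_set_addr: "wr (set_addr C f off c) y \<Longrightarrow> y \<in> range f \<or> y = XT \<or> y = off"
  unfolding set_addr_def by (auto simp: wr_seqs set_adr dest!: wr_addw simp del: upt_Suc)

lemma wr_fetch:
  "wr (fetch_full C f off x) y \<Longrightarrow> y \<in> range f \<or> y = XT \<or> y = x"
  "wr (fetch_part C f off x) y \<Longrightarrow> y \<in> range f \<or> y = XT \<or> y = x"
  unfolding fetch_full_def fetch_part_def or_high_def by (auto simp: set_adr dest!: wr_incw)

lemma wr_cmp: "wr (cmp C a b) y \<Longrightarrow> cmp_scratch y"
  unfolding cmp_def by (auto simp: wr_seqs cmp_upd_def dest!: wr_set_addr wr_fetch)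

lemma loopfree_cmp: "loopfree (cmp C a b)"
  unfolding cmp_def set_addr_def fetch_full_def fetch_part_def or_high_def cmp_upd_def
  by (simp add: loopfree_seqs del: upt_Suc)

definition cmp_time :: "nat \<Rightarrow> nat" where
  "cmp_time C = tmax (cmp C (Im 0) (Im 0))"

lemma tmax_cmp: "tmax (cmp C a b) \<le> elen a + elen b + cmp_time C"
  unfolding cmp_def cmp_time_def by simp

lemma take_bit_less: "a < 2 ^ w \<Longrightarrow> take_bit w a = (a::nat)"
  by (simp add: take_bit_nat_eq_self)

lemma sub_less: "a < 2 ^ w \<Longrightarrow> c \<le> a \<Longrightarrow> take_bit w (a + 2 ^ w - c) = a - (c::nat)"
  by (simp add: take_bit_eq_mod)
    (metis Nat.add_diff_assoc2 add.commute less_imp_diff_less mod_add_self2 mod_less)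

locale packed =
  fixes C w \<sigma> :: nat and T :: "nat list"
  assumes w1: "1 \<le> w" and T_nonempty: "1 \<le> length T" and T_le: "length T \<le> 2 ^ w"
    and sigma_le: "\<sigma> \<le> 2 ^ (C * w)" and T_sub: "set T \<subseteq> {..<\<sigma>}"
begin

abbreviation "n \<equiv> length T"
abbreviation "b \<equiv> char_bits \<sigma>"
abbreviation "M \<equiv> pack_text w \<sigma> T"
abbreviation "r \<equiv> b mod w"
definition "V = horner_sum id (2 ^ b) T"

lemma sigma1: "1 \<le> \<sigma>"
  using T_sub T_nonempty by (cases T) auto

lemma b_le: "b \<le> C * w"
proof -
  have "log 2 (real \<sigma>) \<le> real (C * w)"
    using sigma1 sigma_le log2_of_power_le[of \<sigma> "C * w"] by simp
  then show ?thesis unfolding char_bits_def by (simp add: ceiling_le_iff nat_le_iff)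
qed

lemma sigma_le_b: "\<sigma> \<le> 2 ^ b"
  unfolding char_bits_def by (meson less_log2_of_power real_nat_ceiling_ge not_le)

lemma char: "j < n \<Longrightarrow> take_bit b (drop_bit (j * b) V) = T ! j"
  unfolding V_def using T_sub sigma_le_b by (intro horner_sum_char) fastforce+

lemma mem_word:
  assumes "a * w < n * b"
  shows "a < length M" "M ! a = take_bit w (drop_bit (a * w) V)"
proof -
  have "real a < real (n * b) / real w"
    using assms w1 by (simp add: pos_less_divide_eq flip: of_nat_mult)
  then have "a < nat \<lceil>real (n * b) / real w\<rceil>" by linarith
  then show "a < length M" "M ! a = take_bit w (drop_bit (a * w) V)"
    unfolding pack_text_def to_words_def V_def by auto
qed

text \<open>
  Short words need not hold the number \<open>b\<close> of bits of a character, but \<open>b div w \<le> C\<close>. Hence \<open>b div w\<close> is kept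
  in unary, in the flags, and \<open>vR\<close> holds \<open>b mod w\<close>. Likewise \<open>n = 2 ^ w\<close> is possible, and \<open>vN\<close> holds \<open>n - 1\<close>.
\<close>

definition glob :: "var state \<Rightarrow> bool" where
  "glob s \<longleftrightarrow> s vW = w \<and> s vN = n - 1 \<and> s vR = r \<and> s vMask = 2 ^ r - 1 \<and>
    (\<forall>k<C. s (Flag k) = (if k < b div w then 1 else 0))"

primrec global :: "var \<Rightarrow> bool" where
  "global (Par k) = False"
| "global (AdA k) = False"
| "global (AdB k) = False"
| "global (Flag k) = True"
| "global (Sc k) = (k < 4)"

lemma glob_cong: "glob s \<Longrightarrow> (\<And>y. global y \<Longrightarrow> s' y = s y) \<Longrightarrow> glob s'"
  unfolding glob_def by simp

text \<open>A bit position need not fit into a word; it is kept as a word address of several words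
  and an offset below \<open>w\<close>.\<close>

definition points :: "(nat \<Rightarrow> var) \<Rightarrow> var \<Rightarrow> nat \<Rightarrow> var state \<Rightarrow> bool" where
  "points f off p s \<longleftrightarrow> addr_of w (adr C f) s * w + s off = p \<and> s off < w \<and> (\<forall>x\<in>set (adr C f). s x < 2 ^ w)"

lemma points_cong:
  assumes "points f off p s" "\<And>k. s' (f k) = s (f k)" "s' off = s off"
  shows "points f off p s'"
proof -
  have "addr_of w (adr C f) s' = addr_of w (adr C f) s"
    by (rule addr_of_cong) (use assms(2) in \<open>auto simp: set_adr\<close>)
  then show ?thesis using assms unfolding points_def by (auto simp: set_adr)
qed

lemma C_w: "C \<le> C * w" "C \<le> w + C * w" "C \<le> w + w * C"
  using w1 by (cases w; simp)+

text \<open>Addresses in use are below \<open>2 ^ w * C\<close>, and \<open>C < 2 ^ C\<close>; so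
  \<open>C + 2\<close> words hold even the address after the last one.\<close>

lemma addr_bound:
  assumes "a * w < n * b"
  shows "a + 1 < 2 ^ (w * length (adr C f))"
proof -
  have "a * w < 2 ^ w * (C * w)"
    using assms mult_le_mono[OF T_le b_le] by linarith
  then have "a * w < (2 ^ w * C) * w" by (simp add: algebra_simps)
  then have a: "a < 2 ^ w * C" by (simp only: mult_less_cancel2)
  have "2 ^ w * C < 2 ^ w * (2::nat) ^ C" by simp
  also have "\<dots> \<le> 2 ^ (w * (C + 2))"
    unfolding power_add[symmetric] using C_w by (intro power_increasing) (simp_all add: algebra_simps)
  finally show ?thesis using a by (simp add: adr_def)
qed

text \<open>Keeps the product \<open>(c mod w) * r\<close> in \<open>set_addr\<close> from
  overflowing, for the shortest words too. The square of \<open>w\<close> itself would be too large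
  for \<open>w = 3\<close>.\<close>

lemma square_less: "(w - 1) * (w - 1) < 2 ^ w"
proof -
  have "k * k + k + 2 \<le> 2 ^ (k + 1)" for k :: nat
  proof (induction k)
    case (Suc k)
    have "Suc k * Suc k + Suc k + 2 \<le> 2 * (k * k + k + 2)"
      by (cases k) auto
    also have "\<dots> \<le> 2 * 2 ^ (k + 1)" using Suc by (rule mult_le_mono2)
    finally show ?case by simp
  qed simp
  from this[of "w - 1"] show ?thesis using w1 by simp
qed

lemma one_bit [simp]: "take_bit w (Suc 0) = Suc 0" "take_bit w (1::nat) = 1"
  using w1 by (simp_all add: take_bit_eq_mod)

lemma r_less: "r < w" using w1 by simp

lemma mult_split: "(j div w) * r + ((j mod w) * r) div w = (j * r) div w" "((j mod w) * r) mod w = (j * r) mod w"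
proof -
  have "j * r = (j mod w) * r + w * ((j div w) * r)"
    by (metis add.commute add_mult_distrib div_mult_mod_eq mult.assoc mult.commute)
  then show "(j div w) * r + ((j mod w) * r) div w = (j * r) div w" using w1 by simp
  show "((j mod w) * r) mod w = (j * r) mod w" by (rule mod_mult_left_eq)
qed

lemma div_le: "(j * r) div w \<le> j"
proof -
  have "j * r \<le> j * w" using r_less by simp
  then show ?thesis using w1 by (metis div_le_mono nonzero_mult_div_cancel_right not_one_le_zero)
qed

lemma mod_mult_less: "(j mod w) * r < 2 ^ w"
proof -
  have "(j mod w) * r \<le> (w - 1) * (w - 1)"
    using w1 r_less by (intro mult_le_mono) (auto simp: less_eq_Suc_le[symmetric] Suc_le_eq simp flip: less_Suc_eq_le)
  then show ?thesis using square_less by linarith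
qed

lemma addr_of_0: "(\<And>x. x \<in> set xs \<Longrightarrow> s x = 0) \<Longrightarrow> addr_of w xs s = 0"
  by (induction xs) (auto simp: addr_of_def)

lemma distinct_adr: "f = AdA \<or> f = AdB \<Longrightarrow> distinct (adr C f)"
  unfolding adr_def by (auto simp: distinct_map inj_on_def simp del: upt_Suc)

lemma wp_set_addr:
  assumes g: "glob s" and c: "s c < n" and f: "f = AdA \<or> f = AdB"
    and off: "off = OA \<or> off = OB" and cc: "c = CA \<or> c = CB"
  shows "wp w M (set_addr C f off c) s (\<lambda>s' _. points f off (s c * b) s')"
  unfolding set_addr_def
proof (rule wp_Seq_frame[where ?Q1.0 = "\<lambda>s' _. \<forall>i<C + 2. s' (f i) = 0"])
  show "wp w M (seqs (map (\<lambda>k. (f k) ::= Im 0) [0..<C + 2])) s (\<lambda>s' _. \<forall>i<C + 2. s' (f i) = 0)"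
    by (rule wp_seqs[where I = "\<lambda>k s'. \<forall>i<k. s' (f i) = 0"])
      (auto intro!: wp_AsgI simp: less_Suc_eq)
next
  fix s1 :: "var state" and t1 :: nat
  assume z: "\<forall>i<C + 2. s1 (f i) = 0"
    and fr: "\<And>y. \<not> wr (seqs (map (\<lambda>k. (f k) ::= Im 0) [0..<C + 2])) y \<Longrightarrow> s1 y = s y"
  let ?j = "s c" and ?q = "b div w"
  have same: "s1 (Sc k) = s (Sc k)" "s1 (Flag k) = s (Flag k)" for k
    by (rule fr; use f in \<open>auto simp: wr_seqs simp del: upt_Suc\<close>)+
  have jn: "?j < 2 ^ w" using c T_le by simp
  have s1c: "s1 c = ?j" "s1 vW = w" "s1 vR = r" using cc same g unfolding glob_def by auto
  have fne: "f i \<noteq> Sc k" "f i \<noteq> Flag k" "Sc k \<noteq> f i" "Flag k \<noteq> f i" for i k using f by auto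
  let ?xt = "\<lambda>e. s1(XT := aval w e s1)"
  define s2 where "s2 = s1(XT := (?j * r) div w)"
  define s3 where "s3 = s2(off := (?j * r) mod w)"
  have dle: "?j div w * r \<le> ?j"
    using div_le[of ?j] mult_split(1)[of ?j] by linarith
  have 1: "take_bit w (take_bit w (?j div w * r) + take_bit w (?j mod w * r) div w) = (?j * r) div w"
  proof -
    have "take_bit w (?j div w * r) = ?j div w * r" using dle jn by (intro take_bit_less) linarith
    moreover have "take_bit w (?j mod w * r) = ?j mod w * r" by (rule take_bit_less[OF mod_mult_less])
    moreover have "take_bit w ((?j * r) div w) = (?j * r) div w"
      using div_le[of ?j] jn by (intro take_bit_less) linarith
    ultimately show ?thesis by (simp only: mult_split)
  qed
  have 2: "take_bit w (?j mod w * r) mod w = (?j * r) mod w"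
    by (simp only: take_bit_less[OF mod_mult_less] mult_split)
  have s2c: "s2 c = ?j" "s2 vW = w" "s2 vR = r" using s1c cc unfolding s2_def by auto
  have s3: "s3 c = ?j" "s3 XT = (?j * r) div w" "s3 off = (?j * r) mod w" "s3 (f i) = s1 (f i)" "s3 (Flag k) = s (Flag k)" for i k
    using s2c off cc fne same unfolding s3_def s2_def by auto
  have XTn: "XT \<notin> set (adr C f)" "c \<notin> set (adr C f)" "off \<notin> set (adr C f)"
    using fne cc off by (auto simp: set_adr)
  have z3: "addr_of w (adr C f) s3 = 0" "\<forall>x\<in>set (adr C f). s3 x < 2 ^ w"
    using z s3(4) by (auto simp: set_adr intro!: addr_of_0)
  let ?I = "\<lambda>k s'. addr_of w (adr C f) s' = (?j * r) div w + min k ?q * ?j \<and> (\<forall>x\<in>set (adr C f). s' x < 2 ^ w) \<and>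
    s' c = ?j \<and> s' off = (?j * r) mod w \<and> (\<forall>k. s' (Flag k) = s (Flag k))"
  have bnd: "(?j * r) div w + k * ?j < 2 ^ (w * length (adr C f))" if "k \<le> C" for k
  proof -
    have "(?j * r) div w + k * ?j \<le> (k + 1) * ?j" using div_le[of ?j] by simp
    also have "\<dots> \<le> (C + 1) * ?j" using that by simp
    also have "\<dots> < (C + 1) * 2 ^ w" using jn by (intro mult_less_mono2) auto
    also have "\<dots> \<le> 2 ^ C * 2 ^ w" by (intro mult_le_mono1) (metis Suc_eq_plus1 Suc_leI less_exp)
    also have "\<dots> \<le> 2 ^ (w * (C + 2))"
      unfolding power_add[symmetric] using C_w by (intro power_increasing) (simp_all add: algebra_simps)
    finally show ?thesis by (simp add: adr_def)
  qed
  have wradr: "\<not> wr (addw (adr C f) v) y" if "y \<notin> set (adr C f)" for v y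
    using that wr_addw[of "adr C f" v y] by blast
  have fl: "Flag k \<notin> set (adr C f)" for k using fne by (auto simp: set_adr)
  have "wp w M (addw (adr C f) XT) s3 (\<lambda>s' _. addr_of w (adr C f) s' = addr_of w (adr C f) s3 + s3 XT \<and> (\<forall>x\<in>set (adr C f). s' x < 2 ^ w))"
    using z3 XTn s3(2) bnd[of 0] div_le[of ?j] jn by (intro wp_addw w1 distinct_adr f) auto
  then have a0: "wp w M (addw (adr C f) XT) s3 (\<lambda>s' _. ?I 0 s')"
    by (rule wp_frame) (use z3 s3 XTn wradr fl in auto)
  have step: "wp w M (IF positive (Flag k) THEN addw (adr C f) c ELSE Skip) s' (\<lambda>s'' _. ?I (Suc k) s'')"
    if k: "k < C" and I: "?I k s'" for k s'
  proof (cases "k < ?q")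
    case True
    have fk: "s' (Flag k) = 1" using g k True I unfolding glob_def by simp
    have "wp w M (addw (adr C f) c) s' (\<lambda>s'' _. addr_of w (adr C f) s'' = addr_of w (adr C f) s' + s' c \<and> (\<forall>x\<in>set (adr C f). s'' x < 2 ^ w))"
      using I XTn jn bnd[of "Suc k"] k True by (intro wp_addw w1 distinct_adr f) (auto simp: algebra_simps min_def)
    then have "wp w M (addw (adr C f) c) s' (\<lambda>s'' _. ?I (Suc k) s'')"
      by (rule wp_frame) (use I XTn wradr fl True in \<open>auto simp: min_def algebra_simps\<close>)
    then show ?thesis using fk by (intro wp_CondI) auto
  next
    case False
    have fk: "s' (Flag k) = 0" using g k False I unfolding glob_def by simp
    have "?I (Suc k) s'" using I False by (simp add: min_def)
    then show ?thesis using fk by (intro wp_CondI wp_SkipI) auto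
  qed
  have fin: "points f off (?j * b) s'" if "?I C s'" for s'
  proof -
    have "?q \<le> C" using b_le w1 by (metis div_le_mono nonzero_mult_div_cancel_right not_one_le_zero)
    then have "addr_of w (adr C f) s' * w + s' off = ((?j * r) div w * w + (?j * r) mod w) + ?j * (?q * w)"
      using that by (simp add: algebra_simps)
    also have "\<dots> = ?j * r + ?j * (?q * w)" by simp
    also have "\<dots> = ?j * b" by (simp add: mod_mult_div_eq flip: add_mult_distrib2)
    finally show ?thesis using that w1 unfolding points_def by simp
  qed
  have all: "wp w M (addw (adr C f) XT;; seqs (map (\<lambda>k. IF positive (Flag k) THEN addw (adr C f) c ELSE Skip) [0..<C])) s3
    (\<lambda>s' _. points f off (?j * b) s')"
  proof (rule wp_Seq_frame[OF a0])
    fix s4 :: "var state" and t4 :: nat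
    assume "?I 0 s4"
    then have "wp w M (seqs (map (\<lambda>k. IF positive (Flag k) THEN addw (adr C f) c ELSE Skip) [0..<C])) s4 (\<lambda>s' _. ?I C s')"
      by (intro wp_seqs[where I = ?I]) (use step in auto)
    then show "wp w M (seqs (map (\<lambda>k. IF positive (Flag k) THEN addw (adr C f) c ELSE Skip) [0..<C])) s4 (\<lambda>s' _. points f off (?j * b) s')"
      by (rule wp_mono) (use fin in blast)
  qed
  have e1: "aval w (Bin Mul (Bin Div (Rg c) (Rg vW)) (Rg vR) \<oplus> Bin Div (Bin Mul (Bin Mod (Rg c) (Rg vW)) (Rg vR)) (Rg vW)) s1 =
      (?j * r) div w"
    using 1 by (simp only: aval.simps binop_sem.simps s1c)
  have e2: "aval w (Bin Mod (Bin Mul (Bin Mod (Rg c) (Rg vW)) (Rg vR)) (Rg vW)) s2 = (?j * r) mod w"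
    using 2 by (simp only: aval.simps binop_sem.simps s2c)
  show "wp w M (XT ::= (Bin Mul (Bin Div (Rg c) (Rg vW)) (Rg vR) \<oplus> Bin Div (Bin Mul (Bin Mod (Rg c) (Rg vW)) (Rg vR)) (Rg vW));;
    off ::= Bin Mod (Bin Mul (Bin Mod (Rg c) (Rg vW)) (Rg vR)) (Rg vW);;
    addw (adr C f) XT;; seqs (map (\<lambda>k. IF positive (Flag k) THEN addw (adr C f) c ELSE Skip) [0..<C])) s1
    (\<lambda>s2 t2. points f off (?j * b) s2)"
    using all by (intro wp_Asg_SeqI) (simp only: e1 e2 s2_def[symmetric] s3_def[symmetric])
qed

lemma wp_or_high:
  assumes g: "glob s" and A: "addr_of w (adr C f) s * w < n * b" and f: "f = AdA \<or> f = AdB"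
    and off: "off = OA \<or> off = OB" "s off \<le> w" and x: "x = XA \<or> x = XB"
  shows "wp w M (or_high C f off x) s (\<lambda>s' _. s' x = s x OR
    take_bit w (push_bit (w - s off) (take_bit w (drop_bit (addr_of w (adr C f) s * w) V))))"
proof -
  have "s vW = w" using g unfolding glob_def by simp
  moreover have "take_bit w (w + 2 ^ w - s off) = w - s off" using off by (intro sub_less) auto
  ultimately show ?thesis
    unfolding or_high_def using mem_word[OF A] off(1) x
    by (intro wp_SeqI wp_LdI wp_AsgI) auto
qed

lemma wp_fetch_full:
  assumes g: "glob s" and p: "points f off p s" "p + w \<le> n * b" and f: "f = AdA \<or> f = AdB"
    and off: "off = OA \<or> off = OB" and x: "x = XA \<or> x = XB"
  shows "wp w M (fetch_full C f off x) s (\<lambda>s' _. s' x = take_bit w (drop_bit p V) \<and> points f off (p + w) s')"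
proof -
  define a where "a = addr_of w (adr C f) s"
  define s1 where "s1 = s(x := M ! a, x := drop_bit (s off) (M ! a))"
  have ap: "a * w + s off = p" "s off < w" "\<forall>x\<in>set (adr C f). s x < 2 ^ w"
    using p unfolding a_def points_def by auto
  have aw: "a * w < n * b" using ap p(2) w1 by linarith
  note m = mem_word[OF aw]
  have xn: "x \<notin> set (adr C f)" "off \<notin> set (adr C f)" "XT \<notin> set (adr C f)" "off \<noteq> x" "XT \<noteq> x" "XT \<noteq> off"
    and gn: "vW \<notin> set (adr C f)" "\<And>y. y \<in> set (adr C f) \<Longrightarrow> \<not> global y" "x \<noteq> vW" "\<not> global x" "\<not> global XT"
    using f off x by (auto simp: set_adr)
  have s1: "addr_of w (adr C f) s1 = a" "\<And>y. y \<in> set (adr C f) \<Longrightarrow> s1 y < 2 ^ w" "s1 off = s off"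
    "s1 x = drop_bit (s off) (M ! a)"
    using xn ap(3) unfolding s1_def a_def by auto
  have g1: "glob s1" using g gn by (elim glob_cong) (auto simp: s1_def)
  have inc: "wp w M (incw (adr C f)) s1 (\<lambda>s' _. addr_of w (adr C f) s' = a + 1 \<and> (\<forall>x\<in>set (adr C f). s' x < 2 ^ w))"
    using wp_incw[OF w1 distinct_adr[OF f], of s1] s1 addr_bound[OF aw] by simp
  have rest: "wp w M (IF positive off THEN or_high C f off x ELSE Skip) s2
      (\<lambda>s' _. s' x = take_bit w (drop_bit p V) \<and> points f off (p + w) s')"
    if A: "addr_of w (adr C f) s2 = a + 1 \<and> (\<forall>x\<in>set (adr C f). s2 x < 2 ^ w)"
      and fr: "\<And>y. \<not> wr (incw (adr C f)) y \<Longrightarrow> s2 y = s1 y" for s2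
  proof -
    have fr': "s2 y = s1 y" if "y \<notin> set (adr C f)" for y using fr that wr_incw by metis
    have o2: "s2 off = s off" "s2 x = drop_bit (s off) (M ! a)" using fr'[of off] fr'[of x] s1 xn by auto
    have g2: "glob s2" using g1 by (rule glob_cong) (use fr' gn in blast)
    have p2: "points f off (p + w) s2" using A o2 ap unfolding points_def by auto
    show ?thesis
    proof (cases "s off = 0")
      case True
      then show ?thesis using o2 p2 ap(1) m by (intro wp_CondI wp_SkipI) auto
    next
      case False
      have "(a + 1) * w < n * b" using ap False p(2) by simp
      then have "wp w M (or_high C f off x) s2 (\<lambda>s' _. s' x = s2 x OR
          take_bit w (push_bit (w - s2 off) (take_bit w (drop_bit ((a + 1) * w) V))))"
        using wp_or_high[OF g2 _ f off(1), of x] A o2 x ap(2) by simp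
      then have "wp w M (or_high C f off x) s2 (\<lambda>s' _. s' x = take_bit w (drop_bit p V) \<and> points f off (p + w) s')"
      proof (rule wp_frame)
        fix s' :: "var state" and t :: nat
        assume e: "s' x = s2 x OR take_bit w (push_bit (w - s2 off) (take_bit w (drop_bit ((a + 1) * w) V)))"
          and fr3: "\<And>y. \<not> wr (or_high C f off x) y \<Longrightarrow> s' y = s2 y"
        have "s' x = take_bit w (drop_bit p V)"
          using e piece_full[OF ap(2), of a V] o2 m(2) ap(1) by simp
        moreover have "s' (f k) = s2 (f k)" for k using fr3 f x by (auto simp: or_high_def)
        moreover have "s' off = s2 off" using fr3 xn by (auto simp: or_high_def)
        ultimately show "s' x = take_bit w (drop_bit p V) \<and> points f off (p + w) s'"
          using points_cong[OF p2] by blast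
      qed
      then show ?thesis using False o2 by (intro wp_CondI) auto
    qed
  qed
  have "wp w M (incw (adr C f);; IF positive off THEN or_high C f off x ELSE Skip) s1
      (\<lambda>s' _. s' x = take_bit w (drop_bit p V) \<and> points f off (p + w) s')"
    by (rule wp_Seq_frame[OF inc]) (use rest in blast)
  then show ?thesis
    unfolding fetch_full_def using m(1) xn by (intro wp_Ld_SeqI wp_Asg_SeqI) (auto simp: a_def[symmetric] s1_def)
qed

lemma wp_fetch_part:
  assumes g: "glob s" and p: "points f off p s" "p + r \<le> n * b" "0 < r" and f: "f = AdA \<or> f = AdB"
    and off: "off = OA \<or> off = OB" and x: "x = XA \<or> x = XB"
  shows "wp w M (fetch_part C f off x) s (\<lambda>s' _. s' x = take_bit r (drop_bit p V))"
proof -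
  define a where "a = addr_of w (adr C f) s"
  define s1 where "s1 = s(x := M ! a, x := drop_bit (s off) (M ! a))"
  have ap: "a * w + s off = p" "s off < w" "\<forall>x\<in>set (adr C f). s x < 2 ^ w"
    using p unfolding a_def points_def by auto
  have aw: "a * w < n * b" using ap p(2,3) by linarith
  note m = mem_word[OF aw]
  have xn: "x \<notin> set (adr C f)" "off \<notin> set (adr C f)" "XT \<notin> set (adr C f)" "off \<noteq> x" "XT \<noteq> x" "XT \<noteq> off"
    and gn: "\<And>y. y \<in> set (adr C f) \<Longrightarrow> \<not> global y" "\<not> global x" "\<not> global XT" "\<not> global off"
    using f off x by (auto simp: set_adr)
  have s1: "addr_of w (adr C f) s1 = a" "\<And>y. y \<in> set (adr C f) \<Longrightarrow> s1 y < 2 ^ w" "s1 off = s off"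
    "s1 x = drop_bit (s off) (M ! a)"
    using xn ap(3) unfolding s1_def a_def by auto
  have g1: "glob s1" using g gn by (elim glob_cong) (auto simp: s1_def)
  have gv: "s' vW = w" "s' vR = r" "s' vMask = 2 ^ r - 1" if "glob s'" for s' using that unfolding glob_def by auto
  have mask: "y AND (2 ^ r - 1) = take_bit r (y::nat)" for y by (simp add: take_bit_eq_mask mask_eq_exp_minus_1)
  have sub: "take_bit w (w + 2 ^ w - s off) = w - s off" using ap(2) by (intro sub_less) auto
  have inc: "wp w M (incw (adr C f)) s1 (\<lambda>s' _. addr_of w (adr C f) s' = a + 1 \<and> (\<forall>x\<in>set (adr C f). s' x < 2 ^ w))"
    using wp_incw[OF w1 distinct_adr[OF f], of s1] s1 addr_bound[OF aw] by simp
  have rest: "wp w M (or_high C f off x) s2 (\<lambda>s' _. take_bit r (s' x) = take_bit r (drop_bit p V) \<and> glob s')"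
    if A: "addr_of w (adr C f) s2 = a + 1 \<and> (\<forall>x\<in>set (adr C f). s2 x < 2 ^ w)"
      and fr: "\<And>y. \<not> wr (incw (adr C f)) y \<Longrightarrow> s2 y = s1 y" and lt: "w - s off < r" for s2
  proof -
    have fr': "s2 y = s1 y" if "y \<notin> set (adr C f)" for y using fr that wr_incw by metis
    have o2: "s2 off = s off" "s2 x = drop_bit (s off) (M ! a)" using fr'[of off] fr'[of x] s1 xn by auto
    have g2: "glob s2" using g1 by (rule glob_cong) (use fr' gn in blast)
    have "(a + 1) * w < n * b" using ap lt p(2) by simp
    then have "wp w M (or_high C f off x) s2 (\<lambda>s' _. s' x = s2 x OR
        take_bit w (push_bit (w - s2 off) (take_bit w (drop_bit ((a + 1) * w) V))))"
      using wp_or_high[OF g2 _ f off(1), of x] A o2 x ap(2) by simp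
    then show ?thesis
    proof (rule wp_frame)
      fix s' :: "var state" and t :: nat
      assume e: "s' x = s2 x OR take_bit w (push_bit (w - s2 off) (take_bit w (drop_bit ((a + 1) * w) V)))"
        and fr3: "\<And>y. \<not> wr (or_high C f off x) y \<Longrightarrow> s' y = s2 y"
      have x': "s' x = take_bit w (drop_bit p V)"
        using e piece_full[OF ap(2), of a V] o2 m(2) ap(1) by simp
      have f3: "s' y = s2 y" if "y \<noteq> XT" "y \<noteq> x" for y using fr3 that by (simp add: or_high_def)
      have "glob s'"
      proof (rule glob_cong[OF g2])
        fix y :: var assume "global y"
        then have "y \<noteq> XT" "y \<noteq> x" using gn(2,3) by metis+
        then show "s' y = s2 y" by (rule f3)
      qed
      moreover have "take_bit r (s' x) = take_bit r (drop_bit p V)"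
        unfolding x' take_bit_take_bit using r_less by (simp only: min.absorb1 less_imp_le)
      ultimately show "take_bit r (s' x) = take_bit r (drop_bit p V) \<and> glob s'" by blast
    qed
  qed
  have "wp w M (IF BLt (Rg vW \<ominus> Rg off) (Rg vR) THEN (incw (adr C f);; or_high C f off x) ELSE Skip) s1
      (\<lambda>s' _. take_bit r (s' x) = take_bit r (drop_bit p V) \<and> glob s')"
  proof (cases "w - s off < r")
    case True
    have "wp w M (incw (adr C f);; or_high C f off x) s1 (\<lambda>s' _. take_bit r (s' x) = take_bit r (drop_bit p V) \<and> glob s')"
      by (rule wp_Seq_frame[OF inc]) (use rest True in blast)
    then show ?thesis using True gv[OF g1] s1 sub by (intro wp_CondI) auto
  next
    case False
    then have "take_bit r (s1 x) = take_bit r (drop_bit p V)"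
      using piece_short[OF ap(2), of r a V] ap(2) unfolding s1(4) m(2) ap(1) by linarith
    then show ?thesis using False gv[OF g1] s1 sub g1 by (intro wp_CondI wp_SkipI) auto
  qed
  then have "wp w M (IF BLt (Rg vW \<ominus> Rg off) (Rg vR) THEN (incw (adr C f);; or_high C f off x) ELSE Skip;;
      x ::= Bin And (Rg x) (Rg vMask)) s1 (\<lambda>s' _. s' x = take_bit r (drop_bit p V))"
  proof (rule wp_Seq_frame)
    fix s2 :: "var state" and t :: nat
    assume "take_bit r (s2 x) = take_bit r (drop_bit p V) \<and> glob s2"
    then show "wp w M (x ::= Bin And (Rg x) (Rg vMask)) s2 (\<lambda>s' _. s' x = take_bit r (drop_bit p V))"
      using gv[of s2] by (intro wp_AsgI) (simp only: mask aval.simps binop_sem.simps fun_upd_same)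
  qed
  then show ?thesis
    unfolding fetch_part_def using m(1) xn by (intro wp_Ld_SeqI wp_Asg_SeqI) (auto simp: a_def[symmetric] s1_def)
qed

lemma wp_cmp_upd:
  "wp w M cmp_upd s (\<lambda>s' _. s' LT = (if s XA < s XB then 1 else if s XB < s XA then 0 else s LT) \<and>
    s' EQ = (if s XA = s XB then s EQ else 0))"
  unfolding cmp_upd_def using w1 by (auto intro!: wp_CondI wp_SkipI wp_Asg_SeqI wp_AsgI)

lemma wr_cmp_upd: "wr cmp_upd y \<Longrightarrow> y = LT \<or> y = EQ"
  unfolding cmp_upd_def by auto

lemma wp_pair_full:
  assumes g: "glob s" and p: "points AdA OA pa s" "pa + w \<le> n * b" "points AdB OB pb s" "pb + w \<le> n * b"
    and xa: "xa = take_bit w (drop_bit pa V)" and xb: "xb = take_bit w (drop_bit pb V)"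
  shows "wp w M (fetch_full C AdA OA XA;; fetch_full C AdB OB XB;; cmp_upd) s
    (\<lambda>s' _. points AdA OA (pa + w) s' \<and> points AdB OB (pb + w) s' \<and>
      s' LT = (if xa < xb then 1 else if xb < xa then 0 else s LT) \<and> s' EQ = (if xa = xb then s EQ else 0))"
proof (rule wp_Seq_frame[OF wp_fetch_full[OF g p(1,2)]])
  fix s1 :: "var state" and t1 :: nat
  assume 1: "s1 XA = take_bit w (drop_bit pa V) \<and> points AdA OA (pa + w) s1"
    and "\<And>y. \<not> wr (fetch_full C AdA OA XA) y \<Longrightarrow> s1 y = s y"
  then have f1: "s1 y = s y" if "y \<notin> range AdA" "y \<noteq> XT" "y \<noteq> XA" for y
    using wr_fetch(1) that by blast
  have g1: "glob s1" by (rule glob_cong[OF g]) (rule f1, auto)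
  have p1: "points AdB OB pb s1" by (rule points_cong[OF p(3)]) (rule f1; auto)+
  show "wp w M (fetch_full C AdB OB XB;; cmp_upd) s1
    (\<lambda>s' _. points AdA OA (pa + w) s' \<and> points AdB OB (pb + w) s' \<and>
      s' LT = (if xa < xb then 1 else if xb < xa then 0 else s LT) \<and> s' EQ = (if xa = xb then s EQ else 0))"
  proof (rule wp_Seq_frame[OF wp_fetch_full[OF g1 p1 p(4)]])
    fix s2 :: "var state" and t2 :: nat
    assume 2: "s2 XB = take_bit w (drop_bit pb V) \<and> points AdB OB (pb + w) s2"
      and "\<And>y. \<not> wr (fetch_full C AdB OB XB) y \<Longrightarrow> s2 y = s1 y"
    then have f2: "s2 y = s1 y" if "y \<notin> range AdB" "y \<noteq> XT" "y \<noteq> XB" for y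
      using wr_fetch(1) that by blast
    have p2: "points AdA OA (pa + w) s2"
      by (rule points_cong[OF conjunct2[OF 1]]) (rule f2; auto)+
    have v: "s2 XA = xa" "s2 XB = xb" "s2 LT = s LT" "s2 EQ = s EQ"
      using 1 2 xa xb f1[of LT] f2[of LT] f1[of EQ] f2[of EQ] f2[of XA] by auto
    show "wp w M cmp_upd s2 (\<lambda>s' _. points AdA OA (pa + w) s' \<and> points AdB OB (pb + w) s' \<and>
      s' LT = (if xa < xb then 1 else if xb < xa then 0 else s LT) \<and> s' EQ = (if xa = xb then s EQ else 0))"
    proof (rule wp_frame[OF wp_cmp_upd])
      fix s3 :: "var state" and t3 :: nat
      assume e: "s3 LT = (if s2 XA < s2 XB then 1 else if s2 XB < s2 XA then 0 else s2 LT) \<and>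
          s3 EQ = (if s2 XA = s2 XB then s2 EQ else 0)"
        and "\<And>y. \<not> wr cmp_upd y \<Longrightarrow> s3 y = s2 y"
      then have f3: "s3 y = s2 y" if "y \<noteq> LT" "y \<noteq> EQ" for y using wr_cmp_upd that by blast
      have "points AdA OA (pa + w) s3" by (rule points_cong[OF p2]) (rule f3; auto)+
      moreover have "points AdB OB (pb + w) s3" by (rule points_cong[OF conjunct2[OF 2]]) (rule f3; auto)+
      ultimately show "points AdA OA (pa + w) s3 \<and> points AdB OB (pb + w) s3 \<and>
        s3 LT = (if xa < xb then 1 else if xb < xa then 0 else s LT) \<and> s3 EQ = (if xa = xb then s EQ else 0)"
        using e v by simp
    qed
  qed auto
qed auto

lemma wp_pair_part:
  assumes g: "glob s" and p: "points AdA OA pa s" "pa + r \<le> n * b" "points AdB OB pb s" "pb + r \<le> n * b" "0 < r"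
    and xa: "xa = take_bit r (drop_bit pa V)" and xb: "xb = take_bit r (drop_bit pb V)"
  shows "wp w M (fetch_part C AdA OA XA;; fetch_part C AdB OB XB;; cmp_upd) s
    (\<lambda>s' _. s' LT = (if xa < xb then 1 else if xb < xa then 0 else s LT) \<and> s' EQ = (if xa = xb then s EQ else 0))"
proof (rule wp_Seq_frame[OF wp_fetch_part[OF g p(1,2,5)]])
  fix s1 :: "var state" and t1 :: nat
  assume 1: "s1 XA = take_bit r (drop_bit pa V)"
    and "\<And>y. \<not> wr (fetch_part C AdA OA XA) y \<Longrightarrow> s1 y = s y"
  then have f1: "s1 y = s y" if "y \<notin> range AdA" "y \<noteq> XT" "y \<noteq> XA" for y
    using wr_fetch(2) that by blast
  have g1: "glob s1" by (rule glob_cong[OF g]) (rule f1, auto)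
  have p1: "points AdB OB pb s1" by (rule points_cong[OF p(3)]) (rule f1; auto)+
  show "wp w M (fetch_part C AdB OB XB;; cmp_upd) s1
    (\<lambda>s' _. s' LT = (if xa < xb then 1 else if xb < xa then 0 else s LT) \<and> s' EQ = (if xa = xb then s EQ else 0))"
  proof (rule wp_Seq_frame[OF wp_fetch_part[OF g1 p1 p(4,5)]])
    fix s2 :: "var state" and t2 :: nat
    assume 2: "s2 XB = take_bit r (drop_bit pb V)"
      and "\<And>y. \<not> wr (fetch_part C AdB OB XB) y \<Longrightarrow> s2 y = s1 y"
    then have f2: "s2 y = s1 y" if "y \<notin> range AdB" "y \<noteq> XT" "y \<noteq> XB" for y
      using wr_fetch(2) that by blast
    have v: "s2 XA = xa" "s2 XB = xb" "s2 LT = s LT" "s2 EQ = s EQ"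
      using 1 2 xa xb f1[of LT] f2[of LT] f1[of EQ] f2[of EQ] f2[of XA] by auto
    show "wp w M cmp_upd s2 (\<lambda>s' _. s' LT = (if xa < xb then 1 else if xb < xa then 0 else s LT) \<and>
        s' EQ = (if xa = xb then s EQ else 0))"
      by (rule wp_mono[OF wp_cmp_upd[of s2]]) (use v in simp)
  qed auto
qed auto

text \<open>\<open>cmp_upd\<close> computes the order of two-digit numbers from the order of the
  leading digits and the result for the lower ones.\<close>

lemma cmp_combine:
  fixes la lb :: nat
  assumes "la < 2 ^ k" "lb < 2 ^ k"
  shows "(if xa < xb then 1 else if xb < xa then 0 else of_bool (la < lb)) =
      (of_bool (la + 2 ^ k * xa < lb + 2 ^ k * (xb::nat)) :: nat)"
    "(if xa = xb then of_bool (la = lb) else 0) = (of_bool (la + 2 ^ k * xa = lb + 2 ^ k * xb) :: nat)"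
  using digit_less_iff[OF assms, of xa xb] digit_eq_iff[OF assms, of xa xb] by auto

lemma wp_cmp_loops:
  assumes g: "glob s" and p: "points AdA OA (i * b) s" "points AdB OB (j * b) s"
    and ij: "i < n" "j < n" and res: "s LT = 0" "s EQ = 1"
  shows "wp w M
   (seqs (map (\<lambda>k. IF positive (Flag k)
      THEN (fetch_full C AdA OA XA;; fetch_full C AdB OB XB;; cmp_upd) ELSE Skip) [0..<C]);;
    IF positive vR THEN (fetch_part C AdA OA XA;; fetch_part C AdB OB XB;; cmp_upd) ELSE Skip) s
   (\<lambda>s' _. s' LT = of_bool (T ! i < T ! j) \<and> s' EQ = of_bool (T ! i = T ! j))"
proof -
  let ?Q = "b div w"
  \<comment> \<open>The \<open>k\<close> least significant words of character \<open>j\<close>; the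
    invariant says that \<open>LT\<close> and \<open>EQ\<close> hold the comparison of these
    parts.\<close>
  define low where "low k j = take_bit (k * w) (drop_bit (j * b) V)" for k j
  let ?I = "\<lambda>k s'. glob s' \<and> points AdA OA (i * b + min k ?Q * w) s' \<and> points AdB OB (j * b + min k ?Q * w) s' \<and>
    s' LT = of_bool (low (min k ?Q) i < low (min k ?Q) j) \<and> s' EQ = of_bool (low (min k ?Q) i = low (min k ?Q) j)"
  let ?c = "fetch_full C AdA OA XA;; fetch_full C AdB OB XB;; cmp_upd"
  let ?d = "fetch_part C AdA OA XA;; fetch_part C AdB OB XB;; cmp_upd"
  have bQ: "?Q * w + r = b" by simp
  have nb: "j * b + b \<le> n * b" if "j < n" for j
    using mult_le_mono1[of "Suc j" n b] that by simp
  have low_less: "low k j < 2 ^ (k * w)" for k j unfolding low_def by simp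
  have wrc: "wr ?c y \<or> wr ?d y \<Longrightarrow> y \<in> range AdA \<or> y \<in> range AdB \<or> y \<in> {XA, XB, XT, LT, EQ}" for y
    by (auto dest!: wr_fetch wr_cmp_upd)
  have glob_frame: "glob s''" if "glob s'" "\<And>y. \<not> wr ?c y \<Longrightarrow> s'' y = s' y" for s' s''
  proof (rule glob_cong[OF that(1)])
    fix y :: var assume "global y"
    then have "\<not> wr ?c y" using wrc[of y] by auto
    then show "s'' y = s' y" by (rule that(2))
  qed
  have split: "low (Suc k) j = low k j + 2 ^ (k * w) * take_bit w (drop_bit (j * b + k * w) V)" for k j
    unfolding low_def using take_bit_split[of "k * w" w "drop_bit (j * b) V"]
    by (simp add: drop_bit_drop_bit add.commute)
  have split_r: "T ! j = low ?Q j + 2 ^ (?Q * w) * take_bit r (drop_bit (j * b + ?Q * w) V)" if "j < n" for j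
    unfolding low_def using take_bit_split[of "?Q * w" r "drop_bit (j * b) V"] char[OF that]
    by (simp add: drop_bit_drop_bit add.commute)
  have step: "wp w M (IF positive (Flag k) THEN ?c ELSE Skip) s' (\<lambda>s'' _. ?I (Suc k) s'')"
    if k: "k < C" and I: "?I k s'" for k s'
  proof (cases "k < ?Q")
    case True
    then have m: "min k ?Q = k" "min (Suc k) ?Q = Suc k" by auto
    have "Suc k * w \<le> ?Q * w" using True by (intro mult_le_mono1) simp
    then have "k * w + w \<le> ?Q * w" by simp
    then have kw: "k * w + w \<le> b" using bQ by linarith
    have "wp w M ?c s' (\<lambda>s'' _. ?I (Suc k) s'')"
    proof (rule wp_frame[OF wp_pair_full])
      show "glob s'" using I by blast
      show "points AdA OA (i * b + k * w) s'" "points AdB OB (j * b + k * w) s'" using I m by auto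
      show "i * b + k * w + w \<le> n * b" "j * b + k * w + w \<le> n * b" using nb ij kw by fastforce+
      fix s'' :: "var state" and t :: nat
      let ?xa = "take_bit w (drop_bit (i * b + k * w) V)" and ?xb = "take_bit w (drop_bit (j * b + k * w) V)"
      assume a: "points AdA OA (i * b + k * w + w) s'' \<and> points AdB OB (j * b + k * w + w) s'' \<and>
        s'' LT = (if ?xa < ?xb then 1 else if ?xb < ?xa then 0 else s' LT) \<and>
        s'' EQ = (if ?xa = ?xb then s' EQ else 0)"
        and fr: "\<And>y. \<not> wr ?c y \<Longrightarrow> s'' y = s' y"
      have "glob s''" by (rule glob_frame[OF conjunct1[OF I] fr])
      moreover have "s'' LT = of_bool (low (Suc k) i < low (Suc k) j)"
        "s'' EQ = of_bool (low (Suc k) i = low (Suc k) j)"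
        using a I unfolding m split cmp_combine[OF low_less low_less, of ?xa ?xb k i j, symmetric]
        by simp_all
      moreover have "i * b + k * w + w = i * b + Suc k * w" "j * b + k * w + w = j * b + Suc k * w" by simp_all
      ultimately show "?I (Suc k) s''" using a unfolding m by metis
    qed (rule refl)+
    moreover have "s' (Flag k) = 1" using I k True unfolding glob_def by simp
    ultimately show ?thesis by (intro wp_CondI) auto
  next
    case False
    then have "min k ?Q = ?Q" "min (Suc k) ?Q = ?Q" by auto
    moreover have "s' (Flag k) = 0" using I k False unfolding glob_def by simp
    ultimately show ?thesis using I by (intro wp_CondI wp_SkipI) auto
  qed
  have init: "?I 0 s" using g p res unfolding low_def by simp
  have QC: "min C ?Q = ?Q"
    using b_le w1 by (metis div_le_mono min.absorb2 nonzero_mult_div_cancel_right not_one_le_zero)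
  have "wp w M (seqs (map (\<lambda>k. IF positive (Flag k) THEN ?c ELSE Skip) [0..<C])) s (\<lambda>s' _. ?I C s')"
    by (rule wp_seqs[where I = ?I]) (use step init in auto)
  then show ?thesis
  proof (rule wp_Seq_frame)
    fix s1 :: "var state" and t :: nat
    assume I: "?I C s1"
    show "wp w M (IF positive vR THEN ?d ELSE Skip) s1
      (\<lambda>s' _. s' LT = of_bool (T ! i < T ! j) \<and> s' EQ = of_bool (T ! i = T ! j))"
    proof (cases "r = 0")
      case True
      then show ?thesis
        using I split_r ij unfolding QC by (intro wp_CondI wp_SkipI) (auto simp: glob_def)
    next
      case False
      have "wp w M ?d s1 (\<lambda>s' _. s' LT = of_bool (T ! i < T ! j) \<and> s' EQ = of_bool (T ! i = T ! j))"
      proof (rule wp_mono[OF wp_pair_part])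
        show "glob s1" using I by blast
        show "points AdA OA (i * b + ?Q * w) s1" "points AdB OB (j * b + ?Q * w) s1" using I QC by auto
        show "i * b + ?Q * w + r \<le> n * b" "j * b + ?Q * w + r \<le> n * b" using nb[OF ij(1)] nb[OF ij(2)] bQ by linarith+
        show "0 < r" using False by simp
        fix s'' :: "var state" and t :: nat
        let ?xa = "take_bit r (drop_bit (i * b + ?Q * w) V)" and ?xb = "take_bit r (drop_bit (j * b + ?Q * w) V)"
        assume a: "s'' LT = (if ?xa < ?xb then 1 else if ?xb < ?xa then 0 else s1 LT) \<and>
          s'' EQ = (if ?xa = ?xb then s1 EQ else 0)"
        show "s'' LT = of_bool (T ! i < T ! j) \<and> s'' EQ = of_bool (T ! i = T ! j)"
          using a I unfolding QC split_r[OF ij(1)] split_r[OF ij(2)] cmp_combine[OF low_less low_less, of ?xa ?xb ?Q i j, symmetric]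
          by simp
      qed (rule refl)+
      then show ?thesis using False I by (intro wp_CondI) (auto simp: glob_def)
    qed
  qed
qed

text \<open>\<open>CA\<close> is written before the second expression is evaluated, hence the
  assumption \<open>indep\<close>.\<close>

lemma wp_cmpI:
  assumes g: "glob s" and ea: "aval w ea s < n" and eb: "aval w eb s < n"
    and indep: "\<And>v. aval w eb (s(CA := v)) = aval w eb s"
    and Q: "\<And>s' t. s' LT = of_bool (T ! aval w ea s < T ! aval w eb s) \<Longrightarrow>
      s' EQ = of_bool (T ! aval w ea s = T ! aval w eb s) \<Longrightarrow> t \<le> elen ea + elen eb + cmp_time C \<Longrightarrow>
      (\<And>y. \<not> cmp_scratch y \<Longrightarrow> s' y = s y) \<Longrightarrow> Q s' t"
  shows "wp w M (cmp C ea eb) s Q"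
proof -
  let ?i = "aval w ea s" and ?j = "aval w eb s"
  let ?R = "\<lambda>s' _. s' LT = of_bool (T ! ?i < T ! ?j) \<and> s' EQ = of_bool (T ! ?i = T ! ?j)"
  let ?loops = "seqs (map (\<lambda>k. IF positive (Flag k)
      THEN (fetch_full C AdA OA XA;; fetch_full C AdB OB XB;; cmp_upd) ELSE Skip) [0..<C]);;
    IF positive vR THEN (fetch_part C AdA OA XA;; fetch_part C AdB OB XB;; cmp_upd) ELSE Skip"
  define s1 where "s1 = s(CA := ?i, CB := ?j)"
  have g1: "glob s1" by (rule glob_cong[OF g]) (auto simp: s1_def)
  have s1: "s1 CA = ?i" "s1 CB = ?j" unfolding s1_def by auto
  have A: "wp w M (set_addr C AdA OA CA) s1 (\<lambda>s' _. points AdA OA (?i * b) s')"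
    using wp_set_addr[OF g1, of CA AdA OA] s1 ea by simp
  have "wp w M (set_addr C AdA OA CA;; set_addr C AdB OB CB;; LT ::= Im 0;; EQ ::= Im 1;; ?loops) s1 ?R"
  proof (rule wp_Seq_frame[OF A])
    fix s2 :: "var state" and t2 :: nat
    assume p2: "points AdA OA (?i * b) s2"
      and "\<And>y. \<not> wr (set_addr C AdA OA CA) y \<Longrightarrow> s2 y = s1 y"
    then have f2: "s2 y = s1 y" if "y \<notin> range AdA" "y \<noteq> XT" "y \<noteq> OA" for y
      using that wr_set_addr by blast
    have g2: "glob s2" by (rule glob_cong[OF g1]) (rule f2, auto)
    have "s2 CB = ?j" using f2[of CB] s1 by auto
    then have B: "wp w M (set_addr C AdB OB CB) s2 (\<lambda>s' _. points AdB OB (?j * b) s')"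
      using wp_set_addr[OF g2, of CB AdB OB] eb by simp
    show "wp w M (set_addr C AdB OB CB;; LT ::= Im 0;; EQ ::= Im 1;; ?loops) s2 ?R"
    proof (rule wp_Seq_frame[OF B])
      fix s3 :: "var state" and t3 :: nat
      assume p3: "points AdB OB (?j * b) s3"
        and "\<And>y. \<not> wr (set_addr C AdB OB CB) y \<Longrightarrow> s3 y = s2 y"
      then have f3: "s3 y = s2 y" if "y \<notin> range AdB" "y \<noteq> XT" "y \<noteq> OB" for y
        using that wr_set_addr by blast
      let ?s = "s3(LT := 0, EQ := 1)"
      have "glob ?s"
      proof (rule glob_cong[OF g2])
        fix y :: var assume "global y"
        then show "?s y = s2 y" using f3[of y] by (cases y) auto
      qed
      moreover have "points AdA OA (?i * b) ?s"
        by (rule points_cong[OF p2]) (simp_all add: f3)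
      moreover have "points AdB OB (?j * b) ?s" by (rule points_cong[OF p3]) auto
      ultimately have "wp w M ?loops ?s ?R" using ea eb by (intro wp_cmp_loops) auto
      then show "wp w M (LT ::= Im 0;; EQ ::= Im 1;; ?loops) s3 ?R"
        by (intro wp_Asg_SeqI) (simp only: aval.simps one_bit take_bit_of_0)
    qed
  qed
  then have "wp w M (cmp C ea eb) s ?R"
    unfolding cmp_def by (intro wp_Asg_SeqI) (simp only: s1_def indep)
  then have "wp w M (cmp C ea eb) s (\<lambda>s' t. ?R s' t \<and> t \<le> tmax (cmp C ea eb))"
    by (rule wp_tmax[OF _ loopfree_cmp])
  then show ?thesis
  proof (rule wp_frame)
    fix s' :: "var state" and t :: nat
    assume a: "?R s' t \<and> t \<le> tmax (cmp C ea eb)" and fr: "\<And>y. \<not> wr (cmp C ea eb) y \<Longrightarrow> s' y = s y"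
    show "Q s' t"
    proof (rule Q)
      show "t \<le> elen ea + elen eb + cmp_time C" using a tmax_cmp[of C ea eb] by linarith
      show "s' y = s y" if "\<not> cmp_scratch y" for y using fr wr_cmp that by blast
    qed (rule a[THEN conjunct1, THEN conjunct1] a[THEN conjunct1, THEN conjunct2])+
  qed
qed

end

section \<open>Maximal suffix and period of a prefix of the pattern\<close>

abbreviation rg_plus (infixl \<open>\<boxplus>\<close> 65) where "a \<boxplus> b \<equiv> Bin Add a (Rg b)"
abbreviation rg_minus (infixl \<open>\<boxminus>\<close> 65) where "a \<boxminus> b \<equiv> Bin Sub a (Rg b)"

abbreviation inc :: "var \<Rightarrow> var com" where
  "inc x \<equiv> x ::= (Rg x \<oplus> Im 1)"

definition maxsuf_body :: "nat \<Rightarrow> var com" where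
  "maxsuf_body C =
    IF BEq (Rg vI) (Im 0) THEN (vI ::= Im 1;; vD ::= Im 1)
    ELSE (cmp C (Rg vP \<boxplus> vS \<boxplus> vI) (Rg vP \<boxplus> vS \<boxplus> vI \<boxminus> vD);;
      IF positive EQ THEN inc vI
      ELSE IF positive LT THEN (inc vI;; vD ::= Rg vI)
      ELSE (vS ::= (Rg vS \<boxplus> vD);;
        IF BLt (Rg vI \<boxminus> vD) (Rg vD) THEN vI ::= Im 0 ELSE vI ::= (Rg vI \<boxminus> vD)))"

definition maxsuf_com :: "nat \<Rightarrow> var com" where
  "maxsuf_com C =
    vS ::= Im 0;; vI ::= Im 0;; vD ::= Im 1;; WHILE BLt (Rg vS \<boxplus> vI) (Rg vL) DO maxsuf_body C"

definition period_body :: "nat \<Rightarrow> var com" where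
  "period_body C = cmp C (Rg vP \<boxplus> vK) (Rg vP \<boxplus> vK \<boxplus> vD);;
    IF positive EQ THEN inc vK ELSE (vPer ::= Im 0;; vK ::= Rg vS)"

definition period_com :: "nat \<Rightarrow> var com" where
  "period_com C = vK ::= Im 0;; vPer ::= Im 1;; WHILE BLt (Rg vK) (Rg vS) DO period_body C"

text \<open>The run is followed up to \<open>vM = n - 1 - p\<close> only, since the length
  \<open>n - p\<close> of the pattern might not fit into a word. Therefore \<open>level_ok\<close>
  claims a break at \<open>e\<close> only for \<open>p + e < n - 1\<close>.\<close>

definition reach_body :: "nat \<Rightarrow> var com" where
  "reach_body C =
    IF BLt (Rg vE) (Rg vM)
    THEN (cmp C (Rg vP \<boxplus> vE) (Rg vP \<boxplus> vE \<boxminus> vQ);; IF positive EQ THEN inc vE ELSE vGo2 ::= Im 0)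
    ELSE vGo2 ::= Im 0"

definition reach_com :: "nat \<Rightarrow> var com" where
  "reach_com C = vGo2 ::= Im 1;; WHILE positive vGo2 DO reach_body C"

text \<open>The three values are the lower bounds for all periods given by
  \<open>maxsuf_per_gt\<close>, \<open>maxsuf_per_ge\<close> and \<open>maxsuf_per_long\<close>.
  They add up to \<open>L + 2\<close>, so their maximum exceeds a third of \<open>L\<close>.\<close>

definition long_com :: "var com" where
  "long_com =
    vE ::= Rg vL;; vQ ::= (Rg vS \<oplus> Im 1);; IF BLt (Rg vQ) (Rg vD) THEN vQ ::= Rg vD ELSE Skip;;
    vK ::= (Rg vL \<boxminus> vS \<boxminus> vD \<oplus> Im 1);; IF BLt (Rg vQ) (Rg vK) THEN vQ ::= Rg vK ELSE Skip"

definition setq_com :: "nat \<Rightarrow> var com" where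
  "setq_com C = maxsuf_com C;; period_com C;;
    IF positive vPer THEN (vQ ::= Rg vD;; vE ::= Rg vL;; reach_com C) ELSE long_com"

text \<open>The price of one iteration with one comparison; the 200 covers the expressions, tests
  and jumps around it.\<close>

definition kt :: "nat \<Rightarrow> nat" where
  "kt C = cmp_time C + 200"

lemma not_wr_cmp [simp]: "\<not> cmp_scratch y \<Longrightarrow> \<not> wr (cmp C a b) y"
  using wr_cmp by blast

text \<open>The standard payment: a cost of at most \<open>k\<close> is covered by progress of a
  measure towards its bound \<open>B\<close>.\<close>

lemma pot_step:
  fixes m m' :: nat
  assumes "m < m'" "m' \<le> B" "t \<le> k"
  shows "t + k * (B - m') \<le> k * (B - m)"
proof -
  have "Suc (B - m') \<le> B - m" using assms by linarith
  then have "k * Suc (B - m') \<le> k * (B - m)" by (rule mult_le_mono2)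
  then show ?thesis using assms(3) by simp
qed

context packed
begin

definition pres :: "var com \<Rightarrow> bool" where
  "pres c \<longleftrightarrow> (\<forall>y. global y \<longrightarrow> \<not> wr c y)"

lemma pres_simps [simp]:
  "pres Skip" "pres (x ::= e) \<longleftrightarrow> \<not> global x" "pres (c1;; c2) \<longleftrightarrow> pres c1 \<and> pres c2"
  "pres (IF t THEN c1 ELSE c2) \<longleftrightarrow> pres c1 \<and> pres c2" "pres (WHILE t DO c1) \<longleftrightarrow> pres c1"
  unfolding pres_def by auto

lemma pres_cmp [simp]: "pres (cmp C x y)"
  unfolding pres_def
proof (intro allI impI)
  fix z :: var assume "global z"
  then have "\<not> cmp_scratch z" by (cases z) auto
  then show "\<not> wr (cmp C x y) z" by simp
qed

lemma glob_pres: "glob s \<Longrightarrow> pres c \<Longrightarrow> (\<And>y. \<not> wr c y \<Longrightarrow> s' y = s y) \<Longrightarrow> glob s'"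
  unfolding pres_def by (rule glob_cong) auto

lemma tb [simp]: "a < n \<Longrightarrow> take_bit w a = a"
  using T_le by (intro take_bit_less) simp

lemma tb_sub [simp]: "a < n \<Longrightarrow> c \<le> a \<Longrightarrow> take_bit w (a + 2 ^ w - c) = a - c"
  using T_le by (intro sub_less) auto

lemma tb_last [simp]: "a < n \<Longrightarrow> take_bit w (n + 2 ^ w - Suc a) = n - Suc a"
  using sub_less[of "n - 1" w a] T_le by simp

lemma tb_sub_Suc [simp]: "Suc a < n \<Longrightarrow> c \<le> Suc a \<Longrightarrow> take_bit w (Suc (a + 2 ^ w) - c) = Suc a - c"
  using tb_sub[of "Suc a" c] by simp

lemma w_pos [simp]: "0 < w"
  using w1 by simp

lemma globN: "glob s \<Longrightarrow> s vN = n - 1"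
  unfolding glob_def by blast

lemma wp_maxsuf:
  assumes g: "glob s" and L: "s vP = p" "s vL = L" "1 \<le> L" "p + L < n"
  shows "wp w M (maxsuf_com C) s (\<lambda>s' t. maxsuf (\<lambda>k. T ! (p + k)) L (s' vS) (s' vD) \<and>
    t \<le> kt C * (2 * L + 1))"
proof -
  let ?x = "\<lambda>k. T ! (p + k)"
  \<comment> \<open>\<open>2 * vS + vI\<close> grows in every iteration: when the candidate moves by
    \<open>d\<close>, fewer than \<open>2 * d\<close> scanned characters are given up.\<close>
  define \<Phi> :: "var state \<Rightarrow> nat" where "\<Phi> s = kt C * (2 * L - (2 * s vS + s vI))" for s
  define s1 where "s1 = s(vS := 0, vI := 0, vD := 1)"
  let ?I = "\<lambda>s. maxsuf_inv ?x L (s vS) (s vI) (s vD)"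
  have "wp w M (WHILE BLt (Rg vS \<boxplus> vI) (Rg vL) DO maxsuf_body C) s1
    (\<lambda>s' t. maxsuf ?x L (s' vS) (s' vD) \<and> t + 10 \<le> kt C * (2 * L + 1))"
  proof (rule wp_LoopI[where I = ?I and \<Phi> = \<Phi>])
    show "?I s1" using maxsuf_inv_init[of L ?x] L unfolding s1_def by simp
  next
    fix s2 :: "var state"
    assume I: "?I s2" and b2: "bval w (BLt (Rg vS \<boxplus> vI) (Rg vL)) s2"
      and fr: "\<And>y. \<not> wr (maxsuf_body C) y \<Longrightarrow> s2 y = s1 y"
    have v: "s2 vP = p" "s2 vL = L" using fr[of vP] fr[of vL] L by (auto simp: maxsuf_body_def s1_def)
    have g2: "glob s2"
      by (rule glob_pres[of s1 "maxsuf_body C"]) (use g fr in \<open>auto simp: maxsuf_body_def s1_def glob_def\<close>)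
    have le: "s2 vS < L" "s2 vS + s2 vI \<le> L" using I unfolding maxsuf_inv_def by auto
    then have lt: "s2 vS + s2 vI < L" using b2 v L by simp
    show "wp w M (maxsuf_body C) s2 (\<lambda>s' t. ?I s' \<and> t + (blen (BLt (Rg vS \<boxplus> vI) (Rg vL)) + 1) + \<Phi> s' \<le> \<Phi> s2)"
    proof (cases "s2 vI = 0")
      case True
      have "?I (s2(vI := 1, vD := 1))" using I True maxsuf_inv_1 by auto
      then show ?thesis unfolding maxsuf_body_def using True lt pot_step[of "2 * s2 vS" "Suc (2 * s2 vS)" "2 * L" "kt C" "kt C"]
        by (intro wp_CondI wp_Asg_SeqI wp_AsgI) (auto simp: \<Phi>_def kt_def)
    next
      case False
      have D: "1 \<le> s2 vD" "s2 vD \<le> s2 vI"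
        using I False duval_le[of "\<lambda>k. ?x (s2 vS + k)" "s2 vI" "s2 vD"] unfolding maxsuf_inv_def by auto
      have ea: "aval w (Rg vP \<boxplus> vS \<boxplus> vI) s2 = p + (s2 vS + s2 vI)"
        "aval w (Rg vP \<boxplus> vS \<boxplus> vI \<boxminus> vD) s2 = p + (s2 vS + s2 vI - s2 vD)"
        using v L le lt D by simp_all
      have pay: "t + (blen (BLt (Rg vS \<boxplus> vI) (Rg vL)) + 1) + \<Phi> s' \<le> \<Phi> s2"
        if "t \<le> cmp_time C + 150" "2 * s2 vS + s2 vI < 2 * s' vS + s' vI" "2 * s' vS + s' vI \<le> 2 * L" for t s'
        using pot_step[OF that(2,3), of "t + (blen (BLt (Rg vS \<boxplus> vI) (Rg vL)) + 1)" "kt C"] that(1)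
        unfolding \<Phi>_def kt_def by simp
      have "wp w M (cmp C (Rg vP \<boxplus> vS \<boxplus> vI) (Rg vP \<boxplus> vS \<boxplus> vI \<boxminus> vD);;
        IF positive EQ THEN inc vI
        ELSE IF positive LT THEN (inc vI;; vD ::= Rg vI)
        ELSE (vS ::= (Rg vS \<boxplus> vD);;
          IF BLt (Rg vI \<boxminus> vD) (Rg vD) THEN vI ::= Im 0 ELSE vI ::= (Rg vI \<boxminus> vD))) s2
        (\<lambda>s' t. ?I s' \<and> t + 20 \<le> cmp_time C + 150 \<and>
          2 * s2 vS + s2 vI < 2 * s' vS + s' vI \<and> 2 * s' vS + s' vI \<le> 2 * L)"
      proof (rule wp_SeqI, rule wp_cmpI[OF g2])
        show "aval w (Rg vP \<boxplus> vS \<boxplus> vI) s2 < n" "aval w (Rg vP \<boxplus> vS \<boxplus> vI \<boxminus> vD) s2 < n"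
          unfolding ea using L le lt D by simp_all
        fix s3 :: "var state" and t :: nat
        assume r: "s3 LT = of_bool (T ! aval w (Rg vP \<boxplus> vS \<boxplus> vI) s2 < T ! aval w (Rg vP \<boxplus> vS \<boxplus> vI \<boxminus> vD) s2)"
          "s3 EQ = of_bool (T ! aval w (Rg vP \<boxplus> vS \<boxplus> vI) s2 = T ! aval w (Rg vP \<boxplus> vS \<boxplus> vI \<boxminus> vD) s2)"
          and t: "t \<le> elen (Rg vP \<boxplus> vS \<boxplus> vI) + elen (Rg vP \<boxplus> vS \<boxplus> vI \<boxminus> vD) + cmp_time C"
          and fr3: "\<And>y. \<not> cmp_scratch y \<Longrightarrow> s3 y = s2 y"
        have v3: "s3 vS = s2 vS" "s3 vI = s2 vI" "s3 vD = s2 vD" using fr3 by auto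
        note res = r[unfolded ea]
        consider "?x (s2 vS + s2 vI) = ?x (s2 vS + s2 vI - s2 vD)" | "?x (s2 vS + s2 vI) < ?x (s2 vS + s2 vI - s2 vD)"
          | "?x (s2 vS + s2 vI - s2 vD) < ?x (s2 vS + s2 vI)" by (cases rule: linorder_cases)
        then show "wp w M (IF positive EQ THEN inc vI
          ELSE IF positive LT THEN (inc vI;; vD ::= Rg vI)
          ELSE (vS ::= (Rg vS \<boxplus> vD);;
            IF BLt (Rg vI \<boxminus> vD) (Rg vD) THEN vI ::= Im 0 ELSE vI ::= (Rg vI \<boxminus> vD))) s3
          (\<lambda>s' t'. ?I s' \<and> t + t' + 20 \<le> cmp_time C + 150 \<and>
          2 * s2 vS + s2 vI < 2 * s' vS + s' vI \<and> 2 * s' vS + s' vI \<le> 2 * L)"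
        proof cases
          case 1
          then show ?thesis using res v3 t lt L maxsuf_inv_eq[OF I _ lt] False
            by (intro wp_CondI wp_AsgI) auto
        next
          case 2
          then show ?thesis using res v3 t lt L maxsuf_inv_less[OF I _ lt] False
            by (intro wp_CondI wp_Asg_SeqI wp_AsgI) auto
        next
          case 3
          have new: "maxsuf_inv ?x L (s2 vS + s2 vD) (if s2 vI - s2 vD < s2 vD then 0 else s2 vI - s2 vD) (s2 vD)"
            using maxsuf_inv_greater[OF I _ lt] 3 False by simp
          show ?thesis using 3 res v3 t lt L new False D le
            by (intro wp_CondI wp_Asg_SeqI wp_AsgI) (auto split: if_splits)
        qed
      qed (simp_all)
      then have "wp w M (cmp C (Rg vP \<boxplus> vS \<boxplus> vI) (Rg vP \<boxplus> vS \<boxplus> vI \<boxminus> vD);;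
        IF positive EQ THEN inc vI
        ELSE IF positive LT THEN (inc vI;; vD ::= Rg vI)
        ELSE (vS ::= (Rg vS \<boxplus> vD);;
          IF BLt (Rg vI \<boxminus> vD) (Rg vD) THEN vI ::= Im 0 ELSE vI ::= (Rg vI \<boxminus> vD))) s2
        (\<lambda>s' t. ?I s' \<and> blen (BEq (Rg vI) (Im 0)) + t + 1 + (blen (BLt (Rg vS \<boxplus> vI) (Rg vL)) + 1) + \<Phi> s' \<le> \<Phi> s2)"
      proof (rule wp_mono)
        fix s' :: "var state" and t :: nat
        assume a: "?I s' \<and> t + 20 \<le> cmp_time C + 150 \<and>
          2 * s2 vS + s2 vI < 2 * s' vS + s' vI \<and> 2 * s' vS + s' vI \<le> 2 * L"
        show "?I s' \<and> blen (BEq (Rg vI) (Im 0)) + t + 1 + (blen (BLt (Rg vS \<boxplus> vI) (Rg vL)) + 1) + \<Phi> s' \<le> \<Phi> s2"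
          using a pay[of "t + 10" s'] by simp
      qed
      then show ?thesis unfolding maxsuf_body_def using False by (intro wp_CondI) simp_all
    qed
  next
    fix s2 :: "var state" and t :: nat
    assume I: "?I s2" and b2: "\<not> bval w (BLt (Rg vS \<boxplus> vI) (Rg vL)) s2"
      and t: "t + \<Phi> s2 \<le> \<Phi> s1 + blen (BLt (Rg vS \<boxplus> vI) (Rg vL)) + 1"
      and fr: "\<And>y. \<not> wr (maxsuf_body C) y \<Longrightarrow> s2 y = s1 y"
    have v: "s2 vP = p" "s2 vL = L" using fr[of vP] fr[of vL] L by (auto simp: maxsuf_body_def s1_def)
    have "s2 vS + s2 vI \<le> L" using I unfolding maxsuf_inv_def by auto
    then have "\<not> s2 vS + s2 vI < L" using b2 v L by simp
    then have "maxsuf ?x L (s2 vS) (s2 vD)" using maxsuf_inv_final[OF I] by blast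
    moreover have "\<Phi> s1 = kt C * (2 * L)" unfolding \<Phi>_def s1_def by simp
    ultimately show "maxsuf ?x L (s2 vS) (s2 vD) \<and> t + 10 \<le> kt C * (2 * L + 1)"
      using t by (simp add: kt_def)
  qed
  then show ?thesis unfolding maxsuf_com_def
    by (intro wp_Asg_SeqI) (simp add: s1_def, erule wp_mono, simp)
qed

text \<open>The maximal suffix has period \<open>D\<close> in any case, so comparing the first
  \<open>S\<close> positions with those \<open>D\<close> later decides about the whole
  prefix.\<close>

lemma wp_period:
  assumes g: "glob s" and L: "s vP = p" "s vS = S" "s vD = D" "p + L < n"
    and M: "maxsuf (\<lambda>k. T ! (p + k)) L S D"
  shows "wp w M (period_com C) s (\<lambda>s' t. (0 < s' vPer \<longleftrightarrow> per (\<lambda>k. T ! (p + k)) L D) \<and> t \<le> kt C * (L + 1))"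
proof -
  let ?x = "\<lambda>k. T ! (p + k)"
  have SL: "S < L" using M unfolding maxsuf_def by simp
  have SD: "1 \<le> D" "S + D \<le> L" using maxsuf_le[OF M] by auto
  define \<Phi> :: "var state \<Rightarrow> nat" where "\<Phi> s = kt C * (S - s vK)" for s
  define s1 where "s1 = s(vK := 0, vPer := 1)"
  let ?I = "\<lambda>s. s vK \<le> S \<and> (s vPer = 1 \<and> (\<forall>k<s vK. ?x (k + D) = ?x k) \<or> s vPer = 0 \<and> s vK = S \<and> \<not> per ?x L D)"
  have "wp w M (WHILE BLt (Rg vK) (Rg vS) DO period_body C) s1
    (\<lambda>s' t. (0 < s' vPer \<longleftrightarrow> per ?x L D) \<and> t + 10 \<le> kt C * (L + 1))"
  proof (rule wp_LoopI[where I = ?I and \<Phi> = \<Phi>])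
    show "?I s1" unfolding s1_def by simp
  next
    fix s2 :: "var state"
    assume I: "?I s2" and b2: "bval w (BLt (Rg vK) (Rg vS)) s2"
      and fr: "\<And>y. \<not> wr (period_body C) y \<Longrightarrow> s2 y = s1 y"
    have v: "s2 vP = p" "s2 vS = S" "s2 vD = D"
      using fr[of vP] fr[of vS] fr[of vD] L by (auto simp: period_body_def s1_def)
    have g2: "glob s2"
      by (rule glob_pres[of s1 "period_body C"]) (use g fr in \<open>auto simp: period_body_def s1_def glob_def\<close>)
    let ?k = "s2 vK"
    have k: "?k < S" using b2 v by simp
    then have I': "s2 vPer = 1" "\<forall>k<?k. ?x (k + D) = ?x k" using I by auto
    have ea: "aval w (Rg vP \<boxplus> vK) s2 = p + ?k" "aval w (Rg vP \<boxplus> vK \<boxplus> vD) s2 = p + (?k + D)"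
      using v L k SD by simp_all
    show "wp w M (period_body C) s2 (\<lambda>s' t. ?I s' \<and> t + (blen (BLt (Rg vK) (Rg vS)) + 1) + \<Phi> s' \<le> \<Phi> s2)"
      unfolding period_body_def
    proof (rule wp_SeqI, rule wp_cmpI[OF g2])
      show "aval w (Rg vP \<boxplus> vK) s2 < n" "aval w (Rg vP \<boxplus> vK \<boxplus> vD) s2 < n"
        unfolding ea using L k SD by simp_all
      fix s3 :: "var state" and t :: nat
      assume r: "s3 EQ = of_bool (T ! aval w (Rg vP \<boxplus> vK) s2 = T ! aval w (Rg vP \<boxplus> vK \<boxplus> vD) s2)"
        and t: "t \<le> elen (Rg vP \<boxplus> vK) + elen (Rg vP \<boxplus> vK \<boxplus> vD) + cmp_time C"
        and fr3: "\<And>y. \<not> cmp_scratch y \<Longrightarrow> s3 y = s2 y"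
      have v3: "s3 vK = ?k" "s3 vPer = 1" "s3 vS = S" using fr3 I' v by auto
      have np: "\<not> per ?x L D" if "?x (?k + D) \<noteq> ?x ?k" using that k SD unfolding per_def by (auto intro!: exI[of _ ?k])
      show "wp w M (IF positive EQ THEN inc vK ELSE (vPer ::= Im 0;; vK ::= Rg vS)) s3
        (\<lambda>s' t'. ?I s' \<and> t + t' + (blen (BLt (Rg vK) (Rg vS)) + 1) + \<Phi> s' \<le> \<Phi> s2)"
        using r[unfolded ea] v3 t I' np k SD L pot_step[of ?k "Suc ?k" S "kt C" "kt C"] pot_step[of ?k S S "kt C" "kt C"]
        by (intro wp_CondI wp_Asg_SeqI wp_AsgI) (auto simp: \<Phi>_def kt_def less_Suc_eq)
    qed simp_all
  next
    fix s2 :: "var state" and t :: nat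
    assume I: "?I s2" and b2: "\<not> bval w (BLt (Rg vK) (Rg vS)) s2"
      and t: "t + \<Phi> s2 \<le> \<Phi> s1 + blen (BLt (Rg vK) (Rg vS)) + 1"
      and fr: "\<And>y. \<not> wr (period_body C) y \<Longrightarrow> s2 y = s1 y"
    have v: "s2 vS = S" using fr[of vS] L by (auto simp: period_body_def s1_def)
    have k: "s2 vK = S" using I b2 v by simp
    have "per ?x L D" if e: "\<forall>k<S. ?x (k + D) = ?x k"
      unfolding per_def
    proof (intro allI impI)
      fix k assume k: "k + D < L"
      show "?x (k + D) = ?x k"
      proof (cases "k < S")
        case False
        have "per (\<lambda>k. ?x (S + k)) (L - S) D" using M unfolding maxsuf_def duval_def by blast
        from perD[OF this, of "k - S"] show ?thesis using False k by (simp add: algebra_simps)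
      qed (use e in blast)
    qed
    moreover have "\<Phi> s1 \<le> kt C * L" unfolding \<Phi>_def s1_def using SL by simp
    ultimately show "(0 < s2 vPer \<longleftrightarrow> per ?x L D) \<and> t + 10 \<le> kt C * (L + 1)"
      using t I k by (auto simp: kt_def)
  qed
  then show ?thesis unfolding period_com_def
    by (intro wp_Asg_SeqI) (simp add: s1_def, erule wp_mono, simp)
qed

lemma wp_reach:
  assumes g: "glob s" and L: "s vP = p" "s vE = L" "s vQ = q" "s vM = m" "p + m < n" "L \<le> m" "1 \<le> q" "q \<le> L"
    and per: "per (\<lambda>k. T ! (p + k)) L q"
  shows "wp w M (reach_com C) s (\<lambda>s' t. per (\<lambda>k. T ! (p + k)) (s' vE) q \<and> L \<le> s' vE \<and> s' vE \<le> m \<and>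
    (s' vE < m \<longrightarrow> T ! (p + s' vE) \<noteq> T ! (p + (s' vE - q))) \<and> t \<le> kt C * (n + 1))"
proof -
  let ?x = "\<lambda>k. T ! (p + k)"
  \<comment> \<open>Each iteration increases \<open>vE\<close> or clears \<open>vGo2\<close>;
    counting the flag pays for the iteration that ends the loop.\<close>
  define \<Phi> :: "var state \<Rightarrow> nat" where "\<Phi> s = kt C * (m + 1 - (s vE + 1 - s vGo2))" for s
  define s1 where "s1 = s(vGo2 := 1)"
  let ?I = "\<lambda>s. per ?x (s vE) q \<and> L \<le> s vE \<and> s vE \<le> m \<and>
    (s vGo2 = 1 \<or> s vGo2 = 0 \<and> (s vE < m \<longrightarrow> ?x (s vE) \<noteq> ?x (s vE - q)))"
  have "wp w M (WHILE positive vGo2 DO reach_body C) s1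
    (\<lambda>s' t. per ?x (s' vE) q \<and> L \<le> s' vE \<and> s' vE \<le> m \<and>
    (s' vE < m \<longrightarrow> ?x (s' vE) \<noteq> ?x (s' vE - q)) \<and> t + 10 \<le> kt C * (n + 1))"
  proof (rule wp_LoopI[where I = ?I and \<Phi> = \<Phi>])
    show "?I s1" using L per unfolding s1_def by simp
  next
    fix s2 :: "var state"
    assume I: "?I s2" and b2: "bval w (positive vGo2) s2"
      and fr: "\<And>y. \<not> wr (reach_body C) y \<Longrightarrow> s2 y = s1 y"
    have v: "s2 vP = p" "s2 vQ = q" "s2 vM = m"
      using fr[of vP] fr[of vQ] fr[of vM] L by (auto simp: reach_body_def s1_def)
    have g2: "glob s2"
      by (rule glob_pres[of s1 "reach_body C"]) (use g fr in \<open>auto simp: reach_body_def s1_def glob_def\<close>)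
    let ?e = "s2 vE"
    have go: "s2 vGo2 = 1" using b2 I by auto
    show "wp w M (reach_body C) s2 (\<lambda>s' t. ?I s' \<and> t + (blen (positive vGo2) + 1) + \<Phi> s' \<le> \<Phi> s2)"
    proof (cases "?e < m")
      case False
      then show ?thesis unfolding reach_body_def
        using I v go pot_step[of m "m + 1" "m + 1" "kt C" "kt C"] by (intro wp_CondI wp_AsgI) (auto simp: \<Phi>_def kt_def)
    next
      case True
      have ea: "aval w (Rg vP \<boxplus> vE) s2 = p + ?e" "aval w (Rg vP \<boxplus> vE \<boxminus> vQ) s2 = p + (?e - q)"
        using v L True I by simp_all
      have "wp w M (cmp C (Rg vP \<boxplus> vE) (Rg vP \<boxplus> vE \<boxminus> vQ);; IF positive EQ THEN inc vE ELSE vGo2 ::= Im 0) s2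
        (\<lambda>s' t. ?I s' \<and> blen (BLt (Rg vE) (Rg vM)) + t + (blen (positive vGo2) + 1) + \<Phi> s' \<le> \<Phi> s2)"
      proof (rule wp_SeqI, rule wp_cmpI[OF g2])
        show "aval w (Rg vP \<boxplus> vE) s2 < n" "aval w (Rg vP \<boxplus> vE \<boxminus> vQ) s2 < n"
          unfolding ea using L True by simp_all
        fix s3 :: "var state" and t :: nat
        assume r: "s3 EQ = of_bool (T ! aval w (Rg vP \<boxplus> vE) s2 = T ! aval w (Rg vP \<boxplus> vE \<boxminus> vQ) s2)"
          and t: "t \<le> elen (Rg vP \<boxplus> vE) + elen (Rg vP \<boxplus> vE \<boxminus> vQ) + cmp_time C"
          and fr3: "\<And>y. \<not> cmp_scratch y \<Longrightarrow> s3 y = s2 y"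
        have v3: "s3 vE = ?e" "s3 vGo2 = 1" using fr3 go by auto
        have new: "per ?x (Suc ?e) q" if "?x ?e = ?x (?e - q)"
          unfolding per_def
        proof (intro allI impI)
          fix k assume "k + q < Suc ?e"
          then consider "k + q < ?e" | "k = ?e - q" "k + q = ?e" by linarith
          then show "?x (k + q) = ?x k" using that perD[OF conjunct1[OF I]] by cases auto
        qed
        show "wp w M (IF positive EQ THEN inc vE ELSE vGo2 ::= Im 0) s3
          (\<lambda>s' t'. ?I s' \<and> blen (BLt (Rg vE) (Rg vM)) + (t + t') + (blen (positive vGo2) + 1) + \<Phi> s' \<le> \<Phi> s2)"
        proof (cases "?x ?e = ?x (?e - q)")
          case eq: True
          show ?thesis
            using r[unfolded ea] eq v3 t I True L new[OF eq] go pot_step[of ?e "Suc ?e" "m + 1" "kt C" "kt C"]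
            by (intro wp_CondI wp_AsgI) (auto simp: \<Phi>_def kt_def)
        next
          case neq: False
          show ?thesis
            using r[unfolded ea] neq v3 t I True L go pot_step[of ?e "Suc ?e" "m + 1" "kt C" "kt C"]
            by (intro wp_CondI wp_AsgI) (auto simp: \<Phi>_def kt_def)
        qed
      qed simp_all
      then show ?thesis unfolding reach_body_def using True v by (intro wp_CondI) simp_all
    qed
  next
    fix s2 :: "var state" and t :: nat
    assume I: "?I s2" and b2: "\<not> bval w (positive vGo2) s2"
      and t: "t + \<Phi> s2 \<le> \<Phi> s1 + blen (positive vGo2) + 1"
    have "\<Phi> s1 \<le> kt C * n" unfolding \<Phi>_def s1_def using L by (intro mult_le_mono2) simp
    then show "per ?x (s2 vE) q \<and> L \<le> s2 vE \<and> s2 vE \<le> m \<and>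
      (s2 vE < m \<longrightarrow> ?x (s2 vE) \<noteq> ?x (s2 vE - q)) \<and> t + 10 \<le> kt C * (n + 1)"
      using t I b2 by (auto simp: kt_def)
  qed
  then show ?thesis unfolding reach_com_def
    by (intro wp_Asg_SeqI) (simp add: s1_def, erule wp_mono, simp)
qed

text \<open>
  \<open>S\<close> is the start of the maximal suffix of the prefix of length \<open>L\<close> of the suffix at \<open>p\<close>. Its occurrences are at
  least \<open>q\<close> apart. Either \<open>q\<close> is its period and \<open>e\<close> is the end of the run of this period, or \<open>q\<close> is only a lower
  bound for the periods, which are then all long. The next level is \<open>e + q\<close>.
\<close>

definition level_ok :: "nat \<Rightarrow> nat \<Rightarrow> nat \<Rightarrow> nat \<Rightarrow> nat \<Rightarrow> bool" where
  "level_ok p L S q e \<longleftrightarrow> (\<exists>d. maxsuf (\<lambda>k. T ! (p + k)) L S d) \<and> S < q \<and> q \<le> L \<and> L \<le> e \<and> p + e < n \<and>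
    (\<forall>r. 1 \<le> r \<longrightarrow> per (\<lambda>k. T ! (p + k)) L r \<longrightarrow> q \<le> r) \<and>
    (per (\<lambda>k. T ! (p + k)) e q \<and> (p + e < n - 1 \<longrightarrow> T ! (p + e) \<noteq> T ! (p + (e - q))) \<or> e = L \<and> L < 3 * q)"

lemma wp_setq:
  assumes g: "glob s" and L: "s vP = p" "s vL = L" "s vM = n - 1 - p" "1 \<le> L" "p + L < n"
  shows "wp w M (setq_com C) s (\<lambda>s' t. level_ok p L (s' vS) (s' vQ) (s' vE) \<and> t \<le> kt C * (5 * n))"
proof -
  let ?x = "\<lambda>k. T ! (p + k)"
  show ?thesis unfolding setq_com_def
  proof (rule wp_Seq_frame[OF wp_maxsuf[OF g L(1,2,4,5)]])
    fix s1 :: "var state" and t1 :: nat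
    assume a1: "maxsuf ?x L (s1 vS) (s1 vD) \<and> t1 \<le> kt C * (2 * L + 1)"
      and fr1: "\<And>y. \<not> wr (maxsuf_com C) y \<Longrightarrow> s1 y = s y"
    have v1: "s1 vP = p" "s1 vL = L" "s1 vM = n - 1 - p" using fr1 L by (auto simp: maxsuf_com_def maxsuf_body_def)
    have g1: "glob s1"
      by (rule glob_pres[OF g, of "maxsuf_com C"]) (use fr1 in \<open>auto simp: maxsuf_com_def maxsuf_body_def\<close>)
    define S D where "S = s1 vS" and "D = s1 vD"
    have M1: "maxsuf ?x L S D" using a1 unfolding S_def D_def by simp
    note SD = maxsuf_le[OF M1]
    show "wp w M (period_com C;; IF positive vPer THEN (vQ ::= Rg vD;; vE ::= Rg vL;; reach_com C) ELSE long_com) s1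
      (\<lambda>s' t. level_ok p L (s' vS) (s' vQ) (s' vE) \<and> t1 + t \<le> kt C * (5 * n))"
    proof (rule wp_Seq_frame[OF wp_period[OF g1 v1(1) S_def[symmetric] D_def[symmetric] L(5) M1]])
      fix s2 :: "var state" and t2 :: nat
      assume a2: "(0 < s2 vPer) = per ?x L D \<and> t2 \<le> kt C * (L + 1)"
        and fr2: "\<And>y. \<not> wr (period_com C) y \<Longrightarrow> s2 y = s1 y"
      have v2: "s2 vP = p" "s2 vL = L" "s2 vM = n - 1 - p" "s2 vS = S" "s2 vD = D"
        using fr2 v1 by (auto simp: period_com_def period_body_def S_def D_def)
      have g2: "glob s2"
        by (rule glob_pres[OF g1, of "period_com C"]) (use fr2 in \<open>auto simp: period_com_def period_body_def\<close>)
      have t12: "t1 + t2 \<le> kt C * (3 * L + 2)" using a1 a2 by (simp add: algebra_simps)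
      show "wp w M (IF positive vPer THEN (vQ ::= Rg vD;; vE ::= Rg vL;; reach_com C) ELSE long_com) s2
        (\<lambda>s' t. level_ok p L (s' vS) (s' vQ) (s' vE) \<and> t1 + (t2 + t) \<le> kt C * (5 * n))"
      proof (cases "per ?x L D")
        case True
        define s3 where "s3 = s2(vQ := D, vE := L)"
        have g3: "glob s3" using g2 unfolding s3_def glob_def by simp
        have "wp w M (reach_com C) s3 (\<lambda>s' t. level_ok p L (s' vS) (s' vQ) (s' vE) \<and> t1 + (t2 + (t + 20)) \<le> kt C * (5 * n))"
        proof (rule wp_frame[OF wp_reach[OF g3]])
          show "s3 vP = p" "s3 vE = L" "s3 vQ = D" "s3 vM = n - 1 - p" "p + (n - 1 - p) < n" "L \<le> n - 1 - p" "1 \<le> D" "D \<le> L"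
            using v2 L SD by (auto simp: s3_def)
          show "per ?x L D" by (rule True)
          fix s' :: "var state" and t :: nat
          assume a: "per ?x (s' vE) D \<and> L \<le> s' vE \<and> s' vE \<le> n - 1 - p \<and>
            (s' vE < n - 1 - p \<longrightarrow> ?x (s' vE) \<noteq> ?x (s' vE - D)) \<and> t \<le> kt C * (n + 1)"
            and fr: "\<And>y. \<not> wr (reach_com C) y \<Longrightarrow> s' y = s3 y"
          have v: "s' vS = S" "s' vQ = D" using fr v2 by (auto simp: reach_com_def reach_body_def s3_def)
          have "level_ok p L S D (s' vE)"
            unfolding level_ok_def using M1 maxsuf_per_gt[OF M1 True] maxsuf_per_ge[OF M1] SD a L by auto
          moreover have "t1 + (t2 + (t + 20)) \<le> kt C * (5 * n)"
          proof -
            have "kt C * ((3 * L + 2) + (n + 1) + 1) \<le> kt C * (5 * n)"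
              using L by (intro mult_le_mono2) simp
            moreover have "20 \<le> kt C" by (simp add: kt_def)
            moreover have "t \<le> kt C * (n + 1)" using a by blast
            ultimately show ?thesis using t12 unfolding add_mult_distrib2 by linarith
          qed
          ultimately show "level_ok p L (s' vS) (s' vQ) (s' vE) \<and> t1 + (t2 + (t + 20)) \<le> kt C * (5 * n)"
            using v by simp
        qed
        then show ?thesis using a2 True v2
          by (intro wp_CondI wp_Asg_SeqI) (auto simp: s3_def elim: wp_mono)
      next
        case False
        define q where "q = max (max (S + 1) D) (L - S - D + 1)"
        \<comment> \<open>As \<open>D\<close> is not a period here, \<open>maxsuf_per_long\<close>
          forbids \<open>r + D \<le> L - S\<close>.\<close>
        have "q \<le> r" if "1 \<le> r" "per ?x L r" for r
          using maxsuf_per_gt[OF M1 that(2,1)] maxsuf_per_ge[OF M1 that(2,1)] maxsuf_per_long[OF M1 that(2,1)] False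
          unfolding q_def by linarith
        moreover have q3: "S + 1 \<le> q" "D \<le> q" "L - S - D + 1 \<le> q" "q \<le> L" unfolding q_def using SD by auto
        moreover have "S < q" "L < 3 * q" using q3 by linarith+
        ultimately have ok: "level_ok p L S q L" unfolding level_ok_def using M1 L by blast
        have tt: "t1 + (t2 + 60) \<le> kt C * (5 * n)"
        proof -
          have "kt C * (3 * L + 2) + kt C \<le> kt C * (5 * n)"
            using mult_le_mono2[of "(3 * L + 2) + 1" "5 * n" "kt C"] L by (simp add: algebra_simps)
          then show ?thesis using t12 by (simp add: kt_def)
        qed
        have Ln: "L < n" "S + 1 < n" "L - S - D + 1 < n" using L SD by auto
        have bits: "take_bit w (S + 1) = S + 1" "take_bit w (L + 2 ^ w - S) = L - S" "take_bit w (L - S + 2 ^ w - D) = L - S - D"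
          "take_bit w (L - S - D + 1) = L - S - D + 1"
          using Ln SD by simp_all
        have "wp w M long_com s2 (\<lambda>s' t. s' vQ = q \<and> s' vE = L \<and> s' vS = S \<and> t \<le> 40)"
          unfolding long_com_def using v2 bits[simplified] q_def
          by (intro wp_Asg_SeqI wp_SeqI wp_CondI wp_AsgI wp_SkipI) (auto simp: max_def)
        then have "wp w M long_com s2 (\<lambda>s' t. level_ok p L (s' vS) (s' vQ) (s' vE) \<and> t1 + (t2 + (t + 10)) \<le> kt C * (5 * n))"
          by (rule wp_mono) (use ok tt in auto)
        then show ?thesis using a2 False by (intro wp_CondI) (auto elim: wp_mono)
      qed
    qed
  qed
qed

end

section \<open>Counting the suffixes below a pattern\<close>

definition check_body :: "nat \<Rightarrow> var com" where
  "check_body C = cmp C (Rg vJ \<boxplus> vK) (Rg vP \<boxplus> vK);;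
    IF positive EQ THEN inc vK ELSE (vOk ::= Im 0;; vK ::= Rg vS)"

text \<open>The part before the maximal suffix is compared only after the maximal suffix itself has
  matched.\<close>

definition check_com :: "nat \<Rightarrow> var com" where
  "check_com C = vK ::= Im 0;; vOk ::= Im 1;; WHILE BLt (Rg vK) (Rg vS) DO check_body C"

definition run_body :: "nat \<Rightarrow> var com" where
  "run_body C =
    IF BLt (Rg vF) (Rg vN)
    THEN (cmp C (Rg vF \<oplus> Im 1) (Rg vF \<oplus> Im 1 \<boxminus> vQ);; IF positive EQ THEN inc vF ELSE vGo3 ::= Im 0)
    ELSE vGo3 ::= Im 0"

text \<open>\<open>vF\<close> is the last position of the run and not the first one after it, as the
  latter could be \<open>n = 2 ^ w\<close>. The occurrence itself guarantees the run up to
  \<open>vJ + vL - 1\<close>.\<close>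

definition run_com :: "nat \<Rightarrow> var com" where
  "run_com C =
    vK ::= Bin Add (Rg vJ) (Rg vL \<ominus> Im 1);; IF BLt (Rg vF) (Rg vK) THEN vF ::= Rg vK ELSE Skip;;
    vGo3 ::= Im 1;; WHILE positive vGo3 DO run_body C"

text \<open>If the text ends first, its suffix is a proper prefix of the pattern and counts as
  smaller; if the pattern ends first, it does not. If the fuel is used up by matches, the suffixes
  share \<open>e + q\<close> characters and the decision is left to the next level.\<close>

definition ext_body :: "nat \<Rightarrow> var com" where
  "ext_body C =
    IF BLt (Rg vN \<boxminus> vJ) (Rg vLen) THEN (inc vCnt;; vFuel ::= Im 0)
    ELSE IF BLt (Rg vM) (Rg vLen) THEN vFuel ::= Im 0
    ELSE (cmp C (Rg vJ \<boxplus> vLen) (Rg vP \<boxplus> vLen);;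
      IF positive EQ THEN (inc vLen;; vFuel ::= (Rg vFuel \<ominus> Im 1))
      ELSE ((IF positive LT THEN inc vCnt ELSE Skip);; vFuel ::= Im 0))"

definition ext_com :: "nat \<Rightarrow> var com" where
  "ext_com C =
    (IF BLt (Rg vF \<boxminus> vJ) (Rg vE) THEN vLen ::= (Rg vF \<boxminus> vJ \<oplus> Im 1) ELSE vLen ::= Rg vE);;
    vFuel ::= Rg vQ;; WHILE positive vFuel DO ext_body C"

text \<open>
  For an occurrence at \<open>vJ\<close>, the end \<open>vF\<close> of the run of period \<open>q\<close> that contains it yields a common prefix up
  to the end of the shorter run without looking at characters, and at most \<open>q\<close> comparisons suffice for the rest.
  As \<open>vF\<close> never moves back and occurrences are \<open>q\<close> apart, a level takes linear time.
\<close>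

definition occ_com :: "nat \<Rightarrow> var com" where
  "occ_com C = check_com C;;
    (IF positive vOk THEN (vAdv ::= Rg vQ;; run_com C;; IF BEq (Rg vJ) (Rg vP) THEN Skip ELSE ext_com C)
     ELSE vAdv ::= (Rg vS \<oplus> Im 1));;
    IF BLt (Rg vJM \<boxminus> vJ) (Rg vAdv) THEN vGo2 ::= Im 0 ELSE vNb ::= (Rg vJ \<boxplus> vAdv)"

lemma match_Suc_mono: "match T p l' j \<Longrightarrow> l < l' \<Longrightarrow> match T p (Suc l) j"
  by (rule match_mono) auto

locale level = packed +
  fixes p X L S q e :: nat
  assumes ok: "level_ok p L S q e" and X: "X < n"
begin

abbreviation "x \<equiv> \<lambda>k. T ! (p + k)"
abbreviation "below j \<equiv> drop j T < drop p T"
text \<open>The last position that is to be counted and leaves room for \<open>L\<close>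
  characters.\<close>

definition "JM = min X (n - L)"

lemma bounds: "S < q" "S < L" "q \<le> L" "L \<le> e" "p + e < n" "1 \<le> L" "1 \<le> q" "L < n" "e < n"
  using ok unfolding level_ok_def maxsuf_def by auto

lemma JM: "JM \<le> X" "JM + L \<le> n" "JM < n"
  using bounds X unfolding JM_def by auto

definition lv :: "var state \<Rightarrow> bool" where
  "lv s \<longleftrightarrow> glob s \<and> s vP = p \<and> s vX = X \<and> s vL = L \<and> s vM = n - 1 - p \<and> s vS = S \<and> s vQ = q \<and> s vE = e \<and> s vJM = JM"

lemma lvD: "lv s \<Longrightarrow> glob s" "lv s \<Longrightarrow> s vP = p" "lv s \<Longrightarrow> s vX = X" "lv s \<Longrightarrow> s vL = L" "lv s \<Longrightarrow> s vM = n - 1 - p"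
  "lv s \<Longrightarrow> s vS = S" "lv s \<Longrightarrow> s vQ = q" "lv s \<Longrightarrow> s vE = e" "lv s \<Longrightarrow> s vJM = JM" "lv s \<Longrightarrow> s vN = n - 1"
  unfolding lv_def glob_def by auto

definition lpres :: "var com \<Rightarrow> bool" where
  "lpres c \<longleftrightarrow> pres c \<and> (\<forall>y\<in>{vP, vX, vL, vM, vS, vQ, vE, vJM}. \<not> wr c y)"

lemma lv_pres: "lv s \<Longrightarrow> lpres c \<Longrightarrow> (\<And>y. \<not> wr c y \<Longrightarrow> s' y = s y) \<Longrightarrow> lv s'"
  unfolding lv_def lpres_def using glob_pres[of s c s'] by auto

lemma lpres_simps [simp]:
  "lpres Skip" "lpres (v ::= a) \<longleftrightarrow> \<not> global v \<and> v \<notin> {vP, vX, vL, vM, vS, vQ, vE, vJM}"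
  "lpres (c1;; c2) \<longleftrightarrow> lpres c1 \<and> lpres c2"
  "lpres (IF t THEN c1 ELSE c2) \<longleftrightarrow> lpres c1 \<and> lpres c2" "lpres (WHILE t DO c1) \<longleftrightarrow> lpres c1"
  "lpres (cmp C a1 a2)"
  unfolding lpres_def by auto

lemma lpres_coms [simp]:
  "lpres (check_com C)" "lpres (check_body C)" "lpres (run_com C)" "lpres (run_body C)"
  "lpres (ext_com C)" "lpres (ext_body C)" "lpres (occ_com C)"
  unfolding occ_com_def check_com_def run_com_def ext_com_def check_body_def run_body_def ext_body_def
  by simp_all

lemma wp_check:
  assumes g: "lv s" and j: "s vJ = j" "j + L \<le> n"
  shows "wp w M (check_com C) s (\<lambda>s' t. (0 < s' vOk \<longleftrightarrow> (\<forall>k<S. T ! (j + k) = T ! (p + k))) \<and> t \<le> kt C * (S + 1))"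
proof -
  define \<Phi> :: "var state \<Rightarrow> nat" where "\<Phi> s = kt C * (S - s vK)" for s
  define s1 where "s1 = s(vK := 0, vOk := 1)"
  have lv1: "lv s1" using g unfolding lv_def s1_def glob_def by simp
  let ?I = "\<lambda>s. s vK \<le> S \<and> (s vOk = 1 \<and> (\<forall>k<s vK. T ! (j + k) = T ! (p + k)) \<or>
    s vOk = 0 \<and> s vK = S \<and> \<not> (\<forall>k<S. T ! (j + k) = T ! (p + k)))"
  have "wp w M (WHILE BLt (Rg vK) (Rg vS) DO check_body C) s1
    (\<lambda>s' t. (0 < s' vOk \<longleftrightarrow> (\<forall>k<S. T ! (j + k) = T ! (p + k))) \<and> t + 10 \<le> kt C * (S + 1))"
  proof (rule wp_LoopI[where I = ?I and \<Phi> = \<Phi>])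
    show "?I s1" unfolding s1_def by simp
  next
    fix s2 :: "var state"
    assume I: "?I s2" and b2: "bval w (BLt (Rg vK) (Rg vS)) s2"
      and fr: "\<And>y. \<not> wr (check_body C) y \<Longrightarrow> s2 y = s1 y"
    have lv2: "lv s2" by (rule lv_pres[OF lv1 _ fr]) simp_all
    have v: "s2 vJ = j" using fr[of vJ] j by (auto simp: check_body_def s1_def)
    let ?k = "s2 vK"
    have k: "?k < S" using b2 lvD[OF lv2] by simp
    then have I': "s2 vOk = 1" "\<forall>k<?k. T ! (j + k) = T ! (p + k)" using I by auto
    have ea: "aval w (Rg vJ \<boxplus> vK) s2 = j + ?k" "aval w (Rg vP \<boxplus> vK) s2 = p + ?k"
      using v lvD[OF lv2] k bounds j by simp_all
    show "wp w M (check_body C) s2 (\<lambda>s' t. ?I s' \<and> t + (blen (BLt (Rg vK) (Rg vS)) + 1) + \<Phi> s' \<le> \<Phi> s2)"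
      unfolding check_body_def
    proof (rule wp_SeqI, rule wp_cmpI[OF lvD(1)[OF lv2]])
      show "aval w (Rg vJ \<boxplus> vK) s2 < n" "aval w (Rg vP \<boxplus> vK) s2 < n"
        unfolding ea using j k bounds by simp_all
      fix s3 :: "var state" and t :: nat
      assume r: "s3 EQ = of_bool (T ! aval w (Rg vJ \<boxplus> vK) s2 = T ! aval w (Rg vP \<boxplus> vK) s2)"
        and t: "t \<le> elen (Rg vJ \<boxplus> vK) + elen (Rg vP \<boxplus> vK) + cmp_time C"
        and fr3: "\<And>y. \<not> cmp_scratch y \<Longrightarrow> s3 y = s2 y"
      have v3: "s3 vK = ?k" "s3 vOk = 1" "s3 vS = S" using fr3 I' lvD[OF lv2] by auto
      show "wp w M (IF positive EQ THEN inc vK ELSE (vOk ::= Im 0;; vK ::= Rg vS)) s3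
        (\<lambda>s' t'. ?I s' \<and> t + t' + (blen (BLt (Rg vK) (Rg vS)) + 1) + \<Phi> s' \<le> \<Phi> s2)"
        using r[unfolded ea] v3 t I' k bounds pot_step[of ?k "Suc ?k" S "kt C" "kt C"] pot_step[of ?k S S "kt C" "kt C"]
        by (intro wp_CondI wp_Asg_SeqI wp_AsgI) (auto simp: \<Phi>_def kt_def less_Suc_eq)
    qed simp_all
  next
    fix s2 :: "var state" and t :: nat
    assume I: "?I s2" and b2: "\<not> bval w (BLt (Rg vK) (Rg vS)) s2"
      and t: "t + \<Phi> s2 \<le> \<Phi> s1 + blen (BLt (Rg vK) (Rg vS)) + 1"
      and fr: "\<And>y. \<not> wr (check_body C) y \<Longrightarrow> s2 y = s1 y"
    have "lv s2" by (rule lv_pres[OF lv1 _ fr]) simp_all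
    then have k: "s2 vK = S" using I b2 lvD(6) by fastforce
    have "\<Phi> s1 \<le> kt C * S" unfolding \<Phi>_def s1_def by simp
    then show "(0 < s2 vOk \<longleftrightarrow> (\<forall>k<S. T ! (j + k) = T ! (p + k))) \<and> t + 10 \<le> kt C * (S + 1)"
      using t I k by (auto simp: kt_def)
  qed
  then show ?thesis unfolding check_com_def
    by (intro wp_Asg_SeqI) (simp add: s1_def, erule wp_mono, simp)
qed

text \<open>The cost is charged to the advance of \<open>vF\<close>, so that all runs of a level
  together take linear time. Equalities are claimed only beyond the known run and the occurrence;
  the caller supplies the others.\<close>

lemma wp_run:
  assumes g: "lv s" and j: "s vJ = j" "j + L \<le> n" and F: "s vF = F" "F < n"
  shows "wp w M (run_com C) s (\<lambda>s' t. F \<le> s' vF \<and> s' vF < n \<and> j + L \<le> Suc (s' vF) \<and>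
    (\<forall>k. max F (j + L - 1) < k + q \<and> k + q \<le> s' vF \<longrightarrow> T ! (k + q) = T ! k) \<and>
    (s' vF < n - 1 \<longrightarrow> T ! (s' vF + 1) \<noteq> T ! (s' vF + 1 - q)) \<and> t \<le> kt C * (s' vF - F + 2))"
proof -
  define F1 where "F1 = max F (j + L - 1)"
  define s1 where "s1 = s(vK := j + (L - 1), vF := F1, vGo3 := 1)"
  have lv1: "lv s1" using g unfolding lv_def s1_def glob_def by simp
  define \<Phi> :: "var state \<Rightarrow> nat" where "\<Phi> s = kt C * (n - (s vF + 1 - s vGo3))" for s
  let ?P = "\<lambda>s. F1 \<le> s vF \<and> s vF < n \<and> (\<forall>k. F1 < k + q \<and> k + q \<le> s vF \<longrightarrow> T ! (k + q) = T ! k)"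
  let ?R = "\<lambda>s. s vF < n - 1 \<longrightarrow> T ! (s vF + 1) \<noteq> T ! (s vF + 1 - q)"
  let ?I = "\<lambda>s. ?P s \<and> (s vGo3 = 1 \<or> s vGo3 = 0 \<and> ?R s)"
  have F1: "F \<le> F1" "F1 < n" "j + L \<le> Suc F1" "q \<le> Suc F1" using bounds j F unfolding F1_def by auto
  have loop: "wp w M (WHILE positive vGo3 DO run_body C) s1 (\<lambda>s' t. ?P s' \<and> ?R s' \<and> t + kt C * (n - (s' vF + 1)) \<le> kt C * (n - F1) + 10)"
  proof (rule wp_LoopI[where I = ?I and \<Phi> = \<Phi>])
    show "?I s1" unfolding s1_def using F1 by auto
  next
    fix s2 :: "var state"
    assume I: "?I s2" and b2: "bval w (positive vGo3) s2"
      and fr: "\<And>y. \<not> wr (run_body C) y \<Longrightarrow> s2 y = s1 y"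
    have lv2: "lv s2" by (rule lv_pres[OF lv1 _ fr]) simp_all
    let ?f = "s2 vF"
    have go: "s2 vGo3 = 1" using b2 I by auto
    have f: "q \<le> ?f + 1" using I F1 by simp
    show "wp w M (run_body C) s2 (\<lambda>s' t. ?I s' \<and> t + (blen (positive vGo3) + 1) + \<Phi> s' \<le> \<Phi> s2)"
    proof (cases "?f < n - 1")
      case False
      then have "n - ?f = 1" using I by auto
      then show ?thesis unfolding run_body_def
        using I lvD(10)[OF lv2] go False by (intro wp_CondI wp_AsgI) (auto simp: \<Phi>_def kt_def)
    next
      case True
      have ea: "aval w (Rg vF \<oplus> Im 1) s2 = ?f + 1" "aval w (Rg vF \<oplus> Im 1 \<boxminus> vQ) s2 = ?f + 1 - q"
        using lvD[OF lv2] True I f by simp_all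
      have "wp w M (cmp C (Rg vF \<oplus> Im 1) (Rg vF \<oplus> Im 1 \<boxminus> vQ);; IF positive EQ THEN inc vF ELSE vGo3 ::= Im 0) s2
        (\<lambda>s' t. ?I s' \<and> blen (BLt (Rg vF) (Rg vN)) + t + (blen (positive vGo3) + 1) + \<Phi> s' \<le> \<Phi> s2)"
      proof (rule wp_SeqI, rule wp_cmpI[OF lvD(1)[OF lv2]])
        show "aval w (Rg vF \<oplus> Im 1) s2 < n" "aval w (Rg vF \<oplus> Im 1 \<boxminus> vQ) s2 < n"
          unfolding ea using True by simp_all
        fix s3 :: "var state" and t :: nat
        assume r: "s3 EQ = of_bool (T ! aval w (Rg vF \<oplus> Im 1) s2 = T ! aval w (Rg vF \<oplus> Im 1 \<boxminus> vQ) s2)"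
          and t: "t \<le> elen (Rg vF \<oplus> Im 1) + elen (Rg vF \<oplus> Im 1 \<boxminus> vQ) + cmp_time C"
          and fr3: "\<And>y. \<not> cmp_scratch y \<Longrightarrow> s3 y = s2 y"
        have v3: "s3 vF = ?f" "s3 vGo3 = 1" using fr3 go by auto
        have new: "T ! (k + q) = T ! k" if k: "T ! (?f + 1) = T ! (?f + 1 - q)" "F1 < k + q" "k + q \<le> ?f + 1" for k
        proof -
          consider "k + q \<le> ?f" | "k = ?f + 1 - q" "k + q = ?f + 1" using k(3) by linarith
          then show ?thesis using k I by cases auto
        qed
        show "wp w M (IF positive EQ THEN inc vF ELSE vGo3 ::= Im 0) s3
          (\<lambda>s' t'. ?I s' \<and> blen (BLt (Rg vF) (Rg vN)) + (t + t') + (blen (positive vGo3) + 1) + \<Phi> s' \<le> \<Phi> s2)"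
        proof (cases "T ! (?f + 1) = T ! (?f + 1 - q)")
          case eq: True
          show ?thesis
            using r[unfolded ea] eq v3 t I True new[OF eq] go pot_step[of ?f "Suc ?f" n "kt C" "kt C"]
            by (intro wp_CondI wp_AsgI) (auto simp: \<Phi>_def kt_def)
        next
          case neq: False
          show ?thesis
            using r[unfolded ea] neq v3 t I True go pot_step[of ?f "Suc ?f" n "kt C" "kt C"]
            by (intro wp_CondI wp_AsgI) (auto simp: \<Phi>_def kt_def)
        qed
      qed simp_all
      then show ?thesis unfolding run_body_def using True lvD(10)[OF lv2] by (intro wp_CondI) simp_all
    qed
  next
    fix s2 :: "var state" and t :: nat
    assume I: "?I s2" and b2: "\<not> bval w (positive vGo3) s2"
      and t: "t + \<Phi> s2 \<le> \<Phi> s1 + blen (positive vGo3) + 1"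
    have "\<Phi> s1 = kt C * (n - F1)" "\<Phi> s2 = kt C * (n - (s2 vF + 1))" unfolding \<Phi>_def s1_def using I b2 by auto
    then show "?P s2 \<and> ?R s2 \<and> t + kt C * (n - (s2 vF + 1)) \<le> kt C * (n - F1) + 10"
      using t I b2 by auto
  qed
  have "wp w M (vGo3 ::= Im 1;; WHILE positive vGo3 DO run_body C) (s(vK := j + (L - 1), vF := F1))
    (\<lambda>s' t. ?P s' \<and> ?R s' \<and> t + kt C * (n - (s' vF + 1)) \<le> kt C * (n - F1) + 20)"
    by (rule wp_Asg_SeqI) (use loop in \<open>simp add: s1_def, elim wp_mono, simp\<close>)
  then have rest: "wp w M (vGo3 ::= Im 1;; WHILE positive vGo3 DO run_body C) (s(vK := j + (L - 1), vF := F1))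
    (\<lambda>s' t. ?P s' \<and> ?R s' \<and> t + kt C * (n - (s' vF + 1)) \<le> kt C * (n - F1) + 20)" .
  have upd: "wp w M (IF BLt (Rg vF) (Rg vK) THEN vF ::= Rg vK ELSE Skip) (s(vK := j + (L - 1)))
    (\<lambda>s' t. s' = s(vK := j + (L - 1), vF := F1) \<and> t \<le> 10)"
    using F bounds by (intro wp_CondI wp_AsgI wp_SkipI) (auto simp: F1_def max_def fun_eq_iff)
  have tail: "wp w M (IF BLt (Rg vF) (Rg vK) THEN vF ::= Rg vK ELSE Skip;; vGo3 ::= Im 1;; WHILE positive vGo3 DO run_body C)
    (s(vK := j + (L - 1))) (\<lambda>s' t. ?P s' \<and> ?R s' \<and> t + kt C * (n - (s' vF + 1)) \<le> kt C * (n - F1) + 30)"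
    by (rule wp_Seq_frame[OF upd]) (use rest in \<open>auto elim!: wp_mono\<close>)
  have ea: "aval w (Bin Add (Rg vJ) (Rg vL \<ominus> Im 1)) s = j + (L - 1)"
    using lvD[OF g] j bounds by simp
  have "wp w M (run_com C) s
    (\<lambda>s' t. ?P s' \<and> ?R s' \<and> t + kt C * (n - (s' vF + 1)) \<le> kt C * (n - F1) + 50)"
    unfolding run_com_def by (rule wp_Asg_SeqI) (use tail in \<open>simp only: ea, elim wp_mono, simp\<close>)
  then show ?thesis
  proof (rule wp_mono)
    fix s' :: "var state" and t :: nat
    assume a: "?P s' \<and> ?R s' \<and> t + kt C * (n - (s' vF + 1)) \<le> kt C * (n - F1) + 50"
    have "(n - F1) + 1 \<le> (n - (s' vF + 1)) + (s' vF - F + 2)" using a F1 by linarith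
    then have "kt C * ((n - F1) + 1) \<le> kt C * ((n - (s' vF + 1)) + (s' vF - F + 2))" by (rule mult_le_mono2)
    moreover have "50 \<le> kt C" by (simp add: kt_def)
    ultimately have "t \<le> kt C * (s' vF - F + 2)" using a unfolding add_mult_distrib2 by linarith
    moreover have "F \<le> s' vF" "j + L \<le> Suc (s' vF)" using a F1 by linarith+
    ultimately show "F \<le> s' vF \<and> s' vF < n \<and> j + L \<le> Suc (s' vF) \<and>
      (\<forall>k. max F (j + L - 1) < k + q \<and> k + q \<le> s' vF \<longrightarrow> T ! (k + q) = T ! k) \<and> ?R s' \<and> t \<le> kt C * (s' vF - F + 2)"
      using a unfolding F1_def by blast
  qed
qed

text \<open>If the run in the text ends first, then by \<open>blk\<close> the next character breaks
  it while the pattern continues it, and the first comparison decides. Otherwise the known common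
  prefix has length \<open>e\<close>, and \<open>q\<close> comparisons reach the next level. The
  assumption on \<open>c\<close> keeps the counter from overflowing.\<close>

lemma wp_ext:
  assumes g: "lv s" and j: "s vJ = j" "j < n" "j \<noteq> p" and F: "s vF = F" "j \<le> F" "F < n" and c: "s vCnt = c" "c + 1 < n"
    and m: "match T p (min (F + 1 - j) e) j"
    and blk: "F + 1 - j < e \<Longrightarrow> F + 1 < n \<Longrightarrow> T ! (F + 1) \<noteq> T ! (p + (F + 1 - j))"
  shows "wp w M (ext_com C) s (\<lambda>s' t. s' vCnt = c + of_bool (below j \<and> \<not> match T p (e + q) j) \<and> t \<le> kt C * (q + 2))"
proof -
  define l0 where "l0 = min (F + 1 - j) e"
  define s1 where "s1 = s(vLen := l0, vFuel := q)"
  have lv1: "lv s1" using g unfolding lv_def s1_def glob_def by simp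
  let ?res = "c + of_bool (below j \<and> \<not> match T p (e + q) j)"
  define \<Phi> :: "var state \<Rightarrow> nat" where "\<Phi> s = kt C * (q - (q - s vFuel))" for s
  \<comment> \<open>Positive fuel means undecided. The sum of length and fuel is
    \<open>e + q\<close> unless the next comparison is bound to fail, so exhausted fuel really means
    a match of length \<open>e + q\<close>.\<close>
  let ?I = "\<lambda>s. s vFuel \<le> q \<and> (if 0 < s vFuel then match T p (s vLen) j \<and> s vLen + s vFuel \<le> e + q \<and> s vCnt = c \<and>
      (s vLen + s vFuel < e + q \<longrightarrow> j + s vLen < n \<longrightarrow> T ! (j + s vLen) \<noteq> T ! (p + s vLen))
    else s vCnt = ?res)"
  have loop: "wp w M (WHILE positive vFuel DO ext_body C) s1 (\<lambda>s' t. s' vCnt = ?res \<and> t \<le> kt C * q + 10)"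
  proof (rule wp_LoopI[where I = ?I and \<Phi> = \<Phi>])
    have "l0 + q < e + q \<Longrightarrow> j + l0 < n \<Longrightarrow> T ! (j + l0) \<noteq> T ! (p + l0)"
      using blk F unfolding l0_def by (auto simp: min_def split: if_splits)
    then show "?I s1" unfolding s1_def using m l0_def c bounds by auto
  next
    fix s2 :: "var state"
    assume I: "?I s2" and b2: "bval w (positive vFuel) s2"
      and fr: "\<And>y. \<not> wr (ext_body C) y \<Longrightarrow> s2 y = s1 y"
    have lv2: "lv s2" by (rule lv_pres[OF lv1 _ fr]) simp_all
    note v = lvD[OF lv2]
    have vj: "s2 vJ = j" using fr[of vJ] j by (auto simp: ext_body_def s1_def)
    define l f where "l = s2 vLen" and "f = s2 vFuel"
    have f: "0 < f" "f \<le> q" using b2 I unfolding f_def by simp_all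
    have m2: "match T p l j" and lf: "l + f \<le> e + q" and cnt: "s2 vCnt = c"
      and bl: "l + f < e + q \<Longrightarrow> j + l < n \<Longrightarrow> T ! (j + l) \<noteq> T ! (p + l)"
      using I f unfolding l_def f_def by auto
    have le: "j + l \<le> n" "p + l \<le> n" using m2 unfolding match_def by auto
    have ln: "l < n" using le j(3) by linarith
    have nm: "\<not> match T p (e + q) j" if "\<not> match T p (Suc l) j"
      using that match_Suc_mono[of T p "e + q" j l] lf f by auto
    have pn: "p < n" using bounds by simp
    have pay: "t + (blen (positive vFuel) + 1) + \<Phi> s' \<le> \<Phi> s2" if "s' vFuel < f" "t \<le> cmp_time C + 100" for s' t
      using pot_step[of "q - f" "q - s' vFuel" q "t + (blen (positive vFuel) + 1)" "kt C"] that f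
      unfolding \<Phi>_def f_def kt_def by simp
    consider "j + l = n" | "j + l < n" "p + l = n" | "j + l < n" "p + l < n" using le by linarith
    then show "wp w M (ext_body C) s2 (\<lambda>s' t. ?I s' \<and> t + (blen (positive vFuel) + 1) + \<Phi> s' \<le> \<Phi> s2)"
    proof cases
      case 1
      have ns: "\<not> match T p (Suc l) j" using 1 unfolding match_Suc by simp
      have "below j" using match_less_iff[OF m2 ns] 1 le j(3) by auto
      define s' where "s' = s2(vCnt := c + 1, vFuel := 0)"
      have new: "?I s'" using nm[OF ns] \<open>below j\<close> by (simp add: s'_def)
      have fin: "20 + (blen (positive vFuel) + 1) + \<Phi> s' \<le> \<Phi> s2" by (rule pay) (use f in \<open>simp_all add: s'_def\<close>)
      have b: "bval w (BLt (Rg vN \<boxminus> vJ) (Rg vLen)) s2"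
        using v vj 1 j l_def by simp
      have e: "s2(vCnt := aval w (Rg vCnt \<oplus> Im 1) s2, vFuel := aval w (Im 0) (s2(vCnt := aval w (Rg vCnt \<oplus> Im 1) s2))) = s'"
        using cnt c by (simp add: s'_def)
      show ?thesis unfolding ext_body_def
      proof (rule wp_CondI)
        show "wp w M (inc vCnt;; vFuel ::= Im 0) s2 (\<lambda>s' t. ?I s' \<and>
          blen (BLt (Rg vN \<boxminus> vJ) (Rg vLen)) + t + (blen (positive vFuel) + 1) + \<Phi> s' \<le> \<Phi> s2)"
          by (intro wp_Asg_SeqI wp_AsgI) (simp only: e, rule conjI[OF new], use fin in simp)
      qed (use b in blast)
    next
      case 2
      have ns: "\<not> match T p (Suc l) j" using 2 unfolding match_Suc by simp
      have "\<not> below j" using match_less_iff[OF m2 ns] 2 by auto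
      then have new: "?I (s2(vFuel := 0))" using cnt by simp
      have b: "\<not> bval w (BLt (Rg vN \<boxminus> vJ) (Rg vLen)) s2"
        using v vj 2 j l_def by simp
      have b': "bval w (BLt (Rg vM) (Rg vLen)) s2"
        using v 2 pn l_def by simp
      show ?thesis unfolding ext_body_def
        using new pay[of "s2(vFuel := 0)" 25] f b b'
        by (intro wp_CondI wp_AsgI) auto
    next
      case 3
      have b: "\<not> bval w (BLt (Rg vN \<boxminus> vJ) (Rg vLen)) s2"
        using v vj 3 j l_def by simp
      have b': "\<not> bval w (BLt (Rg vM) (Rg vLen)) s2"
        using v 3 pn l_def by simp
      have ea: "aval w (Rg vJ \<boxplus> vLen) s2 = j + l" "aval w (Rg vP \<boxplus> vLen) s2 = p + l"
        using v vj 3 l_def by simp_all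
      have "wp w M (cmp C (Rg vJ \<boxplus> vLen) (Rg vP \<boxplus> vLen);;
          IF positive EQ THEN (inc vLen;; vFuel ::= (Rg vFuel \<ominus> Im 1))
          ELSE ((IF positive LT THEN inc vCnt ELSE Skip);; vFuel ::= Im 0)) s2
        (\<lambda>s' t. ?I s' \<and> t + 20 + (blen (positive vFuel) + 1) + \<Phi> s' \<le> \<Phi> s2)"
      proof (rule wp_SeqI, rule wp_cmpI[OF v(1)])
        show "aval w (Rg vJ \<boxplus> vLen) s2 < n" "aval w (Rg vP \<boxplus> vLen) s2 < n"
          unfolding ea using 3 by simp_all
        fix s3 :: "var state" and t :: nat
        assume r: "s3 LT = of_bool (T ! aval w (Rg vJ \<boxplus> vLen) s2 < T ! aval w (Rg vP \<boxplus> vLen) s2)"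
          "s3 EQ = of_bool (T ! aval w (Rg vJ \<boxplus> vLen) s2 = T ! aval w (Rg vP \<boxplus> vLen) s2)"
          and t: "t \<le> elen (Rg vJ \<boxplus> vLen) + elen (Rg vP \<boxplus> vLen) + cmp_time C"
          and fr3: "\<And>y. \<not> cmp_scratch y \<Longrightarrow> s3 y = s2 y"
        have v3: "s3 vLen = l" "s3 vFuel = f" "s3 vCnt = c" using fr3 cnt l_def f_def by auto
        note res = r[unfolded ea]
        show "wp w M (IF positive EQ THEN (inc vLen;; vFuel ::= (Rg vFuel \<ominus> Im 1))
          ELSE ((IF positive LT THEN inc vCnt ELSE Skip);; vFuel ::= Im 0)) s3
          (\<lambda>s' t'. ?I s' \<and> t + t' + 20 + (blen (positive vFuel) + 1) + \<Phi> s' \<le> \<Phi> s2)"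
        proof (cases "T ! (j + l) = T ! (p + l)")
          case True
          then have m3: "match T p (Suc l) j" unfolding match_Suc using m2 3 by simp
          \<comment> \<open>By \<open>bl\<close> a comparison can succeed only on the way from
            \<open>e\<close> to \<open>e + q\<close>.\<close>
          have sum: "l + f = e + q" using bl True lf 3 by fastforce
          have "j + Suc l \<le> n" "p + Suc l \<le> n" using 3 by auto
          then have l1: "l + 1 < n" using j(3) by linarith
          have fn: "f < n" using f bounds by linarith
          define s' where "s' = s3(vLen := l + 1, vFuel := f - 1)"
          have "match T p (e + q) j" if "f = 1" using m3 sum that by simp
          then have new: "?I s'" using m3 sum f v3 by (auto simp: s'_def)
          have fin: "t + 40 + (blen (positive vFuel) + 1) + \<Phi> s' \<le> \<Phi> s2" by (rule pay) (use f t in \<open>simp_all add: s'_def\<close>)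
          have e: "s3(vLen := aval w (Rg vLen \<oplus> Im 1) s3, vFuel := aval w (Rg vFuel \<ominus> Im 1) (s3(vLen := aval w (Rg vLen \<oplus> Im 1) s3))) = s'"
            using v3 l1 fn f by (simp add: s'_def)
          show ?thesis
          proof (rule wp_CondI)
            show "wp w M (inc vLen;; vFuel ::= (Rg vFuel \<ominus> Im 1)) s3 (\<lambda>s' t'. ?I s' \<and>
              t + (blen (positive EQ) + t') + 20 + (blen (positive vFuel) + 1) + \<Phi> s' \<le> \<Phi> s2)"
              by (intro wp_Asg_SeqI wp_AsgI) (simp only: e, rule conjI[OF new], use fin in simp)
          qed (use res True in simp)
        next
          case False
          then have ns: "\<not> match T p (Suc l) j" unfolding match_Suc by simp
          have bj: "below j \<longleftrightarrow> T ! (j + l) < T ! (p + l)" using match_less_iff[OF m2 ns] 3 by auto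
          let ?s = "s3(vCnt := c + 1, vFuel := 0)" and ?s' = "s3(vFuel := 0)"
          show ?thesis using res False v3 nm[OF ns] bj pay[of ?s "t + 40"] pay[of ?s' "t + 40"] t f c
            by (intro wp_CondI) (auto intro!: wp_SeqI wp_CondI wp_AsgI wp_SkipI)
        qed
      qed simp_all
      then show ?thesis unfolding ext_body_def using b b'
        by (intro wp_CondI) (auto elim!: wp_mono)
    qed
  next
    fix s2 :: "var state" and t :: nat
    assume I: "?I s2" and b2: "\<not> bval w (positive vFuel) s2"
      and t: "t + \<Phi> s2 \<le> \<Phi> s1 + blen (positive vFuel) + 1"
    have "\<Phi> s1 = kt C * q" unfolding \<Phi>_def s1_def by auto
    then show "s2 vCnt = ?res \<and> t \<le> kt C * q + 10" using t I b2 by auto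
  qed
  have l0: "F - j < e \<Longrightarrow> F - j + 1 = l0" "\<not> F - j < e \<Longrightarrow> e = l0" "F - j < e \<Longrightarrow> F - j + 1 < n"
    using F bounds unfolding l0_def by auto
  have "wp w M (vFuel ::= Rg vQ;; WHILE positive vFuel DO ext_body C) (s(vLen := l0))
    (\<lambda>s' t. s' vCnt = ?res \<and> t \<le> kt C * q + 20)"
  proof (rule wp_Asg_SeqI)
    have e: "s(vLen := l0, vFuel := aval w (Rg vQ) (s(vLen := l0))) = s1" using lvD(7)[OF g] by (simp add: s1_def)
    show "wp w M (WHILE positive vFuel DO ext_body C) (s(vLen := l0, vFuel := aval w (Rg vQ) (s(vLen := l0))))
      (\<lambda>s' t. s' vCnt = ?res \<and> elen (Rg vQ) + 1 + t \<le> kt C * q + 20)"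
      unfolding e by (rule wp_mono[OF loop]) simp
  qed
  then have rest: "wp w M (vFuel ::= Rg vQ;; WHILE positive vFuel DO ext_body C) (s(vLen := l0))
    (\<lambda>s' t. s' vCnt = ?res \<and> t \<le> kt C * q + 20)" .
  have upd: "wp w M (IF BLt (Rg vF \<boxminus> vJ) (Rg vE) THEN vLen ::= (Rg vF \<boxminus> vJ \<oplus> Im 1) ELSE vLen ::= Rg vE) s
    (\<lambda>s' t. s' = s(vLen := l0) \<and> t \<le> 20)"
    using lvD[OF g] j F l0 by (intro wp_CondI wp_AsgI) (auto simp: fun_eq_iff)
  have "wp w M (ext_com C) s (\<lambda>s' t. s' vCnt = ?res \<and> t \<le> kt C * q + 50)"
    unfolding ext_com_def by (rule wp_Seq_frame[OF upd]) (use rest in \<open>auto elim!: wp_mono\<close>)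
  then show ?thesis by (rule wp_mono) (simp add: kt_def)
qed

end

section \<open>Scanning for occurrences of a prefix\<close>

definition probe_com :: "nat \<Rightarrow> var com" where
  "probe_com C = vMt ::= Im 0;;
    IF BLt (Rg vI) (Rg vL \<boxminus> vS)
    THEN (cmp C (Rg vJ \<boxplus> vS \<boxplus> vI) (Rg vP \<boxplus> vS \<boxplus> vI);; IF positive EQ THEN vMt ::= Im 1 ELSE Skip)
    ELSE Skip"

text \<open>Duval's algorithm runs a second time on the pattern, in step with the matching, and
  supplies the period of the matched part when a shift needs it; storing these periods would take
  linear space.\<close>

definition advance_com :: "nat \<Rightarrow> var com" where
  "advance_com C =
    (IF BEq (Rg vI) (Im 0) THEN vD ::= Im 1
     ELSE (cmp C (Rg vP \<boxplus> vS \<boxplus> vI) (Rg vP \<boxplus> vS \<boxplus> vI \<boxminus> vD);;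
       IF positive EQ THEN Skip ELSE vD ::= (Rg vI \<oplus> Im 1)));;
    inc vI"

text \<open>Positions below \<open>vNb\<close> are already known not to match. Leaving them
  unchecked is what keeps the checks of the part before the maximal suffix linear in total.\<close>

definition report_com :: "nat \<Rightarrow> var com" where
  "report_com C =
    IF BEq (Rg vI) (Rg vL \<boxminus> vS) THEN (IF BLt (Rg vJ) (Rg vNb) THEN Skip ELSE occ_com C) ELSE Skip"

text \<open>The shift is the period of the matched part; a remainder shorter than this period is
  forgotten, since \<open>duval\<close> would not hold for it. The end is tested by subtraction
  because \<open>vJ + vAdv\<close> could overflow.\<close>

definition shift_com :: "var com" where
  "shift_com =
    (IF BEq (Rg vI) (Im 0) THEN vAdv ::= Im 1
     ELSE (vAdv ::= Rg vD;; IF BLt (Rg vI \<boxminus> vD) (Rg vD) THEN vI ::= Im 0 ELSE vI ::= (Rg vI \<boxminus> vD)));;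
    IF BLt (Rg vJM \<boxminus> vJ) (Rg vAdv) THEN vGo2 ::= Im 0 ELSE vJ ::= (Rg vJ \<boxplus> vAdv)"

definition match_body :: "nat \<Rightarrow> var com" where
  "match_body C = probe_com C;; IF positive vMt THEN advance_com C ELSE (report_com C;; shift_com)"

definition match_com :: "nat \<Rightarrow> var com" where
  "match_com C =
    vJM ::= Bin Sub (Rg vN) (Rg vL \<ominus> Im 1);; IF BLt (Rg vX) (Rg vJM) THEN vJM ::= Rg vX ELSE Skip;;
    vJ ::= Im 0;; vI ::= Im 0;; vNb ::= Im 0;; vF ::= Im 0;; vGo2 ::= Im 1;;
    WHILE positive vGo2 DO match_body C"

context level
begin

text \<open>Suffixes that leave the pattern before length \<open>L\<close> were counted on earlier
  levels and are present from the start. Of the others, those before \<open>J\<close> are included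
  if this level decides about them, that is, if they do not match \<open>e + q\<close>
  characters.\<close>

definition cset :: "nat \<Rightarrow> nat set" where
  "cset J = {i. i \<le> X \<and> below i \<and> (\<not> match T p L i \<or> i < J \<and> \<not> match T p (e + q) i)}"

definition "cs J = card (cset J)"

definition "cfinal = card {i. i \<le> X \<and> below i \<and> \<not> match T p (e + q) i}"

lemma finite_cset [simp]: "finite (cset J)"
  unfolding cset_def by (rule finite_subset[of _ "{..X}"]) auto

lemma cs_Suc: "j \<le> X \<Longrightarrow> cs (Suc j) = cs j + of_bool (match T p L j \<and> below j \<and> \<not> match T p (e + q) j)"
proof (cases "match T p L j \<and> below j \<and> \<not> match T p (e + q) j")
  case True
  assume "j \<le> X"
  then have "cset (Suc j) = insert j (cset j)" "j \<notin> cset j"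
    unfolding cset_def using True by (auto simp: less_Suc_eq)
  then show ?thesis unfolding cs_def using True by simp
next
  case False
  then have "cset (Suc j) = cset j"
    unfolding cset_def by (auto simp: less_Suc_eq)
  then show ?thesis unfolding cs_def using False by auto
qed

lemma cs_skip: "(\<And>i. a \<le> i \<Longrightarrow> i < c \<Longrightarrow> \<not> match T p L i) \<Longrightarrow> a \<le> c \<Longrightarrow> cs c = cs a"
  unfolding cs_def cset_def by (rule arg_cong[of _ _ card], rule Collect_cong) (meson not_less order_less_le_trans)

text \<open>Beyond \<open>JM\<close> no counted position has room for \<open>L\<close> characters,
  and a match of \<open>e + q\<close> characters contains one of \<open>L\<close>; so the scan may
  stop as soon as no match is left up to \<open>JM\<close>.\<close>

lemma cs_final: "(\<And>i. J \<le> i \<Longrightarrow> i \<le> JM \<Longrightarrow> \<not> match T p L i) \<Longrightarrow> cs J = cfinal"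
  unfolding cs_def cfinal_def cset_def
proof (rule arg_cong[of _ _ card], rule Collect_cong)
  fix i
  assume nm: "\<And>i. J \<le> i \<Longrightarrow> i \<le> JM \<Longrightarrow> \<not> match T p L i"
  have "i \<le> JM" if "i \<le> X" "match T p L i"
    using that unfolding JM_def match_def by auto
  moreover have "match T p L i" if "match T p (e + q) i"
    using match_mono[OF that] bounds by simp
  ultimately show "(i \<le> X \<and> below i \<and> (\<not> match T p L i \<or> i < J \<and> \<not> match T p (e + q) i)) =
    (i \<le> X \<and> below i \<and> \<not> match T p (e + q) i)"
    using nm[of i] by (cases "J \<le> i") auto
qed

text \<open>Neither \<open>p\<close> nor \<open>j\<close> has been counted yet, so the counter can
  be incremented without overflow even if \<open>n = 2 ^ w\<close>.\<close>

lemma cs_less: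
  assumes "j \<noteq> p" "j \<le> X" "match T p L j"
  shows "cs j + 1 < n"
proof -
  have pn: "p < n" using bounds by simp
  have "cset j \<subseteq> {..<n} - {p, j}" unfolding cset_def using X assms by auto
  then have "cs j \<le> card ({..<n} - {p, j})" unfolding cs_def by (intro card_mono) auto
  also have "\<dots> = n - 2" using assms X pn by (simp add: card_Diff_subset)
  finally show ?thesis using assms pn X by linarith
qed

lemma maxsuf_S: "\<exists>d. maxsuf x L S d"
  using ok unfolding level_ok_def by blast

lemma per_ge: "1 \<le> k \<Longrightarrow> per x L k \<Longrightarrow> q \<le> k"
  using ok unfolding level_ok_def by blast

lemma wp_found:
  assumes g: "lv s" and j: "s vJ = j" "j \<le> JM" and m: "match T p L j"
    and F: "s vF = F" "F < n" and run: "\<And>k. per x e q \<Longrightarrow> j \<le> k \<Longrightarrow> k + q \<le> F \<Longrightarrow> T ! (k + q) = T ! k"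
    and c: "s vCnt = cs j"
  shows "wp w M (run_com C;; IF BEq (Rg vJ) (Rg vP) THEN Skip ELSE ext_com C) s
    (\<lambda>s' t. s' vCnt = cs (Suc j) \<and> F \<le> s' vF \<and> s' vF < n \<and>
      (per x e q \<longrightarrow> (\<forall>k\<ge>j. k + q \<le> s' vF \<longrightarrow> T ! (k + q) = T ! k)) \<and>
      t \<le> kt C * (q + 5) + kt C * (s' vF - F))"
proof -
  have jL: "j + L \<le> n" "j \<le> X" "j < n" using JM j(2) by auto
  show ?thesis
  proof (rule wp_Seq_frame[OF wp_run[OF g j(1) jL(1) F]])
    fix s1 :: "var state" and t1 :: nat
    assume a: "F \<le> s1 vF \<and> s1 vF < n \<and> j + L \<le> Suc (s1 vF) \<and>
      (\<forall>k. max F (j + L - 1) < k + q \<and> k + q \<le> s1 vF \<longrightarrow> T ! (k + q) = T ! k) \<and>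
      (s1 vF < n - 1 \<longrightarrow> T ! (s1 vF + 1) \<noteq> T ! (s1 vF + 1 - q)) \<and> t1 \<le> kt C * (s1 vF - F + 2)"
      and fr: "\<And>y. \<not> wr (run_com C) y \<Longrightarrow> s1 y = s y"
    have g1: "lv s1" by (rule lv_pres[OF g _ fr]) simp_all
    have v1: "s1 vJ = j" "s1 vCnt = cs j" using fr j c by (auto simp: run_com_def run_body_def)
    define F1 where "F1 = s1 vF"
    \<comment> \<open>Three sources: beyond both ends the equality was just read by
      \<open>run_com\<close>, up to \<open>F\<close> it was known before, and otherwise the two
      positions lie in the occurrence, where the period of the pattern applies.\<close>
    have run1: "T ! (k + q) = T ! k" if per: "per x e q" and k: "j \<le> k" "k + q \<le> F1" for k
    proof (cases "max F (j + L - 1) < k + q")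
      case True
      then show ?thesis using a k unfolding F1_def by blast
    next
      case False
      show ?thesis
      proof (cases "k + q \<le> F")
        case True
        then show ?thesis using run[OF per k(1)] by blast
      next
        case F2: False
        have kq: "k - j + q < L" using False F2 k bounds by (auto simp: max_def split: if_splits)
        have "x (k - j + q) = x (k - j)" using perD[OF per, of "k - j"] kq bounds by simp
        moreover have "T ! (j + (k - j + q)) = x (k - j + q)" "T ! (j + (k - j)) = x (k - j)"
          using m kq unfolding match_def by auto
        ultimately show ?thesis using k by simp
      qed
    qed
    have t1: "t1 \<le> kt C * (F1 - F) + kt C * 2" using a unfolding F1_def add_mult_distrib2 by blast
    show "wp w M (IF BEq (Rg vJ) (Rg vP) THEN Skip ELSE ext_com C) s1
      (\<lambda>s' t. s' vCnt = cs (Suc j) \<and> F \<le> s' vF \<and> s' vF < n \<and>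
      (per x e q \<longrightarrow> (\<forall>k\<ge>j. k + q \<le> s' vF \<longrightarrow> T ! (k + q) = T ! k)) \<and>
      t1 + t \<le> kt C * (q + 5) + kt C * (s' vF - F))"
    proof (cases "j = p")
      case True
      have "cs (Suc j) = cs j" using cs_Suc[OF jL(2)] True by simp
      moreover have "t1 + 10 \<le> kt C * (q + 5) + kt C * (F1 - F)"
        using t1 by (simp add: add_mult_distrib2) (simp add: kt_def)
      ultimately show ?thesis using True v1 lvD[OF g1] run1 a unfolding F1_def
        by (intro wp_CondI wp_SkipI) auto
    next
      case False
      have Fj: "j \<le> F1" "F1 < n" "j + L \<le> Suc F1" using a bounds unfolding F1_def by auto
      have m': "match T p (min (F1 + 1 - j) e) j" and
        blk: "F1 + 1 - j < e \<Longrightarrow> F1 + 1 < n \<Longrightarrow> T ! (F1 + 1) \<noteq> T ! (p + (F1 + 1 - j))"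
      proof -
        \<comment> \<open>If \<open>q\<close> is only a lower bound for the periods, then
          \<open>e = L\<close> and the occurrence alone is the known common prefix.\<close>
        consider "per x e q" | "e = L" using ok unfolding level_ok_def by blast
        then have "match T p (min (F1 + 1 - j) e) j \<and>
          (F1 + 1 - j < e \<longrightarrow> F1 + 1 < n \<longrightarrow> T ! (F1 + 1) \<noteq> T ! (p + (F1 + 1 - j)))"
        proof cases
          case 1
          have m'': "match T p (min (F1 + 1 - j) e) j"
            using bounds run1[OF 1] Fj by (intro match_run[OF m 1, of F1]) auto
          moreover have "T ! (F1 + 1) \<noteq> T ! (p + (F1 + 1 - j))" if lt: "F1 + 1 - j < e" "F1 + 1 < n"
          proof -
            define r where "r = F1 + 1 - j"
            have r: "L \<le> r" "r < e" "F1 + 1 = j + r" "q \<le> r" using lt Fj bounds unfolding r_def by auto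
            have "T ! (j + r) \<noteq> T ! (j + r - q)" using a lt r(3) unfolding F1_def by auto
            moreover have "T ! (j + (r - q)) = x (r - q)"
              using m''[unfolded match_def, THEN conjunct2, THEN conjunct2, rule_format, of "r - q"] r bounds
              by (simp add: r_def[symmetric])
            moreover have "x (r - q + q) = x (r - q)" using r by (intro perD[OF 1]) simp
            ultimately show ?thesis using r by (simp add: r_def[symmetric])
          qed
          ultimately show ?thesis by blast
        next
          case 2
          then have "min (F1 + 1 - j) e = L" "\<not> F1 + 1 - j < e" using Fj by linarith+
          then show ?thesis using m by simp
        qed
        then show "match T p (min (F1 + 1 - j) e) j"
          "F1 + 1 - j < e \<Longrightarrow> F1 + 1 < n \<Longrightarrow> T ! (F1 + 1) \<noteq> T ! (p + (F1 + 1 - j))" by blast+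
      qed
      have "wp w M (ext_com C) s1 (\<lambda>s' t. s' vCnt = cs (Suc j) \<and> F \<le> s' vF \<and> s' vF < n \<and>
        (per x e q \<longrightarrow> (\<forall>k\<ge>j. k + q \<le> s' vF \<longrightarrow> T ! (k + q) = T ! k)) \<and>
        t1 + (t + 10) \<le> kt C * (q + 5) + kt C * (s' vF - F))"
      proof (rule wp_frame[OF wp_ext[OF g1 v1(1) jL(3) False F1_def[symmetric] Fj(1,2) v1(2) _ m' blk]])
        show "cs j + 1 < n" by (rule cs_less[OF False jL(2) m])
        fix s' :: "var state" and t :: nat
        assume b: "s' vCnt = cs j + of_bool (below j \<and> \<not> match T p (e + q) j) \<and> t \<le> kt C * (q + 2)"
          and fr2: "\<And>y. \<not> wr (ext_com C) y \<Longrightarrow> s' y = s1 y"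
        have f: "s' vF = F1" using fr2 by (auto simp: ext_com_def ext_body_def F1_def)
        have "s' vCnt = cs (Suc j)" using b cs_Suc[OF jL(2)] m by simp
        moreover have "t1 + (t + 10) \<le> kt C * (q + 5) + kt C * (F1 - F)"
          using t1 b by (simp add: add_mult_distrib2) (simp add: kt_def)
        ultimately show "s' vCnt = cs (Suc j) \<and> F \<le> s' vF \<and> s' vF < n \<and>
          (per x e q \<longrightarrow> (\<forall>k\<ge>j. k + q \<le> s' vF \<longrightarrow> T ! (k + q) = T ! k)) \<and>
          t1 + (t + 10) \<le> kt C * (q + 5) + kt C * (s' vF - F)"
          using f a run1 Fj F1_def by auto
      qed
      then show ?thesis using False v1 lvD[OF g1] by (intro wp_CondI) (auto elim!: wp_mono)
    qed
  qed
qed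

text \<open>The check costs \<open>S + 1\<close> and the extension about \<open>q\<close>, apart
  from the advance of \<open>vF\<close>. Both are charged to the advance of \<open>vNb\<close>: it
  is \<open>S + 1\<close> after a failed check, by \<open>maxsuf_no_match\<close>, and
  \<open>q > S\<close> after an occurrence.\<close>

lemma wp_occ:
  assumes g: "lv s" and j: "s vJ = j" "j \<le> JM" and v: "\<And>t. t < L - S \<Longrightarrow> T ! (j + S + t) = T ! (p + S + t)"
    and F: "s vF = F" "F < n" and run: "\<And>k. per x e q \<Longrightarrow> j \<le> k \<Longrightarrow> k + q \<le> F \<Longrightarrow> T ! (k + q) = T ! k"
    and c: "s vCnt = cs j" and go: "s vGo2 = 1" and nb: "s vNb = nb"
  shows "wp w M (occ_com C) s (\<lambda>s' t. s' vCnt = cs (Suc j) \<and> F \<le> s' vF \<and> s' vF < n \<and>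
      (per x e q \<longrightarrow> (\<forall>k\<ge>j. k + q \<le> s' vF \<longrightarrow> T ! (k + q) = T ! k)) \<and>
      (s' vGo2 = 1 \<and> j < s' vNb \<and> s' vNb \<le> JM \<and> (\<forall>i. j < i \<longrightarrow> i < s' vNb \<longrightarrow> \<not> match T p L i) \<and>
         t \<le> kt C * (10 * (s' vNb - j)) + kt C * (s' vF - F) \<or>
       s' vGo2 = 0 \<and> (\<forall>i. j < i \<longrightarrow> i \<le> JM \<longrightarrow> \<not> match T p L i) \<and> t \<le> kt C * (2 * n + 10) + kt C * (s' vF - F)))"
proof -
  have jL: "j + L \<le> n" "j \<le> X" "j < n" using JM j(2) by auto
  let ?c2 = "IF positive vOk THEN (vAdv ::= Rg vQ;; run_com C;; IF BEq (Rg vJ) (Rg vP) THEN Skip ELSE ext_com C)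
     ELSE vAdv ::= (Rg vS \<oplus> Im 1)"
  let ?c3 = "IF BLt (Rg vJM \<boxminus> vJ) (Rg vAdv) THEN vGo2 ::= Im 0 ELSE vNb ::= (Rg vJ \<boxplus> vAdv)"
  let ?Post = "\<lambda>s' t. s' vCnt = cs (Suc j) \<and> F \<le> s' vF \<and> s' vF < n \<and>
      (per x e q \<longrightarrow> (\<forall>k\<ge>j. k + q \<le> s' vF \<longrightarrow> T ! (k + q) = T ! k)) \<and>
      (s' vGo2 = 1 \<and> j < s' vNb \<and> s' vNb \<le> JM \<and> (\<forall>i. j < i \<longrightarrow> i < s' vNb \<longrightarrow> \<not> match T p L i) \<and>
         t \<le> kt C * (10 * (s' vNb - j)) + kt C * (s' vF - F) \<or>
       s' vGo2 = 0 \<and> (\<forall>i. j < i \<longrightarrow> i \<le> JM \<longrightarrow> \<not> match T p L i) \<and> t \<le> kt C * (2 * n + 10) + kt C * (s' vF - F))"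
  let ?Mid = "\<lambda>s' t. s' vCnt = cs (Suc j) \<and> F \<le> s' vF \<and> s' vF < n \<and>
      (per x e q \<longrightarrow> (\<forall>k\<ge>j. k + q \<le> s' vF \<longrightarrow> T ! (k + q) = T ! k)) \<and>
      1 \<le> s' vAdv \<and> s' vAdv \<le> q \<and> (\<forall>i. j < i \<longrightarrow> i < j + s' vAdv \<longrightarrow> \<not> match T p L i) \<and>
      t + kt C \<le> kt C * (2 * s' vAdv + 7) + kt C * (s' vF - F)"
  show ?thesis unfolding occ_com_def
  proof (rule wp_Seq_frame[OF wp_check[OF g j(1) jL(1)]])
    fix s1 :: "var state" and t1 :: nat
    assume a: "(0 < s1 vOk) = (\<forall>k<S. T ! (j + k) = T ! (p + k)) \<and> t1 \<le> kt C * (S + 1)"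
      and fr: "\<And>y. \<not> wr (check_com C) y \<Longrightarrow> s1 y = s y"
    have g1: "lv s1" by (rule lv_pres[OF g _ fr]) simp_all
    have v1: "s1 vJ = j" "s1 vCnt = cs j" "s1 vF = F" "s1 vGo2 = 1"
      using fr j c F go by (auto simp: check_com_def check_body_def)
    have nm: "\<not> match T p L i" if i: "j < i" "i \<le> j + S" for i
    proof -
      obtain d where d: "maxsuf x L S d" using maxsuf_S by blast
      have "T ! (j + S + t) = T ! (p + (S + t))" if "t < L - S" for t
        using v[OF that] by (simp add: add.assoc)
      then have "\<not> match T p L (j + (i - j))" using i by (intro maxsuf_no_match[OF d]) (auto simp: add.assoc)
      then show ?thesis using i by simp
    qed
    have mid: "wp w M ?c2 s1 (\<lambda>s' t. ?Mid s' (t1 + t))"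
    proof (cases "0 < s1 vOk")
      case True
      have m: "match T p L j" unfolding match_def
      proof (intro conjI allI impI)
        fix k assume "k < L"
        then show "T ! (j + k) = T ! (p + k)"
          using a True v[of "k - S"] by (cases "k < S") (auto simp: algebra_simps)
      qed (use jL bounds in auto)
      \<comment> \<open>Two occurrences at a distance below \<open>q\<close> would give the prefix a
        period smaller than \<open>q\<close>.\<close>
      have nm': "\<not> match T p L i" if "j < i" "i < j + q" for i
      proof
        assume "match T p L i"
        then have "per x L (i - j)" using match_period[OF m, of "i - j"] that by simp
        then have "q \<le> i - j" using per_ge[of "i - j"] that by simp
        then show False using that by linarith
      qed
      let ?s = "s1(vAdv := q)"
      have g2: "lv ?s" using g1 unfolding lv_def glob_def by simp
      have "wp w M (run_com C;; IF BEq (Rg vJ) (Rg vP) THEN Skip ELSE ext_com C) ?s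
        (\<lambda>s' t. ?Mid s' (t1 + (t + 10)))"
      proof (rule wp_frame[OF wp_found[OF g2 _ j(2) m _ F(2) run]])
        show "?s vJ = j" "?s vF = F" "?s vCnt = cs j" using v1 by auto
        fix s' :: "var state" and t :: nat
        assume b: "s' vCnt = cs (Suc j) \<and> F \<le> s' vF \<and> s' vF < n \<and>
          (per x e q \<longrightarrow> (\<forall>k\<ge>j. k + q \<le> s' vF \<longrightarrow> T ! (k + q) = T ! k)) \<and>
          t \<le> kt C * (q + 5) + kt C * (s' vF - F)"
          and fr2: "\<And>y. \<not> wr (run_com C;; IF BEq (Rg vJ) (Rg vP) THEN Skip ELSE ext_com C) y \<Longrightarrow> s' y = ?s y"
        have ad: "s' vAdv = q" using fr2[of vAdv] by (auto simp: run_com_def run_body_def ext_com_def ext_body_def)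
        have "kt C * (S + 1) \<le> kt C * q" using bounds by (intro mult_le_mono2) simp
        moreover have "t \<le> kt C * q + kt C * 5 + kt C * (s' vF - F)"
          using b unfolding add_mult_distrib2 by blast
        moreover have "kt C * (2 * q + 7) = kt C * q + kt C * q + kt C * 5 + kt C + kt C" by (simp add: algebra_simps)
        moreover have "10 \<le> kt C" by (simp add: kt_def)
        ultimately have "t1 + (t + 10) + kt C \<le> kt C * (2 * q + 7) + kt C * (s' vF - F)"
          using a by linarith
        then show "?Mid s' (t1 + (t + 10))" using b ad nm' bounds by simp
      qed
      then have "wp w M (vAdv ::= Rg vQ;; run_com C;; IF BEq (Rg vJ) (Rg vP) THEN Skip ELSE ext_com C) s1
        (\<lambda>s' t. ?Mid s' (t1 + (t + 8)))"
      proof (intro wp_Asg_SeqI, unfold aval.simps lvD(7)[OF g1])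
        assume "wp w M (run_com C;; IF BEq (Rg vJ) (Rg vP) THEN Skip ELSE ext_com C) ?s (\<lambda>s' t. ?Mid s' (t1 + (t + 10)))"
        then show "wp w M (run_com C;; IF BEq (Rg vJ) (Rg vP) THEN Skip ELSE ext_com C) ?s
          (\<lambda>s' t. ?Mid s' (t1 + (elen (Rg vQ :: var exp) + 1 + t + 8)))"
          by (rule wp_mono) simp
      qed
      then show ?thesis using True
        by (intro wp_CondI) (auto elim!: wp_mono)
    next
      case False
      then have nok: "\<not> (\<forall>k<S. T ! (j + k) = T ! (p + k))" using a by simp
      have "\<not> match T p L j" using nok bounds(2) unfolding match_def by (meson order.strict_trans)
      then have cs': "cs (Suc j) = cs j" using cs_Suc[OF jL(2)] by simp
      have Sn: "take_bit w (S + 1) = S + 1" using bounds by simp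
      have tt: "t1 + 20 + kt C \<le> kt C * (2 * (S + 1) + 7)"
      proof -
        have "kt C * (2 * (S + 1) + 7) = kt C * (S + 1) + kt C * (S + 1) + kt C * 6 + kt C" by (simp add: algebra_simps)
        moreover have "20 \<le> kt C * 6" by (simp add: kt_def)
        ultimately show ?thesis using a by linarith
      qed
      show ?thesis
      proof (rule wp_CondI)
        show "wp w M (vAdv ::= (Rg vS \<oplus> Im 1)) s1 (\<lambda>s' t. ?Mid s' (t1 + (blen (positive vOk) + t + 1)))"
          using v1 run F cs' nm bounds Sn tt lvD(6)[OF g1] by (intro wp_AsgI) auto
      qed (use False in simp)
    qed
    show "wp w M (?c2;; ?c3) s1 (\<lambda>s' t. ?Post s' (t1 + t))"
    proof (rule wp_Seq_frame[OF mid])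
      fix s2 :: "var state" and t2 :: nat
      assume b: "?Mid s2 (t1 + t2)" and fr2: "\<And>y. \<not> wr ?c2 y \<Longrightarrow> s2 y = s1 y"
      have g2: "lv s2" by (rule lv_pres[of s1 ?c2 s2, OF g1 _ fr2]) simp_all
      have v2: "s2 vJ = j" "s2 vGo2 = 1" using fr2 v1 by (auto simp: run_com_def run_body_def ext_com_def ext_body_def)
      define adv where "adv = s2 vAdv"
      have adv: "1 \<le> adv" "adv \<le> q" "\<And>i. j < i \<Longrightarrow> i < j + adv \<Longrightarrow> \<not> match T p L i"
        using b unfolding adv_def by auto
      have t: "t1 + t2 + kt C \<le> kt C * (2 * adv + 7) + kt C * (s2 vF - F)" using b unfolding adv_def by simp
      have k20: "20 \<le> kt C" by (simp add: kt_def)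
      show "wp w M ?c3 s2 (\<lambda>s' t. ?Post s' (t1 + (t2 + t)))"
      proof (cases "JM - j < adv")
        case True
        have "kt C * (2 * adv + 7) \<le> kt C * (2 * n + 10)" using adv bounds by (intro mult_le_mono2) simp
        then have tt: "t1 + t2 + 20 \<le> kt C * (2 * n + 10) + kt C * (s2 vF - F)" using t k20 by linarith
        have nm: "\<forall>i. j < i \<longrightarrow> i \<le> JM \<longrightarrow> \<not> match T p L i" using adv(3) True j(2) by auto
        define s3 where "s3 = s2(vGo2 := 0)"
        have "?Post s3 (t1 + t2 + 20)" using b tt nm by (simp add: s3_def)
        then have "wp w M (vGo2 ::= Im 0) s2 (\<lambda>s' t. ?Post s' (t1 + (t2 + (blen (BLt (Rg vJM \<boxminus> vJ) (Rg vAdv)) + t))))"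
          by (intro wp_AsgI) (auto simp: s3_def)
        moreover have "bval w (BLt (Rg vJM \<boxminus> vJ) (Rg vAdv)) s2" using True v2 lvD(9)[OF g2] j JM adv_def by simp
        ultimately show ?thesis by (intro wp_CondI) auto
      next
        case False
        have "kt C * (2 * adv + 7) \<le> kt C * (10 * adv)" using adv by (intro mult_le_mono2) simp
        then have tt: "t1 + t2 + 20 \<le> kt C * (10 * adv) + kt C * (s2 vF - F)" using t k20 by linarith
        have jn: "j + adv \<le> JM" using False j(2) by linarith
        have jn': "take_bit w (j + adv) = j + adv" using jn JM by simp
        define s3 where "s3 = s2(vNb := j + adv)"
        have "?Post s3 (t1 + t2 + 20)" using b tt adv jn v2 by (simp add: s3_def)
        then have "wp w M (vNb ::= (Rg vJ \<boxplus> vAdv)) s2 (\<lambda>s' t. ?Post s' (t1 + (t2 + (blen (BLt (Rg vJM \<boxminus> vJ) (Rg vAdv)) + t + 1))))"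
          using jn' v2 by (intro wp_AsgI) (auto simp: s3_def adv_def)
        moreover have "\<not> bval w (BLt (Rg vJM \<boxminus> vJ) (Rg vAdv)) s2" using False v2 lvD(9)[OF g2] j JM adv_def by simp
        ultimately show ?thesis by (intro wp_CondI) auto
      qed
    qed
  qed
qed

abbreviation "v \<equiv> \<lambda>k. T ! (p + S + k)"

text \<open>\<open>vNb\<close> and \<open>vF\<close> survive the shifts of \<open>vJ\<close>: no
  occurrence starts before \<open>vNb\<close>, and from there on the run up to \<open>vF\<close> is
  known, so neither has to be recomputed.\<close>

definition scan_inv :: "var state \<Rightarrow> bool" where
  "scan_inv s \<longleftrightarrow> s vJ \<le> JM \<and> s vI \<le> L - S \<and> (0 < s vI \<longrightarrow> duval v (s vI) (s vD)) \<and>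
    (\<forall>t<s vI. T ! (s vJ + S + t) = v t) \<and> (\<forall>i. s vJ \<le> i \<longrightarrow> i < s vNb \<longrightarrow> \<not> match T p L i) \<and>
    s vNb \<le> JM \<and> s vF < n \<and>
    (per x e q \<longrightarrow> (\<forall>k. s vNb \<le> k \<longrightarrow> s vJ \<le> k \<longrightarrow> k + q \<le> s vF \<longrightarrow> T ! (k + q) = T ! k)) \<and>
    s vCnt = cs (s vJ)"

lemma scan_invD:
  assumes "scan_inv s"
  shows "s vJ \<le> JM" "s vI \<le> L - S" "0 < s vI \<Longrightarrow> duval v (s vI) (s vD)" "\<And>t. t < s vI \<Longrightarrow> T ! (s vJ + S + t) = v t"
    "\<And>i. s vJ \<le> i \<Longrightarrow> i < s vNb \<Longrightarrow> \<not> match T p L i" "s vNb \<le> JM" "s vF < n"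
    "\<And>k. per x e q \<Longrightarrow> s vNb \<le> k \<Longrightarrow> s vJ \<le> k \<Longrightarrow> k + q \<le> s vF \<Longrightarrow> T ! (k + q) = T ! k"
    "s vCnt = cs (s vJ)"
  using assms unfolding scan_inv_def by blast+

lemma duval_v: "\<exists>d. duval v (L - S) d"
  using maxsuf_S unfolding maxsuf_def by (simp add: add.assoc)

lemma wp_probe:
  assumes g: "lv s" and A: "scan_inv s"
  shows "wp w M (probe_com C) s (\<lambda>s' t. (0 < s' vMt \<longleftrightarrow> s vI < L - S \<and> T ! (s vJ + S + s vI) = v (s vI)) \<and>
    t \<le> cmp_time C + 60)"
proof (cases "s vI < L - S")
  case False
  then show ?thesis unfolding probe_com_def
    using lvD[OF g] bounds by (intro wp_Asg_SeqI wp_CondI wp_SkipI) auto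
next
  case True
  define s1 where "s1 = s(vMt := 0)"
  have g1: "lv s1" using g unfolding lv_def glob_def s1_def by simp
  have v1: "s1 vJ = s vJ" "s1 vI = s vI" "s1 vMt = 0" unfolding s1_def by auto
  have jn: "s vJ + L \<le> n" using JM scan_invD(1)[OF A] by linarith
  have ea: "aval w (Rg vJ \<boxplus> vS \<boxplus> vI) s1 = s vJ + S + s vI" "aval w (Rg vP \<boxplus> vS \<boxplus> vI) s1 = p + S + s vI"
    using lvD[OF g1] v1 jn True bounds by simp_all
  have "wp w M (cmp C (Rg vJ \<boxplus> vS \<boxplus> vI) (Rg vP \<boxplus> vS \<boxplus> vI);; IF positive EQ THEN vMt ::= Im 1 ELSE Skip) s1
    (\<lambda>s' t. (0 < s' vMt \<longleftrightarrow> T ! (s vJ + S + s vI) = v (s vI)) \<and> t \<le> cmp_time C + 40)"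
  proof (rule wp_SeqI, rule wp_cmpI[OF lvD(1)[OF g1]])
    show "aval w (Rg vJ \<boxplus> vS \<boxplus> vI) s1 < n" "aval w (Rg vP \<boxplus> vS \<boxplus> vI) s1 < n"
      unfolding ea using jn True bounds by simp_all
    fix s2 :: "var state" and t :: nat
    assume rr: "s2 EQ = of_bool (T ! aval w (Rg vJ \<boxplus> vS \<boxplus> vI) s1 = T ! aval w (Rg vP \<boxplus> vS \<boxplus> vI) s1)"
      and t: "t \<le> elen (Rg vJ \<boxplus> vS \<boxplus> vI) + elen (Rg vP \<boxplus> vS \<boxplus> vI) + cmp_time C"
      and fr: "\<And>y. \<not> cmp_scratch y \<Longrightarrow> s2 y = s1 y"
    have "s2 vMt = 0" using fr v1 by simp
    then show "wp w M (IF positive EQ THEN vMt ::= Im 1 ELSE Skip) s2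
      (\<lambda>s' t'. (0 < s' vMt \<longleftrightarrow> T ! (s vJ + S + s vI) = v (s vI)) \<and> t + t' \<le> cmp_time C + 40)"
      using rr[unfolded ea] t by (intro wp_CondI wp_AsgI wp_SkipI) auto
  qed simp_all
  then have body: "wp w M (cmp C (Rg vJ \<boxplus> vS \<boxplus> vI) (Rg vP \<boxplus> vS \<boxplus> vI);; IF positive EQ THEN vMt ::= Im 1 ELSE Skip) s1
    (\<lambda>s' t. (0 < s' vMt \<longleftrightarrow> s vI < L - S \<and> T ! (s vJ + S + s vI) = v (s vI)) \<and> t + 20 \<le> cmp_time C + 60)"
    by (rule wp_mono) (use True in simp)
  have b: "bval w (BLt (Rg vI) (Rg vL \<boxminus> vS)) s1" using True lvD[OF g1] v1 bounds by simp
  have "wp w M (IF BLt (Rg vI) (Rg vL \<boxminus> vS)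
      THEN (cmp C (Rg vJ \<boxplus> vS \<boxplus> vI) (Rg vP \<boxplus> vS \<boxplus> vI);; IF positive EQ THEN vMt ::= Im 1 ELSE Skip) ELSE Skip) s1
    (\<lambda>s' t. (0 < s' vMt \<longleftrightarrow> s vI < L - S \<and> T ! (s vJ + S + s vI) = v (s vI)) \<and> t + 10 \<le> cmp_time C + 60)"
    by (rule wp_CondI) (use b body in \<open>auto elim!: wp_mono\<close>)
  then show ?thesis unfolding probe_com_def
    by (intro wp_Asg_SeqI) (simp add: s1_def, erule wp_mono, simp)
qed

lemma wp_advance:
  assumes g: "lv s" and A: "scan_inv s" and I: "s vI < L - S" and eq: "T ! (s vJ + S + s vI) = v (s vI)"
  shows "wp w M (advance_com C) s (\<lambda>s' t. s' vI = s vI + 1 \<and> duval v (s vI + 1) (s' vD) \<and> t \<le> cmp_time C + 60)"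
proof -
  have In: "s vI + 1 < n" using I bounds by simp
  let ?c = "IF BEq (Rg vI) (Im 0) THEN vD ::= Im 1
     ELSE (cmp C (Rg vP \<boxplus> vS \<boxplus> vI) (Rg vP \<boxplus> vS \<boxplus> vI \<boxminus> vD);;
       IF positive EQ THEN Skip ELSE vD ::= (Rg vI \<oplus> Im 1))"
  have "wp w M ?c s (\<lambda>s' t. s' vI = s vI \<and> duval v (s vI + 1) (s' vD) \<and> t \<le> cmp_time C + 40)"
  proof (cases "s vI = 0")
    case True
    then show ?thesis using duval_1[of v] by (intro wp_CondI wp_AsgI) auto
  next
    case False
    have D: "duval v (s vI) (s vD)" using scan_invD(3)[OF A] False by simp
    have d: "1 \<le> s vD" "s vD \<le> s vI" using duval_le[OF D] by auto
    obtain d0 where D0: "duval v (L - S) d0" using duval_v by blast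
    \<comment> \<open>A character larger than the one a period earlier would contradict that the
      scanned word begins the maximal suffix; so equal and smaller are the only cases.\<close>
    have le: "v (s vI) \<le> v (s vI - s vD)"
    proof -
      have "v (s vD + t) = v t" if "t < s vI - s vD" for t
        using D that perD[of v "s vI" "s vD" t] unfolding duval_def by (simp add: add.commute)
      then have "v (s vD + (s vI - s vD)) \<le> v (s vI - s vD)"
        using d I by (intro duval_selfmax[OF D0]) auto
      then show ?thesis using d by simp
    qed
    have ea: "aval w (Rg vP \<boxplus> vS \<boxplus> vI) s = p + S + s vI" "aval w (Rg vP \<boxplus> vS \<boxplus> vI \<boxminus> vD) s = p + S + (s vI - s vD)"
      using lvD[OF g] I bounds d by simp_all
    have "wp w M (cmp C (Rg vP \<boxplus> vS \<boxplus> vI) (Rg vP \<boxplus> vS \<boxplus> vI \<boxminus> vD);;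
       IF positive EQ THEN Skip ELSE vD ::= (Rg vI \<oplus> Im 1)) s
       (\<lambda>s' t. s' vI = s vI \<and> duval v (s vI + 1) (s' vD) \<and> t + 10 \<le> cmp_time C + 40)"
    proof (rule wp_SeqI, rule wp_cmpI[OF lvD(1)[OF g]])
      show "aval w (Rg vP \<boxplus> vS \<boxplus> vI) s < n" "aval w (Rg vP \<boxplus> vS \<boxplus> vI \<boxminus> vD) s < n"
        unfolding ea using I bounds by simp_all
      fix s2 :: "var state" and t :: nat
      assume rr: "s2 EQ = of_bool (T ! aval w (Rg vP \<boxplus> vS \<boxplus> vI) s = T ! aval w (Rg vP \<boxplus> vS \<boxplus> vI \<boxminus> vD) s)"
        and t: "t \<le> elen (Rg vP \<boxplus> vS \<boxplus> vI) + elen (Rg vP \<boxplus> vS \<boxplus> vI \<boxminus> vD) + cmp_time C"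
        and fr: "\<And>y. \<not> cmp_scratch y \<Longrightarrow> s2 y = s y"
      have v2: "s2 vI = s vI" "s2 vD = s vD" using fr by auto
      show "wp w M (IF positive EQ THEN Skip ELSE vD ::= (Rg vI \<oplus> Im 1)) s2
        (\<lambda>s' t'. s' vI = s vI \<and> duval v (s vI + 1) (s' vD) \<and> t + t' + 10 \<le> cmp_time C + 40)"
      proof (cases "v (s vI) = v (s vI - s vD)")
        case True
        then show ?thesis using rr[unfolded ea] t v2 duval_eq[OF D True] by (intro wp_CondI wp_SkipI wp_AsgI) auto
      next
        case False
        then have "duval v (Suc (s vI)) (Suc (s vI))" using duval_less[OF D] le by simp
        then show ?thesis using rr[unfolded ea] t v2 False In by (intro wp_CondI wp_SkipI wp_AsgI) auto
      qed
    qed simp_all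
    then show ?thesis using False by (intro wp_CondI) (auto elim!: wp_mono)
  qed
  then show ?thesis unfolding advance_com_def
    by (rule wp_Seq_frame) (use In in \<open>auto intro!: wp_AsgI\<close>)
qed

lemma wp_report:
  assumes g: "lv s" and A: "scan_inv s" and mm: "\<not> (s vI < L - S \<and> T ! (s vJ + S + s vI) = v (s vI))" and go: "s vGo2 = 1"
  shows "wp w M (report_com C) s (\<lambda>s' t. s' vCnt = cs (Suc (s vJ)) \<and> s vF \<le> s' vF \<and> s' vF < n \<and>
      (per x e q \<longrightarrow> (\<forall>k. s' vNb \<le> k \<longrightarrow> s vJ \<le> k \<longrightarrow> k + q \<le> s' vF \<longrightarrow> T ! (k + q) = T ! k)) \<and>
      (s' vGo2 = 1 \<and> s vNb \<le> s' vNb \<and> s' vNb \<le> JM \<and> (\<forall>i. s vJ < i \<longrightarrow> i < s' vNb \<longrightarrow> \<not> match T p L i) \<and>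
         t \<le> 30 + kt C * (10 * (s' vNb - s vNb)) + kt C * (s' vF - s vF) \<or>
       s' vGo2 = 0 \<and> (\<forall>i. s vJ < i \<longrightarrow> i \<le> JM \<longrightarrow> \<not> match T p L i) \<and>
         t \<le> 30 + kt C * (2 * n + 10) + kt C * (s' vF - s vF)))"
    (is "wp w M _ s ?Q")
proof -
  note I = scan_invD[OF A]
  have jX: "s vJ \<le> X" using I(1) JM by linarith
  have LS: "take_bit w (L + 2 ^ w - S) = L - S" using bounds by simp
  have skip: "?Q s t" if "\<not> match T p L (s vJ)" "t \<le> 30" for t
    using cs_Suc[OF jX] that I go by auto
  consider "s vI < L - S" | "s vI = L - S" "s vJ < s vNb" | "s vI = L - S" "s vNb \<le> s vJ"
    using I(2) by linarith
  then show ?thesis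
  proof cases
    case 1
    have "\<not> match T p L (s vJ)"
    proof
      assume "match T p L (s vJ)"
      moreover have "S + s vI < L" using 1 by simp
      ultimately have "T ! (s vJ + (S + s vI)) = T ! (p + (S + s vI))" unfolding match_def by blast
      then show False using mm 1 by (simp add: add.assoc)
    qed
    then have "?Q s 15" using skip[of 15] by simp
    moreover have "\<not> bval w (BEq (Rg vI) (Rg vL \<boxminus> vS)) s" using 1 lvD[OF g] LS by simp
    ultimately show ?thesis unfolding report_com_def by (intro wp_CondI wp_SkipI) auto
  next
    case 2
    have "\<not> match T p L (s vJ)" using I(5)[of "s vJ"] 2 by simp
    then have sk: "?Q s 8" using skip[of 8] by simp
    have b: "bval w (BEq (Rg vI) (Rg vL \<boxminus> vS)) s" using 2 lvD[OF g] LS by simp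
    have "wp w M (IF BLt (Rg vJ) (Rg vNb) THEN Skip ELSE occ_com C) s (\<lambda>s' t. ?Q s' (blen (BEq (Rg vI) (Rg vL \<boxminus> vS)) + t))"
    proof (rule wp_CondI)
      have "blen (BEq (Rg vI) (Rg vL \<boxminus> vS)) + (blen (BLt (Rg vJ) (Rg vNb)) + 0) = 8" by simp
      then show "wp w M Skip s (\<lambda>s' t. ?Q s' (blen (BEq (Rg vI) (Rg vL \<boxminus> vS)) + (blen (BLt (Rg vJ) (Rg vNb)) + t)))"
        using sk by (intro wp_SkipI) simp
    qed (use 2 in simp)
    then show ?thesis unfolding report_com_def by (rule wp_CondI) (use b in blast)
  next
    case 3
    have b: "bval w (BEq (Rg vI) (Rg vL \<boxminus> vS)) s" using 3 lvD[OF g] LS by simp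
    have occ: "wp w M (occ_com C) s (\<lambda>s' t. ?Q s' (t + 20))"
    proof (rule wp_mono[OF wp_occ[OF g refl I(1) _ refl I(7) _ I(9) go refl]])
      show "T ! (s vJ + S + t) = T ! (p + S + t)" if "t < L - S" for t
        using I(4) that 3 by simp
      show "T ! (k + q) = T ! k" if "per x e q" "s vJ \<le> k" "k + q \<le> s vF" for k
        using I(8)[OF that(1) _ that(2,3)] that 3 by simp
      fix s' :: "var state" and t :: nat
      assume a: "s' vCnt = cs (Suc (s vJ)) \<and> s vF \<le> s' vF \<and> s' vF < n \<and>
        (per x e q \<longrightarrow> (\<forall>k\<ge>s vJ. k + q \<le> s' vF \<longrightarrow> T ! (k + q) = T ! k)) \<and>
        (s' vGo2 = 1 \<and> s vJ < s' vNb \<and> s' vNb \<le> JM \<and> (\<forall>i. s vJ < i \<longrightarrow> i < s' vNb \<longrightarrow> \<not> match T p L i) \<and>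
           t \<le> kt C * (10 * (s' vNb - s vJ)) + kt C * (s' vF - s vF) \<or>
         s' vGo2 = 0 \<and> (\<forall>i. s vJ < i \<longrightarrow> i \<le> JM \<longrightarrow> \<not> match T p L i) \<and>
           t \<le> kt C * (2 * n + 10) + kt C * (s' vF - s vF))"
      have "kt C * (10 * (s' vNb - s vJ)) \<le> kt C * (10 * (s' vNb - s vNb))" using 3 by (intro mult_le_mono2) simp
      then have "t + 20 \<le> 30 + kt C * (10 * (s' vNb - s vNb)) + kt C * (s' vF - s vF)"
        if "t \<le> kt C * (10 * (s' vNb - s vJ)) + kt C * (s' vF - s vF)" using that by linarith
      moreover have "t + 20 \<le> 30 + kt C * (2 * n + 10) + kt C * (s' vF - s vF)"
        if "t \<le> kt C * (2 * n + 10) + kt C * (s' vF - s vF)" using that by linarith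
      moreover have "s vNb \<le> s' vNb" if "s vJ < s' vNb" using 3 that by simp
      ultimately show "?Q s' (t + 20)" using a by meson
    qed
    have "wp w M (IF BLt (Rg vJ) (Rg vNb) THEN Skip ELSE occ_com C) s (\<lambda>s' t. ?Q s' (blen (BEq (Rg vI) (Rg vL \<boxminus> vS)) + t))"
    proof (rule wp_CondI)
      show "wp w M (occ_com C) s (\<lambda>s' t. ?Q s' (blen (BEq (Rg vI) (Rg vL \<boxminus> vS)) + (blen (BLt (Rg vJ) (Rg vNb)) + t + 1)))"
        using occ by (rule wp_mono) auto
    qed (use 3 in simp)
    then show ?thesis unfolding report_com_def by (rule wp_CondI) (use b in blast)
  qed
qed

text \<open>Between reporting and shifting: \<open>vJ\<close> is already accounted for in the
  counter. If reporting has cleared \<open>vGo2\<close>, the shift is still executed, and only the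
  absence of further matches has to be remembered.\<close>

definition scan_ready :: "var state \<Rightarrow> bool" where
  "scan_ready s \<longleftrightarrow> s vJ \<le> JM \<and> s vI \<le> L - S \<and> (0 < s vI \<longrightarrow> duval v (s vI) (s vD)) \<and>
    (\<forall>t<s vI. T ! (s vJ + S + t) = v t) \<and> s vCnt = cs (Suc (s vJ)) \<and>
    (s vGo2 = 1 \<and> s vNb \<le> JM \<and> s vF < n \<and> (\<forall>i. s vJ < i \<longrightarrow> i < s vNb \<longrightarrow> \<not> match T p L i) \<and>
      (per x e q \<longrightarrow> (\<forall>k. s vNb \<le> k \<longrightarrow> s vJ \<le> k \<longrightarrow> k + q \<le> s vF \<longrightarrow> T ! (k + q) = T ! k)) \<or>
     s vGo2 = 0 \<and> (\<forall>i. s vJ < i \<longrightarrow> i \<le> JM \<longrightarrow> \<not> match T p L i))"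

definition match_inv :: "var state \<Rightarrow> bool" where
  "match_inv s \<longleftrightarrow> s vGo2 = 1 \<and> scan_inv s \<or> s vGo2 = 0 \<and> s vCnt = cfinal"

lemma wp_shift:
  assumes g: "lv s" and A: "scan_ready s"
  shows "wp w M shift_com s (\<lambda>s' t. match_inv s' \<and> t \<le> 80 \<and>
    (s' vGo2 = 1 \<longrightarrow> s vGo2 = 1 \<and> 2 * s vJ + s vI < 2 * s' vJ + s' vI \<and> 2 * s' vJ + s' vI \<le> 2 * JM + L))"
proof -
  define j i d where "j = s vJ" and "i = s vI" and "d = s vD"
  have I: "j \<le> JM" "i \<le> L - S" "0 < i \<Longrightarrow> duval v i d" "\<And>t. t < i \<Longrightarrow> T ! (j + S + t) = v t" "s vCnt = cs (Suc j)"
    using A unfolding scan_ready_def j_def i_def d_def by blast+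
  define adv where "adv = (if i = 0 then 1 else d)"
  define i' where "i' = (if i = 0 \<or> i - d < d then 0 else i - d)"
  have dl: "1 \<le> d" "d \<le> i" if "0 < i" using duval_le[OF I(3)[OF that]] by auto
  have iL: "i \<le> L" "i < n" "d < n" if "0 < i" using I(2) dl[OF that] bounds by auto
  \<comment> \<open>The last inequality makes \<open>2 * vJ + vI\<close> grow: a shift by
    \<open>adv\<close> forgets fewer than \<open>2 * adv\<close> matched characters.\<close>
  have adv: "1 \<le> adv" "adv \<le> n" "i' \<le> i" "i < 2 * adv + i'" unfolding adv_def i'_def using dl bounds iL by (auto split: if_splits)
  have nm: "\<not> match T p L k" if k: "j < k" "k < j + adv" for k
  proof -
    have i0: "0 < i" and ad: "adv = d" using k unfolding adv_def by (auto split: if_splits)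
    have "S + i \<le> L" using I(2) bounds by linarith
    then have "\<not> match T p L (j + (k - j))"
      using I(4) k ad by (intro duval_no_match[OF I(3)[OF i0]]) auto
    then show ?thesis using k by simp
  qed
  define s1 where "s1 = s(vAdv := adv, vI := i')"
  have upd: "wp w M (IF BEq (Rg vI) (Im 0) THEN vAdv ::= Im 1
     ELSE (vAdv ::= Rg vD;; IF BLt (Rg vI \<boxminus> vD) (Rg vD) THEN vI ::= Im 0 ELSE vI ::= (Rg vI \<boxminus> vD))) s
     (\<lambda>s' t. s' = s1 \<and> t \<le> 40)"
  proof (cases "i = 0")
    case True
    then have "s1 = s(vAdv := 1)" unfolding s1_def adv_def i'_def by (auto simp: i_def fun_eq_iff)
    then show ?thesis using True i_def by (intro wp_CondI wp_AsgI) auto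
  next
    case False
    then have sub: "take_bit w (i + 2 ^ w - d) = i - d" using iL dl by simp
    have "s1 = s(vAdv := d, vI := (if i - d < d then 0 else i - d))"
      unfolding s1_def adv_def i'_def using False by auto
    then show ?thesis using False sub i_def d_def by (intro wp_CondI wp_Asg_SeqI wp_AsgI) auto
  qed
  have g1: "lv s1" using g unfolding lv_def glob_def s1_def by simp
  have v1: "s1 vJ = j" "s1 vAdv = adv" "s1 vCnt = cs (Suc j)" "s1 vGo2 = s vGo2" "s1 vI = i'" "s1 vD = d" "s1 vNb = s vNb" "s1 vF = s vF"
    unfolding s1_def j_def d_def using I(5) j_def by auto
  have "wp w M (IF BLt (Rg vJM \<boxminus> vJ) (Rg vAdv) THEN vGo2 ::= Im 0 ELSE vJ ::= (Rg vJ \<boxplus> vAdv)) s1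
    (\<lambda>s' t. match_inv s' \<and> t \<le> 40 \<and> (s' vGo2 = 1 \<longrightarrow> s vGo2 = 1 \<and> 2 * j + i < 2 * s' vJ + s' vI \<and> 2 * s' vJ + s' vI \<le> 2 * JM + L))"
  proof (cases "JM - j < adv")
    case True
    have "cs (Suc j) = cfinal" by (rule cs_final) (use nm True I(1) in auto)
    then have "match_inv (s1(vGo2 := 0))" unfolding match_inv_def using v1 by simp
    then have "wp w M (vGo2 ::= Im 0) s1 (\<lambda>s' t. match_inv s' \<and> blen (BLt (Rg vJM \<boxminus> vJ) (Rg vAdv)) + t \<le> 40 \<and>
        (s' vGo2 = 1 \<longrightarrow> s vGo2 = 1 \<and> 2 * j + i < 2 * s' vJ + s' vI \<and> 2 * s' vJ + s' vI \<le> 2 * JM + L))"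
      by (intro wp_AsgI) simp
    moreover have "bval w (BLt (Rg vJM \<boxminus> vJ) (Rg vAdv)) s1" using True v1 lvD(9)[OF g1] I(1) JM by simp
    ultimately show ?thesis by (intro wp_CondI) auto
  next
    case False
    have jn: "j + adv \<le> JM" using False I(1) by linarith
    have jn': "take_bit w (j + adv) = j + adv" using jn JM by simp
    define s2 where "s2 = s1(vJ := j + adv)"
    have v2: "s2 vJ = j + adv" "s2 vI = i'" "s2 vD = d" "s2 vCnt = cs (Suc j)" "s2 vGo2 = s vGo2" "s2 vNb = s vNb" "s2 vF = s vF"
      unfolding s2_def using v1 by auto
    have cse: "cs (j + adv) = cs (Suc j)" by (rule cs_skip) (use nm adv in auto)
    have "match_inv s2"
    proof (cases "s vGo2 = 1")
      case True
      have B: "s vNb \<le> JM" "s vF < n" "\<And>k. j < k \<Longrightarrow> k < s vNb \<Longrightarrow> \<not> match T p L k"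
        "per x e q \<Longrightarrow> \<forall>k. s vNb \<le> k \<longrightarrow> j \<le> k \<longrightarrow> k + q \<le> s vF \<longrightarrow> T ! (k + q) = T ! k"
        using A True unfolding scan_ready_def j_def by auto
      have D: "duval v i' d \<and> (\<forall>t<i'. T ! (j + adv + S + t) = v t)" if "0 < i'"
      proof -
        have i0: "0 < i" "i' = i - d" "d \<le> i - d" "adv = d" using that unfolding i'_def adv_def by (auto split: if_splits)
        note Dv = I(3)[OF i0(1)]
        have "T ! (j + d + S + t) = v t" if "t < i - d" for t
        proof -
          have "T ! (j + S + (t + d)) = v (t + d)" using that by (intro I(4)) simp
          moreover have "v (t + d) = v t" using Dv that perD[of v i d t] unfolding duval_def by simp
          ultimately show ?thesis by (simp add: algebra_simps)
        qed
        then show ?thesis using duval_prefix[OF Dv i0(3)] i0 by simp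
      qed
      have "scan_inv s2" unfolding scan_inv_def v2
      proof (intro conjI)
        show "j + adv \<le> JM" by (rule jn)
        show "i' \<le> L - S" using adv I(2) by linarith
        show "0 < i' \<longrightarrow> duval v i' d" using D by blast
        show "\<forall>t<i'. T ! (j + adv + S + t) = v t" using D by (cases "0 < i'") auto
        show "\<forall>k\<ge>j + adv. k < s vNb \<longrightarrow> \<not> match T p L k" using B(3) adv by auto
        show "per x e q \<longrightarrow> (\<forall>k\<ge>s vNb. j + adv \<le> k \<longrightarrow> k + q \<le> s vF \<longrightarrow> T ! (k + q) = T ! k)"
          using B(4) by (meson add_leD1)
        show "cs (Suc j) = cs (j + adv)" using cse by simp
      qed (use B in auto)
      then show ?thesis unfolding match_inv_def using v2 True by simp
    next
      case False
      then have z: "s vGo2 = 0" "\<And>i. j < i \<Longrightarrow> i \<le> JM \<Longrightarrow> \<not> match T p L i" using A unfolding scan_ready_def j_def by auto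
      have "cs (Suc j) = cfinal" by (rule cs_final) (use z in auto)
      then show ?thesis unfolding match_inv_def using v2 z by simp
    qed
    moreover have "2 * j + i < 2 * (j + adv) + i'" using adv(4) by simp
    moreover have "2 * (j + adv) + i' \<le> 2 * JM + L"
      using adv(3) jn I(2) by simp
    ultimately have "match_inv s2" and "s2 vGo2 = 1 \<longrightarrow> s vGo2 = 1 \<and> 2 * j + i < 2 * s2 vJ + s2 vI \<and> 2 * s2 vJ + s2 vI \<le> 2 * JM + L"
      unfolding v2 by blast+
    then have "wp w M (vJ ::= (Rg vJ \<boxplus> vAdv)) s1 (\<lambda>s' t. match_inv s' \<and> blen (BLt (Rg vJM \<boxminus> vJ) (Rg vAdv)) + t + 1 \<le> 40 \<and>
        (s' vGo2 = 1 \<longrightarrow> s vGo2 = 1 \<and> 2 * j + i < 2 * s' vJ + s' vI \<and> 2 * s' vJ + s' vI \<le> 2 * JM + L))"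
      using jn' v1 by (intro wp_AsgI) (simp add: s2_def)
    moreover have "\<not> bval w (BLt (Rg vJM \<boxminus> vJ) (Rg vAdv)) s1" using False v1 lvD(9)[OF g1] I(1) JM by simp
    ultimately show ?thesis by (intro wp_CondI) auto
  qed
  then show ?thesis unfolding shift_com_def j_def[symmetric] i_def[symmetric]
    by (intro wp_Seq_frame[OF upd]) (auto elim!: wp_mono)
qed

lemma lpres_coms2 [simp]:
  "lpres (probe_com C)" "lpres (advance_com C)" "lpres (report_com C)" "lpres shift_com" "lpres (match_body C)"
  unfolding probe_com_def advance_com_def report_com_def shift_com_def match_body_def by simp_all

text \<open>Three kinds of progress pay: scanning, measured by \<open>2 * vJ + vI\<close>, the
  advance of \<open>vNb\<close>, and the advance of \<open>vF\<close>. The last summand is a reserve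
  for the occurrence that ends the search, whose cost is not matched by an advance of
  \<open>vNb\<close>.\<close>

definition pot :: "var state \<Rightarrow> nat" where
  "pot s = (if s vGo2 = 0 then 0 else kt C * (3 * (2 * JM + L - (2 * s vJ + s vI))) + kt C * (10 * (JM - s vNb)) +
    kt C * (n - s vF) + kt C * (2 * n + 20))"

lemma wp_match_body:
  assumes g: "lv s" and A: "scan_inv s" and go: "s vGo2 = 1"
  shows "wp w M (match_body C) s (\<lambda>s' t. match_inv s' \<and> t + 10 + pot s' \<le> pot s)"
  unfolding match_body_def
proof (rule wp_Seq_frame[OF wp_probe[OF g A]])
  note I = scan_invD[OF A]
  fix s1 :: "var state" and t1 :: nat
  let ?hit = "s vI < L - S \<and> T ! (s vJ + S + s vI) = v (s vI)"
  assume a: "(0 < s1 vMt) = ?hit \<and> t1 \<le> cmp_time C + 60"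
    and fr: "\<And>y. \<not> wr (probe_com C) y \<Longrightarrow> s1 y = s y"
  have g1: "lv s1" by (rule lv_pres[of s "probe_com C" s1, OF g _ fr]) simp_all
  have v1: "s1 vI = s vI" "s1 vJ = s vJ" "s1 vD = s vD" "s1 vNb = s vNb" "s1 vF = s vF" "s1 vCnt = s vCnt" "s1 vGo2 = 1"
    using fr go by (auto simp: probe_com_def)
  have A1: "scan_inv s1" using A unfolding scan_inv_def v1 .
  have kC: "kt C = cmp_time C + 200" by (simp add: kt_def)
  show "wp w M (IF positive vMt THEN advance_com C ELSE (report_com C;; shift_com)) s1
    (\<lambda>s' t. match_inv s' \<and> t1 + t + 10 + pot s' \<le> pot s)"
  proof (cases ?hit)
    case True
    have "wp w M (advance_com C) s1 (\<lambda>s' t. match_inv s' \<and> t1 + (blen (positive vMt) + t) + 10 + pot s' \<le> pot s)"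
    proof (rule wp_frame[OF wp_advance[OF g1 A1]])
      show "s1 vI < L - S" "T ! (s1 vJ + S + s1 vI) = v (s1 vI)" using True v1 by auto
      fix s' :: "var state" and t :: nat
      assume b: "s' vI = s1 vI + 1 \<and> duval v (s1 vI + 1) (s' vD) \<and> t \<le> cmp_time C + 60"
        and fr2: "\<And>y. \<not> wr (advance_com C) y \<Longrightarrow> s' y = s1 y"
      have v2: "s' vI = s vI + 1" "s' vJ = s vJ" "s' vNb = s vNb" "s' vF = s vF" "s' vCnt = s vCnt" "s' vGo2 = 1"
        using fr2 v1 b by (auto simp: advance_com_def)
      have "scan_inv s'" unfolding scan_inv_def v2
      proof (intro conjI)
        show "\<forall>t<s vI + 1. T ! (s vJ + S + t) = v t" using I(4) True by (simp add: less_Suc_eq)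
        show "0 < s vI + 1 \<longrightarrow> duval v (s vI + 1) (s' vD)" using b v1 by simp
        show "s vI + 1 \<le> L - S" using True by simp
        show "per x e q \<longrightarrow> (\<forall>k\<ge>s vNb. s vJ \<le> k \<longrightarrow> k + q \<le> s vF \<longrightarrow> T ! (k + q) = T ! k)" using I(8) by blast
        show "\<forall>i\<ge>s vJ. i < s vNb \<longrightarrow> \<not> match T p L i" using I(5) by blast
      qed (rule I)+
      then have "match_inv s'" unfolding match_inv_def using v2 by blast
      moreover have "t1 + (blen (positive vMt) + t) + 10 + pot s' \<le> pot s"
      proof -
        have "Suc (2 * JM + L - (2 * s vJ + (s vI + 1))) \<le> 2 * JM + L - (2 * s vJ + s vI)"
          using I(1) True by linarith
        then have "kt C * (3 * (2 * JM + L - (2 * s vJ + (s vI + 1))) + 3) \<le> kt C * (3 * (2 * JM + L - (2 * s vJ + s vI)))"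
          by (intro mult_le_mono2) linarith
        then have "kt C * (3 * (2 * JM + L - (2 * s vJ + (s vI + 1)))) + kt C * 3 \<le> kt C * (3 * (2 * JM + L - (2 * s vJ + s vI)))"
          unfolding add_mult_distrib2 .
        moreover have "t1 + (blen (positive vMt) + t) + 10 \<le> kt C * 3" using a b kC by simp
        ultimately show ?thesis unfolding pot_def v2 using go by simp
      qed
      ultimately show "match_inv s' \<and> t1 + (blen (positive vMt) + t) + 10 + pot s' \<le> pot s" by blast
    qed
    then show ?thesis using a True by (intro wp_CondI) auto
  next
    case False
    have "wp w M (report_com C;; shift_com) s1 (\<lambda>s' t. match_inv s' \<and> t1 + (blen (positive vMt) + t + 1) + 10 + pot s' \<le> pot s)"
    proof (rule wp_Seq_frame[OF wp_report[OF g1 A1 _ v1(7)]])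
      show "\<not> (s1 vI < L - S \<and> T ! (s1 vJ + S + s1 vI) = v (s1 vI))" using False v1 by simp
      fix s2 :: "var state" and t2 :: nat
      assume b: "s2 vCnt = cs (Suc (s1 vJ)) \<and> s1 vF \<le> s2 vF \<and> s2 vF < n \<and>
        (per x e q \<longrightarrow> (\<forall>k. s2 vNb \<le> k \<longrightarrow> s1 vJ \<le> k \<longrightarrow> k + q \<le> s2 vF \<longrightarrow> T ! (k + q) = T ! k)) \<and>
        (s2 vGo2 = 1 \<and> s1 vNb \<le> s2 vNb \<and> s2 vNb \<le> JM \<and> (\<forall>i. s1 vJ < i \<longrightarrow> i < s2 vNb \<longrightarrow> \<not> match T p L i) \<and>
           t2 \<le> 30 + kt C * (10 * (s2 vNb - s1 vNb)) + kt C * (s2 vF - s1 vF) \<or>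
         s2 vGo2 = 0 \<and> (\<forall>i. s1 vJ < i \<longrightarrow> i \<le> JM \<longrightarrow> \<not> match T p L i) \<and>
           t2 \<le> 30 + kt C * (2 * n + 10) + kt C * (s2 vF - s1 vF))"
        and fr2: "\<And>y. \<not> wr (report_com C) y \<Longrightarrow> s2 y = s1 y"
      note b = b[unfolded v1]
      have g2: "lv s2" by (rule lv_pres[of s1 "report_com C" s2, OF g1 _ fr2]) simp_all
      have v2: "s2 vI = s vI" "s2 vJ = s vJ" "s2 vD = s vD"
        using fr2 v1 by (auto simp: report_com_def occ_com_def check_com_def check_body_def run_com_def run_body_def ext_com_def ext_body_def)
      have R: "scan_ready s2" unfolding scan_ready_def v2
      proof (intro conjI)
        show "0 < s vI \<longrightarrow> duval v (s vI) (s vD)" "\<forall>t<s vI. T ! (s vJ + S + t) = v t" using I(3,4) by blast+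
        show "s2 vCnt = cs (Suc (s vJ))" using b by blast
        show "s2 vGo2 = 1 \<and> s2 vNb \<le> JM \<and> s2 vF < n \<and> (\<forall>i>s vJ. i < s2 vNb \<longrightarrow> \<not> match T p L i) \<and>
            (per x e q \<longrightarrow> (\<forall>k\<ge>s2 vNb. s vJ \<le> k \<longrightarrow> k + q \<le> s2 vF \<longrightarrow> T ! (k + q) = T ! k)) \<or>
          s2 vGo2 = 0 \<and> (\<forall>i>s vJ. i \<le> JM \<longrightarrow> \<not> match T p L i)"
          using b by blast
      qed (rule I)+
      show "wp w M shift_com s2 (\<lambda>s' t. match_inv s' \<and> t1 + (blen (positive vMt) + (t2 + t) + 1) + 10 + pot s' \<le> pot s)"
      proof (rule wp_frame[OF wp_shift[OF g2 R]])
        fix s' :: "var state" and t :: nat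
        assume c: "match_inv s' \<and> t \<le> 80 \<and> (s' vGo2 = 1 \<longrightarrow> s2 vGo2 = 1 \<and>
          2 * s2 vJ + s2 vI < 2 * s' vJ + s' vI \<and> 2 * s' vJ + s' vI \<le> 2 * JM + L)"
          and fr3: "\<And>y. \<not> wr shift_com y \<Longrightarrow> s' y = s2 y"
        have v3: "s' vNb = s2 vNb" "s' vF = s2 vF" using fr3 by (auto simp: shift_com_def)
        \<comment> \<open>\<open>u\<close> is the part of \<open>t2\<close> beyond the fixed
          overhead 30 of \<open>wp_report\<close>. The remaining costs amount to at most one
          \<open>kt C\<close>.\<close>
        define k u where "k = kt C" and "u = t2 - 30"
        have k1: "t1 + (blen (positive vMt) + (t2 + t) + 1) + 10 \<le> k + u"
        proof -
          have "t1 \<le> cmp_time C + 60" "t \<le> 80" using a c by blast+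
          moreover have "blen (positive vMt) = 3" by simp
          ultimately show ?thesis unfolding k_def u_def kC by linarith
        qed
        have F: "k * (n - s vF) = k * (n - s2 vF) + k * (s2 vF - s vF)"
          using b unfolding add_mult_distrib2[symmetric] by (intro arg_cong[of _ _ "(*) k"]) linarith
        have "s' vGo2 = 1 \<or> s' vGo2 = 0" using c unfolding match_inv_def by auto
        then have "t1 + (blen (positive vMt) + (t2 + t) + 1) + 10 + pot s' \<le> pot s"
        proof
          assume 1: "s' vGo2 = 1"
          then have W: "2 * s vJ + s vI < 2 * s' vJ + s' vI" "2 * s' vJ + s' vI \<le> 2 * JM + L" "s2 vGo2 = 1"
            using c v2 by auto
          then have Nb: "s vNb \<le> s2 vNb" "s2 vNb \<le> JM" "t2 \<le> 30 + k * (10 * (s2 vNb - s vNb)) + k * (s2 vF - s vF)"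
            using b unfolding k_def by auto
          then have u: "u \<le> k * (10 * (s2 vNb - s vNb)) + k * (s2 vF - s vF)" unfolding u_def by linarith
          have N: "k * (10 * (JM - s vNb)) = k * (10 * (JM - s2 vNb)) + k * (10 * (s2 vNb - s vNb))"
            using Nb unfolding add_mult_distrib2[symmetric] by (intro arg_cong[of _ _ "(*) k"]) simp
          have "k * (1 + 3 * (2 * JM + L - (2 * s' vJ + s' vI))) \<le> k * (3 * (2 * JM + L - (2 * s vJ + s vI)))"
            using W by (intro mult_le_mono2) linarith
          then have "k + k * (3 * (2 * JM + L - (2 * s' vJ + s' vI))) \<le> k * (3 * (2 * JM + L - (2 * s vJ + s vI)))"
            unfolding add_mult_distrib2 by simp
          then show ?thesis using k1 u F N 1 go unfolding pot_def v3 k_def[symmetric] by simp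
        next
          assume 0: "s' vGo2 = 0"
          have "t2 \<le> 30 + k * (10 * (JM - s vNb)) + k * (2 * n + 10) + k * (s2 vF - s vF)"
          proof -
            have "k * (10 * (s2 vNb - s vNb)) \<le> k * (10 * (JM - s vNb))" if "s2 vNb \<le> JM"
              using that by (intro mult_le_mono2) linarith
            then show ?thesis using b unfolding k_def[symmetric] by linarith
          qed
          then have "u \<le> k * (10 * (JM - s vNb)) + k * (2 * n + 10) + k * (s2 vF - s vF)" unfolding u_def by linarith
          moreover have "k * (2 * n + 20) = k * (2 * n + 10) + k * 10" by (simp add: algebra_simps)
          ultimately show ?thesis using k1 F 0 go unfolding pot_def k_def[symmetric] by simp
        qed
        then show "match_inv s' \<and> t1 + (blen (positive vMt) + (t2 + t) + 1) + 10 + pot s' \<le> pot s" using c by blast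
      qed
    qed
    then show ?thesis using a False by (intro wp_CondI) auto
  qed
qed

lemma wp_match:
  assumes g: "glob s" and v: "s vP = p" "s vX = X" "s vL = L" "s vM = n - 1 - p" "s vS = S" "s vQ = q" "s vE = e"
    and c: "s vCnt = cs 0"
  shows "wp w M (match_com C) s (\<lambda>s' t. s' vCnt = cfinal \<and> t \<le> kt C * (60 * n))"
proof -
  define s1 where "s1 = s(vJM := JM, vJ := 0, vI := 0, vNb := 0, vF := 0, vGo2 := 1)"
  have g1: "lv s1" using g v unfolding lv_def s1_def glob_def by simp
  have "T \<noteq> []" using T_nonempty by auto
  then have A1: "scan_inv s1" unfolding scan_inv_def using c bounds by (simp add: s1_def)
  have loop: "wp w M (WHILE positive vGo2 DO match_body C) s1 (\<lambda>s' t. s' vCnt = cfinal \<and> t \<le> pot s1 + 10)"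
  proof (rule wp_LoopI[where I = match_inv and \<Phi> = pot])
    show "match_inv s1" unfolding match_inv_def using A1 by (simp add: s1_def)
  next
    fix s2 :: "var state"
    assume I: "match_inv s2" and b2: "bval w (positive vGo2) s2"
      and fr: "\<And>y. \<not> wr (match_body C) y \<Longrightarrow> s2 y = s1 y"
    have lv2: "lv s2" by (rule lv_pres[of s1 "match_body C" s2, OF g1 _ fr]) simp_all
    have "scan_inv s2" "s2 vGo2 = 1" using I b2 unfolding match_inv_def by auto
    then have "wp w M (match_body C) s2 (\<lambda>s' t. match_inv s' \<and> t + 10 + pot s' \<le> pot s2)"
      by (intro wp_match_body lv2)
    then show "wp w M (match_body C) s2 (\<lambda>s' t. match_inv s' \<and> t + (blen (positive vGo2) + 1) + pot s' \<le> pot s2)"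
      by (rule wp_mono) simp
  next
    fix s2 :: "var state" and t :: nat
    assume "match_inv s2" "\<not> bval w (positive vGo2) s2" "t + pot s2 \<le> pot s1 + blen (positive vGo2) + 1"
    then show "s2 vCnt = cfinal \<and> t \<le> pot s1 + 10" unfolding match_inv_def by auto
  qed
  have pot1: "pot s1 + 100 \<le> kt C * (60 * n)"
  proof -
    have "JM \<le> n" "L \<le> n" "1 \<le> n" using JM bounds by auto
    then have "3 * (2 * JM + L) + 10 * JM + n + (2 * n + 20) + 1 \<le> 60 * n" by (simp add: algebra_simps)
    then have "kt C * (3 * (2 * JM + L) + 10 * JM + n + (2 * n + 20) + 1) \<le> kt C * (60 * n)" by (rule mult_le_mono2)
    moreover have "pot s1 = kt C * (3 * (2 * JM + L)) + kt C * (10 * JM) + kt C * n + kt C * (2 * n + 20)"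
      unfolding pot_def s1_def by simp
    moreover have "100 \<le> kt C * 1" by (simp add: kt_def)
    ultimately show ?thesis unfolding add_mult_distrib2 by linarith
  qed
  define s2 where "s2 = s(vJM := n - L)"
  have e1: "aval w (Bin Sub (Rg vN) (Rg vL \<ominus> Im 1)) s = n - L"
    using globN[OF g] v bounds sub_less[of "n - 1" w "L - 1"] T_le by simp
  have upd: "wp w M (IF BLt (Rg vX) (Rg vJM) THEN vJM ::= Rg vX ELSE Skip) s2
    (\<lambda>s' t. s' = s(vJM := JM) \<and> t \<le> 20)"
    using v by (intro wp_CondI wp_AsgI wp_SkipI) (auto simp: s2_def JM_def min_def)
  have "wp w M (vJ ::= Im 0;; vI ::= Im 0;; vNb ::= Im 0;; vF ::= Im 0;; vGo2 ::= Im 1;;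
    WHILE positive vGo2 DO match_body C) (s(vJM := JM)) (\<lambda>s' t. s' vCnt = cfinal \<and> t \<le> pot s1 + 50)"
    using wp_mono[OF loop, where Q' = "\<lambda>s' t. s' vCnt = cfinal \<and> t + 30 \<le> pot s1 + 50"]
    by (intro wp_Asg_SeqI) (simp add: s1_def, erule wp_mono, simp)
  then have "wp w M (IF BLt (Rg vX) (Rg vJM) THEN vJM ::= Rg vX ELSE Skip;;
    vJ ::= Im 0;; vI ::= Im 0;; vNb ::= Im 0;; vF ::= Im 0;; vGo2 ::= Im 1;;
    WHILE positive vGo2 DO match_body C) s2 (\<lambda>s' t. s' vCnt = cfinal \<and> t \<le> pot s1 + 70)"
    by (intro wp_Seq_frame[OF upd]) (auto elim!: wp_mono)
  then show ?thesis unfolding match_com_def using pot1 e1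
    by (intro wp_Asg_SeqI) (simp only: e1 s2_def, erule wp_mono, simp)
qed

end

text \<open>The cube of 4 / 3 is 64 / 27, which exceeds 2.\<close>

lemma log_four_thirds: "1 \<le> 3 * log 2 (4 / 3 :: real)"
proof -
  have "(1::real) = log 2 2" by simp
  also have "\<dots> \<le> log 2 ((4 / 3) ^ 3)" by (subst log_le_cancel_iff) (auto simp: power3_eq_cube)
  also have "\<dots> = 3 * log 2 (4 / 3)" by (subst log_nat_power) auto
  finally show ?thesis .
qed

section \<open>The sequence of levels\<close>

definition level_com :: "nat \<Rightarrow> var com" where
  "level_com C = setq_com C;; match_com C;;
    IF BLt (Rg vM \<boxminus> vE) (Rg vQ) THEN vGo ::= Im 0 ELSE vL ::= (Rg vE \<boxplus> vQ)"

text \<open>Prepares the level \<open>L = 1\<close>: the suffixes that differ from the pattern in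
  the first character are decided here.\<close>

definition first_body :: "nat \<Rightarrow> var com" where
  "first_body C = cmp C (Rg vJ) (Rg vP);; (IF positive LT THEN inc vCnt ELSE Skip);;
    IF BLt (Rg vJ) (Rg vX) THEN inc vJ ELSE vGo ::= Im 0"

definition count_com :: "nat \<Rightarrow> var com" where
  "count_com C =
    vCnt ::= Im 0;; vJ ::= Im 0;; vGo ::= Im 1;; WHILE positive vGo DO first_body C;;
    vM ::= (Rg vN \<boxminus> vP);; vL ::= Im 1;; (IF positive vM THEN vGo ::= Im 1 ELSE vGo ::= Im 0);;
    WHILE positive vGo DO level_com C"

context packed
begin

text \<open>By \<open>log_four_thirds\<close> this drops by at least 1 whenever \<open>L\<close>
  grows by the factor 4 / 3 within \<open>n\<close>.\<close>

definition lfl :: "nat \<Rightarrow> nat" where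
  "lfl L = nat \<lfloor>3 * log 2 (real n / real L)\<rfloor>"

lemma lfl_mono: "1 \<le> L \<Longrightarrow> L \<le> L' \<Longrightarrow> lfl L' \<le> lfl L"
  unfolding lfl_def
proof (intro nat_mono floor_mono mult_left_mono)
  assume L: "1 \<le> L" "L \<le> L'"
  have "0 < real n / real L'" "real n / real L' \<le> real n / real L"
    using T_nonempty L by (auto intro!: divide_pos_pos divide_left_mono)
  then show "log 2 (real n / real L') \<le> log 2 (real n / real L)" by simp
qed simp

lemma lfl_less:
  assumes L: "1 \<le> L" "4 * L \<le> 3 * L'" "L' \<le> n"
  shows "lfl L' + 1 \<le> lfl L"
proof -
  have pos: "0 < real L" "0 < real L'" "0 < real n" using L by auto
  have "4 / 3 * (real n / real L') \<le> real n / real L"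
  proof -
    have "real (4 * L) \<le> real (3 * L')" using L(2) by (simp only: of_nat_le_iff)
    then have "real n * (4 * real L) \<le> real n * (3 * real L')" using pos by (intro mult_left_mono) auto
    then have "(4 * real n) / (3 * real L') \<le> real n / real L"
      using pos by (intro divide_le_eq[THEN iffD2]) (simp add: pos_le_divide_eq mult.commute mult.left_commute)
    then show ?thesis by simp
  qed
  then have "log 2 (4 / 3 * (real n / real L')) \<le> log 2 (real n / real L)"
    using pos by (subst log_le_cancel_iff) auto
  moreover have "log 2 (4 / 3 * (real n / real L')) = log 2 (4 / 3) + log 2 (real n / real L')"
    using pos by (intro log_mult_pos divide_pos_pos) auto
  moreover note log_four_thirds
  ultimately have "1 + 3 * log 2 (real n / real L') \<le> 3 * log 2 (real n / real L)" by linarith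
  moreover have "0 \<le> log 2 (real n / real L')" using L pos by (simp add: zero_le_log_cancel_iff field_simps)
  ultimately show ?thesis unfolding lfl_def by linarith
qed

text \<open>A lexicographic pair as one number: a level either lengthens the prefix by the factor 4
  / 3, or replaces a prefix with a short period by a longer one without. The factor 2 lets the first
  kind of progress outweigh a change of the flag.\<close>

definition lev :: "nat \<Rightarrow> nat \<Rightarrow> nat" where
  "lev p L = 2 * lfl L + of_bool (\<not> long_pers (\<lambda>k. T ! (p + k)) L)"

lemma lev_less:
  assumes ok: "level_ok p L S q e" and n: "p + (e + q) < n"
  shows "lev p (e + q) < lev p L"
proof -
  let ?x = "\<lambda>k. T ! (p + k)"
  have b: "1 \<le> q" "q \<le> L" "L \<le> e" using ok unfolding level_ok_def by auto
  show ?thesis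
  proof (cases "L \<le> 3 * q")
    case True
    \<comment> \<open>Here \<open>e + q\<close> is at least \<open>L\<close> plus a third of
      \<open>L\<close>.\<close>
    have "lfl (e + q) + 1 \<le> lfl L" using b n True by (intro lfl_less) auto
    then show ?thesis unfolding lev_def by (simp add: of_bool_def)
  next
    case False
    \<comment> \<open>With \<open>L > 3 * q\<close> the number \<open>q\<close> cannot be a mere
      lower bound; it is a period whose run breaks at \<open>e\<close>.\<close>
    then have p: "per ?x e q" "?x e \<noteq> ?x (e - q)" using ok n b unfolding level_ok_def by auto
    then have "\<not> long_pers ?x L" using False b per_mono[OF p(1) b(3)] unfolding long_pers_def by auto
    moreover have "long_pers ?x (e + q)" using False b by (intro long_pers_next p) auto
    moreover have "lfl (e + q) \<le> lfl L" using b by (intro lfl_mono) auto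
    ultimately show ?thesis unfolding lev_def by simp
  qed
qed

definition less_count :: "nat \<Rightarrow> nat \<Rightarrow> nat" where
  "less_count p X = card {i. i \<le> X \<and> drop i T < drop p T}"

lemma pres_coms [simp]: "pres (setq_com C)" "pres (match_com C)" "pres (level_com C)" "pres (first_body C)" "pres (count_com C)"
  unfolding setq_com_def maxsuf_com_def maxsuf_body_def period_com_def period_body_def reach_com_def reach_body_def long_com_def
    match_com_def match_body_def probe_com_def advance_com_def report_com_def shift_com_def occ_com_def check_com_def check_body_def
    run_com_def run_body_def ext_com_def ext_body_def level_com_def first_body_def count_com_def
  by simp_all

lemmas setq_defs = setq_com_def maxsuf_com_def maxsuf_body_def period_com_def period_body_def reach_com_def reach_body_def long_com_def
lemmas match_defs = match_com_def match_body_def probe_com_def advance_com_def report_com_def shift_com_def occ_com_def check_com_def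
  check_body_def run_com_def run_body_def ext_com_def ext_body_def

lemma not_less_full: "match T p l i \<Longrightarrow> n \<le> p + l \<Longrightarrow> \<not> drop i T < drop p T"
  by (rule match_full_not_less)

definition level_inv :: "nat \<Rightarrow> nat \<Rightarrow> var state \<Rightarrow> bool" where
  "level_inv p X s \<longleftrightarrow>
    s vGo = 1 \<and> 1 \<le> s vL \<and> p + s vL < n \<and> s vCnt = card {i. i \<le> X \<and> drop i T < drop p T \<and> \<not> match T p (s vL) i} \<or>
    s vGo = 0 \<and> s vCnt = less_count p X"

lemma wp_level:
  assumes g: "glob s" and v: "s vP = p" "s vX = X" "s vM = n - 1 - p" "X < n" and I: "level_inv p X s" and go: "s vGo = 1"
  shows "wp w M (level_com C) s (\<lambda>s' t. level_inv p X s' \<and>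
    t + 10 + kt C * (70 * n) * (if s' vGo = 0 then 0 else Suc (lev p (s' vL))) \<le> kt C * (70 * n) * Suc (lev p (s vL)))"
proof -
  define L where "L = s vL"
  have L: "1 \<le> L" "p + L < n" "s vCnt = card {i. i \<le> X \<and> drop i T < drop p T \<and> \<not> match T p L i}"
    using I go unfolding level_inv_def L_def by auto
  show ?thesis unfolding level_com_def L_def[symmetric]
  proof (rule wp_Seq_frame[OF wp_setq[OF g v(1) L_def[symmetric] v(3) L(1,2)]])
    fix s1 :: "var state" and t1 :: nat
    assume a: "level_ok p L (s1 vS) (s1 vQ) (s1 vE) \<and> t1 \<le> kt C * (5 * n)"
      and fr: "\<And>y. \<not> wr (setq_com C) y \<Longrightarrow> s1 y = s y"
    have g1: "glob s1" by (rule glob_pres[OF g, of "setq_com C"]) (use fr in auto)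
    have v1: "s1 vP = p" "s1 vX = X" "s1 vL = L" "s1 vM = n - 1 - p" "s1 vCnt = s vCnt" "s1 vGo = 1"
      using fr v go L_def by (auto simp: setq_defs)
    define S q e where "S = s1 vS" and "q = s1 vQ" and "e = s1 vE"
    have ok: "level_ok p L S q e" using a unfolding S_def q_def e_def by blast
    interpret level C w \<sigma> T p X L S q e by unfold_locales (use ok v in auto)
    have c0: "s1 vCnt = cs 0" using L(3) v1 unfolding cs_def cset_def by simp
    show "wp w M (match_com C;; IF BLt (Rg vM \<boxminus> vE) (Rg vQ) THEN vGo ::= Im 0 ELSE vL ::= (Rg vE \<boxplus> vQ)) s1
      (\<lambda>s' t. level_inv p X s' \<and> t1 + t + 10 + kt C * (70 * n) * (if s' vGo = 0 then 0 else Suc (lev p (s' vL))) \<le> kt C * (70 * n) * Suc (lev p L))"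
    proof (rule wp_Seq_frame[OF wp_match[OF g1 v1(1,2,3,4) S_def[symmetric] q_def[symmetric] e_def[symmetric] c0]])
      fix s2 :: "var state" and t2 :: nat
      assume b: "s2 vCnt = cfinal \<and> t2 \<le> kt C * (60 * n)"
        and fr2: "\<And>y. \<not> wr (match_com C) y \<Longrightarrow> s2 y = s1 y"
      have v2: "s2 vM = n - 1 - p" "s2 vE = e" "s2 vQ = q" "s2 vGo = 1" "s2 vL = L"
        using fr2 v1 by (auto simp: match_defs e_def q_def)
      have "kt C * (5 * n) + kt C * (60 * n) + 100 \<le> kt C * (70 * n)"
      proof -
        have "kt C * 1 \<le> kt C * (5 * n)" using T_nonempty by (intro mult_le_mono2) linarith
        moreover have "100 \<le> kt C * 1" by (simp add: kt_def)
        moreover have "kt C * (70 * n) = kt C * (5 * n) + kt C * (60 * n) + kt C * (5 * n)" by (simp add: algebra_simps)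
        ultimately show ?thesis by linarith
      qed
      then have tt: "t1 + t2 + 100 \<le> kt C * (70 * n)" using a b by linarith
      show "wp w M (IF BLt (Rg vM \<boxminus> vE) (Rg vQ) THEN vGo ::= Im 0 ELSE vL ::= (Rg vE \<boxplus> vQ)) s2
        (\<lambda>s' t. level_inv p X s' \<and> t1 + (t2 + t) + 10 + kt C * (70 * n) * (if s' vGo = 0 then 0 else Suc (lev p (s' vL))) \<le> kt C * (70 * n) * Suc (lev p L))"
      proof (cases "n - 1 - p - e < q")
        case True
        have ge: "n \<le> p + (e + q)" using True bounds by linarith
        \<comment> \<open>The next level would lie at or beyond the end of the pattern, and a suffix
          that matches so far is not smaller.\<close>
        have "cfinal = less_count p X" unfolding cfinal_def less_count_def
        proof (rule arg_cong[of _ _ card], rule Collect_cong)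
          fix i show "(i \<le> X \<and> below i \<and> \<not> match T p (e + q) i) = (i \<le> X \<and> below i)"
            using not_less_full[of p "e + q" i] ge by blast
        qed
        then have "level_inv p X (s2(vGo := 0))" unfolding level_inv_def using b by simp
        moreover have "bval w (BLt (Rg vM \<boxminus> vE) (Rg vQ)) s2" using True v2 bounds by simp
        ultimately show ?thesis using tt by (intro wp_CondI wp_AsgI) (auto simp: algebra_simps)
      next
        case False
        then have eq: "p + (e + q) < n" using bounds by linarith
        define s3 where "s3 = s2(vL := e + q)"
        have "level_inv p X s3" unfolding level_inv_def s3_def using b eq v2 bounds by (simp add: cfinal_def)
        moreover define K where "K = kt C * (70 * n)"
        have "K * Suc (lev p (e + q)) + K \<le> K * Suc (lev p L)"
          using mult_le_mono2[OF Suc_leI[OF lev_less[OF ok eq]], of K] by simp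
        moreover have "\<not> bval w (BLt (Rg vM \<boxminus> vE) (Rg vQ)) s2" using False v2 bounds by simp
        moreover have "s2(vL := aval w (Rg vE \<boxplus> vQ) s2) = s3" using eq v2 unfolding s3_def by simp
        ultimately show ?thesis using tt v2 unfolding K_def[symmetric]
          by (intro wp_CondI wp_AsgI) (auto simp: s3_def)
      qed
    qed
  qed
qed

lemma wp_first:
  assumes g: "glob s" and v: "s vP = p" "s vX = X" "p < n" "X < n" and i: "s vCnt = 0" "s vJ = 0" "s vGo = 1"
  shows "wp w M (WHILE positive vGo DO first_body C) s (\<lambda>s' t.
    s' vCnt = card {i. i \<le> X \<and> T ! i < T ! p} \<and> t \<le> kt C * (3 * n))"
proof -
  let ?I = "\<lambda>s. s vGo = 1 \<and> s vJ \<le> X \<and> s vCnt = card {i. i < s vJ \<and> T ! i < T ! p} \<or>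
    s vGo = 0 \<and> s vCnt = card {i. i \<le> X \<and> T ! i < T ! p}"
  define \<Phi> :: "var state \<Rightarrow> nat" where "\<Phi> s = (if s vGo = 0 then 0 else kt C * Suc (X - s vJ))" for s
  show ?thesis
  proof (rule wp_LoopI[where I = ?I and \<Phi> = \<Phi>])
    show "?I s" using i by simp
  next
    fix s2 :: "var state"
    assume I: "?I s2" and b2: "bval w (positive vGo) s2"
      and fr: "\<And>y. \<not> wr (first_body C) y \<Longrightarrow> s2 y = s y"
    have g2: "glob s2" by (rule glob_pres[OF g, of "first_body C"]) (use fr in auto)
    have v2: "s2 vP = p" "s2 vX = X" using fr v by (auto simp: first_body_def)
    define j where "j = s2 vJ"
    have J: "s2 vGo = 1" "j \<le> X" "s2 vCnt = card {i. i < j \<and> T ! i < T ! p}" using I b2 unfolding j_def by auto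
    have fin: "finite {i. i < k \<and> T ! i < T ! p}" for k by (rule finite_subset[of _ "{..<k}"]) auto
    have cj: "card {i. i < Suc j \<and> T ! i < T ! p} = s2 vCnt + of_bool (T ! j < T ! p)"
    proof -
      have "{i. i < Suc j \<and> T ! i < T ! p} = (if T ! j < T ! p then insert j {i. i < j \<and> T ! i < T ! p} else {i. i < j \<and> T ! i < T ! p})"
        by (auto simp: less_Suc_eq)
      then show ?thesis using fin[of j] J(3) by simp
    qed
    \<comment> \<open>Neither \<open>p\<close> nor \<open>j\<close> has been counted, so the
      increment does not overflow.\<close>
    have cn: "s2 vCnt + 1 < n" if "T ! j < T ! p"
    proof -
      have jp: "j \<noteq> p" "j < n" using that J v by auto
      have "{i. i < j \<and> T ! i < T ! p} \<subseteq> {..<n} - {p, j}" using jp by auto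
      then have "s2 vCnt \<le> card ({..<n} - {p, j})" unfolding J(3) by (intro card_mono) auto
      also have "\<dots> = n - 2" using jp v by (simp add: card_Diff_subset)
      finally show ?thesis using jp v by linarith
    qed
    show "wp w M (first_body C) s2 (\<lambda>s' t. ?I s' \<and> t + (blen (positive vGo) + 1) + \<Phi> s' \<le> \<Phi> s2)"
      unfolding first_body_def
    proof (rule wp_SeqI, rule wp_cmpI[OF g2])
      show "aval w (Rg vJ) s2 < n" "aval w (Rg vP) s2 < n" using J v v2 by (auto simp: j_def)
      fix s3 :: "var state" and t :: nat
      assume r: "s3 LT = of_bool (T ! aval w (Rg vJ) s2 < T ! aval w (Rg vP) s2)"
        and t: "t \<le> elen (Rg vJ :: var exp) + elen (Rg vP :: var exp) + cmp_time C"
        and fr3: "\<And>y. \<not> cmp_scratch y \<Longrightarrow> s3 y = s2 y"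
      have r': "s3 LT = of_bool (T ! j < T ! p)" using r v2 j_def by simp
      have v3: "s3 vJ = j" "s3 vX = X" "s3 vGo = 1" "s3 vCnt = s2 vCnt" using fr3 J v2 j_def by auto
      define s4 where "s4 = s3(vCnt := card {i. i < Suc j \<and> T ! i < T ! p})"
      have upd: "wp w M (IF positive LT THEN inc vCnt ELSE Skip) s3 (\<lambda>s' t. s' = s4 \<and> t \<le> 20)"
        using r' v3 cj cn by (intro wp_CondI wp_AsgI wp_SkipI) (auto simp: s4_def fun_eq_iff)
      have v4: "s4 vJ = j" "s4 vX = X" "s4 vGo = 1" "s4 vCnt = card {i. i < Suc j \<and> T ! i < T ! p}"
        unfolding s4_def using v3 by auto
      have t': "t + 100 \<le> kt C" using t by (simp add: kt_def)
      have pj: "\<Phi> s2 = kt C * Suc (X - j)" unfolding \<Phi>_def using J j_def by simp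
      have "wp w M (IF BLt (Rg vJ) (Rg vX) THEN inc vJ ELSE vGo ::= Im 0) s4
        (\<lambda>s' t'. ?I s' \<and> t + t' + 40 + \<Phi> s' \<le> \<Phi> s2)"
      proof (cases "j < X")
        case True
        have "kt C * Suc (X - Suc j) + kt C = kt C * Suc (X - j)" using True by (simp add: Suc_diff_Suc)
        then show ?thesis using True v4 t' v unfolding pj by (intro wp_CondI wp_AsgI) (auto simp: \<Phi>_def)
      next
        case False
        then have "X = j" using J by simp
        then have "{i. i \<le> X \<and> T ! i < T ! p} = {i. i < Suc j \<and> T ! i < T ! p}" by (auto simp: less_Suc_eq_le)
        then show ?thesis using False v4 t' unfolding pj by (intro wp_CondI wp_AsgI) (auto simp: \<Phi>_def)
      qed
      then have "wp w M (IF BLt (Rg vJ) (Rg vX) THEN inc vJ ELSE vGo ::= Im 0) s'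
        (\<lambda>s'' t''. ?I s'' \<and> t + (t' + t'') + (blen (positive vGo) + 1) + \<Phi> s'' \<le> \<Phi> s2)" if "s' = s4 \<and> t' \<le> 20" for s' t'
        using that by (auto elim!: wp_mono)
      then show "wp w M (IF positive LT THEN inc vCnt ELSE Skip;; IF BLt (Rg vJ) (Rg vX) THEN inc vJ ELSE vGo ::= Im 0) s3
        (\<lambda>s' t'. ?I s' \<and> t + t' + (blen (positive vGo) + 1) + \<Phi> s' \<le> \<Phi> s2)"
        by (intro wp_Seq_frame[OF upd])
    qed simp
  next
    fix s2 :: "var state" and t :: nat
    assume I: "?I s2" and b2: "\<not> bval w (positive vGo) s2" and t: "t + \<Phi> s2 \<le> \<Phi> s + blen (positive vGo) + 1"
    have "kt C * (Suc X + 1) \<le> kt C * (3 * n)" using v by (intro mult_le_mono2) simp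
    then have "\<Phi> s + kt C \<le> kt C * (3 * n)" unfolding \<Phi>_def using i by (simp add: algebra_simps)
    then show "s2 vCnt = card {i. i \<le> X \<and> T ! i < T ! p} \<and> t \<le> kt C * (3 * n)"
      using I b2 t by (auto simp: kt_def)
  qed
qed

text \<open>At most \<open>2 * lfl 1 + 2\<close> levels at \<open>70 * n\<close> each, and
  \<open>10 * n\<close> for the first characters and the overhead.\<close>

definition count_time :: nat where
  "count_time = kt C * (n * (140 * lfl 1 + 150))"

lemma wp_count:
  assumes g: "glob s" and v: "s vP = p" "s vX = X" "p < n" "X < n"
  shows "wp w M (count_com C) s (\<lambda>s' t. s' vCnt = less_count p X \<and> t \<le> count_time)"
proof -
  define s1 where "s1 = s(vCnt := 0, vJ := 0, vGo := 1)"
  have g1: "glob s1" using g unfolding s1_def glob_def by simp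
  let ?rest = "vM ::= (Rg vN \<boxminus> vP);; vL ::= Im 1;; (IF positive vM THEN vGo ::= Im 1 ELSE vGo ::= Im 0);;
    WHILE positive vGo DO level_com C"
  have first: "wp w M (WHILE positive vGo DO first_body C) s1 (\<lambda>s' t.
    s' vCnt = card {i. i \<le> X \<and> T ! i < T ! p} \<and> t \<le> kt C * (3 * n))"
    by (rule wp_first[OF g1]) (use v in \<open>auto simp: s1_def\<close>)
  have "wp w M (WHILE positive vGo DO first_body C;; ?rest) s1 (\<lambda>s' t. s' vCnt = less_count p X \<and> t + 50 \<le> count_time)"
  proof (rule wp_Seq_frame[OF first])
    fix s2 :: "var state" and t2 :: nat
    assume a: "s2 vCnt = card {i. i \<le> X \<and> T ! i < T ! p} \<and> t2 \<le> kt C * (3 * n)"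
      and fr: "\<And>y. \<not> wr (WHILE positive vGo DO first_body C) y \<Longrightarrow> s2 y = s1 y"
    have g2: "glob s2" by (rule glob_pres[OF g1, of "WHILE positive vGo DO first_body C"]) (use fr in auto)
    have v2: "s2 vP = p" "s2 vX = X" using fr v by (auto simp: first_body_def s1_def)
    \<comment> \<open>A pattern of a single character is settled by the first characters alone; then
      no level is entered.\<close>
    define go :: nat where "go = of_bool (0 < n - 1 - p)"
    define s3 where "s3 = s2(vM := n - 1 - p, vL := 1)"
    define s4 where "s4 = s3(vGo := go)"
    have upd: "wp w M (IF positive vM THEN vGo ::= Im 1 ELSE vGo ::= Im 0) s3 (\<lambda>s' t. s' = s4 \<and> t \<le> 20)"
      by (intro wp_CondI wp_AsgI) (auto simp: s4_def s3_def go_def)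
    have g4: "glob s4" using g2 unfolding s4_def s3_def glob_def by simp
    have v4: "s4 vP = p" "s4 vX = X" "s4 vM = n - 1 - p" "s4 vGo = go" "s4 vL = 1" "s4 vCnt = s2 vCnt"
      unfolding s4_def s3_def using v2 by auto
    have I4: "level_inv p X s4"
    proof -
      have "{i. i \<le> X \<and> T ! i < T ! p} = {i. i \<le> X \<and> drop i T < drop p T \<and> \<not> match T p 1 i}"
      proof (rule Collect_cong)
        fix i
        have "drop i T < drop p T \<longleftrightarrow> T ! i < T ! p" if "i \<le> X" "\<not> match T p 1 i"
          using match_less_iff[of T p 0 i] that v by (simp add: match_0)
        moreover have "match T p 1 i \<longleftrightarrow> T ! i = T ! p" if "i \<le> X"
          using that v by (auto simp: match_def)
        ultimately show "(i \<le> X \<and> T ! i < T ! p) = (i \<le> X \<and> drop i T < drop p T \<and> \<not> match T p 1 i)" by auto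
      qed
      then have c: "s4 vCnt = card {i. i \<le> X \<and> drop i T < drop p T \<and> \<not> match T p 1 i}" using a v4 by simp
      show ?thesis
      proof (cases "0 < n - 1 - p")
        case True
        then show ?thesis unfolding level_inv_def v4 using c v4 by (simp add: go_def)
      next
        case False
        have "{i. i \<le> X \<and> drop i T < drop p T \<and> \<not> match T p 1 i} = {i. i \<le> X \<and> drop i T < drop p T}"
          using not_less_full[of p 1] False v by auto
        then show ?thesis unfolding level_inv_def v4 less_count_def using c v4 False by (simp add: go_def)
      qed
    qed
    define \<Phi> :: "var state \<Rightarrow> nat" where "\<Phi> s = kt C * (70 * n) * (if s vGo = 0 then 0 else Suc (lev p (s vL)))" for s
    have loop: "wp w M (WHILE positive vGo DO level_com C) s4 (\<lambda>s' t. s' vCnt = less_count p X \<and> t \<le> \<Phi> s4 + 10)"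
    proof (rule wp_LoopI[where I = "level_inv p X" and \<Phi> = \<Phi>])
      fix s5 :: "var state"
      assume I: "level_inv p X s5" and b5: "bval w (positive vGo) s5"
        and fr: "\<And>y. \<not> wr (level_com C) y \<Longrightarrow> s5 y = s4 y"
      have g5: "glob s5" by (rule glob_pres[OF g4, of "level_com C"]) (use fr in auto)
      have v5: "s5 vP = p" "s5 vX = X" "s5 vM = n - 1 - p" using fr v4 by (auto simp: level_com_def setq_defs match_defs)
      have go: "s5 vGo = 1" using I b5 unfolding level_inv_def by auto
      show "wp w M (level_com C) s5 (\<lambda>s' t. level_inv p X s' \<and> t + (blen (positive vGo) + 1) + \<Phi> s' \<le> \<Phi> s5)"
        using wp_level[OF g5 v5 v(4) I go] by (rule wp_mono) (auto simp: \<Phi>_def go)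
    next
      fix s5 :: "var state" and t :: nat
      assume "level_inv p X s5" "\<not> bval w (positive vGo) s5" "t + \<Phi> s5 \<le> \<Phi> s4 + blen (positive vGo) + 1"
      then show "s5 vCnt = less_count p X \<and> t \<le> \<Phi> s4 + 10" unfolding level_inv_def by auto
    qed (rule I4)
    have tt: "t2 + \<Phi> s4 + 200 \<le> count_time"
    proof -
      have "Suc (lev p 1) \<le> 2 * lfl 1 + 2" unfolding lev_def by (simp add: of_bool_def)
      then have "\<Phi> s4 \<le> kt C * (70 * n) * (2 * lfl 1 + 2)" unfolding \<Phi>_def v4 by (intro mult_le_mono2) auto
      moreover have "kt C * 1 \<le> kt C * (3 * n)" using T_nonempty by (intro mult_le_mono2) linarith
      moreover have "200 \<le> kt C * 1" by (simp add: kt_def)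
      moreover have "count_time = kt C * (70 * n) * (2 * lfl 1 + 2) + kt C * (10 * n)"
        unfolding count_time_def by (simp add: algebra_simps)
      moreover have "kt C * (10 * n) = kt C * (3 * n) + kt C * (3 * n) + kt C * (4 * n)" by (simp add: algebra_simps)
      ultimately show ?thesis using a by linarith
    qed
    have "wp w M (IF positive vM THEN vGo ::= Im 1 ELSE vGo ::= Im 0;; WHILE positive vGo DO level_com C) s3
      (\<lambda>s' t. s' vCnt = less_count p X \<and> t \<le> \<Phi> s4 + 30)"
      by (rule wp_Seq_frame[OF upd]) (use loop in \<open>auto elim!: wp_mono\<close>)
    moreover have "s2(vM := aval w (Rg vN \<boxminus> vP) s2, vL := aval w (Im 1) (s2(vM := aval w (Rg vN \<boxminus> vP) s2))) = s3"
      unfolding s3_def using globN[OF g2] v2 v by simp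
    ultimately show "wp w M ?rest s2 (\<lambda>s' t. s' vCnt = less_count p X \<and> t2 + t + 50 \<le> count_time)"
      using tt by (intro wp_Asg_SeqI) (simp only:, erule wp_mono, simp)
  qed
  then show ?thesis unfolding count_com_def
    by (intro wp_Asg_SeqI) (simp add: s1_def, erule wp_mono, simp)
qed

end

section \<open>One round of the selection\<close>

text \<open>The candidates up to \<open>vMid\<close> are counted as the suffixes below the upper
  bound minus those up to the lower bound. The lower bound itself is missed by
  \<open>count_com\<close> and is added if it lies in the range. Rank \<open>n - 1\<close> at the
  top and rank 0 at the bottom mean that there is no bounding suffix.\<close>

definition search_body :: "nat \<Rightarrow> var com" where
  "search_body C =
    vMid ::= Bin Add (Rg vA) (Bin Shr (Rg vB \<boxminus> vA) (Im 1));; vX ::= Rg vMid;;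
    (IF BLt (Rg vRhi) (Rg vN) THEN (vP ::= Rg vHi;; count_com C;; vSel ::= Rg vCnt) ELSE vSel ::= (Rg vMid \<oplus> Im 1));;
    (IF positive vRlo
     THEN (vP ::= Rg vLo;; count_com C;; (IF BLt (Rg vMid) (Rg vLo) THEN Skip ELSE inc vCnt);; vSel ::= (Rg vSel \<boxminus> vCnt))
     ELSE Skip);;
    IF BLt (Rg vRnk) (Rg vSel) THEN vB ::= Rg vMid ELSE vA ::= (Rg vMid \<oplus> Im 1)"

definition decide_com :: "nat \<Rightarrow> var com" where
  "decide_com C = vP ::= Rg vA;; vX ::= Rg vN;; count_com C;;
    IF BEq (Rg vCnt) (Rg (Par (4 * (C + 2)))) THEN ((Par 0) ::= Rg vA;; vDone ::= Im 1)
    ELSE IF BLt (Rg vCnt) (Rg (Par (4 * (C + 2)))) THEN (vLo ::= Rg vA;; vRlo ::= (Rg vCnt \<oplus> Im 1))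
    ELSE (vHi ::= Rg vA;; vRhi ::= (Rg vCnt \<ominus> Im 1))"

definition round_com :: "nat \<Rightarrow> var com" where
  "round_com C = vRnk ::= Bin Mod (Rg vU) (Rg vRhi \<boxminus> vRlo \<oplus> Im 1);; vA ::= Im 0;; vB ::= Rg vN;;
    WHILE BLt (Rg vA) (Rg vB) DO search_body C;; decide_com C"

fun bitlen :: "nat \<Rightarrow> nat" where
  "bitlen m = (if m = 0 then 0 else Suc (bitlen (m div 2)))"

declare bitlen.simps [simp del]

lemma bitlen_mono: "m \<le> m' \<Longrightarrow> bitlen m \<le> bitlen m'"
proof (induction m' arbitrary: m rule: less_induct)
  case (less m')
  show ?case
  proof (cases "m = 0")
    case False
    then have "bitlen (m div 2) \<le> bitlen (m' div 2)" using less by (intro less.IH) auto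
    then show ?thesis using False less.prems by (subst (1 2) bitlen.simps) simp
  qed (simp add: bitlen.simps)
qed

lemma bitlen_half: "0 < m \<Longrightarrow> m' \<le> m div 2 \<Longrightarrow> Suc (bitlen m') \<le> bitlen m"
  using bitlen_mono[of m' "m div 2"] by (subst (2) bitlen.simps) simp

lemma bitlen_bound: "0 < m \<Longrightarrow> 2 ^ bitlen m \<le> 2 * m"
proof (induction m rule: less_induct)
  case (less m)
  show ?case
  proof (cases "m div 2 = 0")
    case True
    then have "m = 1" using less.prems by simp
    then show ?thesis by (simp add: bitlen.simps)
  next
    case False
    then have "2 ^ bitlen (m div 2) \<le> 2 * (m div 2)" using less.prems by (intro less.IH) auto
    moreover have "bitlen m = Suc (bitlen (m div 2))" using less.prems by (subst bitlen.simps) simp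
    ultimately have "2 ^ bitlen m \<le> 2 * (2 * (m div 2))" by simp
    also have "\<dots> \<le> 2 * m" by simp
    finally show ?thesis .
  qed
qed

context packed
begin

section \<open>Ranks of suffixes and windows of candidates\<close>

abbreviation "suf j \<equiv> drop j T"

definition rank :: "nat \<Rightarrow> nat" where
  "rank p = card {j. j < n \<and> suf j < suf p}"

lemma suf_inj: "i < n \<Longrightarrow> j < n \<Longrightarrow> suf i = suf j \<Longrightarrow> i = j"
  by (metis add_diff_cancel_left' diff_diff_cancel length_drop less_imp_le)

lemma rank_less_iff:
  assumes "i < n" "j < n"
  shows "rank i < rank j \<longleftrightarrow> suf i < suf j"
proof -
  have less: "rank i < rank j" if "suf i < suf j" "i < n" for i j
    unfolding rank_def
  proof (rule psubset_card_mono)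
    have "i \<in> {k. k < n \<and> suf k < suf j}" "i \<notin> {k. k < n \<and> suf k < suf i}" using that by auto
    moreover have "{k. k < n \<and> suf k < suf i} \<subseteq> {k. k < n \<and> suf k < suf j}" using that by auto
    ultimately show "{k. k < n \<and> suf k < suf i} \<subset> {k. k < n \<and> suf k < suf j}" by blast
  qed simp
  show ?thesis using less[of i j] less[of j i] assms suf_inj[of i j] by (metis less_asym linorder_neqE)
qed

lemma rank_inj: "i < n \<Longrightarrow> j < n \<Longrightarrow> rank i = rank j \<Longrightarrow> i = j"
  using rank_less_iff[of i j] rank_less_iff[of j i] suf_inj[of i j] by (metis less_irrefl linorder_neqE)

lemma rank_less: "p < n \<Longrightarrow> rank p < n"
proof -
  assume p: "p < n"
  have "rank p \<le> card ({..<n} - {p})" unfolding rank_def by (intro card_mono) auto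
  then show ?thesis using p by simp
qed

lemma rank_bij: "bij_betw rank {..<n} {..<n}"
proof -
  have inj: "inj_on rank {..<n}" by (rule inj_onI) (use rank_inj in auto)
  moreover have "rank ` {..<n} = {..<n}"
    by (rule endo_inj_surj[OF _ _ inj]) (use rank_less in auto)
  ultimately show ?thesis unfolding bij_betw_def by blast
qed

lemma less_count_rank: "p < n \<Longrightarrow> less_count p (n - 1) = rank p"
  unfolding less_count_def rank_def using T_nonempty by (intro arg_cong[of _ _ card]) auto

text \<open>All suffixes are distinct, so the index in the sorted list is the number of smaller
  elements.\<close>

lemma rank_kth: "p < n \<Longrightarrow> rank p = i \<Longrightarrow> suf p = kth_suffix T i"
proof -
  assume p: "p < n" "rank p = i"
  let ?xs = "sort (map (\<lambda>p. suf p) [0..<n])"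
  have dist: "distinct ?xs" by (auto simp: distinct_map inj_on_def intro: suf_inj)
  have sorted: "sorted ?xs" by simp
  have set: "set ?xs = suf ` {..<n}" by (auto simp: atLeast0LessThan)
  obtain k where k: "k < length ?xs" "?xs ! k = suf p" using set p(1) by (metis imageI in_set_conv_nth lessThan_iff)
  have strict: "sorted_wrt (<) ?xs" using sorted dist by (simp only: strict_sorted_iff)
  have "{y \<in> set ?xs. y < suf p} = (\<lambda>j. ?xs ! j) ` {..<k}"
  proof (intro equalityI subsetI)
    fix y assume y: "y \<in> {y \<in> set ?xs. y < suf p}"
    then have "y \<in> set ?xs" by blast
    then obtain j where j: "j < length ?xs" "?xs ! j = y" unfolding in_set_conv_nth by blast
    have "j < k"
    proof (rule ccontr)
      assume "\<not> j < k"
      then have "?xs ! k \<le> ?xs ! j" using sorted_nth_mono[OF sorted, of k j] j by simp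
      then show False using y j k by (auto simp: not_le)
    qed
    then show "y \<in> (\<lambda>j. ?xs ! j) ` {..<k}" using j by auto
  next
    fix y assume "y \<in> (\<lambda>j. ?xs ! j) ` {..<k}"
    then obtain j where j: "j < k" "y = ?xs ! j" by auto
    then show "y \<in> {y \<in> set ?xs. y < suf p}"
      using sorted_wrt_nth_less[OF strict j(1) k(1)] k by (metis (mono_tags, lifting) mem_Collect_eq nth_mem order.strict_trans)
  qed
  moreover have "inj_on (\<lambda>j. ?xs ! j) {..<k}"
    using dist k(1) by (intro inj_on_nth) auto
  ultimately have "card {y \<in> set ?xs. y < suf p} = k" by (simp only: card_image card_lessThan)
  moreover have "{y \<in> set ?xs. y < suf p} = suf ` {j. j < n \<and> suf j < suf p}" unfolding set by auto
  moreover have "card (suf ` {j. j < n \<and> suf j < suf p}) = rank p"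
    unfolding rank_def by (intro card_image inj_onI suf_inj) auto
  ultimately have "k = i" using p(2) by simp
  then show ?thesis using k unfolding kth_suffix_def by simp
qed

definition cands :: "nat \<Rightarrow> nat \<Rightarrow> nat set" where
  "cands l h = {j. j < n \<and> l \<le> rank j \<and> rank j \<le> h}"

lemma finite_cands [simp]: "finite (cands l h)"
  unfolding cands_def by simp

lemma card_cands: "l \<le> h \<Longrightarrow> h < n \<Longrightarrow> card (cands l h) = h - l + 1"
proof -
  assume lh: "l \<le> h" "h < n"
  have "bij_betw rank (cands l h) {l..h}"
    using rank_bij lh unfolding cands_def bij_betw_def inj_on_def by (auto simp: image_iff set_eq_iff) (metis lessThan_iff order_le_less_trans)
  then show ?thesis using bij_betw_same_card lh by fastforce
qed

text \<open>Ranks up to \<open>h\<close> without the ranks below \<open>l\<close>. Either set is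
  described by a comparison with one bounding suffix, which is what \<open>count_com\<close> can
  evaluate. It is stated as a sum to avoid truncated subtraction.\<close>

lemma card_cands_upto:
  assumes m: "m < n" and h: "h = n - 1 \<or> hi < n \<and> rank hi = h + 1" and l: "l = 0 \<or> lo < n \<and> rank lo + 1 = l" and lh: "l \<le> h" "h < n"
  shows "card {j \<in> cands l h. j \<le> m} + (if 0 < l then less_count lo m + (if m < lo then 0 else 1) else 0) =
    (if h < n - 1 then less_count hi m else m + 1)"
proof -
  let ?H = "{j. j \<le> m \<and> rank j \<le> h}" and ?L = "{j. j \<le> m \<and> rank j < l}"
  have fin: "finite ?L" "finite ?H" by (auto intro: finite_subset[of _ "{..m}"])
  have sub: "?L \<subseteq> ?H" using lh by auto
  have "{j \<in> cands l h. j \<le> m} = ?H - ?L" unfolding cands_def using m by auto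
  then have c: "card {j \<in> cands l h. j \<le> m} + card ?L = card ?H"
    using card_Diff_subset[OF fin(1) sub] card_mono[OF fin(2) sub] by simp
  have H: "card ?H = (if h < n - 1 then less_count hi m else m + 1)"
  proof (cases "h < n - 1")
    case True
    then have hi: "hi < n" "rank hi = h + 1" using h by auto
    have "?H = {j. j \<le> m \<and> suf j < suf hi}"
      using rank_less_iff[OF _ hi(1)] hi(2) m by (auto simp: less_Suc_eq_le)
    then show ?thesis using True unfolding less_count_def by simp
  next
    case False
    have "rank j \<le> h" if "j \<le> m" for j using rank_less[of j] that m lh False by linarith
    then have "?H = {..m}" by auto
    then show ?thesis using False by simp
  qed
  have L: "card ?L = (if 0 < l then less_count lo m + (if m < lo then 0 else 1) else 0)"
  proof (cases "0 < l")
    case True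
    then have lo: "lo < n" "rank lo + 1 = l" using l by auto
    let ?S = "{j. j \<le> m \<and> suf j < suf lo}"
    have S: "finite ?S" "lo \<notin> ?S" by (auto intro: finite_subset[of _ "{..m}"])
    have "rank j < l \<longleftrightarrow> suf j < suf lo \<or> j = lo" if "j \<le> m" for j
      using rank_less_iff[of j lo] rank_inj[of j lo] lo that m by (auto simp: less_Suc_eq)
    then have "?L = (if m < lo then ?S else insert lo ?S)" by auto
    then show ?thesis using True S unfolding less_count_def by simp
  qed simp
  show ?thesis using c unfolding H L .
qed

text \<open>The \<open>k\<close>-th smallest element of \<open>A\<close>, counted from 0: the
  candidates are numbered by their order in the text, as their ranks are unknown to the
  program.\<close>

definition nth_pos :: "nat set \<Rightarrow> nat \<Rightarrow> nat \<Rightarrow> bool" where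
  "nth_pos A k y \<longleftrightarrow> y \<in> A \<and> card {j \<in> A. j < y} = k"

lemma nth_posI:
  assumes "finite A" "card {j \<in> A. j < y} \<le> k" "k < card {j \<in> A. j \<le> y}"
  shows "nth_pos A k y"
proof -
  have e: "{j \<in> A. j \<le> y} = (if y \<in> A then insert y {j \<in> A. j < y} else {j \<in> A. j < y})" by (auto simp: le_less)
  have "finite {j \<in> A. j < y}" using assms(1) by simp
  then have "card {j \<in> A. j \<le> y} = card {j \<in> A. j < y} + of_bool (y \<in> A)" unfolding e by simp
  then show ?thesis unfolding nth_pos_def using assms by (cases "y \<in> A") auto
qed

lemma not_wr_count [simp]:
  "\<not> wr (count_com C) vMid" "\<not> wr (count_com C) vSel" "\<not> wr (count_com C) vA" "\<not> wr (count_com C) vB"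
  "\<not> wr (count_com C) vRnk" "\<not> wr (count_com C) vLo" "\<not> wr (count_com C) vHi" "\<not> wr (count_com C) vRlo"
  "\<not> wr (count_com C) vRhi" "\<not> wr (count_com C) vDone" "\<not> wr (count_com C) vX" "\<not> wr (count_com C) vP"
  "\<not> wr (count_com C) (Par k)"
  by (simp_all add: count_com_def first_body_def level_com_def setq_defs match_defs)

text \<open>\<open>lo\<close> and \<open>hi\<close> are the excluded neighbours of the window in
  rank order; they are arbitrary where the window touches the end of the rank range.\<close>

definition window :: "nat \<Rightarrow> nat \<Rightarrow> nat \<Rightarrow> nat \<Rightarrow> bool" where
  "window l h lo hi \<longleftrightarrow> l \<le> h \<and> h < n \<and> (l = 0 \<or> lo < n \<and> rank lo + 1 = l) \<and> (h = n - 1 \<or> hi < n \<and> rank hi = h + 1)"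

lemma wp_search_body:
  assumes g: "glob s" and win: "window (s vRlo) (s vRhi) (s vLo) (s vHi)" and ab: "s vA < s vB" "s vB < n"
  defines "m \<equiv> s vA + (s vB - s vA) div 2"
  defines "D \<equiv> card {j \<in> cands (s vRlo) (s vRhi). j \<le> m}"
  shows "wp w M (search_body C) s (\<lambda>s' t. s' vA = (if s vRnk < D then s vA else m + 1) \<and>
    s' vB = (if s vRnk < D then m else s vB) \<and> t \<le> 2 * count_time + 150)"
proof -
  define a z l h lo hi where v: "a = s vA" "z = s vB" "l = s vRlo" "h = s vRhi" "lo = s vLo" "hi = s vHi"
  have win': "l \<le> h" "h < n" "l = 0 \<or> lo < n \<and> rank lo + 1 = l" "h = n - 1 \<or> hi < n \<and> rank hi = h + 1"
    using win unfolding window_def v by auto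
  have m: "m < z" "a \<le> m" "m < n" "m + 1 < n" using ab unfolding m_def v by linarith+
  define H where "H = (if h < n - 1 then less_count hi m else m + 1)"
  define L where "L = (if 0 < l then less_count lo m + (if m < lo then 0 else 1) else 0)"
  have D: "D + L = H" unfolding D_def H_def L_def v[symmetric] using card_cands_upto[OF m(3) win'(4,3,1,2)] .
  \<comment> \<open>Since \<open>m < n - 1\<close>, even counting all positions up to
    \<open>m\<close> does not overflow.\<close>
  have "less_count p m \<le> m + 1" for p
    using card_mono[of "{..m}" "{i. i \<le> m \<and> suf i < suf p}"] unfolding less_count_def by auto
  then have "less_count hi m < n" using m(4) by (rule order_le_less_trans)
  then have Hn: "H < n" using m(4) unfolding H_def by simp
  define s1 where "s1 = s(vMid := m, vX := m)"
  have g1: "glob s1" using g unfolding s1_def glob_def by simp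
  have v1: "s1 vMid = m" "s1 vX = m" "s1 vA = a" "s1 vB = z" "s1 vRlo = l" "s1 vRhi = h" "s1 vLo = lo" "s1 vHi = hi"
    "s1 vN = n - 1" "s1 vRnk = s vRnk"
    unfolding s1_def using v globN[OF g] by auto
  let ?hi = "IF BLt (Rg vRhi) (Rg vN) THEN (vP ::= Rg vHi;; count_com C;; vSel ::= Rg vCnt) ELSE vSel ::= (Rg vMid \<oplus> Im 1)"
  let ?dec = "IF BLt (Rg vMid) (Rg vLo) THEN Skip ELSE inc vCnt"
  let ?lo = "IF positive vRlo THEN (vP ::= Rg vLo;; count_com C;; (?dec);; vSel ::= (Rg vSel \<boxminus> vCnt)) ELSE Skip"
  let ?upd = "IF BLt (Rg vRnk) (Rg vSel) THEN vB ::= Rg vMid ELSE vA ::= (Rg vMid \<oplus> Im 1)"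
  have hi: "wp w M ?hi s1 (\<lambda>s' t. s' vSel = H \<and> t \<le> count_time + 20)"
  proof (cases "h < n - 1")
    case True
    then have HH: "H = less_count hi m" unfolding H_def by simp
    have "wp w M (count_com C) (s1(vP := hi)) (\<lambda>s' t. s' vCnt = less_count hi m \<and> t \<le> count_time)"
      by (rule wp_count) (use g1 v1 win' True m in \<open>auto simp: glob_def\<close>)
    then have "wp w M (count_com C;; vSel ::= Rg vCnt) (s1(vP := hi)) (\<lambda>s' t. s' vSel = H \<and> t \<le> count_time + 2)"
      by (rule wp_Seq_frame) (auto intro!: wp_AsgI simp: HH)
    then show ?thesis using True v1 by (intro wp_CondI wp_Asg_SeqI) (auto elim: wp_mono)
  next
    case False
    then show ?thesis using v1 m by (intro wp_CondI wp_AsgI) (auto simp: H_def)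
  qed
  have lo: "wp w M ?lo s2 (\<lambda>s' t. s' vSel = D \<and> t \<le> count_time + 50)"
    if s2: "s2 vSel = H" and fr: "\<And>y. \<not> wr ?hi y \<Longrightarrow> s2 y = s1 y" for s2
  proof (cases "0 < l")
    case True
    have g2: "glob s2" by (rule glob_pres[OF g1, of ?hi]) (use fr in auto)
    have v2: "s2 vMid = m" "s2 vX = m" "s2 vRlo = l" "s2 vLo = lo" using fr v1 by auto
    have c: "wp w M (count_com C) (s2(vP := lo)) (\<lambda>s' t. s' vCnt = less_count lo m \<and> t \<le> count_time)"
      by (rule wp_count) (use g2 v2 win' True m in \<open>auto simp: glob_def\<close>)
    have LL: "L = less_count lo m + (if m < lo then 0 else 1)" using True unfolding L_def by simp
    have "wp w M (count_com C;; (?dec);; vSel ::= (Rg vSel \<boxminus> vCnt)) (s2(vP := lo)) (\<lambda>s' t. s' vSel = D \<and> t \<le> count_time + 40)"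
    proof (rule wp_Seq_frame[OF c])
      fix s3 :: "var state" and t3 :: nat
      assume a: "s3 vCnt = less_count lo m \<and> t3 \<le> count_time"
        and fr3: "\<And>y. \<not> wr (count_com C) y \<Longrightarrow> s3 y = (s2(vP := lo)) y"
      have v3: "s3 vMid = m" "s3 vLo = lo" "s3 vSel = H" using fr3 v2 s2 by auto
      have "wp w M ?dec s3 (\<lambda>s' t. s' vCnt = L \<and> t \<le> 20)"
        using v3 a D Hn LL by (intro wp_CondI wp_SkipI wp_AsgI) auto
      then show "wp w M (?dec;; vSel ::= (Rg vSel \<boxminus> vCnt)) s3 (\<lambda>s' t. s' vSel = D \<and> t3 + t \<le> count_time + 40)"
      proof (rule wp_Seq_frame)
        fix s4 :: "var state" and t4 :: nat
        assume b: "s4 vCnt = L \<and> t4 \<le> 20" and fr4: "\<And>y. \<not> wr ?dec y \<Longrightarrow> s4 y = s3 y"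
        have "s4 vSel = H" using fr4 v3 by auto
        then show "wp w M (vSel ::= (Rg vSel \<boxminus> vCnt)) s4 (\<lambda>s' t. s' vSel = D \<and> t3 + (t4 + t) \<le> count_time + 40)"
          using a b D Hn by (intro wp_AsgI) auto
      qed
    qed
    then show ?thesis using True v2 by (intro wp_CondI wp_Asg_SeqI) (auto elim: wp_mono)
  next
    case False
    moreover have "s2 vRlo = l" using fr v1 by auto
    ultimately show ?thesis using s2 D by (intro wp_CondI wp_SkipI) (auto simp: L_def)
  qed
  let ?Q = "\<lambda>s' t. s' vA = (if s vRnk < D then s vA else m + 1) \<and> s' vB = (if s vRnk < D then m else s vB)
    \<and> t + 30 \<le> 2 * count_time + 150"
  have "wp w M (?hi;; ?lo;; ?upd) s1 ?Q"
  proof (rule wp_Seq_frame[OF hi])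
    fix s2 :: "var state" and t2 :: nat
    assume a2: "s2 vSel = H \<and> t2 \<le> count_time + 20" and fr2: "\<And>y. \<not> wr ?hi y \<Longrightarrow> s2 y = s1 y"
    have l2: "wp w M ?lo s2 (\<lambda>s' t. s' vSel = D \<and> t \<le> count_time + 50)" using lo a2 fr2 by blast
    have v2: "s2 vMid = m" "s2 vRnk = s vRnk" "s2 vA = a" "s2 vB = z" using fr2 v1 by auto
    show "wp w M (?lo;; ?upd) s2 (\<lambda>s' t. ?Q s' (t2 + t))"
    proof (rule wp_Seq_frame[OF l2])
      fix s3 :: "var state" and t3 :: nat
      assume a3: "s3 vSel = D \<and> t3 \<le> count_time + 50" and fr3: "\<And>y. \<not> wr ?lo y \<Longrightarrow> s3 y = s2 y"
      have v3: "s3 vMid = m" "s3 vRnk = s vRnk" "s3 vA = a" "s3 vB = z" using fr3 v2 by auto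
      show "wp w M ?upd s3 (\<lambda>s' t. ?Q s' (t2 + (t3 + t)))"
        using a2 a3 v3 m v by (intro wp_CondI wp_AsgI) auto
    qed
  qed
  moreover have "s(vMid := aval w (Bin Add (Rg vA) (Bin Shr (Rg vB \<boxminus> vA) (Im 1))) s,
    vX := aval w (Rg vMid) (s(vMid := aval w (Bin Add (Rg vA) (Bin Shr (Rg vB \<boxminus> vA) (Im 1))) s))) = s1"
    using ab m unfolding s1_def by (simp add: m_def v drop_bit_Suc)
  ultimately show ?thesis unfolding search_body_def
    by (intro wp_Asg_SeqI) (simp only:, erule wp_mono, simp)
qed

lemma wp_search:
  assumes g: "glob s" and win: "window (s vRlo) (s vRhi) (s vLo) (s vHi)"
    and k: "s vRnk < s vRhi - s vRlo + 1" and v: "s vA = 0" "s vB = n - 1"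
  shows "wp w M (WHILE BLt (Rg vA) (Rg vB) DO search_body C) s (\<lambda>s' t.
    nth_pos (cands (s vRlo) (s vRhi)) (s vRnk) (s' vA) \<and> t \<le> bitlen n * (2 * count_time + 200) + 10)"
proof -
  define K A where "K = 2 * count_time + 200" and "A = cands (s vRlo) (s vRhi)"
  define lb ub where "lb a = card {j \<in> A. j < a}" and "ub a = card {j \<in> A. j \<le> a}" for a
  define k where "k = s vRnk"
  \<comment> \<open>The candidate number \<open>k\<close> lies between \<open>vA\<close> and
    \<open>vB\<close>: at most \<open>k\<close> candidates precede \<open>vA\<close>, and more than
    \<open>k\<close> lie up to \<open>vB\<close>.\<close>
  let ?I = "\<lambda>s. s vA \<le> s vB \<and> s vB < n \<and> lb (s vA) \<le> k \<and> k < ub (s vB)"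
  have Suc: "lb (a + 1) = ub a" for a unfolding lb_def ub_def by (simp add: less_Suc_eq_le)
  show ?thesis
  proof (rule wp_LoopI[where I = ?I and \<Phi> = "\<lambda>s. bitlen (s vB - s vA) * K"])
    have "A = {j \<in> A. j \<le> n - 1}" unfolding A_def cands_def by auto
    then have "ub (n - 1) = card A" unfolding ub_def by simp
    also have "\<dots> = s vRhi - s vRlo + 1" unfolding A_def by (rule card_cands) (use win in \<open>auto simp: window_def\<close>)
    finally show "?I s" using v assms(3) T_nonempty unfolding k_def by (simp add: lb_def)
  next
    fix s2 :: "var state"
    assume I: "?I s2" and b2: "bval w (BLt (Rg vA) (Rg vB)) s2" and fr: "\<And>y. \<not> wr (search_body C) y \<Longrightarrow> s2 y = s y"
    have g2: "glob s2" by (rule glob_pres[OF g, of "search_body C"]) (use fr in \<open>auto simp: search_body_def\<close>)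
    have v2: "s2 vRlo = s vRlo" "s2 vRhi = s vRhi" "s2 vLo = s vLo" "s2 vHi = s vHi" "s2 vRnk = k"
      using fr unfolding k_def by (auto simp: search_body_def)
    have ab: "s2 vA < s2 vB" "s2 vB < n" using I b2 by auto
    have win2: "window (s2 vRlo) (s2 vRhi) (s2 vLo) (s2 vHi)" unfolding v2 by (rule win)
    define a z m where "a = s2 vA" and "z = s2 vB" and "m = a + (z - a) div 2"
    have m: "a \<le> m" "m < z" "z < n" "m - a \<le> (z - a) div 2" "z - (m + 1) \<le> (z - a) div 2"
      using ab unfolding m_def a_def z_def by linarith+
    have pot: "bitlen x * K + K \<le> bitlen (z - a) * K" if "x \<le> (z - a) div 2" for x
      using mult_le_mono1[OF bitlen_half[OF _ that], of K] m by simp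
    show "wp w M (search_body C) s2 (\<lambda>s' t. ?I s' \<and>
      t + (blen (BLt (Rg vA) (Rg vB) :: var bexp) + 1) + bitlen (s' vB - s' vA) * K \<le> bitlen (s2 vB - s2 vA) * K)"
    proof (rule wp_mono[OF wp_search_body[OF g2 win2 ab]])
      fix s' t
      assume "s' vA = (if s2 vRnk < card {j \<in> cands (s2 vRlo) (s2 vRhi). j \<le> s2 vA + (s2 vB - s2 vA) div 2}
          then s2 vA else s2 vA + (s2 vB - s2 vA) div 2 + 1) \<and>
        s' vB = (if s2 vRnk < card {j \<in> cands (s2 vRlo) (s2 vRhi). j \<le> s2 vA + (s2 vB - s2 vA) div 2}
          then s2 vA + (s2 vB - s2 vA) div 2 else s2 vB) \<and> t \<le> 2 * count_time + 150"
      then have r: "s' vA = (if k < ub m then a else m + 1)" "s' vB = (if k < ub m then m else z)" "t + 50 \<le> K"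
        unfolding v2 ub_def A_def a_def z_def m_def K_def by auto
      have I': "lb a \<le> k" "k < ub z" using I unfolding a_def z_def by auto
      show "?I s' \<and> t + (blen (BLt (Rg vA) (Rg vB) :: var bexp) + 1) + bitlen (s' vB - s' vA) * K \<le> bitlen (s2 vB - s2 vA) * K"
      proof (cases "k < ub m")
        case True
        then show ?thesis using r I' m pot[OF m(4)] unfolding a_def[symmetric] z_def[symmetric] by simp
      next
        case False
        then have "lb (m + 1) \<le> k" unfolding Suc by simp
        then show ?thesis using False r I' m pot[OF m(5)] unfolding a_def[symmetric] z_def[symmetric] by simp
      qed
    qed
  next
    fix s2 :: "var state" and t :: nat
    assume I: "?I s2" and b2: "\<not> bval w (BLt (Rg vA) (Rg vB)) s2"
      and t: "t + bitlen (s2 vB - s2 vA) * K \<le> bitlen (s vB - s vA) * K + blen (BLt (Rg vA) (Rg vB) :: var bexp) + 1"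
    have e: "s2 vB = s2 vA" using I b2 by auto
    then have "lb (s2 vA) \<le> k" "k < ub (s2 vA)" using I by auto
    then have "nth_pos A k (s2 vA)" unfolding lb_def ub_def by (intro nth_posI) (auto simp: A_def)
    moreover have "t + bitlen (s2 vB - s2 vA) * K \<le> bitlen (s vB - s vA) * K + 4" using t by simp
    moreover have "bitlen (s vB - s vA) * K \<le> bitlen n * K" using v by (intro mult_le_mono1 bitlen_mono) simp
    moreover have "t \<le> bitlen n * K + 10" using calculation(2,3) by linarith
    ultimately show "nth_pos (cands (s vRlo) (s vRhi)) (s vRnk) (s2 vA) \<and> t \<le> bitlen n * (2 * count_time + 200) + 10"
      unfolding A_def k_def K_def by simp
  qed
qed

definition sel :: "nat \<Rightarrow> var state \<Rightarrow> bool" where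
  "sel i s \<longleftrightarrow> glob s \<and> s (Par (4 * (C + 2))) = i \<and> s vDone = 0 \<and>
    window (s vRlo) (s vRhi) (s vLo) (s vHi) \<and> s vRlo \<le> i \<and> i \<le> s vRhi"

text \<open>Two countings for each bisection step, and one more for the rank of the pivot.\<close>

definition round_time :: nat where
  "round_time = bitlen n * (2 * count_time + 200) + count_time + 100"

definition outcome :: "nat \<Rightarrow> nat \<Rightarrow> nat \<Rightarrow> nat \<Rightarrow> var state \<Rightarrow> bool" where
  "outcome i l h y s \<longleftrightarrow> rank y = i \<and> s (Par 0) = y \<and> s vDone = 1 \<or>
    sel i s \<and> (if rank y < i then s vRlo = rank y + 1 \<and> s vRhi = h else s vRlo = l \<and> s vRhi = rank y - 1 \<and> i < rank y)"

lemma wp_decide: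
  assumes s: "sel i s" and y: "s vA = y" "y \<in> cands (s vRlo) (s vRhi)"
  shows "wp w M (decide_com C) s (\<lambda>s' t. outcome i (s vRlo) (s vRhi) y s' \<and> t \<le> count_time + 50)"
proof -
  have g: "glob s" and pi: "s (Par (4 * (C + 2))) = i" and win: "window (s vRlo) (s vRhi) (s vLo) (s vHi)"
    and li: "s vRlo \<le> i" "i \<le> s vRhi" "s vDone = 0" using s unfolding sel_def by auto
  have yn: "y < n" "s vRlo \<le> rank y" "rank y \<le> s vRhi" using y(2) unfolding cands_def by auto
  have rn: "rank y < n" using rank_less[OF yn(1)] .
  have hn: "s vRhi < n" using win unfolding window_def by simp
  let ?i = "Par (4 * (C + 2))"
  let ?rest = "IF BEq (Rg vCnt) (Rg ?i) THEN ((Par 0) ::= Rg vA;; vDone ::= Im 1)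
    ELSE IF BLt (Rg vCnt) (Rg ?i) THEN (vLo ::= Rg vA;; vRlo ::= (Rg vCnt \<oplus> Im 1))
    ELSE (vHi ::= Rg vA;; vRhi ::= (Rg vCnt \<ominus> Im 1))"
  define s1 where "s1 = s(vP := y, vX := n - 1)"
  have g1: "glob s1" using g unfolding s1_def glob_def by simp
  have "wp w M (count_com C) s1 (\<lambda>s' t. s' vCnt = less_count y (n - 1) \<and> t \<le> count_time)"
    by (rule wp_count[OF g1]) (use yn in \<open>auto simp: s1_def\<close>)
  then have "wp w M (count_com C;; ?rest) s1 (\<lambda>s' t. outcome i (s vRlo) (s vRhi) y s' \<and> t + 10 \<le> count_time + 50)"
  proof (rule wp_Seq_frame)
    fix s2 :: "var state" and t2 :: nat
    assume a: "s2 vCnt = less_count y (n - 1) \<and> t2 \<le> count_time" and fr: "\<And>y. \<not> wr (count_com C) y \<Longrightarrow> s2 y = s1 y"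
    have g2: "glob s2" by (rule glob_pres[OF g1, of "count_com C"]) (use fr in auto)
    have v2: "s2 vA = y" "s2 ?i = i" "s2 vRlo = s vRlo" "s2 vRhi = s vRhi" "s2 vLo = s vLo" "s2 vHi = s vHi" "s2 vDone = 0"
      using fr y pi li unfolding s1_def by auto
    have c: "s2 vCnt = rank y" using a less_count_rank[OF yn(1)] by simp
    consider "rank y = i" | "rank y < i" | "i < rank y" by linarith
    then show "wp w M ?rest s2 (\<lambda>s' t. outcome i (s vRlo) (s vRhi) y s' \<and> t2 + t + 10 \<le> count_time + 50)"
    proof cases
      case 1
      then show ?thesis using a v2 c by (intro wp_CondI wp_SeqI wp_AsgI) (auto simp: outcome_def)
    next
      case 2
      define s3 where "s3 = s2(vLo := y, vRlo := rank y + 1)"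
      have "window (rank y + 1) (s vRhi) y (s vHi)" using win 2 li yn unfolding window_def by auto
      then have "sel i s3" unfolding sel_def s3_def using v2 g2 2 li by (simp add: glob_def)
      then have o: "outcome i (s vRlo) (s vRhi) y s3" using 2 v2 unfolding outcome_def by (simp add: s3_def)
      have "take_bit w (rank y + 1) = rank y + 1" using 2 li hn by (intro tb) linarith
      then have "s2(vLo := aval w (Rg vA) s2, vRlo := aval w (Rg vCnt \<oplus> Im 1) (s2(vLo := aval w (Rg vA) s2))) = s3"
        unfolding s3_def using v2 c by simp
      then show ?thesis using 2 a v2 c o by (intro wp_CondI wp_SeqI wp_AsgI) auto
    next
      case 3
      define s3 where "s3 = s2(vHi := y, vRhi := rank y - 1)"
      have "window (s vRlo) (rank y - 1) (s vLo) y" using win 3 li yn rn unfolding window_def by auto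
      then have "sel i s3" unfolding sel_def s3_def using v2 g2 3 li by (simp add: glob_def)
      then have o: "outcome i (s vRlo) (s vRhi) y s3" using 3 v2 unfolding outcome_def by (simp add: s3_def)
      have "take_bit w (rank y + 2 ^ w - 1) = rank y - 1" using 3 rn by (intro tb_sub) linarith+
      then have "s2(vHi := aval w (Rg vA) s2, vRhi := aval w (Rg vCnt \<ominus> Im 1) (s2(vHi := aval w (Rg vA) s2))) = s3"
        unfolding s3_def using v2 c by simp
      then show ?thesis using 3 a v2 c o by (intro wp_CondI wp_SeqI wp_AsgI) auto
    qed
  qed
  moreover have "s(vP := aval w (Rg vA) s, vX := aval w (Rg vN) (s(vP := aval w (Rg vA) s))) = s1"
    unfolding s1_def using y globN[OF g] by simp
  ultimately show ?thesis unfolding decide_com_def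
    by (intro wp_Asg_SeqI) (simp only:, erule wp_mono, simp)
qed

text \<open>A window of \<open>2 ^ w\<close> ranks makes the divisor overflow to \<open>0\<close>, and then \<open>u mod 0 = u\<close> is what is needed.\<close>

lemma wp_round:
  assumes s: "sel i s" and u: "s vU < 2 ^ w"
  shows "wp w M (round_com C) s (\<lambda>s' t. (\<exists>y. nth_pos (cands (s vRlo) (s vRhi)) (s vU mod (s vRhi - s vRlo + 1)) y \<and>
    outcome i (s vRlo) (s vRhi) y s') \<and> t \<le> round_time)"
proof -
  define k where "k = s vU mod (s vRhi - s vRlo + 1)"
  have g: "glob s" and win: "window (s vRlo) (s vRhi) (s vLo) (s vHi)" using s unfolding sel_def by auto
  have lh: "s vRlo \<le> s vRhi" "s vRhi < n" using win unfolding window_def by auto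
  define s1 where "s1 = s(vRnk := k, vA := 0, vB := n - 1)"
  have g1: "glob s1" using g unfolding s1_def glob_def by simp
  have s1: "sel i s1" using s g1 unfolding s1_def sel_def by simp
  have v1: "s1 vRlo = s vRlo" "s1 vRhi = s vRhi" "s1 vRnk = k" unfolding s1_def by auto
  have search: "wp w M (WHILE BLt (Rg vA) (Rg vB) DO search_body C) s1 (\<lambda>s' t.
    nth_pos (cands (s1 vRlo) (s1 vRhi)) (s1 vRnk) (s' vA) \<and> t \<le> bitlen n * (2 * count_time + 200) + 10)"
    by (rule wp_search[OF g1]) (use win in \<open>auto simp: s1_def k_def\<close>)
  have "wp w M (WHILE BLt (Rg vA) (Rg vB) DO search_body C;; decide_com C) s1 (\<lambda>s' t. (\<exists>y. nth_pos (cands (s vRlo) (s vRhi)) k y \<and>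
    outcome i (s vRlo) (s vRhi) y s') \<and> t + 30 \<le> round_time)"
  proof (rule wp_Seq_frame[OF search])
    fix s2 :: "var state" and t2 :: nat
    assume a: "nth_pos (cands (s1 vRlo) (s1 vRhi)) (s1 vRnk) (s2 vA) \<and> t2 \<le> bitlen n * (2 * count_time + 200) + 10"
      and fr: "\<And>y. \<not> wr (WHILE BLt (Rg vA) (Rg vB) DO search_body C) y \<Longrightarrow> s2 y = s1 y"
    have g2: "glob s2" by (rule glob_pres[OF g1, of "WHILE BLt (Rg vA) (Rg vB) DO search_body C"])
        (use fr in \<open>auto simp: search_body_def\<close>)
    have v2: "s2 vRlo = s1 vRlo" "s2 vRhi = s1 vRhi" "s2 vLo = s1 vLo" "s2 vHi = s1 vHi" "s2 vDone = s1 vDone"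
      "s2 (Par (4 * (C + 2))) = s1 (Par (4 * (C + 2)))" using fr by (auto simp: search_body_def)
    have s2: "sel i s2" using s1 g2 v2 unfolding sel_def by simp
    have n: "nth_pos (cands (s vRlo) (s vRhi)) k (s2 vA)" using a unfolding v1 by simp
    have "s2 vA \<in> cands (s2 vRlo) (s2 vRhi)" using n unfolding nth_pos_def v2 v1 by simp
    from wp_decide[OF s2 refl this]
    show "wp w M (decide_com C) s2 (\<lambda>s' t. (\<exists>y. nth_pos (cands (s vRlo) (s vRhi)) k y \<and>
      outcome i (s vRlo) (s vRhi) y s') \<and> t2 + t + 30 \<le> round_time)"
      by (rule wp_mono) (use n a in \<open>auto simp: round_time_def v2 v1\<close>)
  qed
  moreover have "s(vRnk := aval w (Bin Mod (Rg vU) (Rg vRhi \<boxminus> vRlo \<oplus> Im 1)) s,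
      vA := aval w (Im 0) (s(vRnk := aval w (Bin Mod (Rg vU) (Rg vRhi \<boxminus> vRlo \<oplus> Im 1)) s)),
      vB := aval w (Rg vN) (s(vRnk := aval w (Bin Mod (Rg vU) (Rg vRhi \<boxminus> vRlo \<oplus> Im 1)) s,
        vA := aval w (Im 0) (s(vRnk := aval w (Bin Mod (Rg vU) (Rg vRhi \<boxminus> vRlo \<oplus> Im 1)) s))))) = s1"
  proof -
    have "s vU mod take_bit w (s vRhi - s vRlo + 1) = k"
    proof (cases "s vRhi - s vRlo + 1 < 2 ^ w")
      case True
      then show ?thesis unfolding k_def by (simp add: take_bit_nat_eq_self)
    next
      case False
      then have e: "s vRhi - s vRlo + 1 = 2 ^ w" using lh T_le by linarith
      show ?thesis unfolding k_def e using u by simp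
    qed
    then show ?thesis unfolding s1_def using globN[OF g] lh by simp
  qed
  ultimately show ?thesis unfolding round_com_def k_def[symmetric]
    by (intro wp_Asg_SeqI) (simp only:, erule wp_mono, simp)
qed

section \<open>Distribution of the pivot and the drop of the potential\<close>

lemma nth_pos_index_inj:
  assumes A: "finite A" and y: "nth_pos A k y" "nth_pos A k y'"
  shows "y = y'"
proof -
  have less: "card {j \<in> A. j < y} < card {j \<in> A. j < y'}" if "y < y'" "y \<in> A" for y y'
    by (rule psubset_card_mono) (use that A in auto)
  show ?thesis using less[of y y'] less[of y' y] y unfolding nth_pos_def by (metis less_irrefl linorder_neqE)
qed

text \<open>Every residue occurs once in each of the \<open>N div m\<close> complete blocks; the
  incomplete block is ignored.\<close>

lemma card_mod_in:
  fixes R :: "nat set"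
  assumes m: "0 < m" and R: "R \<subseteq> {..<m}"
  shows "card R * (N div m) \<le> card {u. u < N \<and> u mod m \<in> R}"
proof -
  have "inj_on (\<lambda>(x, q). x + m * q) (R \<times> {..<N div m})"
  proof (rule inj_onI)
    fix y y' assume "y \<in> R \<times> {..<N div m}" "y' \<in> R \<times> {..<N div m}"
      "(case y of (x, q) \<Rightarrow> x + m * q) = (case y' of (x, q) \<Rightarrow> x + m * q)"
    then obtain x q x' q' where x: "x \<in> R" "x' \<in> R" "x + m * q = x' + m * q'" "y = (x, q)" "y' = (x', q')" by auto
    have "x < m" "x' < m" using x R by auto
    then have "x = (x + m * q) mod m" "x' = (x' + m * q') mod m" by simp_all
    then have "x = x'" using x(3) by simp
    then show "y = y'" using x m by simp
  qed
  then have "card R * (N div m) = card ((\<lambda>(x, q). x + m * q) ` (R \<times> {..<N div m}))"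
    by (simp add: card_image card_cartesian_product)
  also have "\<dots> \<le> card {u. u < N \<and> u mod m \<in> R}"
  proof (rule card_mono)
    show "(\<lambda>(x, q). x + m * q) ` (R \<times> {..<N div m}) \<subseteq> {u. u < N \<and> u mod m \<in> R}"
    proof
      fix u assume "u \<in> (\<lambda>(x, q). x + m * q) ` (R \<times> {..<N div m})"
      then obtain x q where x: "x \<in> R" "q \<in> {..<N div m}" "u = x + m * q" by auto
      then have xm: "x < m" using R by auto
      have "m * (q + 1) \<le> m * (N div m)" using x(2) by (intro mult_le_mono2) simp
      also have "\<dots> \<le> N" by simp
      finally have "m * q + m \<le> N" by simp
      then show "u \<in> {u. u < N \<and> u mod m \<in> R}" using xm x by simp
    qed
  qed simp
  finally show ?thesis .
qed

text \<open>Half of the ranks in a window are not among its lowest or highest quarter.\<close>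

definition central :: "nat \<Rightarrow> nat \<Rightarrow> nat \<Rightarrow> bool" where
  "central m l y \<longleftrightarrow> m \<le> 4 * (rank y - l) + 4 \<and> 4 * (rank y - l) \<le> 3 * m"

text \<open>Two factors of 1 / 2: at least half of the ranks in the window are central, and the
  complete blocks of \<open>m\<close> words make up at least half of all words. Ranks and indices in
  the text are matched by the bijection of candidates with either.\<close>

lemma card_central_words:
  assumes lh: "l \<le> h" "h < n"
  defines "m \<equiv> h - l + 1"
  shows "2 ^ w \<le> 4 * card {u. u < 2 ^ w \<and> (\<forall>y. nth_pos (cands l h) (u mod m) y \<longrightarrow> central m l y)}"
proof -
  define A where "A = cands l h"
  \<comment> \<open>The ends are exactly the smallest and the largest rank that
    \<open>central\<close> allows.\<close>
  define K where "K = {l + (m - 1) div 4..l + 3 * m div 4} \<inter> {l..h}"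
  define Y where "Y = {y \<in> A. rank y \<in> K}"
  define R where "R = (\<lambda>y. card {j \<in> A. j < y}) ` Y"
  have m: "0 < m" "m \<le> 2 ^ w" "card A = m" using lh T_le card_cands[OF lh] unfolding m_def A_def by auto
  have fin: "finite A" unfolding A_def by simp
  have "K = {l + (m - 1) div 4..l + 3 * m div 4}" using lh unfolding K_def m_def by auto
  then have "card K = 3 * m div 4 + 1 - (m - 1) div 4" by simp
  then have K: "m \<le> 2 * card K" using m(1) by linarith
  have "rank ` Y = K"
  proof (intro equalityI subsetI)
    fix k assume k: "k \<in> K"
    then have "k \<in> {..<n}" using lh unfolding K_def by auto
    then obtain y where "y < n" "rank y = k" using rank_bij unfolding bij_betw_def by (metis imageE lessThan_iff)
    then show "k \<in> rank ` Y" using k unfolding Y_def A_def cands_def K_def by auto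
  qed (auto simp: Y_def)
  moreover have "inj_on rank Y" by (rule inj_onI) (use rank_inj in \<open>auto simp: Y_def A_def cands_def\<close>)
  ultimately have "card Y = card K" using card_image by metis
  moreover have idx: "nth_pos A (card {j \<in> A. j < y}) y" if "y \<in> A" for y using that unfolding nth_pos_def by simp
  moreover have "inj_on (\<lambda>y. card {j \<in> A. j < y}) Y"
  proof (rule inj_onI)
    fix y y' assume y: "y \<in> Y" "y' \<in> Y" "card {j \<in> A. j < y} = card {j \<in> A. j < y'}"
    then have "y \<in> A" "y' \<in> A" unfolding Y_def by auto
    then show "y = y'" using nth_pos_index_inj[OF fin idx[of y], of y'] idx[of y'] y(3) by simp
  qed
  ultimately have R: "card R = card K" unfolding R_def by (simp add: card_image)
  have "R \<subseteq> {..<m}"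
  proof
    fix x assume "x \<in> R"
    then obtain y where y: "y \<in> A" "x = card {j \<in> A. j < y}" unfolding R_def Y_def by auto
    have "{j \<in> A. j < y} \<subset> A" using y(1) by auto
    then have "x < card A" unfolding y(2) using fin by (rule psubset_card_mono[rotated])
    then show "x \<in> {..<m}" using m by simp
  qed
  then have "card K * (2 ^ w div m) \<le> card {u. u < 2 ^ w \<and> u mod m \<in> R}" using card_mod_in[OF m(1)] R by metis
  also have "\<dots> \<le> card {u. u < 2 ^ w \<and> (\<forall>y. nth_pos A (u mod m) y \<longrightarrow> central m l y)}"
  proof (rule card_mono)
    show "{u. u < 2 ^ w \<and> u mod m \<in> R} \<subseteq> {u. u < 2 ^ w \<and> (\<forall>y. nth_pos A (u mod m) y \<longrightarrow> central m l y)}"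
    proof clarify
      fix u y assume u: "u mod m \<in> R" and y: "nth_pos A (u mod m) y"
      obtain y' where y': "y' \<in> Y" "u mod m = card {j \<in> A. j < y'}" using u unfolding R_def by auto
      have "y' \<in> A" using y' unfolding Y_def by simp
      then have "y' = y" using nth_pos_index_inj[OF fin idx[of y'], of y] y unfolding y'(2) by simp
      then have "rank y \<in> K" using y' unfolding Y_def by simp
      then show "central m l y" unfolding K_def central_def by auto
    qed
  qed simp
  finally have le: "card K * (2 ^ w div m) \<le> card {u. u < 2 ^ w \<and> (\<forall>y. nth_pos A (u mod m) y \<longrightarrow> central m l y)}" .
  \<comment> \<open>There is at least one complete block as \<open>m \<le> 2 ^ w\<close>, and the
    incomplete one is shorter than a block.\<close>
  have "2 ^ w \<le> 2 * (m * (2 ^ w div m))"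
  proof -
    have "1 \<le> 2 ^ w div m" using div_le_mono[OF m(2), of m] m(1) by simp
    then have "m * 1 \<le> m * (2 ^ w div m)" by (rule mult_le_mono2)
    moreover have "2 ^ w = m * (2 ^ w div m) + 2 ^ w mod m" by simp
    moreover have "2 ^ w mod m < m" using m(1) by simp
    ultimately show ?thesis by linarith
  qed
  also have "\<dots> \<le> 2 * (2 * card K * (2 ^ w div m))" using K by (intro mult_le_mono2 mult_le_mono1)
  also have "\<dots> = 4 * (card K * (2 ^ w div m))" by simp
  also have "\<dots> \<le> 4 * card {u. u < 2 ^ w \<and> (\<forall>y. nth_pos A (u mod m) y \<longrightarrow> central m l y)}"
    using le by (rule mult_le_mono2)
  finally show ?thesis unfolding A_def .
qed

definition size :: "var state \<Rightarrow> nat" where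
  "size s = s vRhi - s vRlo + 1"

text \<open>A central pivot lowers the logarithm to base 4 / 3 by at least 1. It has probability at
  least 1 / 4, and a round with its draw costs at most \<open>c + 1\<close>; hence the weight
  \<open>4 * (c + 1)\<close>. The additional 1 pays for the rounds with a single candidate.\<close>

definition pot :: "real \<Rightarrow> var state \<Rightarrow> real" where
  "pot c s = (if s vDone = 1 then 0 else 4 * (c + 1) * (1 + log (4 / 3) (size s)))"

lemma pot_nonneg: "0 \<le> c \<Longrightarrow> 0 \<le> pot c s"
  unfolding pot_def size_def by simp

lemma outcome_pot:
  assumes s: "sel i s" and y: "y \<in> cands (s vRlo) (s vRhi)" and o: "outcome i (s vRlo) (s vRhi) y s'" and c: "0 \<le> c"
  shows "pot c s' \<le> pot c s" "central (size s) (s vRlo) y \<Longrightarrow> pot c s' \<le> pot c s - 4 * (c + 1)"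
proof -
  define m where "m = size s"
  have sm: "pot c s = 4 * (c + 1) * (1 + log (4 / 3) m)" "0 < m" "s vDone = 0" "s vRlo \<le> i" "i \<le> s vRhi"
    using s unfolding pot_def m_def sel_def size_def by auto
  have yr: "s vRlo \<le> rank y" "rank y \<le> s vRhi" using y unfolding cands_def by auto
  have "(s' vDone = 1 \<or> size s' \<le> m) \<and> (central m (s vRlo) y \<longrightarrow> s' vDone = 1 \<or> 4 * size s' \<le> 3 * m)"
  proof (cases "rank y = i \<and> s' vDone = 1")
    case False
    then have si: "sel i s'" and o': "if rank y < i then s' vRlo = rank y + 1 \<and> s' vRhi = s vRhi
        else s' vRlo = s vRlo \<and> s' vRhi = rank y - 1 \<and> i < rank y"
      using o unfolding outcome_def by auto
    show ?thesis
    proof (cases "rank y < i")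
      case True
      \<comment> \<open>The pivot leaves the window, so this side keeps
        \<open>m - 1 - (rank y - s vRlo)\<close> candidates. The summand 4 in \<open>central\<close>
        accounts for that 1.\<close>
      then have "size s' = s vRhi - rank y" using o' yr sm unfolding size_def by auto
      moreover have "m = s vRhi - s vRlo + 1" unfolding m_def size_def ..
      ultimately show ?thesis using yr unfolding central_def by linarith
    next
      case False
      then have "size s' = rank y - s vRlo" using o' yr sm unfolding size_def by auto
      moreover have "m = s vRhi - s vRlo + 1" unfolding m_def size_def ..
      ultimately show ?thesis using yr unfolding central_def by linarith
    qed
  qed simp
  moreover have "0 < size s'" unfolding size_def by simp
  moreover have "log (4 / 3) x \<le> log (4 / 3) m" if "x \<le> m" "0 < x" for x :: nat
    using that by (subst log_le_cancel_iff) auto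
  moreover have "log (4 / 3) x + 1 \<le> log (4 / 3) m" if x: "4 * x \<le> 3 * m" "0 < x" for x :: nat
  proof -
    have "real (4 * x) \<le> real (3 * m)" using x(1) by (rule of_nat_mono)
    then have "log (4 / 3) (real x * (4 / 3)) \<le> log (4 / 3) m" using x(2) by (subst log_le_cancel_iff) auto
    moreover have "log (4 / 3) (real x * (4 / 3)) = log (4 / 3) x + log (4 / 3) (4 / 3 :: real)"
      using x(2) by (intro log_mult_pos) auto
    ultimately show ?thesis by simp
  qed
  moreover have "0 \<le> log (4 / 3) m" using sm(2) by simp
  ultimately have A: "(if s' vDone = 1 then 0 else 1 + log (4 / 3) (size s')) \<le> 1 + log (4 / 3) m"
    "central m (s vRlo) y \<Longrightarrow> (if s' vDone = 1 then 0 else 1 + log (4 / 3) (size s')) \<le> log (4 / 3) m"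
    by (auto simp: add.commute)
  have p': "pot c s' = 4 * (c + 1) * (if s' vDone = 1 then 0 else 1 + log (4 / 3) (size s'))" unfolding pot_def by simp
  show "pot c s' \<le> pot c s" unfolding p' sm(1) using c by (intro mult_left_mono A) auto
  assume "central (size s) (s vRlo) y"
  then have "pot c s' \<le> 4 * (c + 1) * log (4 / 3) m" unfolding p' using c by (intro mult_left_mono A) (auto simp: m_def)
  then show "pot c s' \<le> pot c s - 4 * (c + 1)" unfolding sm(1) by (simp add: algebra_simps)
qed

end

section \<open>Initialisation\<close>

text \<open>The borrow is passed on before the digit is changed, because the test needs the old
  digit.\<close>

primrec decw :: "'v list \<Rightarrow> 'v com" where
  "decw [] = Skip"
| "decw (x # xs) = (IF BEq (Rg x) (Im 0) THEN decw xs ELSE Skip);; x ::= (Rg x \<ominus> Im 1)"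

primrec subw :: "'v list \<Rightarrow> 'v \<Rightarrow> 'v com" where
  "subw [] v = Skip"
| "subw (x # xs) v = (IF BLt (Rg x) (Rg v) THEN decw xs ELSE Skip);; x ::= (Rg x \<ominus> Rg v)"

primrec posw :: "'v list \<Rightarrow> 'v \<Rightarrow> 'v com" where
  "posw [] v = Skip"
| "posw (x # xs) v = (IF BEq (Rg x) (Im 0) THEN Skip ELSE v ::= Im 1);; posw xs v"

lemma wr_decw: "wr (decw xs) y \<Longrightarrow> y \<in> set xs"
  by (induction xs) auto

lemma wr_subw: "wr (subw xs v) y \<Longrightarrow> y \<in> set xs"
  by (cases xs) (auto dest: wr_decw)

lemma wr_posw: "wr (posw xs v) y \<Longrightarrow> y = v"
  by (induction xs) auto

lemma loopfree_words [simp]: "loopfree (decw xs)" "loopfree (subw xs v)" "loopfree (posw xs v)"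
proof -
  show "loopfree (decw xs)" for xs by (induction xs) auto
  then show "loopfree (subw xs v)" by (cases xs) auto
  show "loopfree (posw xs v)" by (induction xs) auto
qed

lemma wp_decw:
  assumes "1 \<le> w" "distinct xs" "\<And>x. x \<in> set xs \<Longrightarrow> s x < 2 ^ w" "0 < addr_of w xs s"
  shows "wp w M (decw xs) s (\<lambda>s' _. addr_of w xs s' + 1 = addr_of w xs s \<and> (\<forall>x\<in>set xs. s' x < 2 ^ w))"
  using assms(2-)
proof (induction xs arbitrary: s)
  case Nil
  then show ?case by (simp add: addr_of_def)
next
  case (Cons x xs)
  have x: "s x < 2 ^ w" "x \<notin> set xs" using Cons.prems by auto
  have one: "take_bit w (1::nat) = 1" using assms(1) by (simp add: take_bit_eq_mod)
  show ?case
  proof (cases "s x = 0")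
    case False
    then have "take_bit w (s x + 2 ^ w - 1) = s x - 1" using x by (intro sub_less) auto
    then show ?thesis using False x Cons.prems one
      by (auto intro!: wp_SeqI wp_AsgI wp_CondI wp_SkipI simp: addr_of_Cons less_imp_diff_less)
  next
    case True
    have nx: "\<not> wr (decw xs) x" using wr_decw[of xs x] x(2) by auto
    have "0 < addr_of w xs s" using True Cons.prems(3) by (simp add: addr_of_Cons)
    then have "wp w M (decw xs) s (\<lambda>s' _. addr_of w xs s' + 1 = addr_of w xs s \<and> (\<forall>x\<in>set xs. s' x < 2 ^ w))"
      using Cons.IH[of s] Cons.prems by auto
    then have "wp w M (decw xs) s (\<lambda>s' _. (addr_of w xs s' + 1 = addr_of w xs s \<and> (\<forall>x\<in>set xs. s' x < 2 ^ w)) \<and> s' x = 0)"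
      by (rule wp_frame) (use nx True in auto)
    moreover have "take_bit w (2 ^ w - 1) = (2 ^ w - 1 :: nat)" by (simp add: take_bit_nat_eq_self)
    moreover have eq: "2 ^ w + 2 ^ w * a = 2 ^ w * c \<longleftrightarrow> Suc a = c" for a c :: nat
      using mult_cancel1[of "2 ^ w" "Suc a" c] by simp
    ultimately show ?thesis using True x one
      by (auto intro!: wp_SeqI wp_AsgI wp_CondI simp: addr_of_Cons eq elim!: wp_mono)
  qed
qed

lemma wp_subw:
  assumes "1 \<le> w" "distinct xs" "\<And>x. x \<in> set xs \<Longrightarrow> s x < 2 ^ w" "v \<notin> set xs" "s v < 2 ^ w" "s v \<le> addr_of w xs s"
  shows "wp w M (subw xs v) s (\<lambda>s' _. addr_of w xs s' + s v = addr_of w xs s \<and> (\<forall>x\<in>set xs. s' x < 2 ^ w))"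
proof (cases xs)
  case Nil
  then show ?thesis using assms by (auto simp: addr_of_def intro: wp_SkipI)
next
  case (Cons x ys)
  have x: "s x < 2 ^ w" "x \<notin> set ys" "v \<noteq> x" "v \<notin> set ys" using assms Cons by auto
  show ?thesis
  proof (cases "s x < s v")
    case False
    then have "take_bit w (s x + 2 ^ w - s v) = s x - s v" using x by (intro sub_less) auto
    then show ?thesis unfolding Cons using False x assms Cons
      by (auto intro!: wp_SeqI wp_AsgI wp_CondI wp_SkipI simp: addr_of_Cons less_imp_diff_less)
  next
    case True
    have "0 < addr_of w ys s"
    proof (rule ccontr)
      assume "\<not> 0 < addr_of w ys s"
      then show False using assms(6) True unfolding Cons by (simp add: addr_of_Cons)
    qed
    then have "wp w M (decw ys) s (\<lambda>s' _. addr_of w ys s' + 1 = addr_of w ys s \<and> (\<forall>x\<in>set ys. s' x < 2 ^ w))"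
      using wp_decw[of w ys s M] assms Cons by auto
    then have "wp w M (decw ys) s (\<lambda>s' _. (addr_of w ys s' + 1 = addr_of w ys s \<and> (\<forall>x\<in>set ys. s' x < 2 ^ w)) \<and> s' x = s x \<and> s' v = s v)"
      by (rule wp_frame) (use wr_decw[of ys] x in auto)
    then have "wp w M (decw ys) s (\<lambda>s' t. wp w M (x ::= (Rg x \<ominus> Rg v)) s' (\<lambda>s'' _.
      addr_of w xs s'' + s v = addr_of w xs s \<and> (\<forall>x\<in>set xs. s'' x < 2 ^ w)))"
    proof (rule wp_mono)
      fix s' t
      assume a: "(addr_of w ys s' + 1 = addr_of w ys s \<and> (\<forall>x\<in>set ys. s' x < 2 ^ w)) \<and> s' x = s x \<and> s' v = s v"
      have lt: "s x + 2 ^ w - s v < 2 ^ w" using True assms(5) by linarith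
      then have "take_bit w (s x + 2 ^ w - s v) = s x + 2 ^ w - s v" by (simp add: take_bit_nat_eq_self)
      then have e: "s'(x := aval w (Rg x \<ominus> Rg v) s') = s'(x := s x + 2 ^ w - s v)" using a by simp
      have "addr_of w xs s = s x + 2 ^ w * (addr_of w ys s' + 1)" unfolding Cons addr_of_Cons using a by simp
      then show "wp w M (x ::= (Rg x \<ominus> Rg v)) s' (\<lambda>s'' _. addr_of w xs s'' + s v = addr_of w xs s \<and> (\<forall>x\<in>set xs. s'' x < 2 ^ w))"
        using a x lt assms(5) by (intro wp_AsgI) (simp add: e Cons addr_of_Cons del: aval.simps)
    qed
    then show ?thesis unfolding Cons subw.simps using True
      by (intro wp_SeqI wp_CondI) (auto simp: Cons)
  qed
qed

lemma wp_posw: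
  assumes "1 \<le> w" "v \<notin> set xs"
  shows "wp w M (posw xs v) s (\<lambda>s' _. s' = s(v := if addr_of w xs s = 0 then s v else 1))"
  using assms(2)
proof (induction xs arbitrary: s)
  case Nil
  then show ?case by (auto intro: wp_SkipI simp: addr_of_def)
next
  case (Cons x xs)
  have one: "take_bit w (1::nat) = 1" using assms(1) by (simp add: take_bit_eq_mod)
  have v: "v \<notin> set xs" "v \<noteq> x" using Cons.prems by auto
  show ?case
  proof (cases "s x = 0")
    case True
    then have e: "addr_of w (x # xs) s = 0 \<longleftrightarrow> addr_of w xs s = 0" by (simp add: addr_of_Cons)
    have "wp w M (posw xs v) s (\<lambda>s' _. s' = s(v := if addr_of w (x # xs) s = 0 then s v else 1))"
      unfolding e by (rule Cons.IH[OF v(1)])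
    then show ?thesis unfolding posw.simps
      by - (rule wp_SeqI, rule wp_CondI, rule wp_SkipI, assumption, simp add: True)
  next
    case False
    then have e: "s(v := if addr_of w (x # xs) s = 0 then s v else 1) = s(v := 1)" by (simp add: addr_of_Cons)
    have "wp w M (posw xs v) (s(v := 1)) (\<lambda>s' _. s' = s(v := 1))"
      by (rule wp_mono[OF Cons.IH[OF v(1)]]) auto
    then show ?thesis unfolding posw.simps e
      by - (rule wp_SeqI, rule wp_CondI, simp add: False, rule wp_AsgI, simp only: aval.simps one)
  qed
qed

definition bits_words :: "nat \<Rightarrow> var list" where
  "bits_words C = map (\<lambda>j. Par (3 * (C + 2) + j)) [0..<C + 2]"

text \<open>Division by repeated subtraction: \<open>b \<le> C * w\<close>, so \<open>C\<close>
  steps suffice, and the flags collect the quotient in unary. A number of several words is at least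
  \<open>w\<close> if an upper word is positive or the lowest one is at least
  \<open>w\<close>.\<close>

definition div_step :: "nat \<Rightarrow> nat \<Rightarrow> var com" where
  "div_step C k =
    XT ::= Im 0;; posw (tl (bits_words C)) XT;;
    (IF BLt (Rg (Par (3 * (C + 2)))) (Rg vW) THEN Skip ELSE XT ::= Im 1);;
    IF positive XT THEN (subw (bits_words C) vW;; (Flag k) ::= Im 1) ELSE Skip"

definition init_com :: "nat \<Rightarrow> var com" where
  "init_com C =
    vW ::= Rg (Par 0);; vN ::= (Rg (Par (C + 2)) \<ominus> Im 1);; seqs (map (div_step C) [0..<C]);;
    vR ::= Rg (Par (3 * (C + 2)));; vMask ::= (Bin Shl (Im 1) (Rg vR) \<ominus> Im 1);; vRhi ::= Rg vN"

lemma loopfree_init [simp]: "loopfree (init_com C)"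
  unfolding init_com_def div_step_def by (auto simp: loopfree_seqs)

lemma bits_words_Cons: "bits_words C = Par (3 * (C + 2)) # tl (bits_words C)"
  unfolding bits_words_def by (simp add: upt_rec[of 0] del: upt_Suc)

context packed
begin

definition initial :: "nat \<Rightarrow> var state \<Rightarrow> bool" where
  "initial i s \<longleftrightarrow> s (Par 0) = w \<and> s (Par (C + 2)) = take_bit w n \<and> addr_of w (bits_words C) s = b \<and>
    (\<forall>x\<in>set (bits_words C). s x < 2 ^ w) \<and> s (Par (4 * (C + 2))) = i \<and> (\<forall>k. s (Flag k) = 0) \<and> (\<forall>k. s (Sc k) = 0)"

lemma wp_div_step:
  assumes k: "k < C" and s: "s vW = w" "addr_of w (bits_words C) s = b - w * min k (b div w)"
    "\<forall>x\<in>set (bits_words C). s x < 2 ^ w" "\<forall>j<C. s (Flag j) = of_bool (j < k \<and> j < b div w)"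
  shows "wp w M (div_step C k) s (\<lambda>s' _. s' vW = w \<and> addr_of w (bits_words C) s' = b - w * min (Suc k) (b div w) \<and>
    (\<forall>x\<in>set (bits_words C). s' x < 2 ^ w) \<and> (\<forall>j<C. s' (Flag j) = of_bool (j < Suc k \<and> j < b div w)))"
proof -
  let ?bw = "bits_words C" and ?x = "Par (3 * (C + 2))"
  define A where "A = addr_of w ?bw s"
  have nin: "Sc j \<notin> set ?bw" "Flag j \<notin> set ?bw" "Sc j \<notin> set (tl ?bw)" for j
    unfolding bits_words_def by (auto dest!: list.set_sel(2)[rotated] simp del: upt_Suc)
  have dist: "distinct ?bw" unfolding bits_words_def by (auto simp: distinct_map inj_on_def)
  have ww: "w < 2 ^ w" by (rule less_exp)
  have split: "A = s ?x + 2 ^ w * addr_of w (tl ?bw) s"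
    unfolding A_def by (subst bits_words_Cons) (simp add: addr_of_Cons)
  have geq: "w \<le> A \<longleftrightarrow> k < b div w"
  proof (cases "k < b div w")
    case True
    then have "w * Suc k \<le> w * (b div w)" by (intro mult_le_mono2) simp
    also have "\<dots> \<le> b" by simp
    finally have "w * k + w \<le> b" by simp
    then show ?thesis using True unfolding A_def s(2) by simp
  next
    case False
    then have "A = b mod w" unfolding A_def s(2) by (simp add: minus_mult_div_eq_mod)
    then show ?thesis using False mod_less_divisor[OF w_pos, of b] by linarith
  qed
  define s1 where "s1 = s(XT := if addr_of w (tl ?bw) s = 0 then 0 else 1)"
  define s2 where "s2 = s(XT := of_bool (k < b div w))"
  have pos: "wp w M (posw (tl ?bw) XT) (s(XT := 0)) (\<lambda>s' _. s' = s1)"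
    by (rule wp_mono[OF wp_posw]) (use w1 nin in \<open>auto simp: s1_def\<close>)
  have low: "wp w M (IF BLt (Rg ?x) (Rg vW) THEN Skip ELSE XT ::= Im 1) s1 (\<lambda>s' _. s' = s2)"
  proof (cases "s ?x < w")
    case True
    have "w \<le> A \<longleftrightarrow> addr_of w (tl ?bw) s \<noteq> 0"
    proof (cases "addr_of w (tl ?bw) s")
      case (Suc a)
      then have "2 ^ w \<le> 2 ^ w * addr_of w (tl ?bw) s" by simp
      then show ?thesis using ww Suc unfolding split by linarith
    qed (use True split in simp)
    then have "s1 = s2" unfolding s1_def s2_def geq by auto
    then show ?thesis using True s(1) by (intro wp_CondI wp_SkipI wp_AsgI) (auto simp: s1_def)
  next
    case False
    then have "k < b div w" using geq split by linarith
    then show ?thesis using False s(1) by (intro wp_CondI wp_SkipI wp_AsgI) (auto simp: s1_def s2_def)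
  qed
  let ?Q = "\<lambda>s'. s' vW = w \<and> addr_of w ?bw s' = b - w * min (Suc k) (b div w) \<and>
    (\<forall>x\<in>set ?bw. s' x < 2 ^ w) \<and> (\<forall>j<C. s' (Flag j) = of_bool (j < Suc k \<and> j < b div w))"
  have upd: "wp w M (IF positive XT THEN (subw ?bw vW;; (Flag k) ::= Im 1) ELSE Skip) s2 (\<lambda>s' _. ?Q s')"
  proof (cases "k < b div w")
    case False
    have "addr_of w ?bw s2 = addr_of w ?bw s" unfolding s2_def using nin by simp
    moreover have "min (Suc k) (b div w) = min k (b div w)" using False by simp
    moreover have "\<forall>x\<in>set ?bw. s2 x < 2 ^ w" using s(3) nin unfolding s2_def by (metis fun_upd_other)
    moreover have "\<forall>j<C. s2 (Flag j) = of_bool (j < Suc k \<and> j < b div w)" using s(4) False unfolding s2_def by (auto simp: less_Suc_eq)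
    moreover have "s2 vW = w" unfolding s2_def using s(1) by simp
    ultimately have "?Q s2" using s(2) by metis
    then show ?thesis using False by (intro wp_CondI wp_SkipI) (auto simp: s2_def)
  next
    case True
    have ad: "addr_of w ?bw s2 = A" unfolding s2_def A_def using nin by simp
    have v2: "s2 vW = w" "\<And>x. x \<in> set ?bw \<Longrightarrow> s2 x < 2 ^ w" "\<forall>j<C. s2 (Flag j) = of_bool (j < k \<and> j < b div w)"
      using s nin unfolding s2_def by (auto simp del: of_bool_conj)
    have "wp w M (subw ?bw vW) s2 (\<lambda>s' _. addr_of w ?bw s' + s2 vW = addr_of w ?bw s2 \<and> (\<forall>x\<in>set ?bw. s' x < 2 ^ w))"
      by (rule wp_subw) (use w1 dist nin ww v2 ad geq True in auto)
    then have "wp w M (subw ?bw vW;; (Flag k) ::= Im 1) s2 (\<lambda>s' _. ?Q s')"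
    proof (rule wp_Seq_frame)
      fix s3 t3
      assume a: "addr_of w ?bw s3 + s2 vW = addr_of w ?bw s2 \<and> (\<forall>x\<in>set ?bw. s3 x < 2 ^ w)"
        and fr: "\<And>y. \<not> wr (subw ?bw vW) y \<Longrightarrow> s3 y = s2 y"
      have fr': "s3 y = s2 y" if "y \<notin> set ?bw" for y using fr wr_subw that by metis
      have "addr_of w ?bw s3 + w = b - w * k" using a v2(1) ad s(2) True unfolding A_def by simp
      then have "addr_of w ?bw s3 = b - w * k - w" by linarith
      then have "addr_of w ?bw s3 = b - w * Suc k" by simp
      moreover have "s3 vW = w" "\<forall>j<C. s3 (Flag j) = of_bool (j < k \<and> j < b div w)" using fr' nin v2 by auto
      ultimately have "?Q (s3(Flag k := 1))" using True a nin by (auto simp: less_Suc_eq)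
      then show "wp w M ((Flag k) ::= Im 1) s3 (\<lambda>s' _. ?Q s')" by (intro wp_AsgI) (simp only: aval.simps one_bit, blast)
    qed
    then show ?thesis using True by (intro wp_CondI) (auto simp: s2_def)
  qed
  show ?thesis unfolding div_step_def
  proof (rule wp_Asg_SeqI, simp only: aval.simps take_bit_of_0, rule wp_Seq_frame[OF pos], simp only:)
    show "wp w M ((IF BLt (Rg ?x) (Rg vW) THEN Skip ELSE XT ::= Im 1);;
      IF positive XT THEN (subw ?bw vW;; (Flag k) ::= Im 1) ELSE Skip) s1 (\<lambda>s' _. ?Q s')"
      by (rule wp_Seq_frame[OF low]) (use upd in simp)
  qed
qed

lemma wp_init:
  assumes s: "initial i s" and i: "i < n"
  shows "wp w M (init_com C) s (\<lambda>s' t. sel i s' \<and> t \<le> tmax (init_com C))"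
proof (rule wp_tmax)
  let ?bw = "bits_words C" and ?x = "Par (3 * (C + 2))"
  let ?I = "\<lambda>k s'. s' vW = w \<and> addr_of w ?bw s' = b - w * min k (b div w) \<and>
    (\<forall>x\<in>set ?bw. s' x < 2 ^ w) \<and> (\<forall>j<C. s' (Flag j) = of_bool (j < k \<and> j < b div w))"
  define s1 where "s1 = s(vW := w, vN := n - 1)"
  have nin: "Sc j \<notin> set ?bw" "Flag j \<notin> set ?bw" "Par (4 * (C + 2)) \<notin> set ?bw" for j unfolding bits_words_def by auto
  have s0: "s (Par 0) = w" "s (Par (C + 2)) = take_bit w n" "addr_of w ?bw s = b" "\<And>x. x \<in> set ?bw \<Longrightarrow> s x < 2 ^ w"
    "s (Par (4 * (C + 2))) = i" "\<And>k. s (Flag k) = 0" "\<And>k. s (Sc k) = 0"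
    using s unfolding initial_def by auto
  have I0: "?I 0 s1" unfolding s1_def using s0 nin by auto
  have QC: "b div w \<le> C"
    using b_le w1 by (metis div_le_mono nonzero_mult_div_cancel_right not_one_le_zero)
  let ?loop = "seqs (map (div_step C) [0..<C])"
  let ?rest = "vR ::= Rg ?x;; vMask ::= (Bin Shl (Im 1) (Rg vR) \<ominus> Im 1);; vRhi ::= Rg vN"
  have "wp w M ?loop s1 (\<lambda>s' _. ?I C s')"
    by (rule wp_seqs[where I = ?I]) (use wp_div_step I0 in auto)
  then have "wp w M (?loop;; ?rest) s1 (\<lambda>s' _. sel i s')"
  proof (rule wp_Seq_frame)
    fix s2 :: "var state" and t2 :: nat
    assume I: "?I C s2" and fr: "\<And>y. \<not> wr ?loop y \<Longrightarrow> s2 y = s1 y"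
    have same: "s2 y = s1 y" if "y \<notin> set ?bw" "y \<noteq> XT" "\<And>k. y \<noteq> Flag k" for y
    proof (rule fr)
      show "\<not> wr ?loop y" using that wr_subw[of ?bw vW y] wr_posw[of "tl ?bw" XT y] by (auto simp: wr_seqs div_step_def)
    qed
    have v2: "s2 vN = n - 1" "s2 (Par (4 * (C + 2))) = i" "s2 vRlo = 0" "s2 vDone = 0" "s2 vW = w"
      using same nin I s0 unfolding s1_def by auto
    have ad: "addr_of w ?bw s2 = r" using I QC by (simp add: minus_mult_div_eq_mod)
    have rw: "r < w" using w_pos by (rule mod_less_divisor)
    have r2: "r < 2 ^ w" using rw less_exp[of w] by linarith
    \<comment> \<open>The remainder is below \<open>2 ^ w\<close>; so the upper words have become 0
      and the lowest one holds \<open>r\<close>.\<close>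
    have "r = s2 ?x + 2 ^ w * addr_of w (tl ?bw) s2"
      using ad by (subst (asm) bits_words_Cons) (simp add: addr_of_Cons)
    then have x: "s2 ?x = r" using r2 by (cases "addr_of w (tl ?bw) s2") auto
    define s3 where "s3 = s2(vR := r)"
    define s4 where "s4 = s3(vMask := 2 ^ r - 1)"
    define s5 where "s5 = s4(vRhi := n - 1)"
    have fl: "\<forall>j<C. s2 (Flag j) = of_bool (j < C \<and> j < b div w)" using I by blast
    have "glob s5" unfolding glob_def s5_def s4_def s3_def using v2 fl by simp
    moreover have "window 0 (n - 1) (s5 vLo) (s5 vHi)" unfolding window_def using T_nonempty by simp
    ultimately have "sel i s5" unfolding sel_def using v2 i by (simp add: s5_def s4_def s3_def)
    moreover have "2 ^ r < (2 ^ w :: nat)" using rw by simp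
    then have "take_bit w (take_bit w (push_bit r 1) + 2 ^ w - 1) = (2 ^ r - 1 :: nat)"
      by (subst sub_less) (auto simp: push_bit_eq_mult take_bit_less)
    then have "s3(vMask := aval w (Bin Shl (Im 1) (Rg vR) \<ominus> Im 1) s3) = s4" unfolding s4_def by (simp add: s3_def)
    moreover have "s2(vR := aval w (Rg ?x) s2) = s3" unfolding s3_def using x by simp
    moreover have "s4(vRhi := aval w (Rg vN) s4) = s5" unfolding s5_def s4_def s3_def using v2 by simp
    ultimately show "wp w M ?rest s2 (\<lambda>s' _. sel i s')" by (intro wp_Asg_SeqI wp_AsgI) (simp only:)
  qed
  moreover have "s(vW := aval w (Rg (Par 0)) s, vN := aval w (Rg (Par (C + 2)) \<ominus> Im 1) (s(vW := aval w (Rg (Par 0)) s))) = s1"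
  proof -
    \<comment> \<open>For \<open>n = 2 ^ w\<close> the lowest word of \<open>n\<close> is 0, and the
      subtraction wraps around to the correct \<open>n - 1\<close>.\<close>
    have "take_bit w (take_bit w n + 2 ^ w - 1) = n - 1"
    proof (cases "n = 2 ^ w")
      case True
      then show ?thesis by (simp add: take_bit_nat_eq_self)
    next
      case False
      then have "n < 2 ^ w" using T_le by simp
      then show ?thesis using T_nonempty by (simp add: take_bit_less sub_less)
    qed
    then show ?thesis unfolding s1_def using s0 by simp
  qed
  ultimately show "wp w M (init_com C) s (\<lambda>s' _. sel i s')" unfolding init_com_def
    by (intro wp_Asg_SeqI) (simp only:)
qed simp

end

section \<open>Expected running time\<close>

lemma halted_step: "halted P s \<Longrightarrow> step P w u s = s"
  by (simp add: step_def)

lemma run_Suc_shift: "run P w s \<omega> (Suc t) = run P w (step P w (\<omega> 0) s) (\<lambda>k. \<omega> (Suc k)) t"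
  using run_add[of P w s \<omega> 1 t] by simp

lemma halted_run: "halted P s \<Longrightarrow> run P w s \<omega> t = s"
  by (induction t) (auto simp: halted_step)

lemma halted_run_mono:
  assumes "halted P (run P w s \<omega> t)" "t \<le> t'"
  shows "run P w s \<omega> t' = run P w s \<omega> t"
  using run_add[of P w s \<omega> t "t' - t"] halted_run[OF assms(1)] assms(2) by simp

abbreviation "coin w \<equiv> uniform_count_measure {..<(2::nat) ^ w}"

lemma space_coin: "space (coin w) = {..<2 ^ w}"
  by (simp add: uniform_count_measure_def space_point_measure)

lemma ennreal_two_power: "(2::ennreal) ^ w = ennreal (2 ^ w)"
  by (simp add: ennreal_power[symmetric])

lemma prob_space_coin: "prob_space (coin w)"
  by (rule prob_space_uniform_count_measure) (auto simp: lessThan_empty_iff)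

lemma sequence_space_coin: "sequence_space (coin w)"
proof -
  interpret prob_space "coin w" by (rule prob_space_coin)
  show ?thesis by unfold_locales
qed

lemma prob_space_random_words: "prob_space (random_words w)"
proof -
  interpret sequence_space "coin w" by (rule sequence_space_coin)
  show ?thesis unfolding random_words_def by (rule prob_space_PiM) (rule prob_space_coin)
qed

lemma space_random_words: "\<omega> \<in> space (random_words w) \<longleftrightarrow> (\<forall>t. \<omega> t < 2 ^ w)"
  unfolding random_words_def by (auto simp: space_PiM PiE_iff space_coin)

text \<open>The last step depends on one of finitely many values of \<open>\<omega> t\<close>, so
  the event is a finite union of events about time \<open>t\<close>. Generalising over
  \<open>Q\<close> avoids a measurable structure on configurations.\<close>

lemma run_measurable: "{\<omega> \<in> space (random_words w). Q (run P w s \<omega> t)} \<in> sets (random_words w)"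
proof (induction t arbitrary: Q)
  case 0
  then show ?case by (cases "Q s") auto
next
  case (Suc t)
  have c: "{\<omega> \<in> space (random_words w). \<omega> t = u} \<in> sets (random_words w)" for u
  proof (cases "u < 2 ^ w")
    case True
    have [measurable]: "(\<lambda>\<omega>. \<omega> t) \<in> measurable (random_words w) (coin w)"
      unfolding random_words_def by measurable
    have "(\<lambda>\<omega>. \<omega> t) -` {u} \<inter> space (random_words w) \<in> sets (random_words w)"
      using True by (intro measurable_sets[of _ _ "coin w"]) (auto simp: sets_uniform_count_measure)
    then show ?thesis by (simp add: vimage_def Int_def conj_commute)
  next
    case False
    then have e: "{\<omega> \<in> space (random_words w). \<omega> t = u} = {}" by (auto simp: space_random_words)
    show ?thesis unfolding e by simp
  qed
  have "{\<omega> \<in> space (random_words w). Q (run P w s \<omega> (Suc t))} =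
    (\<Union>u<2 ^ w. {\<omega> \<in> space (random_words w). \<omega> t = u} \<inter> {\<omega> \<in> space (random_words w). Q (step P w u (run P w s \<omega> t))})"
    by (auto simp: space_random_words)
  then show ?case using Suc c by auto
qed

section \<open>Survival probabilities and expected time\<close>

definition alive :: "prog \<Rightarrow> nat \<Rightarrow> nat \<Rightarrow> config \<Rightarrow> ennreal" where
  "alive P w t s = emeasure (random_words w) {\<omega> \<in> space (random_words w). \<not> halted P (run P w s \<omega> t)}"

definition avg :: "nat \<Rightarrow> (nat \<Rightarrow> ennreal) \<Rightarrow> ennreal" where
  "avg w f = (\<Sum>u<2 ^ w. f u) / 2 ^ w"

lemma nn_integral_coin: "(\<integral>\<^sup>+ u. f u \<partial>coin w) = avg w f"
proof -
  have "(\<integral>\<^sup>+ u. f u \<partial>coin w) = (\<Sum>u<2 ^ w. f u * (1 / 2 ^ w))"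
    unfolding uniform_count_measure_def
    by (subst nn_integral_point_measure_finite)
      (auto simp: mult.commute ennreal_two_power divide_ennreal simp flip: ennreal_1 intro!: sum.cong)
  also have "\<dots> = avg w f"
    unfolding avg_def by (simp add: divide_ennreal_def sum_distrib_right)
  finally show ?thesis .
qed

text \<open>First-step analysis: the sequence space is the product of its first coordinate and the
  space of the shifted sequences, so the configuration after one step meets a fresh
  sequence.\<close>

lemma alive_Suc: "alive P w (Suc t) s = avg w (\<lambda>u. alive P w t (step P w u s))"
proof -
  interpret sequence_space "coin w" by (rule sequence_space_coin)
  interpret RW: prob_space "random_words w" by (rule prob_space_random_words)
  let ?R = "random_words w"
  let ?A = "{\<omega> \<in> space ?R. \<not> halted P (run P w s \<omega> (Suc t))}"
  have A: "?A \<in> sets ?R" by (rule run_measurable)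
  let ?f = "\<lambda>(u, \<omega>). case_nat u \<omega>"
  have f: "?f \<in> measurable (coin w \<Otimes>\<^sub>M ?R) ?R"
    unfolding random_words_def by (simp add: split_beta')
  have "alive P w (Suc t) s = emeasure (distr (coin w \<Otimes>\<^sub>M ?R) ?R ?f) ?A"
    unfolding alive_def using PiM_iter by (simp add: random_words_def)
  also have "\<dots> = emeasure (coin w \<Otimes>\<^sub>M ?R) (?f -` ?A \<inter> space (coin w \<Otimes>\<^sub>M ?R))"
    by (rule emeasure_distr[OF f A])
  also have "\<dots> = (\<integral>\<^sup>+ u. emeasure ?R (Pair u -` (?f -` ?A \<inter> space (coin w \<Otimes>\<^sub>M ?R))) \<partial>coin w)"
    by (rule RW.emeasure_pair_measure_alt) (rule measurable_sets[OF f A])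
  also have "\<dots> = (\<integral>\<^sup>+ u. alive P w t (step P w u s) \<partial>coin w)"
  proof (rule nn_integral_cong)
    fix u assume u: "u \<in> space (coin w)"
    have "Pair u -` (?f -` ?A \<inter> space (coin w \<Otimes>\<^sub>M ?R)) = {\<omega> \<in> space ?R. \<not> halted P (run P w (step P w u s) \<omega> t)}"
      using u by (auto simp: space_pair_measure space_coin run_Suc_shift space_random_words split: nat.splits simp del: run.simps)
    then show "emeasure ?R (Pair u -` (?f -` ?A \<inter> space (coin w \<Otimes>\<^sub>M ?R))) = alive P w t (step P w u s)"
      unfolding alive_def by simp
  qed
  finally show ?thesis unfolding nn_integral_coin .
qed

text \<open>The expected time truncated at \<open>N\<close> steps. Bounds for it can be shown by
  induction on \<open>N\<close>, before the expectation is known to be finite.\<close>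

definition work :: "prog \<Rightarrow> nat \<Rightarrow> nat \<Rightarrow> config \<Rightarrow> ennreal" where
  "work P w N s = (\<Sum>t<N. alive P w t s)"

text \<open>The running time counts the moments at which the machine has not halted; this also
  covers divergence.\<close>

lemma run_time_suminf: "run_time P w s \<omega> = (\<Sum>t. indicator {t. \<not> halted P (run P w s \<omega> t)} t)"
proof (cases "\<exists>t. halted P (run P w s \<omega> t)")
  case True
  define k where "k = (LEAST t. halted P (run P w s \<omega> t))"
  have k: "halted P (run P w s \<omega> k)" unfolding k_def by (rule LeastI_ex[OF True])
  have "(indicator {t. \<not> halted P (run P w s \<omega> t)} t :: ennreal) = (if t \<in> {..<k} then 1 else 0)" for t
  proof (cases "t < k")
    case True
    then show ?thesis using not_less_Least[of t "\<lambda>t. halted P (run P w s \<omega> t)"] unfolding k_def by auto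
  next
    case False
    then show ?thesis using halted_run_mono[OF k, of t] k by auto
  qed
  then have "(\<Sum>t. indicator {t. \<not> halted P (run P w s \<omega> t)} t :: ennreal) = (\<Sum>t\<in>{..<k}. 1)"
    by (simp only:, intro trans[OF suminf_finite[of "{..<k}"]]) auto
  then show ?thesis using True unfolding run_time_def k_def by simp
next
  case False
  then have "(\<Sum>t. indicator {t. \<not> halted P (run P w s \<omega> t)} t :: ennreal) = (\<Sum>t. 1)" by simp
  also have "\<dots> = \<infinity>"
  proof -
    have "of_nat k \<le> (\<Sum>t. 1 :: ennreal)" for k
      using sum_le_suminf[of "\<lambda>_. 1 :: ennreal" "{..<k}"] by simp
    then show ?thesis using ennreal_Ex_less_of_nat[of "\<Sum>t. 1"] by (metis infinity_ennreal_def leD less_top)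
  qed
  finally show ?thesis using False unfolding run_time_def by simp
qed

text \<open>The tail formula for the expectation; sum and integral are exchanged since all terms are
  nonnegative and measurable.\<close>

lemma expected_time_suminf: "expected_time P w s = (\<Sum>t. alive P w t s)"
proof -
  have "expected_time P w s = (\<integral>\<^sup>+ \<omega>. (\<Sum>t. indicator {\<omega> \<in> space (random_words w). \<not> halted P (run P w s \<omega> t)} \<omega>) \<partial>random_words w)"
    unfolding expected_time_def run_time_suminf by (intro nn_integral_cong suminf_cong) (simp add: indicator_def)
  also have "\<dots> = (\<Sum>t. \<integral>\<^sup>+ \<omega>. indicator {\<omega> \<in> space (random_words w). \<not> halted P (run P w s \<omega> t)} \<omega> \<partial>random_words w)"
    by (rule nn_integral_suminf) (intro borel_measurable_indicator run_measurable)
  also have "\<dots> = (\<Sum>t. alive P w t s)"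
    unfolding alive_def by (intro suminf_cong nn_integral_indicator run_measurable)
  finally show ?thesis .
qed

lemma expected_time_le: "(\<And>N. work P w N s \<le> v) \<Longrightarrow> expected_time P w s \<le> v"
  unfolding expected_time_suminf work_def by (rule suminf_le_const) auto

lemma avg_mono: "(\<And>u. u < 2 ^ w \<Longrightarrow> f u \<le> g u) \<Longrightarrow> avg w f \<le> avg w g"
  unfolding avg_def by (intro divide_right_mono_ennreal sum_mono) auto

lemma avg_const: "avg w (\<lambda>_. c) = c"
proof -
  have "avg w (\<lambda>_. c) = c * (2 ^ w / 2 ^ w)" unfolding avg_def by (simp add: ennreal_times_divide mult.commute)
  also have "(2 ^ w / 2 ^ w :: ennreal) = 1" by (rule ennreal_divide_self) (auto simp: ennreal_two_power)
  finally show ?thesis by simp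
qed

lemma avg_sum: "avg w (\<lambda>u. \<Sum>t\<in>A. f t u) = (\<Sum>t\<in>A. avg w (f t))"
  unfolding avg_def by (subst sum.swap) (simp add: divide_ennreal_def sum_distrib_right)

lemma avg_add_const: "avg w (\<lambda>u. c + f u) = c + avg w f"
  using avg_const[of w c] unfolding avg_def by (simp add: sum.distrib divide_ennreal_def distrib_right)

lemma alive_0_le: "alive P w 0 s \<le> 1"
proof -
  interpret prob_space "random_words w" by (rule prob_space_random_words)
  show ?thesis unfolding alive_def by (rule emeasure_le_1)
qed

lemma work_0: "work P w 0 s = 0"
  unfolding work_def by simp

lemma work_mono: "N \<le> N' \<Longrightarrow> work P w N s \<le> work P w N' s"
  unfolding work_def by (rule sum_mono2) auto

lemma work_halted: "halted P s \<Longrightarrow> work P w N s = 0"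
  unfolding work_def alive_def by (simp add: halted_run)

lemma work_Suc: "work P w (Suc N) s \<le> 1 + avg w (\<lambda>u. work P w N (step P w u s))"
  unfolding work_def sum.lessThan_Suc_shift alive_Suc avg_sum
  by (rule add_right_mono) (rule alive_0_le)

lemma reach_Suc: "reach P w s (Suc t) s' \<Longrightarrow> reach P w (step P w u s) t s'"
  unfolding reach_def
proof
  fix \<omega> :: "nat \<Rightarrow> nat"
  assume "\<forall>\<omega>. run P w s \<omega> (Suc t) = s'"
  from spec[OF this, of "case_nat u \<omega>"] show "run P w (step P w u s) \<omega> t = s'"
    unfolding run_Suc_shift by simp
qed

text \<open>Steps without a draw consume random words as well, but averaging over an ignored word
  changes nothing. The horizon \<open>N\<close> is kept on the right, at the expense of
  monotonicity, so that no subtraction occurs.\<close>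

lemma work_reach: "reach P w s t s' \<Longrightarrow> work P w N s \<le> of_nat t + work P w N s'"
proof (induction t arbitrary: s)
  case 0
  then show ?case by (simp add: reach_def)
next
  case (Suc t)
  have "work P w N s \<le> work P w (Suc N) s" by (rule work_mono) simp
  also have "\<dots> \<le> 1 + avg w (\<lambda>u. work P w N (step P w u s))" by (rule work_Suc)
  also have "\<dots> \<le> 1 + avg w (\<lambda>u. of_nat t + work P w N s')"
    using Suc.IH[OF reach_Suc[OF Suc.prems]] by (intro add_left_mono avg_mono) auto
  also have "\<dots> = of_nat (Suc t) + work P w N s'" unfolding avg_const by (simp add: add.assoc)
  finally show ?case .
qed

text \<open>
  \<open>H s v\<close>: the configuration \<open>s\<close> is about to draw a random word, and \<open>v\<close> is a potential that bounds the expected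
  remaining time.
\<close>

lemma work_potential:
  assumes step: "\<And>s v. H s v \<Longrightarrow> \<exists>f :: nat \<Rightarrow> real.
      (\<forall>u<2 ^ w. 0 \<le> f u \<and> (\<exists>t s'. reach P w (step P w u s) t s' \<and> real t \<le> c \<and> (halted P s' \<or> H s' (f u)))) \<and>
      1 + c + (\<Sum>u<2 ^ w. f u) / 2 ^ w \<le> v"
    and c: "0 \<le> c" and H: "H s v"
  shows "work P w N s \<le> ennreal v"
  using H
proof (induction N arbitrary: s v)
  case 0
  then show ?case by (simp add: work_0)
next
  case (Suc N)
  obtain f where f: "\<And>u. u < 2 ^ w \<Longrightarrow> 0 \<le> f u \<and>
      (\<exists>t s'. reach P w (step P w u s) t s' \<and> real t \<le> c \<and> (halted P s' \<or> H s' (f u)))"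
    and v: "1 + c + (\<Sum>u<2 ^ w. f u) / 2 ^ w \<le> v"
    using step[OF Suc.prems] by blast
  have le: "work P w N (step P w u s) \<le> ennreal c + ennreal (f u)" if u: "u < 2 ^ w" for u
  proof -
    obtain t s' where t: "reach P w (step P w u s) t s'" "real t \<le> c" "halted P s' \<or> H s' (f u)"
      using f[OF u] by blast
    have "work P w N (step P w u s) \<le> of_nat t + work P w N s'" by (rule work_reach[OF t(1)])
    also have "of_nat t \<le> ennreal c" using t(2) by (simp add: ennreal_of_nat_eq_real_of_nat ennreal_leI)
    also have "work P w N s' \<le> ennreal (f u)" using t(3) work_halted Suc.IH by auto
    finally show ?thesis by (simp add: add_mono)
  qed
  have "work P w (Suc N) s \<le> 1 + avg w (\<lambda>u. work P w N (step P w u s))" by (rule work_Suc)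
  also have "\<dots> \<le> 1 + avg w (\<lambda>u. ennreal c + ennreal (f u))"
    by (intro add_left_mono avg_mono le)
  also have "\<dots> = 1 + (ennreal c + avg w (\<lambda>u. ennreal (f u)))" unfolding avg_add_const ..
  also have "avg w (\<lambda>u. ennreal (f u)) = ennreal ((\<Sum>u<2 ^ w. f u) / 2 ^ w)"
  proof -
    have "0 \<le> (\<Sum>u<2 ^ w. f u)" using f by (intro sum_nonneg) auto
    moreover have "(\<Sum>u<2 ^ w. ennreal (f u)) = ennreal (\<Sum>u<2 ^ w. f u)" using f by (intro sum_ennreal) auto
    ultimately show ?thesis unfolding avg_def ennreal_two_power by (simp add: divide_ennreal)
  qed
  also have "1 + (ennreal c + ennreal ((\<Sum>u<2 ^ w. f u) / 2 ^ w)) = ennreal (1 + c + (\<Sum>u<2 ^ w. f u) / 2 ^ w)"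
  proof -
    have "0 \<le> (\<Sum>u<2 ^ w. f u) / 2 ^ w" using f by (intro divide_nonneg_nonneg sum_nonneg) auto
    then show ?thesis using c by (simp only: add.assoc ennreal_plus add_nonneg_nonneg zero_le_one flip: ennreal_1)
  qed
  also have "\<dots> \<le> ennreal v" by (rule ennreal_leI[OF v])
  finally show ?case .
qed

text \<open>\<open>G\<close> describes the configurations that are about to draw. The conclusion
  holds for every sequence of words: the result is never wrong, and only termination is a matter of
  probability.\<close>

lemma halts_invariant:
  assumes step: "\<And>s u. G s \<Longrightarrow> u < 2 ^ w \<Longrightarrow> \<not> halted P s \<and>
      (\<exists>t s'. reach P w (step P w u s) t s' \<and> (halted P s' \<and> R s' \<or> G s'))"
    and G: "G s" and \<omega>: "\<And>t. \<omega> t < 2 ^ w" and h: "halted P (run P w s \<omega> t)"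
  shows "R (run P w s \<omega> t)"
  using G \<omega> h
proof (induction t arbitrary: s \<omega> rule: less_induct)
  case (less t)
  obtain k s' where k: "reach P w (step P w (\<omega> 0) s) k s'" "halted P s' \<and> R s' \<or> G s'"
    using step[OF less.prems(1), of "\<omega> 0"] less.prems(2) by blast
  have e: "run P w s \<omega> (Suc k) = s'" using k(1) unfolding run_Suc_shift reach_def by blast
  show ?case
  proof (cases "t < Suc k")
    case True
    \<comment> \<open>A machine that halts before the next checkpoint stays as it is, so it has
      reached \<open>s'\<close>; and \<open>G s'\<close> is impossible since such configurations
      have not halted.\<close>
    then have "run P w s \<omega> t = s'" using halted_run_mono[OF less.prems(3), of "Suc k"] e by simp
    then show ?thesis using k(2) step[of s' 0] less.prems(3) by auto
  next
    case False
    have r: "run P w s \<omega> t = run P w s' (\<lambda>i. \<omega> (Suc k + i)) (t - Suc k)"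
      using run_add[of P w s \<omega> "Suc k" "t - Suc k"] e False by simp
    show ?thesis
    proof (cases "G s'")
      case True
      then show ?thesis unfolding r using less.prems r False by (intro less.IH) auto
    next
      case False
      then show ?thesis using k(2) unfolding r by (simp add: halted_run)
    qed
  qed
qed

lemma almost_surely_halts:
  assumes "expected_time P w s \<le> ennreal v"
  shows "measure (random_words w) {\<omega> \<in> space (random_words w). \<exists>t. halted P (run P w s \<omega> t)} = 1"
proof -
  interpret prob_space "random_words w" by (rule prob_space_random_words)
  let ?A = "{\<omega> \<in> space (random_words w). \<exists>t. halted P (run P w s \<omega> t)}"
  have "?A = (\<Union>t. {\<omega> \<in> space (random_words w). halted P (run P w s \<omega> t)})" by auto
  then have A: "?A \<in> events" using run_measurable[of w "halted P"] by auto
  have m: "(\<lambda>\<omega>. run_time P w s \<omega>) \<in> borel_measurable (random_words w)"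
  proof -
    have "(\<lambda>\<omega>. \<Sum>t. indicator {\<omega> \<in> space (random_words w). \<not> halted P (run P w s \<omega> t)} \<omega> :: ennreal) \<in> borel_measurable (random_words w)"
      by (intro borel_measurable_suminf_order borel_measurable_indicator run_measurable)
    moreover have "run_time P w s \<omega> = (\<Sum>t. indicator {\<omega> \<in> space (random_words w). \<not> halted P (run P w s \<omega> t)} \<omega>)"
      if "\<omega> \<in> space (random_words w)" for \<omega>
      unfolding run_time_suminf using that by (intro suminf_cong) (simp add: indicator_def)
    ultimately show ?thesis using measurable_cong[of "random_words w"] by (metis (no_types, lifting))
  qed
  have "expected_time P w s \<noteq> \<infinity>" using assms by (auto simp: top_unique)
  then have "AE \<omega> in random_words w. run_time P w s \<omega> \<noteq> \<infinity>"
    unfolding expected_time_def by (rule nn_integral_PInf_AE[OF m])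
  then have "AE \<omega> in random_words w. \<omega> \<in> ?A"
    by (rule AE_mp) (auto intro!: AE_I2 simp: run_time_def split: if_splits)
  then show ?thesis using prob_eq_1[OF A] by blast
qed

section \<open>The selection program\<close>

context regmap
begin

text \<open>The only random instruction is placed by hand at the head of the loop. The final test
  jumps back to it or falls off the end of the program, which is how the machine halts.\<close>

definition loop_prog :: "'v com \<Rightarrow> 'v \<Rightarrow> 'v com \<Rightarrow> 'v bexp \<Rightarrow> prog" where
  "loop_prog c1 x c2 t = (let p = comp c1 0 in p @ [Rand (\<rho> x)] @ comp c2 (Suc (length p)) @ cbexp t (length p))"

lemma loop_prog_no_store: "Store as a \<notin> set (loop_prog c1 x c2 t)"
proof -
  have e: "Store as a \<notin> set (cexp e k)" for e k by (induction e arbitrary: k) auto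
  have "Store as a \<notin> set (cbexp t k)" for k by (cases t) (auto simp: e)
  then show ?thesis unfolding loop_prog_def Let_def using comp_no_store by auto
qed

lemma loop_prog_start:
  assumes "uses_regs_below R (loop_prog c1 x c2 t)" "big w M c1 s k s'" "sim R M 0 s cfg"
  shows "\<exists>cfg'. reach (loop_prog c1 x c2 t) w cfg k cfg' \<and> sim R M (length (comp c1 0)) s' cfg'"
proof -
  have "code_at (loop_prog c1 x c2 t) 0 (comp c1 0)"
    unfolding code_at_def loop_prog_def Let_def by (intro exI[of _ "[]"] exI) auto
  from comp_correct[OF assms(1,2) this assms(3)] show ?thesis by simp
qed

lemma loop_prog_round:
  fixes c1 :: "'v com"
  defines "a \<equiv> length (comp c1 0)"
  assumes R: "uses_regs_below R (loop_prog c1 x c2 t)" and s: "sim R M a s cfg" and c: "big w M c2 (s(x := u)) k s'"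
  shows "\<not> halted (loop_prog c1 x c2 t) cfg"
    and "\<exists>cfg'. reach (loop_prog c1 x c2 t) w (step (loop_prog c1 x c2 t) w u cfg) (k + blen t) cfg' \<and>
      sim R M (if bval w t s' then a else length (loop_prog c1 x c2 t)) s' cfg'"
proof -
  let ?P = "loop_prog c1 x c2 t"
  have P: "?P = comp c1 0 @ [Rand (\<rho> x)] @ comp c2 (Suc a) @ cbexp t a" unfolding loop_prog_def a_def Let_def ..
  have at1: "code_at ?P a [Rand (\<rho> x)]" unfolding P code_at_def a_def by (intro exI conjI) auto
  have at2: "code_at ?P (Suc a) (comp c2 (Suc a))"
    unfolding code_at_def P by (intro exI[of _ "comp c1 0 @ [Rand (\<rho> x)]"] exI) (auto simp: a_def)
  have at3: "code_at ?P (Suc a + length (comp c2 (Suc a))) (cbexp t a @ [])"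
    unfolding code_at_def P by (intro exI[of _ "comp c1 0 @ [Rand (\<rho> x)] @ comp c2 (Suc a)"] exI) (auto simp: a_def)
  have pc: "pc cfg = a" using s unfolding sim_def by simp
  have lt: "a < length ?P" "?P ! a = Rand (\<rho> x)" using code_at_ConsD[OF at1] by auto
  then show nh: "\<not> halted ?P cfg" unfolding halted_def pc by simp
  have xR: "\<rho> x < R" using code_at_regs[OF R at1] by simp
  have st: "step ?P w u cfg = set_reg (\<rho> x) u cfg" using nh lt unfolding step_def pc by simp
  have "sim R M (Suc a) (s(x := u)) (step ?P w u cfg)"
    using s xR unfolding st by (auto simp: sim_def rel_def set_reg_def nth_list_update)
  then obtain d where d: "reach ?P w (step ?P w u cfg) k d" "sim R M (Suc a + length (comp c2 (Suc a))) s' d"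
    using comp_correct[OF R c at2] by blast
  obtain e where e: "reach ?P w d (blen t) e"
    "sim R M (if bval w t s' then a else Suc a + length (comp c2 (Suc a)) + blen t) s' e"
    using cbexp_correct[OF R at3 d(2), of w] by blast
  have "Suc a + length (comp c2 (Suc a)) + blen t = length ?P" unfolding P by (simp add: a_def)
  then show "\<exists>cfg'. reach ?P w (step ?P w u cfg) (k + blen t) cfg' \<and> sim R M (if bval w t s' then a else length ?P) s' cfg'"
    using reach_trans[OF d(1) e(1)] e(2) by auto
qed

end

lemma mem_run:
  assumes "\<And>as a. Store as a \<notin> set P"
  shows "mem (run P w s \<omega> t) = mem s"
proof (induction t)
  case (Suc t)
  have e: "mem (exec w u ins s) = mem s" if "\<And>as a. ins \<noteq> Store as a" for u ins s
    using that by (cases ins) (auto simp: set_reg_def)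
  have "mem (step P w u c) = mem c" for u c
  proof (cases "halted P c")
    case False
    then have "P ! pc c \<in> set P" unfolding halted_def by simp
    then have "P ! pc c \<noteq> Store as a" for as a using assms[of as a] by metis
    then have "mem (exec w u (P ! pc c) c) = mem c" by (rule e)
    then show ?thesis using False unfolding step_def by simp
  qed (simp add: step_def)
  then show ?case using Suc by simp
qed simp

text \<open>A finite program mentions finitely many registers. As the program depends on
  \<open>C\<close> only, this is the constant working space.\<close>

lemma ex_uses_regs_below: "\<exists>S. uses_regs_below (m + S) P"
proof -
  have "finite (instr_regs ins)" for ins by (cases ins) auto
  then have "finite (\<Union>ins\<in>set P. instr_regs ins)" by auto
  then obtain k where "\<forall>x\<in>(\<Union>ins\<in>set P. instr_regs ins). x < k" using finite_nat_set_iff_bounded by blast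
  then show ?thesis unfolding uses_regs_below_def by (intro exI[of _ k]) fastforce
qed

text \<open>The parameters of the machine keep their registers; behind them, variables and temporaries alternate.\<close>

definition var_reg :: "nat \<Rightarrow> var \<Rightarrow> reg" where
  "var_reg C x = (case x of Par k \<Rightarrow> if k < 5 * (C + 2) then k else 5 * (C + 2) + 2 * var_code x
    | _ \<Rightarrow> 5 * (C + 2) + 2 * var_code x)"

definition tmp_reg :: "nat \<Rightarrow> nat \<Rightarrow> reg" where
  "tmp_reg C i = 5 * (C + 2) + 2 * i + 1"

lemma var_reg_cases: "(\<exists>k < 5 * (C + 2). x = Par k \<and> var_reg C x = k) \<or> var_reg C x = 5 * (C + 2) + 2 * var_code x"
  unfolding var_reg_def by (cases x) auto

interpretation var: regmap "var_reg C" "tmp_reg C" for C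
proof
  fix x y :: var and i j :: nat
  have "x = y" if "var_reg C x = var_reg C y"
    using var_reg_cases[of C x] var_reg_cases[of C y] that by (auto simp: var_code_inj[symmetric])
  then show "var_reg C x = var_reg C y \<longleftrightarrow> x = y" by auto
  show "tmp_reg C i = tmp_reg C j \<longleftrightarrow> i = j" unfolding tmp_reg_def by simp
  have "even (5 * (C + 2) + 2 * a) \<longleftrightarrow> odd (5 * (C + 2) + 2 * i + 1)" for a by simp
  then show "var_reg C x \<noteq> tmp_reg C i" using var_reg_cases[of C x] unfolding tmp_reg_def
    by (metis add_lessD1 less_irrefl)
qed

definition select_prog :: "nat \<Rightarrow> prog" where
  "select_prog C = var.loop_prog C (init_com C) vU (round_com C) (BEq (Rg vDone) (Im 0))"

section \<open>From the initial registers to the rounds\<close>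

lemma horner_sum_digits:
  "horner_sum (\<lambda>j. take_bit w (drop_bit (j * w) x)) (2 ^ w) [0..<d] = take_bit (d * w) (x :: nat)"
proof (induction d arbitrary: x)
  case (Suc d)
  have map: "horner_sum f a (map Suc xs) = horner_sum (\<lambda>j. f (Suc j)) a xs" for f :: "nat \<Rightarrow> nat" and a xs
    by (induction xs) auto
  have "[0..<Suc d] = 0 # map Suc [0..<d]" by (simp only: upt_conv_Cons map_Suc_upt zero_less_Suc)
  then have "horner_sum (\<lambda>j. take_bit w (drop_bit (j * w) x)) (2 ^ w) [0..<Suc d] =
    take_bit w x + 2 ^ w * horner_sum (\<lambda>j. take_bit w (drop_bit (Suc j * w) x)) (2 ^ w) [0..<d]"
    by (simp only: horner_sum_simps map) simp
  also have "(\<lambda>j. take_bit w (drop_bit (Suc j * w) x)) = (\<lambda>j. take_bit w (drop_bit (j * w) (drop_bit w x)))"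
    by (simp add: add.commute)
  also have "take_bit w x + 2 ^ w * horner_sum (\<lambda>j. take_bit w (drop_bit (j * w) (drop_bit w x))) (2 ^ w) [0..<d] =
    x mod 2 ^ w + 2 ^ w * (x div 2 ^ w mod 2 ^ (d * w))"
    unfolding Suc by (simp add: take_bit_eq_mod drop_bit_eq_div)
  also have "\<dots> = x mod (2 ^ w * 2 ^ (d * w))" by (simp only: mod_mult2_eq add.commute)
  finally show ?case by (simp add: take_bit_eq_mod power_add)
qed simp

lemma nth_concat_block:
  assumes "\<And>x. x \<in> set xs \<Longrightarrow> length (f x) = d" "k < length xs" "j < d"
  shows "concat (map f xs) ! (k * d + j) = f (xs ! k) ! j"
  using assms
proof (induction xs arbitrary: k)
  case (Cons x xs)
  then show ?case by (cases k) (auto simp: nth_append algebra_simps)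
qed simp

context packed
begin

text \<open>The value 0 for variables outside the register file is a default that \<open>rel\<close>
  does not look at.\<close>

definition init_state :: "nat \<Rightarrow> nat \<Rightarrow> var state" where
  "init_state S i x = (if var_reg C x < 5 * (C + 2) + S then regs (init_config C S w \<sigma> T i) ! var_reg C x else 0)"

lemma length_init: "length (regs (init_config C S w \<sigma> T i)) = 5 * (C + 2) + S"
  unfolding init_config_def by (simp add: to_words_def)

lemma sim_init: "var.sim C (5 * (C + 2) + S) M 0 (init_state S i) (init_config C S w \<sigma> T i)"
  unfolding var.sim_def var.rel_def length_init by (intro conjI allI impI) (simp_all only: init_state_def if_True, simp_all add: init_config_def)

lemma init_state_param:
  assumes "k < 5" "j < C + 2"
  shows "init_state S i (Par (k * (C + 2) + j)) = take_bit w (drop_bit (j * w) ([w, n, \<sigma>, b, i] ! k))"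
proof -
  have lt: "k * (C + 2) + j < 5 * (C + 2)"
  proof -
    have "k * (C + 2) + (C + 2) \<le> 5 * (C + 2)" using mult_le_mono1[of "Suc k" 5 "C + 2"] assms(1) by simp
    then show ?thesis using assms(2) by linarith
  qed
  have len: "length (concat (map (to_words w (C + 2)) [w, n, \<sigma>, b, i])) = 5 * (C + 2)" by (simp add: to_words_def)
  have "init_state S i (Par (k * (C + 2) + j)) = (concat (map (to_words w (C + 2)) [w, n, \<sigma>, b, i])) ! (k * (C + 2) + j)"
    unfolding init_state_def var_reg_def init_config_def using lt len by (simp only: var.case if_True config.simps nth_append trans_less_add1 if_True)
  also have "\<dots> = to_words w (C + 2) ([w, n, \<sigma>, b, i] ! k) ! j"
    by (rule nth_concat_block) (use assms in \<open>auto simp: to_words_def\<close>)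
  also have "\<dots> = take_bit w (drop_bit (j * w) ([w, n, \<sigma>, b, i] ! k))"
    unfolding to_words_def using assms(2) by (simp del: upt_Suc)
  finally show ?thesis .
qed

lemma init_state_other: "var_reg C x = 5 * (C + 2) + 2 * var_code x \<Longrightarrow> init_state S i x = 0"
proof -
  assume x: "var_reg C x = 5 * (C + 2) + 2 * var_code x"
  have len: "length (concat (map (to_words w (C + 2)) [w, n, \<sigma>, b, i])) = 5 * (C + 2)" by (simp add: to_words_def)
  show ?thesis unfolding init_state_def x init_config_def using len
    by (simp only: config.simps nth_append not_add_less1 if_False add_diff_cancel_left' nth_replicate) simp
qed

lemma initial_init: "i < n \<Longrightarrow> initial i (init_state S i)"
  unfolding initial_def
proof (intro conjI)
  assume i: "i < n"
  have "w < 2 ^ w" by (rule less_exp)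
  then show "init_state S i (Par 0) = w" using init_state_param[of 0 0 S i] by (simp add: take_bit_nat_eq_self)
  show "init_state S i (Par (C + 2)) = take_bit w n" using init_state_param[of 1 0 S i] by simp
  show "init_state S i (Par (4 * (C + 2))) = i" using init_state_param[of 4 0 S i] i by simp
  have p: "init_state S i (Par (3 * (C + 2) + j)) = take_bit w (drop_bit (j * w) b)" if "j < C + 2" for j
    using init_state_param[of 3 j S i] that by simp
  then show "\<forall>x\<in>set (bits_words C). init_state S i x < 2 ^ w" unfolding bits_words_def by (auto simp del: upt_Suc)
  have "addr_of w (bits_words C) (init_state S i) = horner_sum (\<lambda>j. take_bit w (drop_bit (j * w) b)) (2 ^ w) [0..<C + 2]"
    unfolding addr_of_def bits_words_def horner_sum_foldr foldr_map using p by (intro foldr_cong) (auto simp del: upt_Suc)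
  also have "\<dots> = take_bit ((C + 2) * w) b" by (rule horner_sum_digits)
  also have "\<dots> = b"
  proof (rule take_bit_nat_eq_self)
    have "b < 2 ^ b" by (rule less_exp)
    also have "\<dots> \<le> 2 ^ ((C + 2) * w)" using b_le by (intro power_increasing) (auto simp: algebra_simps)
    finally show "b < 2 ^ ((C + 2) * w)" .
  qed
  finally show "addr_of w (bits_words C) (init_state S i) = b" .
  show "\<forall>k. init_state S i (Flag k) = 0" "\<forall>k. init_state S i (Sc k) = 0"
    by (intro allI init_state_other; simp add: var_reg_def)+
qed

text \<open>The program counter is at the draw, the first instruction after the
  initialisation.\<close>

definition ready :: "nat \<Rightarrow> nat \<Rightarrow> var state \<Rightarrow> config \<Rightarrow> bool" where
  "ready S i s cfg \<longleftrightarrow> var.sim C (5 * (C + 2) + S) M (length (var.comp C (init_com C) 0)) s cfg \<and> sel i s"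

lemma ready_start:
  assumes R: "uses_regs_below (5 * (C + 2) + S) (select_prog C)" and i: "i < n"
  obtains t s cfg where "reach (select_prog C) w (init_config C S w \<sigma> T i) t cfg" "ready S i s cfg" "t \<le> tmax (init_com C)"
proof -
  obtain t s where t: "big w M (init_com C) (init_state S i) t s" "sel i s" "t \<le> tmax (init_com C)"
    using wp_init[OF initial_init[OF i] i] unfolding wp_def by blast
  show ?thesis
    using var.loop_prog_start[OF R[unfolded select_prog_def] t(1) sim_init] t(2,3) that
    unfolding select_prog_def[symmetric] ready_def by blast
qed

lemma ready_round:
  assumes R: "uses_regs_below (5 * (C + 2) + S) (select_prog C)" and s: "ready S i s cfg" and u: "u < 2 ^ w"
  shows "\<not> halted (select_prog C) cfg"
    and "\<exists>t s' cfg' y. reach (select_prog C) w (step (select_prog C) w u cfg) t cfg' \<and> t \<le> round_time + 3 \<and>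
      nth_pos (cands (s vRlo) (s vRhi)) (u mod size s) y \<and> outcome i (s vRlo) (s vRhi) y s' \<and>
      (if s' vDone = 0 then ready S i s' cfg' else halted (select_prog C) cfg' \<and> selects_suffix T i cfg')"
proof -
  let ?P = "select_prog C" and ?s = "s(vU := u)"
  have sel: "sel i s" using s unfolding ready_def by simp
  have g: "glob ?s" using sel unfolding sel_def glob_def by simp
  have sel': "sel i ?s" using sel g unfolding sel_def by simp
  have "wp w M (round_com C) ?s (\<lambda>s' t. (\<exists>y. nth_pos (cands (?s vRlo) (?s vRhi)) (?s vU mod (?s vRhi - ?s vRlo + 1)) y \<and>
    outcome i (?s vRlo) (?s vRhi) y s') \<and> t \<le> round_time)"
    by (rule wp_round[OF sel']) (use u in simp)
  then obtain t s' y where b: "big w M (round_com C) ?s t s'" "t \<le> round_time"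
    and y: "nth_pos (cands (s vRlo) (s vRhi)) (u mod size s) y" "outcome i (s vRlo) (s vRhi) y s'"
    unfolding wp_def size_def by auto
  note r = var.loop_prog_round[OF R[unfolded select_prog_def] conjunct1[OF s[unfolded ready_def]] b(1), folded select_prog_def]
  show "\<not> halted ?P cfg" by (rule r(1))
  have test: "bval w (BEq (Rg vDone) (Im 0)) s' \<longleftrightarrow> s' vDone = 0" "blen (BEq (Rg vDone) (Im 0) :: var bexp) = 3" by simp_all
  obtain cfg' where c: "reach ?P w (step ?P w u cfg) (t + 3) cfg'"
    "var.sim C (5 * (C + 2) + S) M (if s' vDone = 0 then length (var.comp C (init_com C) 0) else length ?P) s' cfg'"
    using r(2) unfolding test by blast
  have "if s' vDone = 0 then ready S i s' cfg' else halted ?P cfg' \<and> selects_suffix T i cfg'"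
  proof (cases "s' vDone = 0")
    case True
    then have "sel i s'" using y(2) unfolding outcome_def by auto
    then show ?thesis using True c(2) unfolding ready_def by simp
  next
    case False
    then have o: "rank y = i" "s' (Par 0) = y" using y(2) unfolding outcome_def sel_def by auto
    have yn: "y < n" using y(1) unfolding nth_pos_def cands_def by simp
    have "var_reg C (Par 0) = 0" unfolding var_reg_def by simp
    then have "regs cfg' ! 0 = y" using c(2) o(2) unfolding var.sim_def var.rel_def by (metis add_gr_0 mult_pos_pos zero_less_numeral)
    then have "selects_suffix T i cfg'" using rank_kth[OF yn o(1)] yn unfolding selects_suffix_def by simp
    then show ?thesis using False c(2) unfolding var.sim_def halted_def by simp
  qed
  then show "\<exists>t s' cfg' y. reach ?P w (step ?P w u cfg) t cfg' \<and> t \<le> round_time + 3 \<and>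
      nth_pos (cands (s vRlo) (s vRhi)) (u mod size s) y \<and> outcome i (s vRlo) (s vRhi) y s' \<and>
      (if s' vDone = 0 then ready S i s' cfg' else halted ?P cfg' \<and> selects_suffix T i cfg')"
    using c(1) b(2) y by (intro exI[of _ "t + 3"] exI[of _ s'] exI[of _ cfg'] exI[of _ y]) simp
qed

lemma ready_work:
  assumes R: "uses_regs_below (5 * (C + 2) + S) (select_prog C)" and s: "ready S i s cfg"
  shows "work (select_prog C) w N cfg \<le> ennreal (pot (real (round_time + 3)) s)"
proof -
  let ?P = "select_prog C" and ?c = "real (round_time + 3)"
  let ?H = "\<lambda>cfg v. \<exists>s. ready S i s cfg \<and> v = pot ?c s"
  show ?thesis
  proof (rule work_potential[where H = ?H and c = ?c])
    fix cfg v assume "?H cfg v"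
    then obtain s where s: "ready S i s cfg" "v = pot ?c s" by blast
    have sel: "sel i s" using s(1) unfolding ready_def by simp
    have win: "s vRlo \<le> s vRhi" "s vRhi < n" using sel unfolding sel_def window_def by auto
    \<comment> \<open>The words that lead to a central pivot.\<close>
    define G where "G = {u. u < 2 ^ w \<and> (\<forall>y. nth_pos (cands (s vRlo) (s vRhi)) (u mod size s) y \<longrightarrow> central (size s) (s vRlo) y)}"
    define good where "good u v' \<longleftrightarrow> 0 \<le> v' \<and>
      (\<exists>t s'. reach ?P w (step ?P w u cfg) t s' \<and> real t \<le> ?c \<and> (halted ?P s' \<or> ?H s' v')) \<and>
      v' \<le> v - (if u \<in> G then 4 * (?c + 1) else 0)" for u v'
    have "\<exists>v'. good u v'" if u: "u < 2 ^ w" for u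
    proof -
      obtain t s' cfg' y where t: "reach ?P w (step ?P w u cfg) t cfg'" "t \<le> round_time + 3"
        "nth_pos (cands (s vRlo) (s vRhi)) (u mod size s) y" "outcome i (s vRlo) (s vRhi) y s'"
        "if s' vDone = 0 then ready S i s' cfg' else halted ?P cfg' \<and> selects_suffix T i cfg'"
        using ready_round(2)[OF R s(1) u] by blast
      have yA: "y \<in> cands (s vRlo) (s vRhi)" using t(3) unfolding nth_pos_def by simp
      have c: "u \<in> G \<Longrightarrow> central (size s) (s vRlo) y" unfolding G_def using t(3) by blast
      have "halted ?P cfg' \<or> ?H cfg' (pot ?c s')" using t(5) by (auto split: if_splits)
      moreover have "pot ?c s' \<le> v - (if u \<in> G then 4 * (?c + 1) else 0)"
        using outcome_pot[OF sel yA t(4), of ?c] c unfolding s(2) by auto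
      moreover have "0 \<le> pot ?c s'" by (rule pot_nonneg) simp
      moreover have "real t \<le> ?c" using t(2) by (rule of_nat_mono)
      ultimately show ?thesis unfolding good_def using t(1) by (intro exI[of _ "pot ?c s'"]) auto
    qed
    \<comment> \<open>The choice of the new potential for each word, as
      \<open>work_potential\<close> demands a function of the word.\<close>
    then obtain f where f: "\<And>u. u < 2 ^ w \<Longrightarrow> good u (f u)" by metis
    have Gs: "G \<subseteq> {..<2 ^ w}" unfolding G_def by auto
    have "(\<Sum>u<2 ^ w. f u) \<le> (\<Sum>u<2 ^ w. v - (if u \<in> G then 4 * (?c + 1) else 0))"
      using f unfolding good_def by (intro sum_mono) auto
    also have "\<dots> = 2 ^ w * v - real (card G) * (4 * (?c + 1))"
      using Gs by (simp add: sum_subtractf sum.If_cases Int_absorb1)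
    \<comment> \<open>At least a quarter of the words lie in \<open>G\<close>, and each of them
      lowers the potential by \<open>4 * (?c + 1)\<close>; on average this pays for the draw and the
      round.\<close>
    also have "\<dots> \<le> 2 ^ w * v - 2 ^ w * (?c + 1)"
    proof -
      have "real (2 ^ w) \<le> real (4 * card G)"
        using card_central_words[OF win] unfolding G_def size_def by (simp only: of_nat_le_iff)
      then have "2 ^ w * (?c + 1) \<le> 4 * real (card G) * (?c + 1)" by (intro mult_right_mono) auto
      then show ?thesis by (simp add: algebra_simps)
    qed
    finally have "(\<Sum>u<2 ^ w. f u) \<le> 2 ^ w * (v - (?c + 1))" by (simp add: algebra_simps)
    then have "(\<Sum>u<2 ^ w. f u) / 2 ^ w \<le> v - (?c + 1)" by (simp add: pos_divide_le_eq mult.commute)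
    then have "1 + ?c + (\<Sum>u<2 ^ w. f u) / 2 ^ w \<le> v" by simp
    then show "\<exists>f. (\<forall>u<2 ^ w. 0 \<le> f u \<and>
        (\<exists>t s'. reach ?P w (step ?P w u cfg) t s' \<and> real t \<le> ?c \<and> (halted ?P s' \<or> ?H s' (f u)))) \<and>
      1 + ?c + (\<Sum>u<2 ^ w. f u) / 2 ^ w \<le> v"
      using f unfolding good_def by (intro exI[of _ f]) blast
  next
    show "?H cfg (pot ?c s)" using s by blast
  qed simp
qed

section \<open>Numerical bounds and the conclusion\<close>

lemma n1: "1 \<le> real n"
  using of_nat_mono[OF T_nonempty] unfolding of_nat_1 .

text \<open>One logarithm stems from the bisection, the other from the levels of a counting. The
  maximum with 1 absorbs the additive constants, in particular for \<open>n = 1\<close>.\<close>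

lemma round_time_le: "real (round_time + 4) \<le> real n * max 1 (log 2 n) ^ 2 * (3000 * real (kt C) + 600)"
proof -
  define L where "L = max 1 (log 2 n)"
  have L: "1 \<le> L" "log 2 n \<le> L" unfolding L_def by auto
  have "2 ^ bitlen n \<le> 2 * n" using T_nonempty by (intro bitlen_bound) linarith
  then have "real (2 ^ bitlen n) \<le> real (2 * n)" by (rule of_nat_mono)
  then have "log 2 (2 ^ bitlen n) \<le> log 2 (2 * real n)" using n1 by (subst log_le_cancel_iff) auto
  moreover have "log 2 (2 * real n) = 1 + log 2 n" using n1 by (subst log_mult_pos) auto
  ultimately have B: "real (bitlen n) \<le> 2 * L" using L by (simp add: log_nat_power)
  have "real (lfl 1) \<le> 3 * L" unfolding lfl_def using L n1 by (simp add: of_nat_nat zero_le_log_cancel_iff) linarith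
  then have "140 * real (lfl 1) + 150 \<le> 570 * L" using L by linarith
  then have "real (kt C) * (real n * (140 * real (lfl 1) + 150)) \<le> real (kt C) * (real n * (570 * L))"
    using n1 by (intro mult_left_mono) auto
  then have c: "real count_time \<le> 570 * (real (kt C) * real n * L)" unfolding count_time_def by simp
  define X where "X = real (kt C) * real n * L"
  have X: "0 \<le> X" unfolding X_def using L n1 by simp
  have "real (bitlen n) * (2 * real count_time + 200) \<le> 2 * L * (1140 * X + 200)"
    using B c X unfolding X_def[symmetric] by (intro mult_mono) auto
  then have "real (round_time + 4) \<le> 2 * L * (1140 * X + 200) + 570 * X + 104"
    using c unfolding round_time_def X_def[symmetric] by simp
  also have "\<dots> = 2280 * (L * X) + 400 * L + 570 * X + 104" by (simp add: algebra_simps)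
  also have "\<dots> \<le> 3000 * (L * X) + 600 * (real n * L\<^sup>2)"
  proof -
    have "1 * X \<le> L * X" using L X by (intro mult_right_mono) auto
    moreover have "1 * L \<le> (real n * L) * L" using L n1 mult_mono[of 1 "real n" 1 L] by (intro mult_right_mono) auto
    then have "L \<le> real n * L\<^sup>2" by (simp add: power2_eq_square mult.assoc)
    ultimately show ?thesis using L X by linarith
  qed
  also have "\<dots> = real n * L\<^sup>2 * (3000 * real (kt C) + 600)" unfolding X_def by (simp add: algebra_simps power2_eq_square)
  finally show ?thesis unfolding L_def .
qed

text \<open>The third logarithm is the number of rounds. Changing its base from 4 / 3 to 2 costs a
  factor of at most 3; with the additional 1 this gives \<open>4 * L\<close>, and with the weight 4
  of the potential the factor 16.\<close>

lemma pot_le: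
  assumes "sel i s"
  shows "pot (real (round_time + 3)) s \<le> 16 * (3000 * real (kt C) + 600) * (real n * max 1 (log 2 n) ^ 3)"
proof -
  define L where "L = max 1 (log 2 n)"
  have L: "1 \<le> L" "log 2 n \<le> L" unfolding L_def by auto
  have sz: "0 < size s" "size s \<le> n" using assms unfolding size_def sel_def window_def by auto
  note three = log_four_thirds
  have "log (4 / 3) (size s) = log 2 (size s) / log 2 (4 / 3)" by (rule log_base_change) auto
  also have "\<dots> \<le> log 2 (size s) * 3"
  proof -
    have "0 \<le> log 2 (size s)" using sz by simp
    then have "log 2 (size s) * 1 \<le> log 2 (size s) * (3 * log 2 (4 / 3))" using three by (intro mult_left_mono)
    then show ?thesis using three by (simp add: pos_divide_le_eq)
  qed
  also have "log 2 (size s) \<le> log 2 n" using sz by (subst log_le_cancel_iff) auto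
  finally have lg: "1 + log (4 / 3) (size s) \<le> 4 * L" using L by linarith
  have "pot (real (round_time + 3)) s \<le> 4 * (real (round_time + 3) + 1) * (1 + log (4 / 3) (size s))"
    unfolding pot_def using sz by (simp add: zero_le_mult_iff)
  also have "\<dots> = 4 * (real (round_time + 4) * (1 + log (4 / 3) (size s)))" by simp
  also have "\<dots> \<le> 4 * ((real n * L ^ 2 * (3000 * real (kt C) + 600)) * (4 * L))"
    using lg round_time_le sz L unfolding L_def[symmetric] by (intro mult_left_mono mult_mono) auto
  also have "\<dots> = 16 * (3000 * real (kt C) + 600) * (real n * L ^ 3)" by (simp add: power2_eq_square power3_eq_cube)
  finally show ?thesis unfolding L_def .
qed

lemma select_expected_time:
  assumes R: "uses_regs_below (5 * (C + 2) + S) (select_prog C)" and i: "i < n"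
  shows "expected_time (select_prog C) w (init_config C S w \<sigma> T i) \<le>
    ennreal ((real (tmax (init_com C)) + 16 * (3000 * real (kt C) + 600)) * real n * max 1 (log 2 n) ^ 3)"
proof (rule expected_time_le)
  fix N
  let ?P = "select_prog C" and ?cfg = "init_config C S w \<sigma> T i" and ?L = "max 1 (log 2 n)"
  obtain t s cfg where s: "reach ?P w ?cfg t cfg" "ready S i s cfg" "t \<le> tmax (init_com C)"
    using ready_start[OF R i] by blast
  let ?c = "real (round_time + 3)"
  have "work ?P w N ?cfg \<le> of_nat t + work ?P w N cfg" by (rule work_reach[OF s(1)])
  also have "\<dots> \<le> ennreal (real t) + ennreal (pot ?c s)"
    using ready_work[OF R s(2)] by (intro add_mono) (auto simp: ennreal_of_nat_eq_real_of_nat)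
  also have "\<dots> = ennreal (real t + pot ?c s)" by (simp add: pot_nonneg)
  also have "\<dots> \<le> ennreal ((real (tmax (init_com C)) + 16 * (3000 * real (kt C) + 600)) * real n * ?L ^ 3)"
  proof (rule ennreal_leI)
    have "pot ?c s \<le> 16 * (3000 * real (kt C) + 600) * (real n * ?L ^ 3)"
      using pot_le s(2) unfolding ready_def by blast
    moreover have "real t \<le> real (tmax (init_com C)) * (real n * ?L ^ 3)"
    proof -
      have "1 * 1 \<le> real n * ?L ^ 3" using n1 by (intro mult_mono one_le_power) auto
      then have "real (tmax (init_com C)) * 1 \<le> real (tmax (init_com C)) * (real n * ?L ^ 3)" by (intro mult_left_mono) auto
      then show ?thesis using s(3) by simp
    qed
    ultimately show "real t + pot ?c s \<le> (real (tmax (init_com C)) + 16 * (3000 * real (kt C) + 600)) * real n * ?L ^ 3"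
      by (simp add: algebra_simps)
  qed
  finally show "work ?P w N ?cfg \<le> ennreal ((real (tmax (init_com C)) + 16 * (3000 * real (kt C) + 600)) * real n * ?L ^ 3)" .
qed

lemma select_correct:
  assumes R: "uses_regs_below (5 * (C + 2) + S) (select_prog C)" and i: "i < n"
    and \<omega>: "\<And>t. \<omega> t < 2 ^ w" and h: "halted (select_prog C) (run (select_prog C) w (init_config C S w \<sigma> T i) \<omega> t)"
  shows "selects_suffix T i (run (select_prog C) w (init_config C S w \<sigma> T i) \<omega> t)"
proof -
  let ?P = "select_prog C" and ?cfg = "init_config C S w \<sigma> T i"
  obtain t0 s cfg where s: "reach ?P w ?cfg t0 cfg" "ready S i s cfg" "t0 \<le> tmax (init_com C)"
    using ready_start[OF R i] by blast
  have "run ?P w ?cfg \<omega> t0 = cfg" using s(1) unfolding reach_def by (rule spec)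
  then have "run ?P w ?cfg \<omega> (t0 + t) = run ?P w cfg (\<lambda>k. \<omega> (t0 + k)) t"
    using run_add[of ?P w ?cfg \<omega> t0 t] by (simp only:)
  moreover have "run ?P w ?cfg \<omega> (t0 + t) = run ?P w ?cfg \<omega> t" by (rule halted_run_mono[OF h]) simp
  ultimately have r: "run ?P w ?cfg \<omega> t = run ?P w cfg (\<lambda>k. \<omega> (t0 + k)) t" by (rule trans[OF sym, rotated])
  show ?thesis unfolding r
  proof (rule halts_invariant[where G = "\<lambda>cfg. \<exists>s. ready S i s cfg"])
    fix cfg :: config and u :: nat
    assume "\<exists>s. ready S i s cfg" and u: "u < 2 ^ w"
    then obtain s where s: "ready S i s cfg" by blast
    obtain t s' cfg' where "reach ?P w (step ?P w u cfg) t cfg'"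
      "if s' vDone = 0 then ready S i s' cfg' else halted ?P cfg' \<and> selects_suffix T i cfg'"
      using ready_round(2)[OF R s u] by blast
    then show "\<not> halted ?P cfg \<and> (\<exists>t cfg'. reach ?P w (step ?P w u cfg) t cfg' \<and>
      (halted ?P cfg' \<and> selects_suffix T i cfg' \<or> (\<exists>s. ready S i s cfg')))"
      using ready_round(1)[OF R s u] by (auto split: if_splits)
  next
    show "\<exists>s. ready S i s cfg" using s(2) by blast
    show "halted ?P (run ?P w cfg (\<lambda>k. \<omega> (t0 + k)) t)" using h unfolding r .
  qed (rule \<omega>)
qed

end

theorem theorem7:
  fixes C :: nat and c :: real
  shows "\<exists>(P :: prog) (S :: nat) (K :: real).
    uses_regs_below (5 * (C + 2) + S) P \<and>
    (\<forall>(w :: nat) (n :: nat) (\<sigma> :: nat) (T :: nat list) (i :: nat).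
       1 \<le> w \<longrightarrow> log 2 (real n) \<le> real w \<longrightarrow> \<sigma> \<le> 2 ^ (C * w) \<longrightarrow>
       length T = n \<longrightarrow> set T \<subseteq> {..<\<sigma>} \<longrightarrow> i < n \<longrightarrow>
       (let s = init_config C S w \<sigma> T i in
          measure (random_words w)
            {\<omega> \<in> space (random_words w). \<exists>s'. halts_with P w s \<omega> s' \<and> selects_suffix T i s'}
            \<ge> 1 - real n powr (- c) \<and>
          expected_time P w s \<le> ennreal (K * real n * max 1 (log 2 (real n)) ^ 3) \<and>
          (\<forall>\<omega> \<in> space (random_words w). \<forall>s'.
             halts_with P w s \<omega> s' \<longrightarrow> mem s' = pack_text w \<sigma> T)))"
proof -
  let ?P = "select_prog C" and ?K = "real (tmax (init_com C)) + 16 * (3000 * real (kt C) + 600)"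
  obtain S where R: "uses_regs_below (5 * (C + 2) + S) ?P" using ex_uses_regs_below by blast
  show ?thesis
  proof (intro exI[of _ ?P] exI[of _ S] exI[of _ ?K] conjI R allI impI)
    fix w n \<sigma> :: nat and T :: "nat list" and i :: nat
    assume a: "1 \<le> w" "log 2 (real n) \<le> real w" "\<sigma> \<le> 2 ^ (C * w)" "length T = n" "set T \<subseteq> {..<\<sigma>}" "i < n"
    have "real n \<le> 2 powr real w" using a(2,6) by (subst (asm) log_le_iff) auto
    then have "real n \<le> real (2 ^ w)" by (simp add: powr_realpow)
    then have nw: "n \<le> 2 ^ w" by (simp only: of_nat_le_iff)
    interpret packed C w \<sigma> T by unfold_locales (use a nw in auto)
    let ?s = "init_config C S w \<sigma> T i"
    have i: "i < length T" using a by simp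
    have time: "expected_time ?P w ?s \<le> ennreal (?K * real n * max 1 (log 2 (real n)) ^ 3)"
      using select_expected_time[OF R i] a(4) by simp
    \<comment> \<open>Every halting run is correct, so the success event is the halting event and
      has probability 1, which is at least the required bound for every \<open>c\<close>.\<close>
    have "{\<omega> \<in> space (random_words w). \<exists>s'. halts_with ?P w ?s \<omega> s' \<and> selects_suffix T i s'} =
      {\<omega> \<in> space (random_words w). \<exists>t. halted ?P (run ?P w ?s \<omega> t)}"
      using select_correct[OF R i] unfolding halts_with_def space_random_words by blast
    then have one: "measure (random_words w) {\<omega> \<in> space (random_words w). \<exists>s'. halts_with ?P w ?s \<omega> s' \<and> selects_suffix T i s'} = 1"
      using almost_surely_halts[OF time] by simp
    have mem: "mem s' = pack_text w \<sigma> T" if "halts_with ?P w ?s \<omega> s'" for \<omega> s'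
    proof -
      have "mem (run ?P w ?s \<omega> t) = mem ?s" for t
        by (rule mem_run) (simp add: select_prog_def var.loop_prog_no_store)
      then show ?thesis using that unfolding halts_with_def by (auto simp: init_config_def)
    qed
    show "let s = ?s in
          measure (random_words w)
            {\<omega> \<in> space (random_words w). \<exists>s'. halts_with ?P w s \<omega> s' \<and> selects_suffix T i s'}
            \<ge> 1 - real n powr (- c) \<and>
          expected_time ?P w s \<le> ennreal (?K * real n * max 1 (log 2 (real n)) ^ 3) \<and>
          (\<forall>\<omega> \<in> space (random_words w). \<forall>s'. halts_with ?P w s \<omega> s' \<longrightarrow> mem s' = pack_text w \<sigma> T)"
      unfolding Let_def one using time mem by auto
  qed
qed

end
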